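(* Let $k\ge 3$ be an integer. There exists a constant $K_k<2^{8k}$ such that for all sufficiently small $b>0$, \[1+2kb^2\;\le\;\frac{\alpha_k(\tfrac12-b)}{\alpha_k(\tfrac12)}\;\le\;1+K_k b^2 .\]
   Context: Fix $n$ Boolean variables $x_1,\dots,x_n$ and $p\in(0,1)$. A $p$-biased random $k$-clause is formed by choosing a $k$-subset of the variables uniformly at random and then, independently for each chosen variable $x$, including the literal $x$ with probability $p$ and the literal $\neg x$ otherwise; the clause is the disjunction of these $k$ literals. $\Phi^p_k(m,n)$ denotes the conjunction of $m$ i.i.d. $p$-biased random $k$-clauses (equivalently one may use $\mathrm{Poisson}(m)$ clauses; the resulting thresholds agree up to a factor $1\pm o(1)$). Let $\alpha_k(p,n):=\inf\{m/n:\Pr(\Phi^p_k(m,n)\text{ is satisfiable})\le \tfrac12\}$ and $\alpha_k(p):=\lim_{n\to\infty}\alpha_k(p,n)$; when the limit is not known to exist, statements about $\alpha_k(p)$ are understood in terms of $\liminf_n$ / $\limsup_n$ of $\alpha_k(p,n)$ as appropriate. Here the parametrization $p=\tfrac12-b$ is used. *)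

theory Defs
  imports "HOL-Probability.Probability"
begin

(* A literal is a variable (a natural number) together with its required truth value;
   a formula is a list of clauses, so that repeated clauses are allowed. *)
type_synonym literal = "nat \<times> bool"
type_synonym clause = "literal set"
type_synonym formula = "clause list"

definition satisfies_clause :: "(nat \<Rightarrow> bool) \<Rightarrow> clause \<Rightarrow> bool" where
  "satisfies_clause \<sigma> C \<longleftrightarrow> (\<exists>(x, s) \<in> C. \<sigma> x = s)"

definition satisfiable :: "formula \<Rightarrow> bool" where
  "satisfiable F \<longleftrightarrow> (\<exists>\<sigma>. \<forall>C \<in> set F. satisfies_clause \<sigma> C)"

(* The set of k-subsets is empty for n < k, where the distribution is unspecified;
   this affects only finitely many n. *)
definition random_clause :: "nat \<Rightarrow> real \<Rightarrow> nat \<Rightarrow> clause pmf" where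
  "random_clause k p n =
     bind_pmf (pmf_of_set {V. V \<subseteq> {..<n} \<and> card V = k}) (\<lambda>V.
     map_pmf (\<lambda>s. (\<lambda>x. (x, s x)) ` V) (Pi_pmf V False (\<lambda>_. bernoulli_pmf p)))"

definition random_formula :: "nat \<Rightarrow> real \<Rightarrow> nat \<Rightarrow> nat \<Rightarrow> formula pmf" where
  "random_formula k p m n = replicate_pmf m (random_clause k p n)"

(* Extended reals, so that the infimum of an empty set would be infinite
   and liminf/limsup below are those of a complete lattice. *)
definition alpha_n :: "nat \<Rightarrow> real \<Rightarrow> nat \<Rightarrow> ereal" where
  "alpha_n k p n =
     Inf {ereal (real m / real n) | m.
       measure_pmf.prob (random_formula k p m n) {F. satisfiable F} \<le> 1 / 2}"

(* The limit of alpha_n k p is not known to exist; these are its two substitutes,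
   both equal to the limit whenever it exists. *)
definition alpha_lower :: "nat \<Rightarrow> real \<Rightarrow> ereal" where
  "alpha_lower k p = liminf (alpha_n k p)"

definition alpha_upper :: "nat \<Rightarrow> real \<Rightarrow> ereal" where
  "alpha_upper k p = limsup (alpha_n k p)"

end

(* Lower bound.  Let the bias t decrease from b to 0 while every clause is kept with probability
   exp (- 2 k (b^2 - t^2)).  The derivative of the probability of unsatisfiability is a sum over the
   variables x of (1 - p) h(x, false) - p h(x, true), where h(x, s) is the probability that a random
   clause containing the literal (x, s) makes the formula unsatisfiable.  Given the clauses without x,
   the signs of x in the other clauses are independent, and an odds-ratio inequality for monotone
   events in these signs shows that each term is at most the probability that x stays frozen while
   shorter clauses are added.  Averaged over a window of densities this is o(1), so the unsatisfiability
   at bias b and m clauses is at most that at bias 0 and exp (- 2 k b^2) m clauses, up to o(1).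

   Upper bound.  After Poissonization, the clauses containing x positively and negatively are
   independent, so given the rest the formula is unsatisfiable with probability F (u) F (v), where u and
   v are the two rates and F (l) is the mean of a nondecreasing sequence at a Poisson variable of mean l.
   Passing from equal rates l, l to the rates l exp (C e^2 / 2 + e) and l exp (C e^2 / 2 - e) does not
   decrease this product.  Doing so for one variable after the other compares bias 0 with bias
   b = e / 2 + O(e^3) at the cost of a factor 1 + O(b^2) in the number of clauses.

   The Poincare inequality U(m) (1 - U(m)) <= m (U(m) - U(m - 1)) for the probability U(m) of
   unsatisfiability makes the window at level 1/2 steep enough to transfer both comparisons to the
   thresholds. *)

theory Submission
  imports Defs "HOL-Real_Asymp.Real_Asymp"
begin

section \<open>Insertion operators\<close>

text \<open>The race between the two values of \<open>x\<close> that underlies the lower bound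
  controls the signed terms only after summation over the number M of short clauses already present,
  not each one alone. So the interpolated formula carries M < G clauses of length k - 1 and is
  averaged over M. Adding them must be harmless: with a fraction z of frozen variables a short
  clause is fatal with probability at most z^(k-1), while z itself and z^k are small on average over
  a window of densities. For k >= 3 the power z^(k-1) can be interpolated between these two, which
  makes room for G of larger order than the window sum of z.

  In the upper bound C has to dominate the mean number of clauses per variable. The first moment
  bounds the relevant densities by a multiple of 2^k, so C is of order k 2^k and K of order k C. All
  comparisons have additive errors in probability and in density; they yield a ratio because the
  unbiased threshold lies between two positive constants, by the first moment from above and by the
  absence of small unsatisfiable cores from below.\<close>

definition unsat :: "clause set \<Rightarrow> bool" where
  "unsat X \<longleftrightarrow> \<not> (\<exists>\<sigma>. \<forall>C\<in>X. satisfies_clause \<sigma> C)"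

definition uind :: "clause set \<Rightarrow> real" where
  "uind X = of_bool (unsat X)"

lemma unsat_mono: "X \<subseteq> Y \<Longrightarrow> unsat X \<Longrightarrow> unsat Y"
  unfolding unsat_def by blast

lemma uind_mono: "X \<subseteq> Y \<Longrightarrow> uind X \<le> uind Y"
  unfolding uind_def using unsat_mono by auto

lemma uind_nonneg [simp]: "0 \<le> uind X" and uind_le1 [simp]: "uind X \<le> 1"
  by (auto simp: uind_def)

text \<open>Iterating \<open>Op\<close> \<open>m\<close> times and evaluating at the empty set gives the expectation over \<open>m\<close>
independent random clauses.  Operators for different clause distributions commute, which replaces
exchangeability arguments.\<close>

definition Op :: "'i set \<Rightarrow> ('i \<Rightarrow> real) \<Rightarrow> ('i \<Rightarrow> 'c) \<Rightarrow> ('c set \<Rightarrow> real) \<Rightarrow> 'c set \<Rightarrow> real" where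
  "Op I w c f X = (\<Sum>i\<in>I. w i * f (insert (c i) X))"

lemma Op_commute: "Op I w c (Op J v d f) = Op J v d (Op I w c f)"
proof
  fix X
  have "Op I w c (Op J v d f) X = (\<Sum>i\<in>I. \<Sum>j\<in>J. w i * (v j * f (insert (d j) (insert (c i) X))))"
    by (simp add: Op_def sum_distrib_left)
  also have "\<dots> = (\<Sum>j\<in>J. \<Sum>i\<in>I. v j * (w i * f (insert (c i) (insert (d j) X))))"
    by (subst sum.swap) (simp add: insert_commute mult.left_commute)
  also have "\<dots> = Op J v d (Op I w c f) X"
    by (simp add: Op_def sum_distrib_left)
  finally show "Op I w c (Op J v d f) X = Op J v d (Op I w c f) X" .
qed

lemma Op_pow_commute1: "(Op I w c ^^ m) (Op J v d f) = Op J v d ((Op I w c ^^ m) f)"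
proof (induction m)
  case (Suc m)
  have "(Op I w c ^^ Suc m) (Op J v d f) = Op I w c (Op J v d ((Op I w c ^^ m) f))"
    by (simp add: Suc.IH)
  also have "\<dots> = Op J v d (Op I w c ((Op I w c ^^ m) f))" by (rule Op_commute)
  finally show ?case by simp
qed simp

lemma Op_pow_commute: "(Op I w c ^^ m) ((Op J v d ^^ l) f) = (Op J v d ^^ l) ((Op I w c ^^ m) f)"
proof (induction l)
  case (Suc l)
  have "(Op I w c ^^ m) ((Op J v d ^^ Suc l) f) = Op J v d ((Op I w c ^^ m) ((Op J v d ^^ l) f))"
    by (simp add: Op_pow_commute1)
  then show ?case by (simp add: Suc.IH)
qed simp

lemma Op_pow_Suc': "(Op I w c ^^ Suc m) f = (Op I w c ^^ m) (Op I w c f)"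
  by (simp add: funpow_swap1)

lemma Op_pow_add: "(Op I w c ^^ (m + l)) f = (Op I w c ^^ m) ((Op I w c ^^ l) f)"
  by (simp add: funpow_add)

lemma Op_sum: "Op I w c (\<lambda>X. \<Sum>j\<in>J. a j * g j X) = (\<lambda>X. \<Sum>j\<in>J. a j * Op I w c (g j) X)"
  unfolding Op_def by (rule ext, simp add: sum_distrib_left, subst sum.swap) (simp add: mult.left_commute)

lemma Op_pow_sum: "(Op I w c ^^ m) (\<lambda>X. \<Sum>j\<in>J. a j * g j X) = (\<lambda>X. \<Sum>j\<in>J. a j * (Op I w c ^^ m) (g j) X)"
  by (induction m) (simp_all add: Op_sum)

lemma Op_add: "Op I w c (\<lambda>X. f X + g X) = (\<lambda>X. Op I w c f X + Op I w c g X)"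
  unfolding Op_def by (simp add: algebra_simps sum.distrib)

lemma Op_pow_add_fun: "(Op I w c ^^ m) (\<lambda>X. f X + g X) = (\<lambda>X. (Op I w c ^^ m) f X + (Op I w c ^^ m) g X)"
  by (induction m) (simp_all add: Op_add)

lemma Op_cmult: "Op I w c (\<lambda>X. a * f X) = (\<lambda>X. a * Op I w c f X)"
  unfolding Op_def by (simp add: sum_distrib_left mult.left_commute)

lemma Op_pow_cmult: "(Op I w c ^^ m) (\<lambda>X. a * f X) = (\<lambda>X. a * (Op I w c ^^ m) f X)"
  by (induction m) (simp_all add: Op_cmult)

lemma Op_pow_diff_fun: "(Op I w c ^^ m) (\<lambda>X. f X - g X) = (\<lambda>X. (Op I w c ^^ m) f X - (Op I w c ^^ m) g X)"
  using Op_pow_add_fun[of m I w c f "\<lambda>X. (-1) * g X"] Op_pow_cmult[of m I w c "-1" g] by simp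

lemma Op_pow_const: "(\<Sum>i\<in>I. w i) = s \<Longrightarrow> (Op I w c ^^ m) (\<lambda>_. a) = (\<lambda>_. s ^ m * a)"
proof (induction m)
  case (Suc m)
  then show ?case
    by (auto simp: Op_def fun_eq_iff sum_distrib_right [symmetric])
qed simp

text \<open>The invariant \<open>Q\<close> allows averaging of inequalities that hold only for
  special clause sets, such as those avoiding a variable or consisting of k-clauses.\<close>

lemma Op_pow_mono_inv:
  assumes "\<And>i. i \<in> I \<Longrightarrow> 0 \<le> w i"
    and "\<And>Y i. Q Y \<Longrightarrow> i \<in> I \<Longrightarrow> Q (insert (c i) Y)"
    and "\<And>Y. Q Y \<Longrightarrow> f Y \<le> g Y" and "Q X"
  shows "(Op I w c ^^ m) f X \<le> (Op I w c ^^ m) g X"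
  using assms(4)
proof (induction m arbitrary: X)
  case 0 then show ?case using assms(3) by simp
next
  case (Suc m)
  then show ?case
    unfolding funpow.simps comp_def Op_def
    by (intro sum_mono mult_left_mono) (use assms(1,2) in auto)
qed

lemma Op_pow_mono:
  assumes "\<And>i. i \<in> I \<Longrightarrow> 0 \<le> w i" "\<And>Y. X \<subseteq> Y \<Longrightarrow> f Y \<le> g Y"
  shows "(Op I w c ^^ m) f X \<le> (Op I w c ^^ m) g X"
  by (rule Op_pow_mono_inv[where Q="\<lambda>Y. X \<subseteq> Y"]) (use assms in auto)

lemma Op_pow_nonneg:
  assumes "\<And>i. i \<in> I \<Longrightarrow> 0 \<le> w i" "\<And>Y. 0 \<le> f Y"
  shows "0 \<le> (Op I w c ^^ m) f X"
proof -
  have "(Op I w c ^^ m) (\<lambda>_. 0) X = 0"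
    using Op_pow_cmult[of m I w c 0 f] by (simp add: fun_eq_iff)
  moreover have "(Op I w c ^^ m) (\<lambda>_. 0) X \<le> (Op I w c ^^ m) f X"
    by (rule Op_pow_mono) (use assms in auto)
  ultimately show ?thesis by simp
qed

lemma Op_pow_le_const:
  assumes "\<And>i. i \<in> I \<Longrightarrow> 0 \<le> w i" "(\<Sum>i\<in>I. w i) = 1" "\<And>Y. X \<subseteq> Y \<Longrightarrow> f Y \<le> a"
  shows "(Op I w c ^^ m) f X \<le> a"
proof -
  have "(Op I w c ^^ m) f X \<le> (Op I w c ^^ m) (\<lambda>_. a) X"
    by (rule Op_pow_mono) (use assms in auto)
  then show ?thesis using Op_pow_const[OF assms(2), where c=c and m=m and a=a] by (simp add: fun_eq_iff)
qed

lemma Op_pow_mono_set: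
  assumes "\<And>i. i \<in> I \<Longrightarrow> 0 \<le> w i" "\<And>X Y. X \<subseteq> Y \<Longrightarrow> f X \<le> f Y" "X \<subseteq> Y"
  shows "(Op I w c ^^ m) f X \<le> (Op I w c ^^ m) f Y"
  using assms(3)
proof (induction m arbitrary: X Y)
  case 0 then show ?case using assms(2) by simp
next
  case (Suc m)
  have "(Op I w c ^^ m) f (insert (c i) X) \<le> (Op I w c ^^ m) f (insert (c i) Y)" if "i \<in> I" for i
    using Suc by (intro Suc.IH) auto
  then show ?case
    unfolding funpow.simps comp_def Op_def
    by (intro sum_mono mult_left_mono) (use assms(1) in auto)
qed

text \<open>By commutation the additional clause may be regarded as drawn last, so the increment is
  the mean effect of one more clause.\<close>

lemma Op_pow_telescope:
  assumes "(\<Sum>i\<in>I. w i) = 1"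
  shows "(Op I w c ^^ Suc m) f X - (Op I w c ^^ m) f X
    = (Op I w c ^^ m) (\<lambda>X. \<Sum>i\<in>I. w i * (f (insert (c i) X) - f X)) X"
proof -
  have "(\<lambda>X. \<Sum>i\<in>I. w i * (f (insert (c i) X) - f X)) = (\<lambda>X. Op I w c f X - f X)"
    by (simp add: Op_def fun_eq_iff right_diff_distrib sum_subtractf sum_distrib_right[symmetric] assms)
  then show ?thesis
    by (simp add: Op_pow_diff_fun Op_pow_commute1)
qed

lemma Op_pow_incr:
  assumes "\<And>i. i \<in> I \<Longrightarrow> 0 \<le> w i" "(\<Sum>i\<in>I. w i) = 1" "\<And>X Y. X \<subseteq> Y \<Longrightarrow> f X \<le> f Y" "m \<le> l"
  shows "(Op I w c ^^ m) f X \<le> (Op I w c ^^ l) f X"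
proof -
  have "(Op I w c ^^ m) f X \<le> (Op I w c ^^ Suc m) f X" for m
  proof -
    have "0 \<le> (Op I w c ^^ m) (\<lambda>X. \<Sum>i\<in>I. w i * (f (insert (c i) X) - f X)) X"
    proof (rule Op_pow_nonneg)
      show "0 \<le> (\<Sum>i\<in>I. w i * (f (insert (c i) Y) - f Y))" for Y
        using assms(1) assms(3)[of Y "insert _ Y"] by (intro sum_nonneg mult_nonneg_nonneg) auto
    qed (use assms in auto)
    then show ?thesis using Op_pow_telescope[OF assms(2), where c=c and m=m and f=f and X=X] by linarith
  qed
  then show ?thesis using assms(4) by (rule lift_Suc_mono_le)
qed

text \<open>Unsatisfiability can set in only once, so the fatal probabilities at successive numbers
  of clauses telescope. Every average over a window of densities rests on this.\<close>

lemma Op_pow_telescope_sum_le: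
  assumes "\<And>i. i \<in> I \<Longrightarrow> 0 \<le> w i" "(\<Sum>i\<in>I. w i) = 1" "\<And>Y. 0 \<le> f Y" "\<And>Y. f Y \<le> 1"
  shows "(\<Sum>m\<in>{a..<a+l}. (Op I w c ^^ m) (\<lambda>X. \<Sum>i\<in>I. w i * (f (insert (c i) X) - f X)) X) \<le> 1"
proof -
  have "(\<Sum>m\<in>{a..<a+l}. (Op I w c ^^ m) (\<lambda>X. \<Sum>i\<in>I. w i * (f (insert (c i) X) - f X)) X)
      = (\<Sum>m\<in>{a..<a+l}. (Op I w c ^^ Suc m) f X - (Op I w c ^^ m) f X)"
    by (intro sum.cong refl Op_pow_telescope[OF assms(2), symmetric])
  also have "\<dots> = (Op I w c ^^ (a+l)) f X - (Op I w c ^^ a) f X"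
    by (rule sum_Suc_diff') simp
  also have "\<dots> \<le> 1 - 0"
    by (intro diff_mono Op_pow_le_const Op_pow_nonneg) (use assms in auto)
  finally show ?thesis by simp
qed

lemma Op_has_derivative:
  fixes f :: "real \<Rightarrow> 'c set \<Rightarrow> real"
  assumes "\<And>i. i \<in> I \<Longrightarrow> ((\<lambda>t. w t i) has_real_derivative w' i) (at t0)"
    and "\<And>Y. ((\<lambda>t. f t Y) has_real_derivative f' Y) (at t0)"
  shows "((\<lambda>t. Op I (w t) c (f t) X) has_real_derivative (Op I w' c (f t0) X + Op I (w t0) c f' X)) (at t0)"
  unfolding Op_def sum.distrib[symmetric]
  by (rule DERIV_sum) (auto intro!: derivative_eq_intros assms simp: algebra_simps)

text \<open>The differentiated factor can be moved to the inside by commutation, so all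
  \<open>m\<close> factors contribute the same amount.\<close>

lemma Op_pow_has_derivative:
  fixes f :: "real \<Rightarrow> 'c set \<Rightarrow> real"
  assumes "\<And>i. i \<in> I \<Longrightarrow> ((\<lambda>t. w t i) has_real_derivative w' i) (at t0)"
    and "\<And>Y. ((\<lambda>t. f t Y) has_real_derivative f' Y) (at t0)"
  shows "((\<lambda>t. (Op I (w t) c ^^ m) (f t) X) has_real_derivative
    (real m * (Op I (w t0) c ^^ (m - 1)) (Op I w' c (f t0)) X + (Op I (w t0) c ^^ m) f' X)) (at t0)"
proof (induction m arbitrary: X)
  case 0 then show ?case using assms(2) by simp
next
  case (Suc m)
  have eq: "Op I (w t0) c (\<lambda>X. real m * (Op I (w t0) c ^^ (m - 1)) (Op I w' c (f t0)) X + (Op I (w t0) c ^^ m) f' X) X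
     = real m * (Op I (w t0) c ^^ m) (Op I w' c (f t0)) X + (Op I (w t0) c ^^ Suc m) f' X"
    by (cases m) (simp_all add: Op_add Op_cmult)
  show ?case
    using Op_has_derivative[of I w w' t0 "\<lambda>t. (Op I (w t) c ^^ m) (f t)", OF assms(1) Suc.IH, of c X] eq
    by (simp add: Op_pow_commute1 algebra_simps)
qed

text \<open>Conditioning on the first clause splits \<open>U * (1 - U)\<close> into the mean of the
  conditional variances, treated by induction, and the variance of the conditional means
  \<open>g i\<close>. As \<open>g i - a\<close> lies between 0 and 1, its second moment is at most
  its mean \<open>U - a\<close>.\<close>

lemma Op_pow_poincare:
  fixes f :: "'c set \<Rightarrow> real"
  assumes fin: "finite I" and w0: "\<And>i. i \<in> I \<Longrightarrow> 0 \<le> w i" and w1: "(\<Sum>i\<in>I. w i) = 1"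
    and f01: "\<And>X. f X = 0 \<or> f X = 1" and mono: "\<And>X Y. X \<subseteq> Y \<Longrightarrow> f X \<le> f Y"
  shows "(Op I w c ^^ m) f X * (1 - (Op I w c ^^ m) f X)
    \<le> real m * ((Op I w c ^^ m) f X - (Op I w c ^^ (m - 1)) f X)"
proof (induction m arbitrary: X)
  case 0 then show ?case using f01[of X] by auto
next
  case (Suc m)
  define g where "g i = (Op I w c ^^ m) f (insert (c i) X)" for i
  define a where "a = (Op I w c ^^ m) f X"
  define U where "U = (Op I w c ^^ Suc m) f X"
  have f0: "0 \<le> f Y" and f1: "f Y \<le> 1" for Y using f01[of Y] by auto
  have U: "U = (\<Sum>i\<in>I. w i * g i)" by (simp add: U_def g_def Op_def)
  have ag: "a \<le> g i" if "i \<in> I" for i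
    unfolding a_def g_def by (rule Op_pow_mono_set) (use w0 mono in auto)
  have g1: "g i \<le> 1" for i unfolding g_def by (rule Op_pow_le_const) (use w0 w1 f1 in auto)
  have a0: "0 \<le> a" unfolding a_def by (rule Op_pow_nonneg) (use w0 f0 in auto)
  \<comment> \<open>For \<open>m = 0\<close> each \<open>g i\<close> is 0 or 1 and the left side
    vanishes. Otherwise removing a clause after the first one gives \<open>a\<close> on
    average.\<close>
  have IH: "(\<Sum>i\<in>I. w i * (g i * (1 - g i))) \<le> real m * (U - a)"
  proof (cases m)
    case 0
    have "g i * (1 - g i) = 0" for i using f01[of "insert (c i) X"] 0 by (auto simp: g_def)
    then have "(\<Sum>i\<in>I. w i * (g i * (1 - g i))) = 0" by (simp only: mult_zero_right sum.neutral_const)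
    then show ?thesis using 0 by (simp only: of_nat_0 mult_zero_left order_refl)
  next
    case (Suc l)
    have "(\<Sum>i\<in>I. w i * (g i * (1 - g i))) \<le> (\<Sum>i\<in>I. w i * (real m * (g i - (Op I w c ^^ (m - 1)) f (insert (c i) X))))"
      unfolding g_def by (intro sum_mono mult_left_mono Suc.IH) (simp add: w0)
    also have "\<dots> = real m * (U - Op I w c ((Op I w c ^^ (m - 1)) f) X)"
      unfolding U by (simp add: Op_def sum_distrib_left right_diff_distrib sum_subtractf mult.left_commute)
    also have "Op I w c ((Op I w c ^^ (m - 1)) f) X = a" by (simp add: a_def Suc)
    finally show ?thesis .
  qed
  have sq: "(\<Sum>i\<in>I. w i * (g i - a)\<^sup>2) \<le> (\<Sum>i\<in>I. w i * (g i - a))"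
  proof (intro sum_mono mult_left_mono w0)
    fix i assume i: "i \<in> I"
    have "0 \<le> g i - a" "g i - a \<le> 1" using ag[OF i] g1[of i] a0 by auto
    then show "(g i - a)\<^sup>2 \<le> g i - a" by (simp add: power2_eq_square mult_left_le)
  qed
  have e1: "(\<Sum>i\<in>I. w i * (g i - a)) = U - a"
    by (simp add: U right_diff_distrib sum_subtractf sum_distrib_right[symmetric] w1)
  have e2: "(\<Sum>i\<in>I. w i * (g i - a)\<^sup>2) = (\<Sum>i\<in>I. w i * (g i)\<^sup>2) - 2 * a * U + a\<^sup>2"
  proof -
    have "(\<Sum>i\<in>I. w i * (g i - a)\<^sup>2) = (\<Sum>i\<in>I. w i * (g i)\<^sup>2 - 2 * a * (w i * g i) + w i * a\<^sup>2)"
      by (intro sum.cong) (auto simp: power2_eq_square algebra_simps)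
    then show ?thesis by (simp add: sum.distrib sum_subtractf sum_distrib_left[symmetric] U sum_distrib_right[symmetric] w1)
  qed
  have e3: "(\<Sum>i\<in>I. w i * (g i * (1 - g i))) = U - (\<Sum>i\<in>I. w i * (g i)\<^sup>2)"
    by (simp add: U right_diff_distrib sum_subtractf power2_eq_square)
  \<comment> \<open>The variance is the second moment about \<open>a\<close> minus this square,
    which is discarded.\<close>
  have "0 \<le> (U - a)\<^sup>2" by simp
  then have "U * (1 - U) \<le> real (Suc m) * (U - a)"
    using IH sq unfolding e1 e2 e3 by (simp add: power2_eq_square algebra_simps)
  then show ?case by (simp add: U_def a_def)
qed

section \<open>Random clauses\<close>

definition CL :: "nat set \<Rightarrow> nat \<Rightarrow> clause set" where
  "CL V k = {c. c \<subseteq> V \<times> UNIV \<and> inj_on fst c \<and> card c = k}"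

definition lw :: "(literal \<Rightarrow> real) \<Rightarrow> clause \<Rightarrow> real" where
  "lw a c = (\<Prod>l\<in>c. a l)"

lemma CL_finite_clause: "finite V \<Longrightarrow> c \<in> CL V k \<Longrightarrow> finite c"
  unfolding CL_def using finite_subset by fastforce

lemma CL_mono: "V \<subseteq> V' \<Longrightarrow> CL V k \<subseteq> CL V' k"
  unfolding CL_def by auto

lemma finite_CL [simp]: "finite V \<Longrightarrow> finite (CL V k)"
  unfolding CL_def by (rule finite_subset[of _ "Pow (V \<times> UNIV)"]) auto

lemma CL_0: "finite V \<Longrightarrow> CL V 0 = {{}}"
  unfolding CL_def using finite_subset[of _ "V \<times> (UNIV :: bool set)"] by auto

lemma CL_avoid: "c \<in> CL (V - {x}) k \<Longrightarrow> (x, s) \<notin> c"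
  unfolding CL_def by auto

lemma CL_unique: "c \<in> CL V k \<Longrightarrow> (x, s) \<in> c \<Longrightarrow> (x, t) \<in> c \<Longrightarrow> s = t"
  unfolding CL_def using inj_onD[of fst c "(x, s)" "(x, t)"] by auto

lemma CL_empty: "finite V \<Longrightarrow> card V < k \<Longrightarrow> CL V k = {}"
proof (rule ccontr)
  assume fin: "finite V" "card V < k" "CL V k \<noteq> {}"
  then obtain c where "c \<in> CL V k" by blast
  then have c: "c \<subseteq> V \<times> UNIV" "inj_on fst c" "card c = k" by (auto simp: CL_def)
  have "card c = card (fst ` c)" using c by (simp add: card_image)
  also have "\<dots> \<le> card V" using c fin by (intro card_mono) auto
  finally show False using fin c by simp
qed

lemma CL_insert_mem:
  assumes "finite V" "x \<in> V" "D \<in> CL (V - {x}) h"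
  shows "insert (x, s) D \<in> CL V (Suc h)"
proof -
  have "finite D" using CL_finite_clause assms by blast
  then show ?thesis using assms CL_avoid[OF assms(3)] unfolding CL_def
    by (auto simp: inj_on_def)
qed

lemma CL_remove_mem:
  assumes "finite V" "c \<in> CL V (Suc h)" "(x, s) \<in> c"
  shows "c - {(x, s)} \<in> CL (V - {x}) h" "x \<in> V"
proof -
  have fc: "finite c" using CL_finite_clause assms by blast
  have cc: "c \<subseteq> V \<times> UNIV" "inj_on fst c" "card c = Suc h" using assms(2) by (auto simp: CL_def)
  show "x \<in> V" using cc(1) assms(3) by blast
  have "c - {(x, s)} \<subseteq> (V - {x}) \<times> UNIV"
  proof
    fix l assume l: "l \<in> c - {(x, s)}"
    obtain y t where yt: "l = (y, t)" by (cases l)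
    then have "y \<noteq> x" using l CL_unique[OF assms(2,3), of t] by auto
    then show "l \<in> (V - {x}) \<times> UNIV" using l cc(1) yt by auto
  qed
  moreover have "inj_on fst (c - {(x, s)})" using cc(2) by (rule inj_on_subset) blast
  ultimately show "c - {(x, s)} \<in> CL (V - {x}) h"
    using fc cc(3) assms(3) by (simp add: CL_def)
qed

text \<open>Double counting of pairs of a clause and one of its literals: remove the literal, but
  remember its variable and sign. This turns derivatives of literal weights into sums over
  variables.\<close>

lemma sum_CL_literals:
  assumes "finite V"
  shows "(\<Sum>c\<in>CL V (Suc h). \<Sum>l\<in>c. g l c)
    = (\<Sum>x\<in>V. \<Sum>D\<in>CL (V - {x}) h. \<Sum>s\<in>UNIV. g (x, s) (insert (x, s) D))"
proof -
  have fc: "finite c" if "c \<in> CL V (Suc h)" for c using CL_finite_clause assms that by blast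
  have "(\<Sum>c\<in>CL V (Suc h). \<Sum>l\<in>c. g l c) = (\<Sum>(c, l)\<in>(SIGMA c:CL V (Suc h). c). g l c)"
    by (rule sum.Sigma) (use assms fc in auto)
  also have "\<dots> = (\<Sum>(x, D, s)\<in>(SIGMA x:V. CL (V - {x}) h \<times> UNIV). g (x, s) (insert (x, s) D))"
  proof (rule sum.reindex_bij_witness[where i="\<lambda>(x, D, s). (insert (x, s) D, (x, s))"
          and j="\<lambda>(c, l). (fst l, c - {l}, snd l)"], goal_cases)
    case (1 a)
    then show ?case by (cases a) (auto simp: insert_absorb)
  next
    case (2 a)
    then obtain c x s where a: "a = (c, (x, s))" "c \<in> CL V (Suc h)" "(x, s) \<in> c" by (cases a) auto
    then show ?case using CL_remove_mem[OF assms a(2,3)] by simp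
  next
    case (3 b)
    then obtain x D s where b: "b = (x, D, s)" "D \<in> CL (V - {x}) h" by (cases b) auto
    then show ?case using CL_avoid[OF b(2), of s] by simp
  next
    case (4 b)
    then obtain x D s where b: "b = (x, D, s)" "D \<in> CL (V - {x}) h" "x \<in> V" by (cases b) auto
    then show ?case using CL_insert_mem[OF assms b(3,2)] by simp
  next
    case (5 a)
    then show ?case by (cases a) (auto simp: insert_absorb)
  qed
  also have "\<dots> = (\<Sum>x\<in>V. \<Sum>(D, s)\<in>CL (V - {x}) h \<times> UNIV. g (x, s) (insert (x, s) D))"
    by (rule sum.Sigma[symmetric]) (use assms in auto)
  also have "\<dots> = (\<Sum>x\<in>V. \<Sum>D\<in>CL (V - {x}) h. \<Sum>s\<in>UNIV. g (x, s) (insert (x, s) D))"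
    by (simp add: sum.cartesian_product)
  finally show ?thesis .
qed

lemma sum_CL_split:
  assumes "finite V" "x \<in> V"
  shows "(\<Sum>c\<in>CL V (Suc h). g c)
    = (\<Sum>c\<in>CL (V - {x}) (Suc h). g c) + (\<Sum>D\<in>CL (V - {x}) h. \<Sum>s\<in>UNIV. g (insert (x, s) D))"
proof -
  let ?T = "{c \<in> CL V (Suc h). \<exists>s. (x, s) \<in> c}"
  have eq: "CL V (Suc h) = CL (V - {x}) (Suc h) \<union> ?T" "CL (V - {x}) (Suc h) \<inter> ?T = {}"
    unfolding CL_def by auto
  have "(\<Sum>c\<in>CL V (Suc h). g c) = (\<Sum>c\<in>CL (V - {x}) (Suc h). g c) + sum g ?T"
    using eq(2) assms by (subst eq(1), subst sum.union_disjoint) auto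
  also have "sum g ?T = (\<Sum>(D, s)\<in>CL (V - {x}) h \<times> UNIV. g (insert (x, s) D))"
  proof (rule sum.reindex_bij_witness[where i="\<lambda>(D, s). insert (x, s) D"
        and j="\<lambda>c. (c - {(x, True), (x, False)}, (x, True) \<in> c)"], goal_cases)
    case (1 c)
    then obtain s where s: "(x, s) \<in> c" "c \<in> CL V (Suc h)" by auto
    then have "(x, \<not> s) \<notin> c" using CL_unique[OF s(2,1), of "\<not> s"] by auto
    then show ?case using s by (cases s) auto
  next
    case (2 c)
    then obtain s where s: "(x, s) \<in> c" "c \<in> CL V (Suc h)" by auto
    then have "(x, \<not> s) \<notin> c" using CL_unique[OF s(2,1), of "\<not> s"] by auto
    then have "c - {(x, True), (x, False)} = c - {(x, s)}" by (cases s) auto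
    then show ?case using CL_remove_mem(1)[OF assms(1) s(2) s(1)] by auto
  next
    case (3 b)
    then obtain D s where b: "b = (D, s)" "D \<in> CL (V - {x}) h" by (cases b) auto
    have "(x, True) \<notin> D" "(x, False) \<notin> D" using CL_avoid[OF b(2)] by auto
    then show ?case using b(1) by (cases s) auto
  next
    case (4 b)
    then show ?case using CL_insert_mem assms by auto
  next
    case (5 c)
    then obtain s where s: "(x, s) \<in> c" "c \<in> CL V (Suc h)" by auto
    then have "(x, \<not> s) \<notin> c" using CL_unique[OF s(2,1), of "\<not> s"] by auto
    then have "insert (x, (x, True) \<in> c) (c - {(x, True), (x, False)}) = c" using s by (cases s) auto
    then show ?case by simp
  qed
  finally show ?thesis by (simp add: sum.cartesian_product)
qed

lemma lw_insert:
  assumes "finite V" "D \<in> CL (V - {x}) h"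
  shows "lw a (insert (x, s) D) = a (x, s) * lw a D"
  unfolding lw_def using CL_finite_clause[of "V - {x}" D h] assms CL_avoid[OF assms(2)] by simp

lemma lw_cong: "(\<And>l. l \<in> c \<Longrightarrow> a l = b l) \<Longrightarrow> lw a c = lw b c"
  unfolding lw_def by (rule prod.cong) auto

lemma lw_nonneg: "(\<And>l. 0 \<le> a l) \<Longrightarrow> 0 \<le> lw a c"
  unfolding lw_def by (rule prod_nonneg) auto

text \<open>Summing over signs first gives a factor \<open>A\<close> for each chosen variable; the
  induction is Pascal's rule.\<close>

lemma sum_lw_CL:
  assumes "finite V" "\<And>x. x \<in> V \<Longrightarrow> a (x, True) + a (x, False) = A"
  shows "(\<Sum>c\<in>CL V k. lw a c) = real (card V choose k) * A ^ k"
  using assms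
proof (induction V arbitrary: k rule: finite_induct)
  case empty
  show ?case by (cases k) (auto simp: CL_0 lw_def CL_empty)
next
  case (insert x V)
  show ?case
  proof (cases k)
    case 0
    then show ?thesis using insert by (simp add: CL_0 lw_def)
  next
    case (Suc h)
    have V: "insert x V - {x} = V" using insert by auto
    have "(\<Sum>c\<in>CL (insert x V) k. lw a c) = (\<Sum>c\<in>CL V (Suc h). lw a c)
        + (\<Sum>D\<in>CL V h. \<Sum>s\<in>UNIV. lw a (insert (x, s) D))"
      using sum_CL_split[of "insert x V" x "lw a" h] insert.hyps(1) unfolding V Suc by simp
    also have "(\<Sum>D\<in>CL V h. \<Sum>s\<in>UNIV. lw a (insert (x, s) D)) = (\<Sum>D\<in>CL V h. A * lw a D)"
    proof (intro sum.cong refl)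
      fix D assume "D \<in> CL V h"
      then have "lw a (insert (x, s) D) = a (x, s) * lw a D" for s
        using lw_insert[of "insert x V" D x h] insert.hyps(1) V by auto
      then show "(\<Sum>s\<in>UNIV. lw a (insert (x, s) D)) = A * lw a D"
        using insert.prems[of x] by (simp add: UNIV_bool distrib_right[symmetric] add.commute)
    qed
    finally show ?thesis
      using insert by (simp add: Suc sum_distrib_left[symmetric] algebra_simps)
  qed
qed

section \<open>The p-biased clause distribution as an insertion operator\<close>

definition pol :: "real \<Rightarrow> literal \<Rightarrow> real" where
  "pol p l = (if snd l then p else 1 - p)"

lemma pol_simps [simp]: "pol p (x, True) = p" "pol p (x, False) = 1 - p"
  by (simp_all add: pol_def)

definition cw :: "nat \<Rightarrow> nat \<Rightarrow> real \<Rightarrow> clause \<Rightarrow> real" where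
  "cw n k p c = lw (pol p) c / real (n choose k)"

lemma cw_nonneg: "0 \<le> p \<Longrightarrow> p \<le> 1 \<Longrightarrow> 0 \<le> cw n k p c"
  unfolding cw_def by (intro divide_nonneg_nonneg lw_nonneg) (auto simp: pol_def)

lemma sum_cw: "k \<le> n \<Longrightarrow> (\<Sum>c\<in>CL {..<n} k. cw n k p c) = 1"
  unfolding cw_def using sum_lw_CL[of "{..<n}" "pol p" 1 k]
  by (simp add: sum_divide_distrib[symmetric])

lemma finite_set_Pi_bernoulli: "finite V \<Longrightarrow> finite (set_pmf (Pi_pmf V d (\<lambda>_. bernoulli_pmf p)))"
  by (induction V rule: finite_induct) (simp_all add: Pi_pmf_insert)

text \<open>The signs are revealed one variable at a time. This links the product measure of the
  model with the multiplicative weights \<open>lw\<close>.\<close>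

lemma signed_expectation:
  assumes "finite V" "0 \<le> p" "p \<le> 1"
  shows "measure_pmf.expectation (map_pmf (\<lambda>s. (\<lambda>x. (x, s x)) ` V) (Pi_pmf V False (\<lambda>_. bernoulli_pmf p))) (f :: clause \<Rightarrow> real)
    = (\<Sum>c\<in>CL V (card V). lw (pol p) c * f c)"
  using assms(1)
proof (induction V arbitrary: f rule: finite_induct)
  case empty
  then show ?case by (simp add: CL_0 lw_def)
next
  case (insert x V)
  have V: "insert x V - {x} = V" using insert by auto
  let ?P = "Pi_pmf V False (\<lambda>_. bernoulli_pmf p)"
  let ?Q = "map_pmf (\<lambda>s. (\<lambda>x. (x, s x)) ` V) ?P"
  have img: "(\<lambda>z. (z, (f(x := y)) z)) ` insert x V = insert (x, y) ((\<lambda>z. (z, f z)) ` V)" for f :: "nat \<Rightarrow> bool" and y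
  proof -
    have "(\<lambda>z. (z, (f(x := y)) z)) ` V = (\<lambda>z. (z, f z)) ` V"
      by (rule image_cong) (use insert.hyps(2) in auto)
    then show ?thesis by simp
  qed
  have "map_pmf (\<lambda>s. (\<lambda>x. (x, s x)) ` insert x V) (Pi_pmf (insert x V) False (\<lambda>_. bernoulli_pmf p))
    = bind_pmf (bernoulli_pmf p) (\<lambda>y. map_pmf (insert (x, y)) ?Q)"
    using insert.hyps
    by (subst Pi_pmf_insert') (simp_all add: map_bind_pmf img map_pmf_def bind_assoc_pmf bind_return_pmf del: image_insert fun_upd_apply)
  also have "measure_pmf.expectation \<dots> f
    = (\<Sum>y\<in>UNIV. pmf (bernoulli_pmf p) y *\<^sub>R measure_pmf.expectation (map_pmf (insert (x, y)) ?Q) f)"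
    by (rule pmf_expectation_bind) (use finite_set_Pi_bernoulli[OF insert.hyps(1)] in auto)
  also have "\<dots> = (\<Sum>y\<in>UNIV. pmf (bernoulli_pmf p) y * (\<Sum>c\<in>CL V (card V). lw (pol p) c * f (insert (x, y) c)))"
    unfolding integral_map_pmf[of "insert (x, _)" ?Q f] insert.IH by simp
  also have "\<dots> = (\<Sum>y\<in>UNIV. \<Sum>c\<in>CL V (card V). lw (pol p) (insert (x, y) c) * f (insert (x, y) c))"
  proof (intro sum.cong refl)
    fix y
    have "pmf (bernoulli_pmf p) y * lw (pol p) c = lw (pol p) (insert (x, y) c)" if "c \<in> CL V (card V)" for c
      using lw_insert[of "insert x V" c x "card V" "pol p" y] that insert.hyps(1) V assms by (cases y) auto
    then show "pmf (bernoulli_pmf p) y * (\<Sum>c\<in>CL V (card V). lw (pol p) c * f (insert (x, y) c))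
      = (\<Sum>c\<in>CL V (card V). lw (pol p) (insert (x, y) c) * f (insert (x, y) c))"
      by (simp add: sum_distrib_left mult.assoc[symmetric])
  qed
  also have "\<dots> = (\<Sum>c\<in>CL (insert x V) (card (insert x V)). lw (pol p) c * f c)"
    using sum_CL_split[of "insert x V" x "\<lambda>c. lw (pol p) c * f c" "card V"] insert.hyps V
    by (simp add: CL_empty sum.swap[of _ UNIV])
  finally show ?case .
qed

lemma sum_CL_by_vars:
  assumes "finite W"
  shows "(\<Sum>V\<in>{V. V \<subseteq> W \<and> card V = k}. \<Sum>c\<in>CL V k. g c) = (\<Sum>c\<in>CL W k. g c)"
proof -
  let ?K = "{V. V \<subseteq> W \<and> card V = k}"
  have finK: "finite ?K" using assms by (intro finite_subset[of ?K "Pow W"]) auto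
  have vars: "fst ` c = V" if "V \<in> ?K" "c \<in> CL V k" for V c
  proof (rule card_subset_eq)
    show "finite V" using that assms finite_subset by auto
    show "fst ` c \<subseteq> V" using that by (auto simp: CL_def)
    show "card (fst ` c) = card V" using that by (auto simp: CL_def card_image)
  qed
  have "(\<Sum>V\<in>?K. \<Sum>c\<in>CL V k. g c) = sum g (\<Union>V\<in>?K. CL V k)"
  proof (rule sum.UNION_disjoint[symmetric])
    show "\<forall>V\<in>?K. finite (CL V k)" using assms by (metis (mono_tags) finite_CL finite_subset mem_Collect_eq)
    show "\<forall>V\<in>?K. \<forall>V'\<in>?K. V \<noteq> V' \<longrightarrow> CL V k \<inter> CL V' k = {}" using vars by blast
  qed (rule finK)
  also have "(\<Union>V\<in>?K. CL V k) = CL W k"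
  proof
    show "(\<Union>V\<in>?K. CL V k) \<subseteq> CL W k" using CL_mono by blast
    show "CL W k \<subseteq> (\<Union>V\<in>?K. CL V k)"
    proof
      fix c assume c: "c \<in> CL W k"
      have "c \<subseteq> fst ` c \<times> UNIV" by force
      then have "fst ` c \<in> ?K" "c \<in> CL (fst ` c) k"
        using c by (auto simp: CL_def card_image)
      then show "c \<in> (\<Union>V\<in>?K. CL V k)" by blast
    qed
  qed
  finally show ?thesis .
qed

lemma random_clause_expectation:
  assumes "k \<le> n" "0 \<le> p" "p \<le> 1"
  shows "measure_pmf.expectation (random_clause k p n) (f :: clause \<Rightarrow> real)
    = (\<Sum>c\<in>CL {..<n} k. cw n k p c * f c)"
    and "finite (set_pmf (random_clause k p n))"
proof -
  let ?K = "{V. V \<subseteq> {..<n} \<and> card V = k}"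
  have K: "finite ?K" "card ?K = n choose k"
     apply (rule finite_subset[of _ "Pow {..<n}"], blast, simp)
    using n_subsets[of "{..<n}" k] by simp
  have K0: "?K \<noteq> {}"
  proof
    assume "?K = {}"
    then have "n choose k = 0" using K(2) by (metis card.empty)
    then show False using assms(1) by simp
  qed
  have fin: "finite (set_pmf (map_pmf (\<lambda>s. (\<lambda>x. (x, s x)) ` V) (Pi_pmf V False (\<lambda>_. bernoulli_pmf p))))"
    if "V \<in> ?K" for V
  proof -
    have "finite V" using that by (metis (mono_tags) finite_lessThan finite_subset mem_Collect_eq)
    from finite_set_Pi_bernoulli[OF this, of False p] show ?thesis by simp
  qed
  show "finite (set_pmf (random_clause k p n))"
    unfolding random_clause_def set_bind_pmf set_pmf_of_set[OF K0 K(1)]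
    using K fin by (intro finite_UN_I) auto
  have "measure_pmf.expectation (random_clause k p n) f
    = (\<Sum>V\<in>?K. (\<Sum>c\<in>CL V k. lw (pol p) c * f c) / real (n choose k))"
    unfolding random_clause_def
  proof (subst pmf_expectation_bind_pmf_of_set[OF K0 K(1) fin], assumption, intro sum.cong refl)
    fix V assume V: "V \<in> ?K"
    then have "finite V" using finite_subset by auto
    then show "measure_pmf.expectation (map_pmf (\<lambda>s. (\<lambda>x. (x, s x)) ` V) (Pi_pmf V False (\<lambda>_. bernoulli_pmf p))) f /\<^sub>R real (card ?K)
      = (\<Sum>c\<in>CL V k. lw (pol p) c * f c) / real (n choose k)"
      using V K(2) signed_expectation[of V p f] assms by (simp add: divide_inverse mult.commute)
  qed
  also have "\<dots> = (\<Sum>V\<in>?K. \<Sum>c\<in>CL V k. cw n k p c * f c)"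
    by (simp add: cw_def sum_divide_distrib)
  also have "\<dots> = (\<Sum>c\<in>CL {..<n} k. cw n k p c * f c)" by (rule sum_CL_by_vars) simp
  finally show "measure_pmf.expectation (random_clause k p n) (f :: clause \<Rightarrow> real)
    = (\<Sum>c\<in>CL {..<n} k. cw n k p c * f c)" .
qed

definition COp :: "nat \<Rightarrow> nat \<Rightarrow> real \<Rightarrow> (clause set \<Rightarrow> real) \<Rightarrow> clause set \<Rightarrow> real" where
  "COp n k p = Op (CL {..<n} k) (cw n k p) (\<lambda>c. c)"

text \<open>Satisfiability depends only on the set of clauses, so multiplicities may be forgotten;
  \<open>X\<close> holds the clauses drawn before, which makes the induction work.\<close>

lemma random_formula_expectation:
  assumes "k \<le> n" "0 \<le> p" "p \<le> 1"
  shows "measure_pmf.expectation (replicate_pmf m (random_clause k p n)) (\<lambda>F. f (set F \<union> X))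
    = (COp n k p ^^ m) f X"
proof (induction m arbitrary: X)
  case (Suc m)
  let ?R = "random_clause k p n"
  have fin: "finite (set_pmf (replicate_pmf m ?R))"
    unfolding set_replicate_pmf
    by (rule finite_subset[OF _ finite_lists_length_eq[OF random_clause_expectation(2)[OF assms], of m]]) auto
  have eq: "replicate_pmf (Suc m) ?R = bind_pmf ?R (\<lambda>x. map_pmf ((#) x) (replicate_pmf m ?R))"
    by (simp add: map_pmf_def)
  have "measure_pmf.expectation (replicate_pmf (Suc m) ?R) (\<lambda>F. f (set F \<union> X))
    = (\<Sum>x\<in>set_pmf ?R. pmf ?R x * measure_pmf.expectation (map_pmf ((#) x) (replicate_pmf m ?R)) (\<lambda>F. f (set F \<union> X)))"
    unfolding eq
    by (subst pmf_expectation_bind[where A="set_pmf ?R"])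
      (use fin random_clause_expectation(2)[OF assms] in \<open>simp_all only: finite_imageI set_map_pmf order_refl real_scaleR_def\<close>)
  also have "\<dots> = (\<Sum>x\<in>set_pmf ?R. pmf ?R x * (COp n k p ^^ m) f (insert x X))"
    unfolding integral_map_pmf Suc.IH[symmetric] by simp
  also have "\<dots> = measure_pmf.expectation ?R (\<lambda>x. (COp n k p ^^ m) f (insert x X))"
    using random_clause_expectation(2)[OF assms]
    by (subst integral_measure_pmf[where A="set_pmf ?R"]) (simp_all add: set_pmf_eq)
  also have "\<dots> = (COp n k p ^^ Suc m) f X"
    unfolding random_clause_expectation(1)[OF assms] by (simp add: COp_def Op_def)
  finally show ?case .
qed simp

definition US :: "nat \<Rightarrow> real \<Rightarrow> nat \<Rightarrow> nat \<Rightarrow> real" where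
  "US k p n m = (COp n k p ^^ m) uind {}"

lemma prob_sat_eq:
  assumes "k \<le> n" "0 \<le> p" "p \<le> 1"
  shows "measure_pmf.prob (random_formula k p m n) {F. satisfiable F} = 1 - US k p n m"
proof -
  have "measure_pmf.prob (random_formula k p m n) {F. \<not> satisfiable F}
    = measure_pmf.expectation (random_formula k p m n) (indicator {F. \<not> satisfiable F})"
    by simp
  also have "indicator {F. \<not> satisfiable F} = (\<lambda>F. uind (set F \<union> {}))"
    by (auto simp: fun_eq_iff uind_def unsat_def satisfiable_def)
  finally have "measure_pmf.prob (random_formula k p m n) {F. \<not> satisfiable F} = US k p n m"
    unfolding random_formula_def US_def using random_formula_expectation[OF assms, of m uind "{}"] by simp
  then show ?thesis
    using measure_pmf.prob_compl[of "{F. satisfiable F}" "random_formula k p m n"]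
    by (simp add: Compl_eq_Diff_UNIV[symmetric] Collect_neg_eq)
qed

section \<open>The signs of one variable\<close>

lemma unsat_insert_clause: "unsat (insert D Y) \<longleftrightarrow> (\<forall>l\<in>D. unsat (insert {l} Y))"
  unfolding unsat_def satisfies_clause_def by (auto; blast)

text \<open>Equivalently, no solution gives \<open>x\<close> the value \<open>s\<close>. The form
  with a unit clause inherits monotonicity from \<open>unsat\<close>.\<close>

definition blocked :: "nat \<Rightarrow> bool \<Rightarrow> clause set \<Rightarrow> bool" where
  "blocked x s Y \<longleftrightarrow> unsat (insert {(x, s)} Y)"

lemma blocked_mono: "X \<subseteq> Y \<Longrightarrow> blocked x s X \<Longrightarrow> blocked x s Y"
  unfolding blocked_def by (erule unsat_mono[rotated]) auto

lemma unsat_iff_blocked: "unsat Y \<longleftrightarrow> blocked x s Y \<and> blocked x (\<not> s) Y"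
proof
  assume "unsat Y" then show "blocked x s Y \<and> blocked x (\<not> s) Y"
    unfolding blocked_def by (auto intro: unsat_mono[of Y])
next
  assume b: "blocked x s Y \<and> blocked x (\<not> s) Y"
  show "unsat Y"
  proof (rule ccontr)
    assume "\<not> unsat Y"
    then obtain \<sigma> where \<sigma>: "\<forall>C\<in>Y. satisfies_clause \<sigma> C" by (auto simp: unsat_def)
    then have "\<forall>C\<in>insert {(x, \<sigma> x)} Y. satisfies_clause \<sigma> C" by (auto simp: satisfies_clause_def)
    then have "\<not> blocked x (\<sigma> x) Y" by (auto simp: blocked_def unsat_def)
    then show False using b by (cases "\<sigma> x = s") auto
  qed
qed

lemma blocked_insert_same: "blocked x s (insert (insert (x, s) D) Y) \<longleftrightarrow> blocked x s Y"
proof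
  assume a: "blocked x s (insert (insert (x, s) D) Y)"
  show "blocked x s Y"
  proof (rule ccontr)
    assume "\<not> blocked x s Y"
    then obtain \<sigma> where \<sigma>: "\<forall>C\<in>insert {(x, s)} Y. satisfies_clause \<sigma> C" by (auto simp: blocked_def unsat_def)
    then have "satisfies_clause \<sigma> (insert (x, s) D)" by (auto simp: satisfies_clause_def)
    then show False using a \<sigma> unfolding blocked_def unsat_def by auto
  qed
qed (rule blocked_mono, auto)

lemma blocked_insert_opp: "blocked x s (insert (insert (x, \<not> s) D) Y) \<longleftrightarrow> blocked x s (insert D Y)"
proof -
  have "satisfies_clause \<sigma> (insert (x, \<not> s) D) = satisfies_clause \<sigma> D" if "satisfies_clause \<sigma> {(x, s)}" for \<sigma>
    using that by (auto simp: satisfies_clause_def)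
  then show ?thesis unfolding blocked_def unsat_def by auto
qed

lemma blocked_insert_opp': "blocked x (\<not> s) (insert (insert (x, s) D) Y) \<longleftrightarrow> blocked x (\<not> s) (insert D Y)"
  using blocked_insert_opp[of x "\<not> s" D Y] by simp

text \<open>Under the value \<open>s\<close> of \<open>x\<close> the new clause is satisfied, under
  the other value it acts as \<open>D\<close>.\<close>

lemma unsat_insert_lit: "unsat (insert (insert (x, s) D) Y) \<longleftrightarrow> blocked x s Y \<and> blocked x (\<not> s) (insert D Y)"
  by (subst unsat_iff_blocked[of _ x s]) (simp only: blocked_insert_same blocked_insert_opp')

text \<open>A backbone variable: solutions exist and all of them give \<open>x\<close> the value
  opposite to \<open>s\<close>.\<close>

definition frozen :: "nat \<Rightarrow> bool \<Rightarrow> clause set \<Rightarrow> real" where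
  "frozen x s Y = of_bool (blocked x s Y \<and> \<not> unsat Y)"

lemma frozen_bounds [simp]: "0 \<le> frozen x s Y" "frozen x s Y \<le> 1" by (auto simp: frozen_def)

text \<open>The condition is semantic because the always satisfied clause \<open>UNIV\<close> has to
  avoid every variable, although it contains all literals.\<close>

definition avoids :: "nat \<Rightarrow> clause \<Rightarrow> bool" where
  "avoids x C \<longleftrightarrow> (\<forall>\<sigma> v. satisfies_clause (\<sigma>(x := v)) C = satisfies_clause \<sigma> C)"

definition all_avoid :: "nat \<Rightarrow> clause set \<Rightarrow> bool" where
  "all_avoid x X \<longleftrightarrow> (\<forall>C\<in>X. avoids x C)"

lemma all_avoid_empty [simp]: "all_avoid x {}" by (simp add: all_avoid_def)
lemma all_avoid_insert: "all_avoid x (insert C X) \<longleftrightarrow> avoids x C \<and> all_avoid x X" by (auto simp: all_avoid_def)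
lemma all_avoid_Un: "all_avoid x (X \<union> Y) \<longleftrightarrow> all_avoid x X \<and> all_avoid x Y" by (auto simp: all_avoid_def)
lemma avoids_CL: "c \<in> CL (V - {x}) k \<Longrightarrow> avoids x c"
proof -
  assume c: "c \<in> CL (V - {x}) k"
  have "fst l \<noteq> x" if "l \<in> c" for l using CL_avoid[OF c, of "snd l"] that by (metis prod.collapse)
  then have "(\<exists>l\<in>c. (\<sigma>(x := v)) (fst l) = snd l) \<longleftrightarrow> (\<exists>l\<in>c. \<sigma> (fst l) = snd l)" for \<sigma> :: "nat \<Rightarrow> bool" and v
    by (intro bex_cong) auto
  then show ?thesis by (simp add: avoids_def satisfies_clause_def case_prod_beta)
qed
lemma avoids_UNIV: "avoids x UNIV"
  by (auto simp: avoids_def satisfies_clause_def)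

lemma blocked_all_avoid: "all_avoid x X \<Longrightarrow> blocked x s X \<longleftrightarrow> unsat X"
proof
  assume x: "all_avoid x X" "blocked x s X"
  show "unsat X"
  proof (rule ccontr)
    assume "\<not> unsat X"
    then obtain \<sigma> where "\<forall>C\<in>X. satisfies_clause \<sigma> C" by (auto simp: unsat_def)
    then have "\<forall>C\<in>insert {(x, s)} X. satisfies_clause (\<sigma>(x := s)) C"
      using x(1) by (auto simp: all_avoid_def avoids_def) (simp add: satisfies_clause_def)
    then show False using x(2) unfolding blocked_def unsat_def by blast
  qed
qed (auto simp: blocked_def intro: unsat_mono[of X])

text \<open>\<open>N\<close> and \<open>P\<close> are the remainders of the clauses that contain \<open>x\<close> negatively and positively.\<close>

definition glue :: "nat \<Rightarrow> clause set \<Rightarrow> clause set \<Rightarrow> clause set \<Rightarrow> clause set" where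
  "glue x X N P = X \<union> insert (x, False) ` N \<union> insert (x, True) ` P"

lemma glue_insert:
  "insert c (glue x X N P) = glue x (insert c X) N P"
  "insert (insert (x, False) D) (glue x X N P) = glue x X (insert D N) P"
  "insert (insert (x, True) D) (glue x X N P) = glue x X N (insert D P)"
  by (auto simp: glue_def)

text \<open>Setting \<open>x\<close> to true satisfies the clauses built from \<open>P\<close> and
  leaves the remainders in \<open>N\<close>; setting it to false does the opposite.\<close>

lemma blocked_glue:
  assumes "all_avoid x X" "all_avoid x N" "all_avoid x P"
  shows "blocked x True (glue x X N P) \<longleftrightarrow> unsat (X \<union> N)" "blocked x False (glue x X N P) \<longleftrightarrow> unsat (X \<union> P)"
proof -
  have 1: "satisfies_clause \<sigma> (insert (x, s) D) \<longleftrightarrow> \<sigma> x = s \<or> satisfies_clause \<sigma> D" for \<sigma> s D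
    by (auto simp: satisfies_clause_def)
  have 2: "satisfies_clause \<sigma> {(x, s)} \<longleftrightarrow> \<sigma> x = s" "\<not> satisfies_clause \<sigma> {}" for \<sigma> s
    by (auto simp: satisfies_clause_def)
  have "(\<forall>C\<in>insert {(x, True)} (glue x X N P). satisfies_clause \<sigma> C)
      \<longleftrightarrow> (\<forall>C\<in>insert {(x, True)} (X \<union> N). satisfies_clause \<sigma> C)" for \<sigma>
    unfolding glue_def by (cases "\<sigma> x") (auto simp add: 1 2 ball_Un)
  then have "blocked x True (glue x X N P) \<longleftrightarrow> blocked x True (X \<union> N)"
    unfolding blocked_def unsat_def by simp
  then show "blocked x True (glue x X N P) \<longleftrightarrow> unsat (X \<union> N)" using blocked_all_avoid[of x "X \<union> N"] assms by (simp add: all_avoid_Un)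
  have "(\<forall>C\<in>insert {(x, False)} (glue x X N P). satisfies_clause \<sigma> C)
      \<longleftrightarrow> (\<forall>C\<in>insert {(x, False)} (X \<union> P). satisfies_clause \<sigma> C)" for \<sigma>
    unfolding glue_def by (cases "\<sigma> x") (auto simp add: 1 2 ball_Un)
  then have "blocked x False (glue x X N P) \<longleftrightarrow> blocked x False (X \<union> P)"
    unfolding blocked_def unsat_def by simp
  then show "blocked x False (glue x X N P) \<longleftrightarrow> unsat (X \<union> P)" using blocked_all_avoid[of x "X \<union> P"] assms by (simp add: all_avoid_Un)
qed

section \<open>The race between the two values of a variable\<close>

primrec first_blocked :: "nat \<Rightarrow> bool \<Rightarrow> clause set \<Rightarrow> clause list \<Rightarrow> bool" where
  "first_blocked x s Y [] = (blocked x s Y \<and> \<not> blocked x (\<not> s) Y)"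
| "first_blocked x s Y (E # Es) = ((blocked x s Y \<and> \<not> blocked x (\<not> s) Y) \<or> first_blocked x s (insert E Y) Es)"

lemma first_blocked_opp: "blocked x (\<not> s) Y \<Longrightarrow> \<not> first_blocked x s Y Es"
proof (induction Es arbitrary: Y)
  case (Cons E Es)
  then show ?case using Cons.IH[of "insert E Y"] blocked_mono[of Y "insert E Y" x "\<not> s"] by auto
qed simp

lemma first_blocked_now: "blocked x s Y \<Longrightarrow> \<not> blocked x (\<not> s) Y \<Longrightarrow> first_blocked x s Y Es"
  by (cases Es) auto

text \<open>The race of \<open>first_blocked\<close> with \<open>x\<close> eliminated. In this form
  it is an event of the signs that increases in \<open>N\<close>, decreases in \<open>P\<close> and
  excludes its mirror image, which is what \<open>col_avg_coloring\<close> asks for. Ties count for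
  neither side.\<close>

primrec first_unsat :: "clause set \<Rightarrow> clause set \<Rightarrow> clause set \<Rightarrow> clause list \<Rightarrow> bool" where
  "first_unsat X N P [] = (unsat (X \<union> N) \<and> \<not> unsat (X \<union> P))"
| "first_unsat X N P (E # Es) = ((unsat (X \<union> N) \<and> \<not> unsat (X \<union> P)) \<or> first_unsat (insert E X) N P Es)"

lemma first_blocked_glue:
  assumes "all_avoid x X" "all_avoid x N" "all_avoid x P" "\<forall>E\<in>set Es. avoids x E"
  shows "first_blocked x True (glue x X N P) Es \<longleftrightarrow> first_unsat X N P Es" "first_blocked x False (glue x X N P) Es \<longleftrightarrow> first_unsat X P N Es"
  using assms(1,4)
  by (induction Es arbitrary: X)
     (simp_all add: blocked_glue assms(2,3) glue_insert all_avoid_insert)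

lemma first_unsat_mono: "N \<subseteq> N' \<Longrightarrow> P' \<subseteq> P \<Longrightarrow> first_unsat X N P Es \<Longrightarrow> first_unsat X N' P' Es"
proof (induction Es arbitrary: X)
  case Nil
  then show ?case using unsat_mono[of "X \<union> N" "X \<union> N'"] unsat_mono[of "X \<union> P'" "X \<union> P"] by auto
next
  case (Cons E Es)
  then show ?case using unsat_mono[of "X \<union> N" "X \<union> N'"] unsat_mono[of "X \<union> P'" "X \<union> P"] by auto
qed

lemma first_unsat_blocked: "unsat (X \<union> P) \<Longrightarrow> \<not> first_unsat X N P Es"
proof (induction Es arbitrary: X)
  case (Cons E Es)
  have "unsat (insert E X \<union> P)" by (rule unsat_mono[OF _ Cons.prems]) auto
  then show ?case using Cons.IH[of "insert E X"] Cons.prems by simp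
qed simp

lemma first_unsat_excl: "first_unsat X N P Es \<Longrightarrow> \<not> first_unsat X P N Es"
proof (induction Es arbitrary: X)
  case (Cons E Es)
  have "unsat (X \<union> N) \<Longrightarrow> \<not> first_unsat (insert E X) P N Es"
    by (rule first_unsat_blocked) (rule unsat_mono[of "X \<union> N"], auto)
  moreover have "unsat (X \<union> P) \<Longrightarrow> \<not> first_unsat (insert E X) N P Es"
    by (rule first_unsat_blocked) (rule unsat_mono[of "X \<union> P"], auto)
  ultimately show ?case using Cons.IH[of "insert E X"] Cons.prems by auto
qed auto

section \<open>Independent random signs and the odds of monotone events\<close>

primrec col_avg :: "real \<Rightarrow> 'd list \<Rightarrow> ('d set \<Rightarrow> 'd set \<Rightarrow> real) \<Rightarrow> 'd set \<Rightarrow> 'd set \<Rightarrow> real" where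
  "col_avg t [] \<phi> N P = \<phi> N P"
| "col_avg t (D # Ys) \<phi> N P = t * col_avg t Ys \<phi> (insert D N) P + (1 - t) * col_avg t Ys \<phi> N (insert D P)"

lemma col_avg_mono:
  assumes "0 \<le> t" "t \<le> 1" "\<And>N P. \<phi> N P \<le> \<psi> N P"
  shows "col_avg t Ys \<phi> N P \<le> col_avg t Ys \<psi> N P"
  by (induction Ys arbitrary: N P) (auto intro!: add_mono mult_left_mono simp: assms)

lemma col_avg_const: "col_avg t Ys (\<lambda>_ _. a) N P = a"
  by (induction Ys arbitrary: N P) (auto simp: algebra_simps)

lemma col_avg_sum: "col_avg t Ys (\<lambda>N P. \<Sum>j\<in>J. a j * \<phi> j N P) N P = (\<Sum>j\<in>J. a j * col_avg t Ys (\<phi> j) N P)"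
proof (induction Ys arbitrary: N P)
  case (Cons D Ys)
  show ?case
    unfolding col_avg.simps Cons.IH sum_distrib_left sum.distrib[symmetric]
    by (intro sum.cong refl) (simp add: algebra_simps)
qed simp

lemma col_avg_add: "col_avg t Ys (\<lambda>N P. \<phi> N P + \<psi> N P) N P = col_avg t Ys \<phi> N P + col_avg t Ys \<psi> N P"
proof (induction Ys arbitrary: N P)
  case (Cons D Ys)
  show ?case unfolding col_avg.simps Cons.IH by (simp add: algebra_simps)
qed simp

lemma col_avg_cmult: "col_avg t Ys (\<lambda>N P. a * \<phi> N P) N P = a * col_avg t Ys \<phi> N P"
proof (induction Ys arbitrary: N P)
  case (Cons D Ys)
  show ?case unfolding col_avg.simps Cons.IH by (simp add: algebra_simps)
qed simp

lemma col_avg_diff: "col_avg t Ys (\<lambda>N P. \<phi> N P - \<psi> N P) N P = col_avg t Ys \<phi> N P - col_avg t Ys \<psi> N P"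
proof (induction Ys arbitrary: N P)
  case (Cons D Ys)
  show ?case unfolding col_avg.simps Cons.IH by (simp add: algebra_simps)
qed simp

lemma col_avg_swap: "col_avg t Ys (\<lambda>N P. \<phi> P N) N P = col_avg (1 - t) Ys \<phi> P N"
  by (induction Ys arbitrary: N P) auto

lemma col_avg_insert:
  "col_avg t Ys (\<lambda>N P. \<phi> (insert D N) P) N P = col_avg t Ys \<phi> (insert D N) P"
  "col_avg t Ys (\<lambda>N P. \<phi> N (insert D P)) N P = col_avg t Ys \<phi> N (insert D P)"
  by (induction Ys arbitrary: N P) (auto simp: insert_commute)

lemma col_avg_cong_inv:
  assumes "\<And>N P. N \<subseteq> set Ys \<union> N0 \<Longrightarrow> P \<subseteq> set Ys \<union> P0 \<Longrightarrow> \<phi> N P = \<psi> N P"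
  shows "col_avg t Ys \<phi> N0 P0 = col_avg t Ys \<psi> N0 P0"
  using assms
proof (induction Ys arbitrary: N0 P0)
  case (Cons D Ys)
  have "col_avg t Ys \<phi> (insert D N0) P0 = col_avg t Ys \<psi> (insert D N0) P0"
    by (rule Cons.IH, rule Cons.prems) auto
  moreover have "col_avg t Ys \<phi> N0 (insert D P0) = col_avg t Ys \<psi> N0 (insert D P0)"
    by (rule Cons.IH, rule Cons.prems) auto
  ultimately show ?case by simp
qed simp

lemma col_avg_mono_set:
  assumes t: "0 \<le> t" "t \<le> 1" and A: "\<And>N N' P P'. N \<subseteq> N' \<Longrightarrow> P' \<subseteq> P \<Longrightarrow> \<phi> N P \<le> \<phi> N' P'"
  shows "N \<subseteq> N' \<Longrightarrow> P' \<subseteq> P \<Longrightarrow> col_avg t Ys \<phi> N P \<le> col_avg t Ys \<phi> N' P'"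
proof (induction Ys arbitrary: N P N' P')
  case Nil then show ?case using A by simp
next
  case (Cons D Ys)
  have "col_avg t Ys \<phi> (insert D N) P \<le> col_avg t Ys \<phi> (insert D N') P'"
    "col_avg t Ys \<phi> N (insert D P) \<le> col_avg t Ys \<phi> N' (insert D P')"
    using Cons.prems by (auto intro!: Cons.IH)
  then show ?case using t by (auto intro!: add_mono mult_left_mono)
qed

text \<open>The map \<open>a \<mapsto> \<rho> a / (1 + (\<rho> - 1) a)\<close> multiplies the odds \<open>a / (1 - a)\<close> by \<open>\<rho>\<close>.\<close>

lemma odds_mix:
  fixes p :: real
  assumes "0 \<le> p" "p \<le> 1" "0 \<le> x" "x \<le> y" "y \<le> 1" "1 \<le> \<rho>"
  defines "\<beta> \<equiv> \<lambda>a. \<rho> * a / (1 + (\<rho> - 1) * a)"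
  shows "\<beta> (p * y + (1 - p) * x) \<le> \<beta> p * \<beta> y + (1 - \<beta> p) * \<beta> x"
proof -
  define r where "r = \<rho> - 1"
  have r: "0 \<le> r" "\<rho> = 1 + r" using assms by (auto simp: r_def)
  define a where "a = p * y + (1 - p) * x"
  have a0: "0 \<le> a" unfolding a_def using assms by (intro add_nonneg_nonneg mult_nonneg_nonneg) auto
  have pos: "0 < 1 + r * p" "0 < 1 + r * x" "0 < 1 + r * y" "0 < 1 + r * a"
    using r assms a0 by (auto intro!: add_pos_nonneg mult_nonneg_nonneg)
  have \<beta>: "\<beta> a = (1 + r) * a / (1 + r * a)" for a by (simp add: \<beta>_def r(2))
  have "\<beta> p * \<beta> y + (1 - \<beta> p) * \<beta> x
    = ((1 + r) * p * ((1 + r) * y) * (1 + r * x) + (1 - p) * ((1 + r) * x) * (1 + r * y)) / ((1 + r * p) * (1 + r * x) * (1 + r * y))"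
  proof -
    have comb: "A / (d1 * d3) + B / (d1 * d2) = (A * d2 + B * d3) / (d1 * d2 * d3)"
      if "0 < d1" "0 < d2" "0 < d3" for A B d1 d2 d3 :: real
      using that by (simp add: field_simps)
    have "1 - \<beta> p = (1 - p) / (1 + r * p)"
      unfolding \<beta> using pos by (simp add: field_simps)
    then show ?thesis
      unfolding \<beta>[of y] \<beta>[of x] using comb[OF pos(1,2,3), of "(1 + r) * p * ((1 + r) * y)" "(1 - p) * ((1 + r) * x)"]
      by (simp add: \<beta>[of p])
  qed
  moreover have "(1 + r) * a * ((1 + r * p) * (1 + r * x) * (1 + r * y))
     \<le> ((1 + r) * p * ((1 + r) * y) * (1 + r * x) + (1 - p) * ((1 + r) * x) * (1 + r * y)) * (1 + r * a)"
  proof -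
    \<comment> \<open>After clearing denominators the difference is an explicit product of
      nonnegative factors; this is where \<open>x \<le> y\<close> and \<open>y \<le> 1\<close>
      enter.\<close>
    have "((1 + r) * p * ((1 + r) * y) * (1 + r * x) + (1 - p) * ((1 + r) * x) * (1 + r * y)) * (1 + r * a)
       - (1 + r) * a * ((1 + r * p) * (1 + r * x) * (1 + r * y))
      = (1 + r) * (p * (1 - p) * (y - x) * r * ((1 - y) + (1 + r) * x))"
      unfolding a_def by (simp add: algebra_simps)
    moreover have "0 \<le> (1 + r) * (p * (1 - p) * (y - x) * r * ((1 - y) + (1 + r) * x))"
      using r assms by (intro mult_nonneg_nonneg add_nonneg_nonneg) auto
    ultimately show ?thesis by linarith
  qed
  ultimately show ?thesis
    unfolding a_def[symmetric] \<beta>[of a] using pos by (simp add: divide_le_eq le_divide_eq mult.commute mult.left_commute)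
qed

lemma odds_mono:
  fixes a :: real
  assumes "1 \<le> \<rho>" "0 \<le> a" "a \<le> b"
  shows "\<rho> * a / (1 + (\<rho> - 1) * a) \<le> \<rho> * b / (1 + (\<rho> - 1) * b)"
proof -
  have "0 < 1 + (\<rho> - 1) * a" "0 < 1 + (\<rho> - 1) * b" using assms by (auto intro!: add_pos_nonneg mult_nonneg_nonneg)
  then show ?thesis using assms by (simp add: frac_le_eq divide_le_0_iff) (simp add: field_simps mult_left_mono)
qed

text \<open>The two-point inequality \<open>odds_mix\<close> tensorizes: each colour contributes one
  step, and the values 0 and 1 at the leaves are fixed points of the odds map. An event that depends
  on a single colour gives equality.\<close>

lemma col_avg_odds:
  assumes t: "0 \<le> p" "p \<le> 1" "1 \<le> \<rho>" "q = \<rho> * p / (1 + (\<rho> - 1) * p)" "q \<le> 1"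
    and A01: "\<And>N P. \<phi> N P = 0 \<or> \<phi> N P = 1"
    and A: "\<And>N N' P P'. N \<subseteq> N' \<Longrightarrow> P' \<subseteq> P \<Longrightarrow> \<phi> N P \<le> \<phi> N' P'"
  shows "\<rho> * col_avg p Ys \<phi> N P / (1 + (\<rho> - 1) * col_avg p Ys \<phi> N P) \<le> col_avg q Ys \<phi> N P"
proof (induction Ys arbitrary: N P)
  case Nil
  then show ?case using A01[of N P] t by auto
next
  case (Cons D Ys)
  have bnd: "0 \<le> col_avg p Ys \<phi> N P" "col_avg p Ys \<phi> N P \<le> 1" for N P
  proof -
    have "0 \<le> \<phi> N P" "\<phi> N P \<le> 1" for N P using A01[of N P] by auto
    then show "0 \<le> col_avg p Ys \<phi> N P" "col_avg p Ys \<phi> N P \<le> 1"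
      using col_avg_mono[OF t(1,2), of "\<lambda>_ _. 0" \<phi> Ys N P] col_avg_mono[OF t(1,2), of \<phi> "\<lambda>_ _. 1" Ys N P] by (auto simp: col_avg_const)
  qed
  let ?y = "col_avg p Ys \<phi> (insert D N) P" and ?x = "col_avg p Ys \<phi> N (insert D P)"
  let ?\<beta> = "\<lambda>a. \<rho> * a / (1 + (\<rho> - 1) * a)"
  have xy: "?x \<le> ?y" by (rule col_avg_mono_set[OF t(1,2) A]) auto
  have q0: "0 \<le> q" using t by (auto intro!: divide_nonneg_nonneg add_nonneg_nonneg)
  have "?\<beta> (p * ?y + (1 - p) * ?x) \<le> q * ?\<beta> ?y + (1 - q) * ?\<beta> ?x"
    using odds_mix[OF t(1,2) bnd(1) xy bnd(2) t(3)] t(4) by simp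
  also have "\<dots> \<le> q * col_avg q Ys \<phi> (insert D N) P + (1 - q) * col_avg q Ys \<phi> N (insert D P)"
    by (intro add_mono mult_left_mono Cons.IH) (use q0 t(5) in auto)
  finally show ?case by simp
qed

text \<open>Passing from bias \<open>p\<close> to \<open>1 - p\<close> multiplies the odds of each
  colour by \<open>((1 - p) / p)^2\<close>. The event and its mirror image exclude each other, so
  its probabilities \<open>a\<close> and \<open>b\<close> under the two biases satisfy
  \<open>a + b \<le> 1\<close>; this forces \<open>a \<le> p\<close>. Up to \<open>p\<close> the
  odds map lies above the line of slope \<open>(1 - p) / p\<close> through the origin.\<close>

lemma col_avg_coloring:
  assumes p: "0 < p" "p \<le> 1/2"
    and A: "\<And>N N' P P'. N \<subseteq> N' \<Longrightarrow> P' \<subseteq> P \<Longrightarrow> A N P \<Longrightarrow> A N' P'"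
    and excl: "\<And>N P. A N P \<Longrightarrow> \<not> A P N"
  shows "col_avg (1 - p) Ys (\<lambda>N P. (1 - p) * of_bool (A P N) - p * of_bool (A N P)) {} {} \<le> 0"
proof -
  define \<phi> :: "'a set \<Rightarrow> 'a set \<Rightarrow> real" where "\<phi> N P = of_bool (A N P)" for N P
  define a where "a = col_avg p Ys \<phi> {} {}"
  define b where "b = col_avg (1 - p) Ys \<phi> {} {}"
  define \<rho> where "\<rho> = (1 - p)\<^sup>2 / p\<^sup>2"
  have "p\<^sup>2 \<le> (1 - p)\<^sup>2" using p by (intro power_mono) auto
  then have \<rho>1: "1 \<le> \<rho>" using p by (simp add: \<rho>_def)
  have \<rho>p: "1 + (\<rho> - 1) * p = (1 - p) / p" using p by (simp add: \<rho>_def field_simps power2_eq_square)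
  have q: "1 - p = \<rho> * p / (1 + (\<rho> - 1) * p)"
    unfolding \<rho>p using p by (simp add: \<rho>_def field_simps power2_eq_square)
  have swap: "col_avg (1 - p) Ys (\<lambda>N P. \<phi> P N) {} {} = a"
    unfolding a_def using col_avg_swap[of "1 - p" Ys \<phi> "{}" "{}"] by simp
  have "col_avg (1 - p) Ys (\<lambda>N P. \<phi> P N + \<phi> N P) {} {} \<le> col_avg (1 - p) Ys (\<lambda>_ _. 1) {} {}"
    by (rule col_avg_mono) (use p excl in \<open>auto simp: \<phi>_def\<close>)
  then have ab1: "a + b \<le> 1" by (simp add: col_avg_add swap b_def col_avg_const)
  have a0: "0 \<le> a" unfolding a_def using col_avg_mono[of p "\<lambda>_ _. 0" \<phi> Ys "{}" "{}"] p by (auto simp: col_avg_const \<phi>_def)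
  have ab: "\<rho> * a / (1 + (\<rho> - 1) * a) \<le> b"
    unfolding a_def b_def by (rule col_avg_odds) (use p \<rho>1 q A in \<open>auto simp: \<phi>_def\<close>)
  have ap: "a \<le> p"
  proof (rule ccontr)
    assume "\<not> a \<le> p"
    then have "p \<le> a" by simp
    then have "1 - p \<le> b" using odds_mono[OF \<rho>1, of p a] p ab q by linarith
    then show False using ab1 \<open>\<not> a \<le> p\<close> by linarith
  qed
  have den: "1 + (\<rho> - 1) * a \<le> (1 - p) / p" "0 < 1 + (\<rho> - 1) * a"
    using \<rho>p ap \<rho>1 a0 mult_left_mono[of a p "\<rho> - 1"] by (auto intro!: add_pos_nonneg)
  have "(1 - p) * a \<le> p * b"
  proof -
    have "(1 - p) * a / p = \<rho> * a / ((1 - p) / p)" using p by (simp add: \<rho>_def field_simps power2_eq_square)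
    also have "\<dots> \<le> \<rho> * a / (1 + (\<rho> - 1) * a)"
      using den \<rho>1 a0 p by (intro divide_left_mono mult_pos_pos) auto
    also have "\<dots> \<le> b" by (rule ab)
    finally show ?thesis using p by (simp add: field_simps)
  qed
  then show ?thesis
    using swap by (simp add: col_avg_diff col_avg_cmult \<phi>_def[symmetric] b_def)
qed

lemma not_UNIV_CL: "c \<in> CL {..<n} k \<Longrightarrow> c \<noteq> UNIV"
proof
  assume "c \<in> CL {..<n} k" "c = UNIV"
  then have "(n, True) \<in> {..<n} \<times> UNIV" unfolding CL_def by blast
  then show False by simp
qed

lemma uind_insert_UNIV [simp]: "uind (insert UNIV X) = uind X"
proof -
  have "satisfies_clause \<sigma> UNIV" for \<sigma> by (auto simp: satisfies_clause_def)
  then show ?thesis by (simp add: uind_def unsat_def)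
qed

section \<open>Comparison of the two polarities\<close>

text \<open>The clause \<open>UNIV\<close> is satisfied by every assignment and stands for an empty slot: a slot carries a
random clause with probability \<open>\<tau>\<close>.  The clauses in \<open>DI\<close> have one literal less; they are what remains
of a clause when one of its literals is false.\<close>

locale slots =
  fixes n h :: nat and p \<tau> :: real
  assumes h2: "2 \<le> h" and hn: "h + 2 \<le> n" and p: "0 < p" "p \<le> 1/2" and \<tau>: "0 < \<tau>" "\<tau> \<le> 1"
begin

definition SI :: "clause set" where "SI = insert UNIV (CL {..<n} (Suc h))"
definition sw :: "clause \<Rightarrow> real" where
  "sw c = (if c = UNIV then 1 - \<tau> else \<tau> * cw n (Suc h) p c)"
definition dx :: "clause \<Rightarrow> real" where
  "dx D = lw (pol p) D / real ((n - 1) choose h)"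
definition XI :: "nat \<Rightarrow> clause set" where "XI x = CL ({..<n} - {x}) h"
definition DI :: "clause set" where "DI = CL {..<n} h"
definition dw :: "clause \<Rightarrow> real" where "dw = cw n h p"

abbreviation OS :: "(clause set \<Rightarrow> real) \<Rightarrow> clause set \<Rightarrow> real" where "OS \<equiv> Op SI sw (\<lambda>c. c)"
abbreviation OX :: "nat \<Rightarrow> (clause set \<Rightarrow> real) \<Rightarrow> clause set \<Rightarrow> real" where "OX x \<equiv> Op (XI x) dx (\<lambda>c. c)"
abbreviation OD :: "(clause set \<Rightarrow> real) \<Rightarrow> clause set \<Rightarrow> real" where "OD \<equiv> Op DI dw (\<lambda>c. c)"
abbreviation OK :: "nat \<Rightarrow> (clause set \<Rightarrow> real) \<Rightarrow> clause set \<Rightarrow> real" where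
  "OK x \<equiv> Op (XI x \<times> UNIV) (\<lambda>(D, t). dx D * pol p (x, t)) (\<lambda>(D, t). insert (x, t) D)"

lemma finite_XI [simp]: "finite (XI x)" by (simp add: XI_def)
lemma finite_DI [simp]: "finite DI" by (simp add: DI_def)

lemma pol_nonneg [simp]: "0 \<le> pol p l" using p by (simp add: pol_def)
lemma pol_ge: "p \<le> pol p l" using p by (simp add: pol_def)

lemma dx_nonneg [simp]: "0 \<le> dx D"
  unfolding dx_def by (intro divide_nonneg_nonneg lw_nonneg) auto
lemma dw_nonneg [simp]: "0 \<le> dw D"
  unfolding dw_def by (rule cw_nonneg) (use p in auto)
lemma sw_nonneg [simp]: "0 \<le> sw c"
  unfolding sw_def using \<tau> cw_nonneg[of p n "Suc h" c] p by auto

lemma sum_dx: "x < n \<Longrightarrow> (\<Sum>D\<in>XI x. dx D) = 1"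
  unfolding dx_def XI_def sum_divide_distrib[symmetric]
  using sum_lw_CL[of "{..<n} - {x}" "pol p" 1 h] hn by simp

lemma sum_dw: "(\<Sum>D\<in>DI. dw D) = 1"
  unfolding dw_def DI_def by (rule sum_cw) (use hn in simp)

lemma sum_SI: "(\<Sum>c\<in>SI. sw c * g c) = (1 - \<tau>) * g UNIV + (\<Sum>c\<in>CL {..<n} (Suc h). \<tau> * cw n (Suc h) p c * g c)"
proof -
  have "UNIV \<notin> CL {..<n} (Suc h)" using not_UNIV_CL by blast
  then have "(\<Sum>c\<in>SI. sw c * g c) = sw UNIV * g UNIV + (\<Sum>c\<in>CL {..<n} (Suc h). sw c * g c)"
    unfolding SI_def by simp
  also have "(\<Sum>c\<in>CL {..<n} (Suc h). sw c * g c) = (\<Sum>c\<in>CL {..<n} (Suc h). \<tau> * cw n (Suc h) p c * g c)"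
    by (intro sum.cong refl) (simp add: sw_def not_UNIV_CL)
  finally show ?thesis by (simp add: sw_def)
qed

lemma sum_sw: "(\<Sum>c\<in>SI. sw c) = 1"
  using sum_SI[of "\<lambda>_. 1"] sum_cw[of "Suc h" n p] hn by (simp add: sum_distrib_left[symmetric])

definition touch_prob :: real where "touch_prob = \<tau> * real (Suc h) / real n"

lemma touch_prob_bounds: "0 \<le> touch_prob" "touch_prob \<le> 1"
proof -
  have "real (Suc h) / real n \<le> 1" using hn by simp
  then show "0 \<le> touch_prob" "touch_prob \<le> 1" unfolding touch_prob_def using \<tau> mult_mono[of \<tau> 1 "real (Suc h) / real n" 1] by auto
qed

lemma choose_Suc_h: "real (Suc h) * real (n choose Suc h) = real n * real ((n - 1) choose h)"
  using Suc_times_binomial_eq[of "n - 1" h] hn by (simp del: of_nat_Suc of_nat_mult flip: of_nat_mult add: mult.commute)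

text \<open>Given that a slot contains \<open>x\<close>, which has probability
  \<open>touch_prob\<close>, the remainder and the sign of \<open>x\<close> are independent.\<close>

lemma cw_insert:
  assumes "x < n" "D \<in> XI x"
  shows "\<tau> * cw n (Suc h) p (insert (x, t) D) = touch_prob * (dx D * pol p (x, t))"
proof -
  have "lw (pol p) (insert (x, t) D) = pol p (x, t) * lw (pol p) D"
    using lw_insert[of "{..<n}" D x h "pol p" t] assms by (simp add: XI_def)
  moreover have "0 < real (n choose Suc h)" "0 < real ((n - 1) choose h)" "0 < real n" using hn by auto
  moreover have "1 / real (n choose Suc h) = (real (Suc h) / real n) / real ((n - 1) choose h)"
    using choose_Suc_h calculation(2,3,4) by (simp add: frac_eq_eq mult.commute del: of_nat_Suc)
  then have "y / real (n choose Suc h) = y * ((real (Suc h) / real n) / real ((n - 1) choose h))" for y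
    by (metis times_divide_eq_right mult.right_neutral)
  ultimately show ?thesis
    by (simp add: cw_def dx_def touch_prob_def)
qed

lemma OS_split:
  assumes "x < n"
  shows "OS f X = (\<Sum>c\<in>insert UNIV (CL ({..<n} - {x}) (Suc h)). sw c * f (insert c X)) + touch_prob * OK x f X"
proof -
  have nin: "UNIV \<notin> CL ({..<n} - {x}) (Suc h)" using not_UNIV_CL CL_mono[of "{..<n} - {x}" "{..<n}" "Suc h"] by blast
  have "(\<Sum>D\<in>XI x. \<Sum>s\<in>UNIV. \<tau> * cw n (Suc h) p (insert (x, s) D) * f (insert (insert (x, s) D) X)) = touch_prob * OK x f X"
    unfolding Op_def sum_distrib_left sum.cartesian_product
    by (intro sum.cong refl) (auto simp: cw_insert[OF assms] mult.assoc)
  moreover have "(\<Sum>c\<in>CL ({..<n} - {x}) (Suc h). \<tau> * cw n (Suc h) p c * f (insert c X))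
    = (\<Sum>c\<in>CL ({..<n} - {x}) (Suc h). sw c * f (insert c X))"
    using not_UNIV_CL CL_mono[of "{..<n} - {x}" "{..<n}" "Suc h"]
    by (intro sum.cong refl) (auto simp: sw_def)
  ultimately show ?thesis
    unfolding Op_def[of SI] sum_SI
    by (subst sum_CL_split[where x=x]) (use assms nin in \<open>auto simp: XI_def sw_def\<close>)
qed

lemma sum_OK_weight: "x < n \<Longrightarrow> (\<Sum>i\<in>XI x \<times> UNIV. (case i of (D, t) \<Rightarrow> dx D * pol p (x, t))) = 1"
  unfolding sum.cartesian_product[symmetric]
  by (simp add: UNIV_bool distrib_left[symmetric] sum_dx)

lemma sum_S0: "x < n \<Longrightarrow> (\<Sum>c\<in>insert UNIV (CL ({..<n} - {x}) (Suc h)). sw c) = 1 - touch_prob"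
proof -
  assume x: "x < n"
  have "OK x (\<lambda>_. 1) {} = 1" using sum_OK_weight[OF x] by (simp add: Op_def case_prod_beta)
  then show ?thesis using OS_split[OF x, of "\<lambda>_. 1" "{}"] sum_sw by (simp add: Op_def)
qed

lemma OK_eq: "OK x f Y = (\<Sum>D\<in>XI x. dx D * ((1 - p) * f (insert (insert (x, False) D) Y) + p * f (insert (insert (x, True) D) Y)))"
proof -
  have "OK x f Y = (\<Sum>(D, t)\<in>XI x \<times> UNIV. dx D * pol p (x, t) * f (insert (insert (x, t) D) Y))"
    by (simp add: Op_def case_prod_beta)
  also have "\<dots> = (\<Sum>D\<in>XI x. \<Sum>t\<in>UNIV. dx D * pol p (x, t) * f (insert (insert (x, t) D) Y))"
    by (rule sum.cartesian_product[symmetric])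
  finally show ?thesis by (simp add: UNIV_bool algebra_simps)
qed

section \<open>Pivotal clauses and the race\<close>

definition pivot :: "nat \<Rightarrow> bool \<Rightarrow> clause set \<Rightarrow> real" where
  "pivot x s Y = (\<Sum>D\<in>XI x. dx D * (uind (insert (insert (x, s) D) Y) - uind Y))"

lemma pivot_nonneg [simp]: "0 \<le> pivot x s Y"
  unfolding pivot_def by (intro sum_nonneg mult_nonneg_nonneg) (auto intro!: uind_mono)

text \<open>By \<open>unsat_insert_lit\<close>, once \<open>s\<close> is blocked a clause with the
  literal \<open>(x, s)\<close> is fatal exactly if its remainder, added as a short clause, blocks
  the other value too. Pivotality is thus the probability that the next step of the race ends in a
  contradiction.\<close>

lemma pivot_eq: "pivot x s Y = (if unsat Y \<or> \<not> blocked x s Y then 0 else \<Sum>D\<in>XI x. dx D * of_bool (blocked x (\<not> s) (insert D Y)))"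
proof (cases "unsat Y")
  case True
  then have "unsat (insert C Y)" for C using unsat_mono[of Y "insert C Y"] by auto
  then show ?thesis using True by (simp add: pivot_def uind_def)
next
  case False
  then show ?thesis by (simp add: pivot_def uind_def unsat_insert_lit)
qed

definition pivot_diff :: "nat \<Rightarrow> clause set \<Rightarrow> real" where
  "pivot_diff x Y = (1 - p) * pivot x False Y - p * pivot x True Y"

definition blocked_balance :: "nat \<Rightarrow> clause set \<Rightarrow> clause list \<Rightarrow> real" where
  "blocked_balance x Y Es = (1 - p) * of_bool (first_blocked x False Y Es) - p * of_bool (first_blocked x True Y Es)"

primrec seq_avg :: "nat \<Rightarrow> nat \<Rightarrow> (clause list \<Rightarrow> real) \<Rightarrow> real" where
  "seq_avg x 0 \<phi> = \<phi> []"
| "seq_avg x (Suc G) \<phi> = (\<Sum>D\<in>XI x. dx D * seq_avg x G (\<lambda>Es. \<phi> (D # Es)))"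

lemma seq_avg_const: "x < n \<Longrightarrow> seq_avg x G (\<lambda>_. a) = a"
  by (induction G) (simp_all add: sum_distrib_right[symmetric] sum_dx)

lemma seq_avg_nonpos:
  assumes "\<And>Es. set Es \<subseteq> XI x \<Longrightarrow> \<phi> Es \<le> 0"
  shows "seq_avg x G \<phi> \<le> 0"
  using assms
proof (induction G arbitrary: \<phi>)
  case (Suc G)
  have "seq_avg x G (\<lambda>Es. \<phi> (D # Es)) \<le> 0" if "D \<in> XI x" for D
    by (rule Suc.IH, rule Suc.prems) (use that in auto)
  then show ?case by (simp add: sum_nonpos mult_nonneg_nonpos)
qed simp

text \<open>The recursive form of the sum in \<open>pivot_balance_eq\<close>; it follows the race
  clause by clause.\<close>

primrec pivot_balance :: "nat \<Rightarrow> nat \<Rightarrow> clause set \<Rightarrow> real" where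
  "pivot_balance x 0 = (\<lambda>Y. - p * frozen x True Y)"
| "pivot_balance x (Suc G) = (\<lambda>Y. pivot_diff x Y + OX x (pivot_balance x G) Y)"

lemma pivot_balance_eq: "pivot_balance x G Y = (\<Sum>M<G. (OX x ^^ M) (pivot_diff x) Y) - p * (OX x ^^ G) (frozen x True) Y"
proof (induction G arbitrary: Y)
  case (Suc G)
  have "pivot_balance x G = (\<lambda>Y. (\<Sum>M<G. 1 * (OX x ^^ M) (pivot_diff x) Y) + (- p) * (OX x ^^ G) (frozen x True) Y)"
    using Suc.IH by (simp add: fun_eq_iff)
  then have "OX x (pivot_balance x G) Y = OX x (\<lambda>Y. (\<Sum>M<G. 1 * (OX x ^^ M) (pivot_diff x) Y) + (- p) * (OX x ^^ G) (frozen x True) Y) Y"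
    by (rule arg_cong)
  also have "\<dots> = (\<Sum>M<G. (OX x ^^ Suc M) (pivot_diff x) Y) - p * (OX x ^^ Suc G) (frozen x True) Y"
    unfolding Op_add Op_sum Op_cmult by simp
  finally show ?case
    by (simp only: pivot_balance.simps sum.lessThan_Suc_shift) simp
qed simp

text \<open>If \<open>s\<close> is blocked first, the pivots of \<open>(x, s)\<close> add up to the
  probability that the other value is blocked within the remaining short clauses. What is missing
  from the probability of being first is the probability that \<open>x\<close> is still frozen at
  the end. For True this is the term subtracted in \<open>pivot_balance\<close>; for False it has
  the favourable sign and is dropped.\<close>

lemma pivot_balance_le_seq_avg:
  assumes x: "x < n"
  shows "pivot_balance x G Y \<le> seq_avg x G (blocked_balance x Y)"
proof (induction G arbitrary: Y)
  case 0
  show ?case using p unsat_iff_blocked[of Y x True] by (auto simp: blocked_balance_def frozen_def)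
next
  case (Suc G)
  have IH: "OX x (pivot_balance x G) Y \<le> (\<Sum>D\<in>XI x. dx D * seq_avg x G (blocked_balance x (insert D Y)))"
    unfolding Op_def by (intro sum_mono mult_left_mono Suc.IH) simp
  have up: "blocked x s Y \<Longrightarrow> blocked x s (insert D Y)" for s D by (rule blocked_mono[of Y]) auto
  consider (same) "blocked x True Y = blocked x False Y" | (F) "blocked x False Y" "\<not> blocked x True Y" | (T) "blocked x True Y" "\<not> blocked x False Y"
    by blast
  then show ?case
  proof cases
    case same
    \<comment> \<open>Either neither value is blocked and the race is still open, or both are and it
      has no winner from here on.\<close>
    have "blocked_balance x Y (D # Es) = blocked_balance x (insert D Y) Es" for D Es
      using same first_blocked_opp up by (auto simp: blocked_balance_def)
    moreover have "pivot_diff x Y = 0"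
      using same unsat_iff_blocked[of Y x True] by (auto simp: pivot_diff_def pivot_eq)
    ultimately show ?thesis using IH by simp
  next
    case F
    have nu: "\<not> unsat Y" using F unsat_iff_blocked[of Y x True] by simp
    have g: "pivot_diff x Y = (1 - p) * (\<Sum>D\<in>XI x. dx D * of_bool (blocked x True (insert D Y)))"
      using F nu by (simp add: pivot_diff_def pivot_eq)
    have R1: "blocked_balance x Y Es = 1 - p" for Es
      using first_blocked_now[of x False Y Es] first_blocked_opp[of x True Y Es] F by (simp add: blocked_balance_def)
    \<comment> \<open>The recursion restarts the race at \<open>insert D Y\<close>. If True is
      blocked there as well, the restarted race has no winner, and the amount lost is precisely the
      pivot term.\<close>
    have R2: "seq_avg x G (blocked_balance x (insert D Y)) = (1 - p) * (1 - of_bool (blocked x True (insert D Y)))" for D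
    proof -
      have "blocked_balance x (insert D Y) = (\<lambda>_. (1 - p) * (1 - of_bool (blocked x True (insert D Y))))"
      proof
        fix Es
        have "blocked x False (insert D Y)" using up F by simp
        then show "blocked_balance x (insert D Y) Es = (1 - p) * (1 - of_bool (blocked x True (insert D Y)))"
          using first_blocked_now[of x False "insert D Y" Es] first_blocked_opp[of x True "insert D Y" Es] first_blocked_opp[of x False "insert D Y" Es]
          by (auto simp: blocked_balance_def)
      qed
      then show ?thesis using seq_avg_const[OF x] by simp
    qed
    have "(\<Sum>D\<in>XI x. dx D * ((1 - p) * (1 - of_bool (blocked x True (insert D Y)))))
      = (\<Sum>D\<in>XI x. dx D * (1 - p)) - (1 - p) * (\<Sum>D\<in>XI x. dx D * of_bool (blocked x True (insert D Y)))"
      unfolding sum_distrib_left sum_subtractf[symmetric]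
      by (intro sum.cong refl) (simp only: right_diff_distrib mult_1_right mult.left_commute)
    then have "pivot_diff x Y + OX x (pivot_balance x G) Y \<le> (\<Sum>D\<in>XI x. dx D * (1 - p))"
      using IH unfolding g R2 by linarith
    also have "\<dots> = seq_avg x (Suc G) (blocked_balance x Y)"
      by (simp add: R1 seq_avg_const[OF x])
    finally show ?thesis by simp
  next
    case T
    have nu: "\<not> unsat Y" using T unsat_iff_blocked[of Y x True] by simp
    have g: "pivot_diff x Y = - p * (\<Sum>D\<in>XI x. dx D * of_bool (blocked x False (insert D Y)))"
      using T nu by (simp add: pivot_diff_def pivot_eq)
    have R1: "blocked_balance x Y Es = - p" for Es
      using first_blocked_now[of x True Y Es] first_blocked_opp[of x False Y Es] T by (simp add: blocked_balance_def)
    have R2: "seq_avg x G (blocked_balance x (insert D Y)) = - p * (1 - of_bool (blocked x False (insert D Y)))" for D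
    proof -
      have "blocked_balance x (insert D Y) = (\<lambda>_. - p * (1 - of_bool (blocked x False (insert D Y))))"
      proof
        fix Es
        have "blocked x True (insert D Y)" using up T by simp
        then show "blocked_balance x (insert D Y) Es = - p * (1 - of_bool (blocked x False (insert D Y)))"
          using first_blocked_now[of x True "insert D Y" Es] first_blocked_opp[of x True "insert D Y" Es] first_blocked_opp[of x False "insert D Y" Es]
          by (auto simp: blocked_balance_def)
      qed
      then show ?thesis using seq_avg_const[OF x] by simp
    qed
    have "(\<Sum>D\<in>XI x. dx D * (- p * (1 - of_bool (blocked x False (insert D Y)))))
      = (\<Sum>D\<in>XI x. dx D * (- p)) - (- p) * (\<Sum>D\<in>XI x. dx D * of_bool (blocked x False (insert D Y)))"
      unfolding sum_distrib_left sum_subtractf[symmetric]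
      by (intro sum.cong refl) (simp only: right_diff_distrib mult_1_right mult.left_commute)
    then have "pivot_diff x Y + OX x (pivot_balance x G) Y \<le> (\<Sum>D\<in>XI x. dx D * (- p))"
      using IH unfolding g R2 by linarith
    also have "\<dots> = seq_avg x (Suc G) (blocked_balance x Y)"
      by (simp add: R1 seq_avg_const[OF x])
    finally show ?thesis by simp
  qed
qed

lemma col_avg_seq_avg: "col_avg t Ys (\<lambda>N P. seq_avg x G (\<lambda>Es. \<phi> N P Es)) N P = seq_avg x G (\<lambda>Es. col_avg t Ys (\<lambda>N P. \<phi> N P Es) N P)"
proof (induction G arbitrary: \<phi>)
  case (Suc G)
  show ?case
    unfolding seq_avg.simps col_avg_sum by (intro sum.cong refl arg_cong2[where f="(*)"] Suc.IH)
qed simp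

lemma XI_avoids: "D \<in> XI x \<Longrightarrow> avoids x D"
  unfolding XI_def by (rule avoids_CL)

text \<open>For each fixed sequence of short clauses the outcome of the race is an event of the
  signs at \<open>x\<close> alone, so \<open>col_avg_coloring\<close> applies before averaging over
  sequences.\<close>

lemma colored_seq_avg_nonpos:
  assumes x: "x < n" and X: "all_avoid x X" and Ys: "set Ys \<subseteq> XI x"
  shows "col_avg (1 - p) Ys (\<lambda>N P. seq_avg x G (blocked_balance x (glue x X N P))) {} {} \<le> 0"
  unfolding col_avg_seq_avg
proof (rule seq_avg_nonpos)
  fix Es assume Es: "set Es \<subseteq> XI x"
  have "col_avg (1 - p) Ys (\<lambda>N P. blocked_balance x (glue x X N P) Es) {} {}
    = col_avg (1 - p) Ys (\<lambda>N P. (1 - p) * of_bool (first_unsat X P N Es) - p * of_bool (first_unsat X N P Es)) {} {}"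
  proof (rule col_avg_cong_inv)
    fix N P assume "N \<subseteq> set Ys \<union> {}" "P \<subseteq> set Ys \<union> {}"
    then have "all_avoid x N" "all_avoid x P" using Ys XI_avoids by (auto simp: all_avoid_def)
    then show "blocked_balance x (glue x X N P) Es = (1 - p) * of_bool (first_unsat X P N Es) - p * of_bool (first_unsat X N P Es)"
      using first_blocked_glue[of x X N P Es] X Es XI_avoids by (auto simp: blocked_balance_def)
  qed
  also have "\<dots> \<le> 0"
    by (rule col_avg_coloring[OF p]) (erule (2) first_unsat_mono, erule first_unsat_excl)
  finally show "col_avg (1 - p) Ys (\<lambda>N P. blocked_balance x (glue x X N P) Es) {} {} \<le> 0" .
qed

lemma OK_glue: "OK x f (glue x X N P)
  = (\<Sum>D\<in>XI x. dx D * ((1 - p) * f (glue x X (insert D N) P) + p * f (glue x X N (insert D P))))"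
  by (simp only: OK_eq glue_insert(2,3))

text \<open>The clauses containing \<open>x\<close> are collected in \<open>Ys\<close> with their signs at \<open>x\<close> still undecided.\<close>

lemma colored_slots_nonpos:
  assumes x: "x < n"
  shows "all_avoid x X \<Longrightarrow> set Ys \<subseteq> XI x \<Longrightarrow>
    col_avg (1 - p) Ys (\<lambda>N P. (OS ^^ m) (\<lambda>Y. seq_avg x G (blocked_balance x Y)) (glue x X N P)) {} {} \<le> 0"
proof (induction m arbitrary: X Ys)
  case 0
  then show ?case using colored_seq_avg_nonpos[OF x] by simp
next
  case (Suc m)
  let ?f = "(OS ^^ m) (\<lambda>Y. seq_avg x G (blocked_balance x Y))"
  let ?C = "insert UNIV (CL ({..<n} - {x}) (Suc h))"
  have "(OS ^^ Suc m) (\<lambda>Y. seq_avg x G (blocked_balance x Y)) (glue x X N P) = (\<Sum>c\<in>?C. sw c * ?f (glue x (insert c X) N P))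
     + (\<Sum>D\<in>XI x. (touch_prob * dx D) * ((1 - p) * ?f (glue x X (insert D N) P) + p * ?f (glue x X N (insert D P))))" for N P
    by (simp add: OS_split[OF x] OK_glue glue_insert(1) sum_distrib_left mult.assoc del: sum.insert)
  then have "col_avg (1 - p) Ys (\<lambda>N P. (OS ^^ Suc m) (\<lambda>Y. seq_avg x G (blocked_balance x Y)) (glue x X N P)) {} {}
    = (\<Sum>c\<in>?C. sw c * col_avg (1 - p) Ys (\<lambda>N P. ?f (glue x (insert c X) N P)) {} {})
     + (\<Sum>D\<in>XI x. (touch_prob * dx D) * col_avg (1 - p) (D # Ys) (\<lambda>N P. ?f (glue x X N P)) {} {})"
    by (simp only: col_avg_add col_avg_sum col_avg_cmult col_avg_insert[where \<phi>="\<lambda>N P. ?f (glue x X N P)"] col_avg.simps) simp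
  also have "\<dots> \<le> 0 + 0"
  proof (intro add_mono sum_nonpos mult_nonneg_nonpos)
    fix c assume "c \<in> ?C"
    then have "avoids x c" using avoids_UNIV avoids_CL by auto
    then show "col_avg (1 - p) Ys (\<lambda>N P. ?f (glue x (insert c X) N P)) {} {} \<le> 0"
      using Suc.prems by (intro Suc.IH) (simp_all add: all_avoid_insert)
  next
    fix D assume "D \<in> XI x"
    then show "col_avg (1 - p) (D # Ys) (\<lambda>N P. ?f (glue x X N P)) {} {} \<le> 0"
      using Suc.prems by (intro Suc.IH) simp_all
  qed (use touch_prob_bounds in auto)
  finally show ?case by simp
qed

text \<open>Starting from the empty formula no signs are pending, hence the empty colouring. On the
  right there remains only the probability that \<open>x\<close> is frozen after all
  \<open>G\<close> short clauses.\<close>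

lemma pivot_window_le:
  assumes x: "x < n"
  shows "(\<Sum>M<G. (OS ^^ m) ((OX x ^^ M) (pivot_diff x)) {}) \<le> p * (OS ^^ m) ((OX x ^^ G) (frozen x True)) {}"
proof -
  have "(OS ^^ m) (pivot_balance x G) {} \<le> (OS ^^ m) (\<lambda>Y. seq_avg x G (blocked_balance x Y)) {}"
    by (rule Op_pow_mono) (use pivot_balance_le_seq_avg[OF x] in auto)
  also have "\<dots> \<le> 0"
    using colored_slots_nonpos[OF x, of "{}" "[]" m G] by (simp add: glue_def)
  finally have "(OS ^^ m) (\<lambda>Y. (\<Sum>M\<in>{..<G}. 1 * (OX x ^^ M) (pivot_diff x) Y) + (- p) * (OX x ^^ G) (frozen x True) Y) {} \<le> 0"
    by (simp add: pivot_balance_eq[abs_def])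
  then show ?thesis
    unfolding Op_pow_add_fun Op_pow_sum Op_pow_cmult by simp
qed

end

section \<open>Frozen variables\<close>

lemma binomial_ratio_Suc: "real (Suc h) * real (s choose Suc h) = (real s - real h) * real (s choose h)" 
proof (cases "h \<le> s")
  case True
  have "Suc h * (s choose Suc h) = (s - h) * (s choose h)"
    by (metis binomial_absorb_comp binomial_absorption mult.commute Suc_diff_le True choose_reduce_nat)
  then show ?thesis using True by (metis of_nat_diff of_nat_mult)
qed (simp add: binomial_eq_0)

text \<open>Factor by factor, \<open>(s - i) / (n - i)\<close> is at most
  \<open>s / n\<close>.\<close>

lemma binomial_ratio_le:
  assumes "s \<le> n" "h \<le> n"
  shows "real (s choose h) * real n ^ h \<le> real s ^ h * real (n choose h)"
  using assms(2)
proof (induction h)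
  case (Suc h)
  then have IH: "real (s choose h) * real n ^ h \<le> real s ^ h * real (n choose h)" by simp
  have hn: "real h \<le> real n" using Suc by simp
  have "real (Suc h) * (real (s choose Suc h) * real n ^ Suc h) = ((real s - real h) * real n) * (real (s choose h) * real n ^ h)"
  proof -
    have "real (Suc h) * (real (s choose Suc h) * real n ^ Suc h) = (real (Suc h) * real (s choose Suc h)) * (real n * real n ^ h)"
      by (simp only: power_Suc mult.assoc)
    then show ?thesis unfolding binomial_ratio_Suc[of h s] by (simp only: mult_ac)
  qed
  also have "\<dots> \<le> (real s * (real n - real h)) * (real s ^ h * real (n choose h))"
  proof (cases "h \<le> s")
    case True
    show ?thesis
    proof (rule mult_mono[OF _ IH])
      have "real h * real s \<le> real h * real n" using assms by (intro mult_left_mono) auto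
      then show "(real s - real h) * real n \<le> real s * (real n - real h)" by (simp add: algebra_simps)
    qed (use hn in auto)
  next
    case False
    then have "(real s - real h) * real n * (real (s choose h) * real n ^ h) = 0" by (simp add: binomial_eq_0)
    moreover have "0 \<le> (real s * (real n - real h)) * (real s ^ h * real (n choose h))" using hn by auto
    ultimately show ?thesis by linarith
  qed
  also have "\<dots> = real (Suc h) * (real s ^ Suc h * real (n choose Suc h))"
  proof -
    have "real (Suc h) * (real s ^ Suc h * real (n choose Suc h)) = (real s * real s ^ h) * (real (Suc h) * real (n choose Suc h))"
      by (simp only: power_Suc mult_ac)
    then show ?thesis unfolding binomial_ratio_Suc[of h n] by (simp only: mult_ac)
  qed
  finally show ?case by (rule mult_left_le_imp_le) simp
qed simp

text \<open>As long as \<open>i\<close> is at most half of \<open>s\<close>, the factor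
  \<open>(s - i) / (n - i)\<close> is at least \<open>s / (2 * n)\<close>.\<close>

lemma binomial_ratio_ge:
  assumes "s \<le> n" "2 * k \<le> s" "h \<le> k"
  shows "real s ^ h * real (n choose h) \<le> real (s choose h) * (2 * real n) ^ h"
  using assms(3)
proof (induction h)
  case (Suc h)
  then have IH: "real s ^ h * real (n choose h) \<le> real (s choose h) * (2 * real n) ^ h" by simp
  have hs: "2 * real h \<le> real s" "real h \<le> real n" using Suc assms by auto
  have "real (Suc h) * (real s ^ Suc h * real (n choose Suc h)) = (real s * (real n - real h)) * (real s ^ h * real (n choose h))"
  proof -
    have "real (Suc h) * (real s ^ Suc h * real (n choose Suc h)) = (real s * real s ^ h) * (real (Suc h) * real (n choose Suc h))"
      by (simp only: power_Suc mult_ac)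
    then show ?thesis unfolding binomial_ratio_Suc[of h n] by (simp only: mult_ac)
  qed
  also have "\<dots> \<le> ((real s - real h) * (2 * real n)) * (real (s choose h) * (2 * real n) ^ h)"
  proof (rule mult_mono[OF _ IH])
    have "real s * (real n - real h) \<le> real s * real n" by (intro mult_left_mono) auto
    also have "\<dots> \<le> (2 * (real s - real h)) * real n" using hs by (intro mult_right_mono) auto
    finally show "real s * (real n - real h) \<le> (real s - real h) * (2 * real n)" by (simp add: algebra_simps)
  qed (use hs in auto)
  also have "\<dots> = real (Suc h) * (real (s choose Suc h) * (2 * real n) ^ Suc h)"
  proof -
    have "real (Suc h) * (real (s choose Suc h) * (2 * real n) ^ Suc h) = (real (Suc h) * real (s choose Suc h)) * ((2 * real n) * (2 * real n) ^ h)"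
      by (simp only: power_Suc mult.assoc)
    then show ?thesis unfolding binomial_ratio_Suc[of h s] by (simp only: mult_ac)
  qed
  finally show ?case by (rule mult_left_le_imp_le) simp
qed simp

context slots
begin

definition avoid_prob :: real where "avoid_prob = (real n - real h) / real n"
abbreviation OT :: "nat \<Rightarrow> (clause set \<Rightarrow> real) \<Rightarrow> clause set \<Rightarrow> real" where "OT x \<equiv> Op (DI - XI x) dw (\<lambda>c. c)"

lemma avoid_prob_bounds: "0 < avoid_prob" "avoid_prob \<le> 1" "1 - avoid_prob = real h / real n"
  using hn by (auto simp: avoid_prob_def field_simps)

lemma dw_dx: "dw D = avoid_prob * dx D"
proof -
  have "(n - h) * (n choose h) = n * ((n - 1) choose h)" by (rule binomial_absorb_comp)
  then have e: "(real n - real h) * real (n choose h) = real n * real ((n - 1) choose h)"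
    using hn by (metis of_nat_diff of_nat_mult add_leD1 trans_le_add1 nat_le_iff_add)
  have pos: "0 < real (n choose h)" "0 < real ((n - 1) choose h)" "0 < real n" using hn by auto
  have "1 / real (n choose h) = avoid_prob / real ((n - 1) choose h)"
    unfolding avoid_prob_def using e pos by (simp add: field_simps)
  then have "y / real (n choose h) = avoid_prob * (y / real ((n - 1) choose h))" for y
    by (metis times_divide_eq_right mult.right_neutral mult.left_commute mult.commute)
  then show ?thesis by (simp add: dw_def cw_def dx_def)
qed

lemma XI_DI: "XI x \<subseteq> DI" unfolding XI_def DI_def by (rule CL_mono) auto

lemma OD_split: "OD f Y = avoid_prob * OX x f Y + OT x f Y"
proof -
  have "OD f Y = (\<Sum>D\<in>XI x. dw D * f (insert D Y)) + (\<Sum>D\<in>DI - XI x. dw D * f (insert D Y))"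
    unfolding Op_def using sum.subset_diff[OF XI_DI finite_DI, of "\<lambda>D. dw D * f (insert D Y)" x] by simp
  moreover have "(\<Sum>D\<in>XI x. dw D * f (insert D Y)) = avoid_prob * OX x f Y"
    by (simp add: Op_def dw_dx sum_distrib_left mult.assoc)
  ultimately show ?thesis by (simp add: Op_def)
qed

lemma sum_OT: "x < n \<Longrightarrow> (\<Sum>D\<in>DI - XI x. dw D) = real h / real n"
  using OD_split[of "\<lambda>_. 1" "{}" x] sum_dw sum_dx[of x] avoid_prob_bounds(3) by (simp add: Op_def)

lemma Op1_mono: "(\<And>i. i \<in> I \<Longrightarrow> 0 \<le> w i) \<Longrightarrow> (\<And>Y. f Y \<le> g Y) \<Longrightarrow> Op I w c f X \<le> Op I w c g X"
  unfolding Op_def by (intro sum_mono mult_left_mono) auto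

lemma Op1_nonneg: "(\<And>i. i \<in> I \<Longrightarrow> 0 \<le> w i) \<Longrightarrow> (\<And>Y. 0 \<le> f Y) \<Longrightarrow> 0 \<le> Op I w c f X"
  unfolding Op_def by (intro sum_nonneg mult_nonneg_nonneg) auto

text \<open>Sums over \<open>x\<close> need an operator that does not depend on \<open>x\<close>.
  Demanding that all \<open>M\<close> short clauses avoid \<open>x\<close> costs the factor
  \<open>avoid_prob ^ M\<close>, which later stays above 1/2.\<close>

lemma OX_le_OD:
  assumes "\<And>Y. 0 \<le> f Y"
  shows "avoid_prob ^ M * (OX x ^^ M) f Y \<le> (OD ^^ M) f Y"
proof (induction M arbitrary: Y)
  case (Suc M)
  have "avoid_prob ^ Suc M * (OX x ^^ Suc M) f Y = avoid_prob * OX x (\<lambda>Y. avoid_prob ^ M * (OX x ^^ M) f Y) Y"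
    by (simp add: Op_cmult)
  also have "\<dots> \<le> avoid_prob * OX x ((OD ^^ M) f) Y"
    using avoid_prob_bounds by (intro mult_left_mono Op1_mono Suc.IH) auto
  also have "\<dots> \<le> OD ((OD ^^ M) f) Y"
    unfolding OD_split[of "(OD ^^ M) f" Y x]
    by (simp, intro Op1_nonneg Op_pow_nonneg) (use assms in auto)
  finally show ?case by simp
qed simp

lemma OD_le_OX_touch:
  assumes x: "x < n" and f: "\<And>Y. 0 \<le> f Y" "\<And>Y. f Y \<le> 1"
  shows "(OD ^^ M) f Y \<le> (OX x ^^ M) f Y + real M * (real h / real n)"
proof (induction M arbitrary: Y)
  case (Suc M)
  have c: "OX x (\<lambda>Y. (OX x ^^ M) f Y + real M * (real h / real n)) Y = (OX x ^^ Suc M) f Y + real M * (real h / real n)"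
    unfolding Op_add by (simp add: Op_def sum_distrib_right[symmetric] sum_divide_distrib[symmetric] sum_dx[OF x])
  have "(OD ^^ Suc M) f Y = avoid_prob * OX x ((OD ^^ M) f) Y + OT x ((OD ^^ M) f) Y"
    by (simp add: OD_split[of "(OD ^^ M) f" Y x])
  also have "\<dots> \<le> avoid_prob * OX x (\<lambda>Y. (OX x ^^ M) f Y + real M * (real h / real n)) Y + OT x (\<lambda>_. 1) Y"
    using avoid_prob_bounds sum_dw f
    by (intro add_mono mult_left_mono Op1_mono Suc.IH Op_pow_le_const) auto
  also have "\<dots> \<le> 1 * ((OX x ^^ Suc M) f Y + real M * (real h / real n)) + real h / real n"
    unfolding c
    using avoid_prob_bounds sum_OT[OF x] Op_pow_nonneg[where I="XI x" and w=dx and f=f and c="\<lambda>c. c" and m="Suc M" and X=Y] f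
    by (intro add_mono mult_right_mono) (auto simp: Op_def)
  finally show ?case by (simp add: algebra_simps add_divide_distrib)
qed simp

text \<open>A union bound over the short clause that contains \<open>x\<close>; by commutation that
  clause becomes the innermost one.\<close>

lemma OD_diff_touch:
  assumes f: "\<And>Y. 0 \<le> f Y"
  shows "(OD ^^ M) f Y - avoid_prob ^ M * (OX x ^^ M) f Y \<le> real M * (OD ^^ (M - 1)) (OT x f) Y"
proof (induction M arbitrary: Y)
  case (Suc M)
  let ?g = "\<lambda>Y. real M * (OD ^^ (M - 1)) (OT x f) Y"
  have g0: "0 \<le> ?g Y" for Y
    by (intro mult_nonneg_nonneg Op_pow_nonneg Op1_nonneg) (use f in auto)
  have e1: "(OD ^^ Suc M) f Y - avoid_prob ^ Suc M * (OX x ^^ Suc M) f Y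
    = avoid_prob * (OX x ((OD ^^ M) f) Y - OX x (\<lambda>Y. avoid_prob ^ M * (OX x ^^ M) f Y) Y) + OT x ((OD ^^ M) f) Y"
    by (simp add: OD_split[of "(OD ^^ M) f" Y x] Op_cmult algebra_simps)
  have e2: "OX x ((OD ^^ M) f) Y - OX x (\<lambda>Y. avoid_prob ^ M * (OX x ^^ M) f Y) Y
     = OX x (\<lambda>Y. (OD ^^ M) f Y - avoid_prob ^ M * (OX x ^^ M) f Y) Y"
    by (simp add: Op_def sum_subtractf right_diff_distrib)
  have e3: "avoid_prob * OX x (\<lambda>Y. (OD ^^ M) f Y - avoid_prob ^ M * (OX x ^^ M) f Y) Y \<le> avoid_prob * OX x ?g Y"
    using avoid_prob_bounds by (intro mult_left_mono Op1_mono Suc.IH) auto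
  have e4: "avoid_prob * OX x ?g Y \<le> OD ?g Y"
    unfolding OD_split[of ?g Y x] by (simp, intro Op1_nonneg) (use g0 in auto)
  have e5: "OD ?g Y = real M * (OD ^^ M) (OT x f) Y"
    by (cases M) (simp_all add: Op_cmult, simp add: Op_def)
  have e6: "OT x ((OD ^^ M) f) = (OD ^^ M) (OT x f)" by (rule Op_pow_commute1[symmetric])
  show ?case using e1 e2 e3 e4 e5 e6 by (simp add: algebra_simps)
qed simp

text \<open>A blocked value of \<open>x\<close> means that \<open>X\<close> together with one of the
  two families of remainders is unsatisfiable, hence also with both. This forgets the signs at
  \<open>x\<close>.\<close>

lemma OK_le_OX:
  assumes x: "x < n"
  shows "all_avoid x X \<Longrightarrow> all_avoid x N \<Longrightarrow> all_avoid x P \<Longrightarrow>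
    (OK x ^^ j) (frozen x s) (glue x X N P) \<le> (OX x ^^ j) uind (X \<union> N \<union> P)"
proof (induction j arbitrary: N P)
  case 0
  have "blocked x s (glue x X N P) \<Longrightarrow> unsat (X \<union> N \<union> P)"
    using blocked_glue[OF 0] unsat_mono[of "X \<union> N" "X \<union> N \<union> P"] unsat_mono[of "X \<union> P" "X \<union> N \<union> P"]
    by (cases s) auto
  then show ?case by (auto simp: frozen_def uind_def)
next
  case (Suc j)
  let ?u = "\<lambda>D. (OX x ^^ j) uind (insert D (X \<union> N \<union> P))"
  have "(OK x ^^ Suc j) (frozen x s) (glue x X N P) = (\<Sum>D\<in>XI x. dx D * ((1 - p) * (OK x ^^ j) (frozen x s) (glue x X (insert D N) P)
      + p * (OK x ^^ j) (frozen x s) (glue x X N (insert D P))))"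
    by (simp only: funpow.simps comp_def OK_glue)
  also have "\<dots> \<le> (\<Sum>D\<in>XI x. dx D * ((1 - p) * ?u D + p * ?u D))"
  proof (intro sum_mono mult_left_mono add_mono)
    fix D assume D: "D \<in> XI x"
    then have xf: "all_avoid x (insert D N)" "all_avoid x (insert D P)" using Suc.prems XI_avoids by (auto simp: all_avoid_insert)
    show "(OK x ^^ j) (frozen x s) (glue x X (insert D N) P) \<le> ?u D"
      using Suc.IH[OF Suc.prems(1) xf(1) Suc.prems(3)] by simp
    show "(OK x ^^ j) (frozen x s) (glue x X N (insert D P)) \<le> ?u D"
      using Suc.IH[OF Suc.prems(1,2) xf(2)] by simp
  qed (use p in auto)
  also have "\<dots> = (OX x ^^ Suc j) uind (X \<union> N \<union> P)"
    by (simp add: Op_def algebra_simps)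
  finally show ?case .
qed

definition frozen_later :: "nat \<Rightarrow> bool \<Rightarrow> nat \<Rightarrow> clause set \<Rightarrow> real" where
  "frozen_later x s L Y = frozen x s Y * (OX x ^^ L) uind Y"

lemma OK_w_nonneg [simp]: "0 \<le> (case i of (D, t) \<Rightarrow> dx D * pol p (x, t))"
  by (cases i) auto

text \<open>Fix the clauses \<open>X\<close> without \<open>x\<close>, and let \<open>j\<close>
  clauses contain \<open>x\<close>. If \<open>x\<close> is frozen with probability \<theta>, then
  the \<open>j\<close> remainders make \<open>X\<close> unsatisfiable with at least this
  probability, and so do \<open>L \<ge> j\<close> fresh short clauses, whatever the signs and the
  old remainders are. Hence the square of \<theta> is at most the probability of being frozen now
  and contradictory later. The last term accounts for \<open>j > L\<close> through an exponential
  moment of \<open>j\<close> with base 2.\<close>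

lemma frozen_core:
  assumes x: "x < n" and \<eta>: "0 < \<eta>"
  shows "all_avoid x X \<Longrightarrow> (OS ^^ m) ((OK x ^^ j) (frozen x s)) X
    \<le> \<eta> / 2 + 1 / (2 * \<eta>) * (OS ^^ m) ((OK x ^^ j) (frozen_later x s L)) X + 2 ^ j / 2 ^ L * (1 + touch_prob) ^ m"
proof (induction m arbitrary: X j)
  case 0
  define \<theta> where "\<theta> = (OK x ^^ j) (frozen x s) X"
  define e where "e = (OK x ^^ j) (frozen_later x s L) X"
  define b where "b = (OX x ^^ L) uind X"
  have e0: "0 \<le> e" unfolding e_def
    by (intro Op_pow_nonneg) (auto simp: frozen_later_def intro!: mult_nonneg_nonneg Op_pow_nonneg)
  have \<theta>0: "0 \<le> \<theta>" unfolding \<theta>_def by (intro Op_pow_nonneg) auto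
  have \<theta>1: "\<theta> \<le> 1" unfolding \<theta>_def by (intro Op_pow_le_const) (use sum_OK_weight[OF x] in auto)
  have "\<theta> \<le> \<eta> / 2 + 1 / (2 * \<eta>) * e + 2 ^ j / 2 ^ L"
  proof (cases "j \<le> L")
    case True
    have "\<theta> \<le> (OX x ^^ j) uind X"
      unfolding \<theta>_def using OK_le_OX[OF x 0, of "{}" "{}" j s] by (simp add: glue_def)
    also have "\<dots> \<le> b" unfolding b_def
      by (rule Op_pow_incr) (use True sum_dx[OF x] uind_mono in auto)
    finally have "\<theta> * \<theta> \<le> b * \<theta>" using \<theta>0 by (rule mult_right_mono)
    also have "b * \<theta> = (OK x ^^ j) (\<lambda>Y. b * frozen x s Y) X"
      by (simp add: \<theta>_def Op_pow_cmult)
    also have "\<dots> \<le> e" unfolding e_def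
    proof (rule Op_pow_mono)
      fix Y assume "X \<subseteq> Y"
      then have "b \<le> (OX x ^^ L) uind Y" unfolding b_def by (intro Op_pow_mono_set uind_mono) auto
      then show "b * frozen x s Y \<le> frozen_later x s L Y" by (simp add: frozen_later_def mult_left_mono mult.commute[of b])
    qed auto
    finally have sq: "\<theta> * \<theta> \<le> e" .
    \<comment> \<open>The quadratic bound is linearized because only a linear one survives averaging
      over \<open>X\<close> and \<open>j\<close>.\<close>
    have "0 \<le> (\<theta> - \<eta>)\<^sup>2" by simp
    then have "2 * \<eta> * \<theta> \<le> \<eta> * \<eta> + e" using sq by (simp add: power2_eq_square algebra_simps)
    then have "\<theta> \<le> \<eta> / 2 + 1 / (2 * \<eta>) * e" using \<eta> by (simp add: field_simps)
    then show ?thesis by (smt (verit) divide_nonneg_nonneg zero_le_power)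
  next
    case False
    then have "(1::real) \<le> 2 ^ j / 2 ^ L" by (simp add: power_increasing)
    moreover have "0 \<le> 1 / (2 * \<eta>) * e" using e0 \<eta> by simp
    ultimately show ?thesis using \<theta>1 \<eta> by linarith
  qed
  then show ?case by (simp add: \<theta>_def e_def)
next
  case (Suc m)
  let ?C = "insert UNIV (CL ({..<n} - {x}) (Suc h))"
  \<comment> \<open>A slot either enlarges \<open>X\<close> or raises \<open>j\<close> by one. The
    error term doubles in the second case, so each slot multiplies it by
    \<open>1 + touch_prob\<close>.\<close>
  have split: "(OS ^^ Suc m) ((OK x ^^ j) f) X = (\<Sum>c\<in>?C. sw c * (OS ^^ m) ((OK x ^^ j) f) (insert c X))
     + touch_prob * (OS ^^ m) ((OK x ^^ Suc j) f) X" for f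
  proof -
    have "OK x ((OS ^^ m) ((OK x ^^ j) f)) = (OS ^^ m) ((OK x ^^ Suc j) f)"
      by (simp add: Op_pow_commute1)
    then show ?thesis by (simp add: OS_split[OF x] del: sum.insert)
  qed
  let ?A = "\<eta> / 2" and ?B = "1 / (2 * \<eta>)" and ?R = "2 ^ j / 2 ^ L * (1 + touch_prob) ^ m"
  let ?e = "\<lambda>j X. (OS ^^ m) ((OK x ^^ j) (frozen_later x s L)) X"
  have "(OS ^^ Suc m) ((OK x ^^ j) (frozen x s)) X
    \<le> (\<Sum>c\<in>?C. sw c * (?A + ?B * ?e j (insert c X) + ?R)) + touch_prob * (?A + ?B * ?e (Suc j) X + 2 ^ Suc j / 2 ^ L * (1 + touch_prob) ^ m)"
    unfolding split
  proof (intro add_mono sum_mono mult_left_mono Suc.IH)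
    fix c assume "c \<in> ?C"
    then have "avoids x c" using avoids_UNIV avoids_CL by auto
    then show "all_avoid x (insert c X)" using Suc.prems by (simp add: all_avoid_insert)
  qed (use Suc.prems touch_prob_bounds in auto)
  also have "(\<Sum>c\<in>?C. sw c * (?A + ?B * ?e j (insert c X) + ?R)) = (1 - touch_prob) * (?A + ?R) + ?B * (\<Sum>c\<in>?C. sw c * ?e j (insert c X))"
  proof -
    have "(\<Sum>c\<in>?C. sw c * (?A + ?B * ?e j (insert c X) + ?R)) = (\<Sum>c\<in>?C. sw c * (?A + ?R) + ?B * (sw c * ?e j (insert c X)))"
      by (intro sum.cong refl) (simp only: distrib_left mult.left_commute add.assoc add.commute[of "_ * ?R"])
    also have "\<dots> = (\<Sum>c\<in>?C. sw c) * (?A + ?R) + ?B * (\<Sum>c\<in>?C. sw c * ?e j (insert c X))"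
      by (simp only: sum.distrib sum_distrib_left sum_distrib_right)
    finally show ?thesis by (simp only: sum_S0[OF x])
  qed
  also have "(1 - touch_prob) * (?A + ?R) + ?B * (\<Sum>c\<in>?C. sw c * ?e j (insert c X)) + touch_prob * (?A + ?B * ?e (Suc j) X + 2 ^ Suc j / 2 ^ L * (1 + touch_prob) ^ m)
    = ?A + ?B * ((\<Sum>c\<in>?C. sw c * ?e j (insert c X)) + touch_prob * ?e (Suc j) X) + 2 ^ j / 2 ^ L * (1 + touch_prob) ^ Suc m"
  proof -
    have a: "2 ^ Suc j / 2 ^ L * (1 + touch_prob) ^ m = 2 * ?R" "2 ^ j / 2 ^ L * (1 + touch_prob) ^ Suc m = (1 + touch_prob) * ?R"
      by simp_all
    have "(1 - s) * (A + R) + B * S + s * (A + B * E + 2 * R) = A + B * (S + s * E) + (1 + s) * R"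
      for s A B R S E :: real by (simp add: algebra_simps)
    then show ?thesis unfolding a .
  qed
  finally show ?case unfolding split[symmetric] .
qed

text \<open>Once \<open>s\<close> is blocked, a short clause \<open>D\<close> has the same effect as
  \<open>D\<close> with the literal \<open>(x, s)\<close> added. The fatal probabilities of the
  \<open>L\<close> short clauses therefore telescope into pivots.\<close>

lemma frozen_later_le:
  assumes x: "x < n"
  shows "frozen_later x s L Y \<le> (\<Sum>i<L. (OX x ^^ i) (pivot x s) Y)"
proof (cases "blocked x s Y \<and> \<not> unsat Y")
  case False
  then have "frozen_later x s L Y = 0" by (simp add: frozen_later_def frozen_def)
  moreover have "0 \<le> (\<Sum>i<L. (OX x ^^ i) (pivot x s) Y)" by (intro sum_nonneg Op_pow_nonneg) auto
  ultimately show ?thesis by simp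
next
  case True
  let ?k = "\<lambda>Y. \<Sum>D\<in>XI x. dx D * (uind (insert D Y) - uind Y)"
  have "frozen_later x s L Y = (OX x ^^ L) uind Y - (OX x ^^ 0) uind Y"
    using True by (simp add: frozen_later_def frozen_def uind_def)
  also have "\<dots> = (\<Sum>i<L. (OX x ^^ Suc i) uind Y - (OX x ^^ i) uind Y)"
    by (rule sum_lessThan_telescope[symmetric])
  also have "\<dots> = (\<Sum>i<L. (OX x ^^ i) ?k Y)"
    by (intro sum.cong refl Op_pow_telescope sum_dx[OF x])
  also have "\<dots> \<le> (\<Sum>i<L. (OX x ^^ i) (pivot x s) Y)"
  proof (intro sum_mono Op_pow_mono)
    fix Y' assume Y': "Y \<subseteq> Y'"
    have b: "blocked x s Z" if "Y' \<subseteq> Z" for Z using True blocked_mono[of Y Z x s] that Y' by auto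
    have "uind (insert D Y') = uind (insert (insert (x, s) D) Y')" for D
      using b[of Y'] b[of "insert D Y'"] unsat_insert_lit[of x s D Y'] unsat_iff_blocked[of "insert D Y'" x s]
      by (auto simp: uind_def)
    then show "?k Y' \<le> pivot x s Y'" by (simp add: pivot_def)
  qed auto
  finally show ?thesis .
qed

definition slot_pivot :: "clause set \<Rightarrow> real" where
  "slot_pivot Y = (\<Sum>c\<in>SI. sw c * (uind (insert c Y) - uind Y))"
definition short_pivot :: "clause set \<Rightarrow> real" where
  "short_pivot Y = (\<Sum>D\<in>DI. dw D * (uind (insert D Y) - uind Y))"

lemma kill_nonneg [simp]: "0 \<le> uind (insert c Y) - uind Y" using uind_mono[of Y "insert c Y"] by auto
lemma slot_pivot_nonneg [simp]: "0 \<le> slot_pivot Y" unfolding slot_pivot_def by (intro sum_nonneg mult_nonneg_nonneg kill_nonneg) simp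
lemma short_pivot_nonneg [simp]: "0 \<le> short_pivot Y" unfolding short_pivot_def by (intro sum_nonneg mult_nonneg_nonneg kill_nonneg) simp

lemma slot_pivot_eq: "slot_pivot Y = (\<Sum>c\<in>CL {..<n} (Suc h). \<tau> * cw n (Suc h) p c * (uind (insert c Y) - uind Y))"
  unfolding slot_pivot_def sum_SI by simp

text \<open>With a constant \<open>a\<close> this counts the literals of a clause; with a
  logarithmic derivative as \<open>a\<close> it differentiates the clause weights.\<close>

lemma literal_sum:
  "(\<Sum>c\<in>CL {..<n} (Suc h). \<tau> * cw n (Suc h) p c * (\<Sum>l\<in>c. a (snd l)) * g c)
    = touch_prob * (\<Sum>x<n. \<Sum>D\<in>XI x. dx D * ((1 - p) * a False * g (insert (x, False) D) + p * a True * g (insert (x, True) D)))"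
proof -
  have "(\<Sum>c\<in>CL {..<n} (Suc h). \<tau> * cw n (Suc h) p c * (\<Sum>l\<in>c. a (snd l)) * g c)
    = (\<Sum>c\<in>CL {..<n} (Suc h). \<Sum>l\<in>c. \<tau> * cw n (Suc h) p c * a (snd l) * g c)"
    by (simp add: sum_distrib_left sum_distrib_right)
  also have "\<dots> = (\<Sum>x<n. \<Sum>D\<in>XI x. \<Sum>s\<in>UNIV. \<tau> * cw n (Suc h) p (insert (x, s) D) * a s * g (insert (x, s) D))"
    by (subst sum_CL_literals) (simp_all add: XI_def)
  also have "\<dots> = (\<Sum>x<n. \<Sum>D\<in>XI x. touch_prob * (dx D * ((1 - p) * a False * g (insert (x, False) D) + p * a True * g (insert (x, True) D))))"
    by (intro sum.cong refl) (simp add: cw_insert UNIV_bool algebra_simps)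
  finally show ?thesis by (simp add: sum_distrib_left)
qed

text \<open>Every fatal clause is counted once for each literal of sign \<open>s\<close>, at most
  \<open>Suc h\<close> times, and each sign has probability at least \<open>p\<close>.\<close>

lemma sum_pivot_le: "(\<Sum>x<n. 1 / real n * pivot x s Y) \<le> slot_pivot Y / (\<tau> * p)"
proof -
  let ?kill = "\<lambda>c. uind (insert c Y) - uind Y"
  have "touch_prob * (\<Sum>x<n. p * pivot x s Y) \<le> touch_prob * (\<Sum>x<n. \<Sum>D\<in>XI x. dx D * ((1 - p) * of_bool (False = s) * ?kill (insert (x, False) D) + p * of_bool (True = s) * ?kill (insert (x, True) D)))"
  proof (intro mult_left_mono sum_mono)
    fix x assume "x \<in> {..<n}"
    have "p * pivot x s Y = (\<Sum>D\<in>XI x. dx D * (p * ?kill (insert (x, s) D)))"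
      by (simp add: pivot_def sum_distrib_left mult.left_commute)
    also have "\<dots> \<le> (\<Sum>D\<in>XI x. dx D * ((1 - p) * of_bool (False = s) * ?kill (insert (x, False) D) + p * of_bool (True = s) * ?kill (insert (x, True) D)))"
    proof (intro sum_mono mult_left_mono)
      fix D
      have "p * ?kill (insert (x, False) D) \<le> (1 - p) * ?kill (insert (x, False) D)" using p by (intro mult_right_mono kill_nonneg) auto
      then show "p * ?kill (insert (x, s) D) \<le> (1 - p) * of_bool (False = s) * ?kill (insert (x, False) D) + p * of_bool (True = s) * ?kill (insert (x, True) D)"
        by (cases s) auto
    qed auto
    finally show "p * pivot x s Y \<le> \<dots>" .
  qed (use touch_prob_bounds in auto)
  also have "\<dots> = (\<Sum>c\<in>CL {..<n} (Suc h). \<tau> * cw n (Suc h) p c * (\<Sum>l\<in>c. of_bool (snd l = s)) * ?kill c)"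
    by (rule literal_sum[symmetric])
  also have "\<dots> \<le> (\<Sum>c\<in>CL {..<n} (Suc h). \<tau> * cw n (Suc h) p c * real (Suc h) * ?kill c)"
  proof (intro sum_mono mult_right_mono mult_left_mono kill_nonneg)
    fix c assume "c \<in> CL {..<n} (Suc h)"
    then have "card c = Suc h" by (simp add: CL_def)
    moreover have "(\<Sum>l\<in>c. of_bool (snd l = s)) \<le> (\<Sum>l\<in>c. (1::real))" by (intro sum_mono) auto
    ultimately show "(\<Sum>l\<in>c. of_bool (snd l = s)) \<le> real (Suc h)" by simp
  qed (use \<tau> cw_nonneg p in auto)
  also have "\<dots> = real (Suc h) * slot_pivot Y"
    by (simp only: slot_pivot_eq sum_distrib_left) (intro sum.cong refl, simp only: mult_ac)
  finally have "touch_prob * p * (\<Sum>x<n. pivot x s Y) \<le> real (Suc h) * slot_pivot Y" by (simp add: sum_distrib_left mult.assoc)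
  then have "\<tau> * p * (1 / real n * (\<Sum>x<n. pivot x s Y)) * real (Suc h) \<le> slot_pivot Y * real (Suc h)"
    by (simp add: touch_prob_def mult_ac)
  then have "\<tau> * p * (1 / real n * (\<Sum>x<n. pivot x s Y)) \<le> slot_pivot Y" by (rule mult_right_le_imp_le) simp
  then have "\<tau> * p * (\<Sum>x<n. 1 / real n * pivot x s Y) \<le> slot_pivot Y" by (simp only: sum_distrib_left)
  then show ?thesis using \<tau> p by (simp only: pos_le_divide_eq[OF mult_pos_pos[OF \<tau>(1) p(1)]] mult.commute)
qed

end

section \<open>Averages over a window of densities\<close>

context slots
begin

lemma OS_OD: "(OS ^^ m) ((OD ^^ M) f) = (OD ^^ M) ((OS ^^ m) f)" by (rule Op_pow_commute)
lemma OS_OX: "(OS ^^ m) ((OX x ^^ M) f) = (OX x ^^ M) ((OS ^^ m) f)" by (rule Op_pow_commute)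

lemma sum_slot_pivot_window: "(\<Sum>m\<in>{a..<a+w}. (OS ^^ m) ((OD ^^ M) slot_pivot) Y) \<le> 1"
proof -
  have "(\<Sum>m\<in>{a..<a+w}. (OS ^^ m) ((OD ^^ M) slot_pivot) Y) = (\<Sum>m\<in>{a..<a+w}. 1 * (OD ^^ M) ((OS ^^ m) slot_pivot) Y)"
    by (simp only: mult_1_left OS_OD)
  also have "\<dots> = (OD ^^ M) (\<lambda>Y. \<Sum>m\<in>{a..<a+w}. 1 * (OS ^^ m) slot_pivot Y) Y"
    by (simp only: Op_pow_sum)
  also have "\<dots> \<le> 1"
  proof (rule Op_pow_le_const)
    fix Y
    show "(\<Sum>m\<in>{a..<a+w}. 1 * (OS ^^ m) slot_pivot Y) \<le> 1"
      using Op_pow_telescope_sum_le[of SI sw uind "\<lambda>c. c" Y a w] sum_sw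
      by (simp add: slot_pivot_def[abs_def])
  qed (use sum_dw in auto)
  finally show ?thesis .
qed

lemma OS_const: "(OS ^^ m) (\<lambda>_. a) = (\<lambda>_. a)" using Op_pow_const[OF sum_sw] by simp
lemma OD_const: "(OD ^^ m) (\<lambda>_. a) = (\<lambda>_. a)" using Op_pow_const[OF sum_dw] by simp
lemma OX_const: "x < n \<Longrightarrow> (OX x ^^ m) (\<lambda>_. a) = (\<lambda>_. a)" using Op_pow_const[OF sum_dx] by simp

definition frozen_mean :: "bool \<Rightarrow> nat \<Rightarrow> nat \<Rightarrow> real" where
  "frozen_mean s G m = (\<Sum>x<n. 1 / real n * (OS ^^ m) ((OX x ^^ G) (frozen x s)) {})"

lemma frozen_le_pivots:
  assumes x: "x < n" and \<eta>: "0 < \<eta>"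
  shows "(OS ^^ m) ((OX x ^^ G) (frozen x s)) {}
    \<le> \<eta> / 2 + 1 / (2 * \<eta>) * (\<Sum>i<L. (OS ^^ m) ((OX x ^^ (G + i)) (pivot x s)) {}) + (1 + touch_prob) ^ m / 2 ^ L"
proof -
  have inv: "all_avoid x Y \<Longrightarrow> i \<in> XI x \<Longrightarrow> all_avoid x (insert i Y)" for Y i
    using XI_avoids by (simp add: all_avoid_insert)
  have "(OS ^^ m) ((OX x ^^ G) (frozen x s)) {} = (OX x ^^ G) ((OS ^^ m) (frozen x s)) {}"
    by (simp only: OS_OX)
  also have "\<dots> \<le> (OX x ^^ G) (\<lambda>Y. (\<eta> / 2 + (1 + touch_prob) ^ m / 2 ^ L) + 1 / (2 * \<eta>) * (OS ^^ m) (frozen_later x s L) Y) {}"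
  proof (rule Op_pow_mono_inv[where Q="all_avoid x"])
    fix Y assume Y: "all_avoid x Y"
    show "(OS ^^ m) (frozen x s) Y \<le> (\<eta> / 2 + (1 + touch_prob) ^ m / 2 ^ L) + 1 / (2 * \<eta>) * (OS ^^ m) (frozen_later x s L) Y"
      using frozen_core[OF x \<eta> Y, of m 0 s L] by simp
  qed (use inv in auto)
  also have "\<dots> = (\<eta> / 2 + (1 + touch_prob) ^ m / 2 ^ L) + 1 / (2 * \<eta>) * (OX x ^^ G) ((OS ^^ m) (frozen_later x s L)) {}"
    unfolding Op_pow_add_fun Op_pow_cmult OX_const[OF x] ..
  finally have e1: "(OS ^^ m) ((OX x ^^ G) (frozen x s)) {} \<le> (\<eta> / 2 + (1 + touch_prob) ^ m / 2 ^ L) + 1 / (2 * \<eta>) * (OX x ^^ G) ((OS ^^ m) (frozen_later x s L)) {}" .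
  have "(OX x ^^ G) ((OS ^^ m) (frozen_later x s L)) {} \<le> (OX x ^^ G) ((OS ^^ m) (\<lambda>Y. \<Sum>i<L. 1 * (OX x ^^ i) (pivot x s) Y)) {}"
    by (intro Op_pow_mono) (use frozen_later_le[OF x] in auto)
  also have "\<dots> = (\<Sum>i<L. (OS ^^ m) ((OX x ^^ (G + i)) (pivot x s)) {})"
    unfolding Op_pow_sum OS_OX[symmetric] by (simp only: Op_pow_add mult_1_left)
  finally have "1 / (2 * \<eta>) * (OX x ^^ G) ((OS ^^ m) (frozen_later x s L)) {} \<le> 1 / (2 * \<eta>) * (\<Sum>i<L. (OS ^^ m) ((OX x ^^ (G + i)) (pivot x s)) {})"
    using \<eta> by (intro mult_left_mono) auto
  then show ?thesis using e1 by linarith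
qed

text \<open>By \<open>frozen_le_pivots\<close> freezing is paid for by pivots at \<open>L\<close>
  successive numbers of short clauses, and for each of these numbers the slot pivots sum to at most
  1 over the whole window. With \<open>w\<close> of order \<open>n\<close> the average over the
  window becomes small.\<close>

lemma frozen_mean_window:
  assumes \<eta>: "0 < \<eta>" and vG: "1/2 \<le> avoid_prob ^ (G + L)"
  shows "(\<Sum>m\<in>{a..<a+w}. frozen_mean s G m) \<le> real w * (\<eta> / 2 + (1 + touch_prob) ^ (a + w) / 2 ^ L) + real L / (\<eta> * (\<tau> * p))"
proof -
  have n0: "0 < real n" using hn by simp
  have v2: "avoid_prob ^ M \<ge> 1/2" if "M \<le> G + L" for M
    using power_decreasing[OF that, of avoid_prob] avoid_prob_bounds vG by simp
  have xb: "(OS ^^ m) ((OX x ^^ M) (pivot x s)) {} \<le> 2 * (OS ^^ m) ((OD ^^ M) (pivot x s)) {}" if "M \<le> G + L" for m M x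
  proof -
    have "(OX x ^^ M) (pivot x s) Y \<le> 2 * (OD ^^ M) (pivot x s) Y" for Y
    proof -
      have "0 \<le> (OX x ^^ M) (pivot x s) Y" by (intro Op_pow_nonneg) auto
      then have "1/2 * (OX x ^^ M) (pivot x s) Y \<le> avoid_prob ^ M * (OX x ^^ M) (pivot x s) Y"
        using v2[OF that] by (intro mult_right_mono) auto
      then show ?thesis using OX_le_OD[of "pivot x s" M x Y] by simp
    qed
    then have "(OS ^^ m) ((OX x ^^ M) (pivot x s)) {} \<le> (OS ^^ m) (\<lambda>Y. 2 * (OD ^^ M) (pivot x s) Y) {}"
      by (intro Op_pow_mono) auto
    then show ?thesis by (simp add: Op_pow_cmult)
  qed
  have hs: "(\<Sum>m\<in>{a..<a+w}. \<Sum>x<n. 1 / real n * (OS ^^ m) ((OD ^^ M) (pivot x s)) {}) \<le> 1 / (\<tau> * p)" for M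
  proof -
    have "(\<Sum>m\<in>{a..<a+w}. \<Sum>x<n. 1 / real n * (OS ^^ m) ((OD ^^ M) (pivot x s)) {})
      = (\<Sum>m\<in>{a..<a+w}. (OS ^^ m) ((OD ^^ M) (\<lambda>Y. \<Sum>x<n. 1 / real n * pivot x s Y)) {})"
      by (simp only: Op_pow_sum)
    also have "\<dots> \<le> (\<Sum>m\<in>{a..<a+w}. (OS ^^ m) ((OD ^^ M) (\<lambda>Y. 1 / (\<tau> * p) * slot_pivot Y)) {})"
      by (intro sum_mono Op_pow_mono) (use sum_pivot_le in auto)
    also have "\<dots> = 1 / (\<tau> * p) * (\<Sum>m\<in>{a..<a+w}. (OS ^^ m) ((OD ^^ M) slot_pivot) {})"
      by (simp only: Op_pow_cmult sum_distrib_left)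
    also have "\<dots> \<le> 1 / (\<tau> * p) * 1"
      using \<tau> p by (intro mult_left_mono sum_slot_pivot_window) auto
    finally show ?thesis by simp
  qed
  have mb: "(1 + touch_prob) ^ m \<le> (1 + touch_prob) ^ (a + w)" if "m \<in> {a..<a+w}" for m
    using touch_prob_bounds that by (intro power_increasing) auto
  have "(\<Sum>m\<in>{a..<a+w}. frozen_mean s G m)
    \<le> (\<Sum>m\<in>{a..<a+w}. \<Sum>x<n. 1 / real n * ((\<eta> / 2 + (1 + touch_prob) ^ (a + w) / 2 ^ L)
        + (\<Sum>i<L. 1 / \<eta> * (OS ^^ m) ((OD ^^ (G + i)) (pivot x s)) {})))"
    unfolding frozen_mean_def
  proof (intro sum_mono mult_left_mono)
    fix m x assume m: "m \<in> {a..<a+w}" and x: "x \<in> {..<n}"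
    have "(OS ^^ m) ((OX x ^^ G) (frozen x s)) {}
      \<le> \<eta> / 2 + 1 / (2 * \<eta>) * (\<Sum>i<L. (OS ^^ m) ((OX x ^^ (G + i)) (pivot x s)) {}) + (1 + touch_prob) ^ m / 2 ^ L"
      using frozen_le_pivots[OF _ \<eta>] x by simp
    also have "\<dots> \<le> \<eta> / 2 + 1 / (2 * \<eta>) * (\<Sum>i<L. 2 * (OS ^^ m) ((OD ^^ (G + i)) (pivot x s)) {}) + (1 + touch_prob) ^ (a + w) / 2 ^ L"
      using \<eta> mb[OF m] by (intro add_mono mult_left_mono sum_mono xb divide_right_mono) auto
    also have "\<dots> = (\<eta> / 2 + (1 + touch_prob) ^ (a + w) / 2 ^ L) + (\<Sum>i<L. 1 / \<eta> * (OS ^^ m) ((OD ^^ (G + i)) (pivot x s)) {})"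
      by (simp add: sum_distrib_left sum_divide_distrib)
    finally show "(OS ^^ m) ((OX x ^^ G) (frozen x s)) {} \<le> \<dots>" .
  qed auto
  also have "\<dots> = real w * (\<eta> / 2 + (1 + touch_prob) ^ (a + w) / 2 ^ L)
     + (\<Sum>m\<in>{a..<a+w}. \<Sum>x<n. 1 / real n * (\<Sum>i<L. 1 / \<eta> * (OS ^^ m) ((OD ^^ (G + i)) (pivot x s)) {}))"
    using n0 by (simp add: distrib_left sum.distrib)
  also have "(\<Sum>m\<in>{a..<a+w}. \<Sum>x<n. 1 / real n * (\<Sum>i<L. 1 / \<eta> * (OS ^^ m) ((OD ^^ (G + i)) (pivot x s)) {}))
    = (\<Sum>i<L. 1 / \<eta> * (\<Sum>m\<in>{a..<a+w}. \<Sum>x<n. 1 / real n * (OS ^^ m) ((OD ^^ (G + i)) (pivot x s)) {}))"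
  proof -
    let ?A = "\<lambda>m x i. 1 / \<eta> * (1 / real n * (OS ^^ m) ((OD ^^ (G + i)) (pivot x s)) {})"
    have "(\<Sum>m\<in>{a..<a+w}. \<Sum>x<n. 1 / real n * (\<Sum>i<L. 1 / \<eta> * (OS ^^ m) ((OD ^^ (G + i)) (pivot x s)) {}))
      = (\<Sum>m\<in>{a..<a+w}. \<Sum>x<n. \<Sum>i<L. ?A m x i)"
      by (intro sum.cong refl) (simp only: sum_distrib_left mult.left_commute[of "1 / real n" "1 / \<eta>"])
    also have "\<dots> = (\<Sum>m\<in>{a..<a+w}. \<Sum>i<L. \<Sum>x<n. ?A m x i)"
      by (intro sum.cong[OF refl] sum.swap)
    also have "\<dots> = (\<Sum>i<L. \<Sum>m\<in>{a..<a+w}. \<Sum>x<n. ?A m x i)"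
      by (rule sum.swap)
    finally show ?thesis by (simp only: sum_distrib_left)
  qed
  also have "\<dots> \<le> (\<Sum>i<L. 1 / \<eta> * (1 / (\<tau> * p)))"
    using \<eta> by (intro sum_mono mult_left_mono hs) auto
  finally show ?thesis by simp
qed

section \<open>The fraction of frozen variables and the effect of short clauses\<close>

definition frozen_frac :: "clause set \<Rightarrow> real" where
  "frozen_frac Y = (\<Sum>x<n. 1 / real n * (frozen x True Y + frozen x False Y))"

definition frac_mean :: "nat \<Rightarrow> nat \<Rightarrow> real" where
  "frac_mean M m = (OS ^^ m) ((OD ^^ M) frozen_frac) {}"

lemma frac_mean_le: "frac_mean M m \<le> frozen_mean True M m + frozen_mean False M m + 2 * (real M * real h / real n)"
proof -
  have n0: "0 < real n" using hn by simp
  let ?t = "real M * (real h / real n)"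
  have c: "(OS ^^ m) ((OD ^^ M) (frozen x s)) {} \<le> (OS ^^ m) ((OX x ^^ M) (frozen x s)) {} + ?t" if "x < n" for x s
  proof -
    have "(OS ^^ m) ((OD ^^ M) (frozen x s)) {} \<le> (OS ^^ m) (\<lambda>Y. (OX x ^^ M) (frozen x s) Y + ?t) {}"
      by (intro Op_pow_mono OD_le_OX_touch that) auto
    then show ?thesis by (simp only: Op_pow_add_fun OS_const)
  qed
  have "frac_mean M m = (\<Sum>x<n. 1 / real n * ((OS ^^ m) ((OD ^^ M) (frozen x True)) {} + (OS ^^ m) ((OD ^^ M) (frozen x False)) {}))"
    unfolding frac_mean_def frozen_frac_def[abs_def] by (simp only: Op_pow_sum Op_pow_add_fun)
  also have "\<dots> \<le> (\<Sum>x<n. 1 / real n * (((OS ^^ m) ((OX x ^^ M) (frozen x True)) {} + ?t) + ((OS ^^ m) ((OX x ^^ M) (frozen x False)) {} + ?t)))"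
    by (intro sum_mono mult_left_mono add_mono c) auto
  also have "\<dots> = frozen_mean True M m + frozen_mean False M m + 2 * ?t"
    using n0 by (simp add: frozen_mean_def sum.distrib add_divide_distrib)
  finally show ?thesis by simp
qed

definition frozen_lits :: "clause set \<Rightarrow> literal set" where
  "frozen_lits Y = {l. fst l < n \<and> blocked (fst l) (snd l) Y}"

lemma frozen_lits_facts:
  assumes "\<not> unsat Y"
  shows "finite (frozen_lits Y)" "inj_on fst (frozen_lits Y)" "frozen_lits Y \<subseteq> {..<n} \<times> UNIV" "real (card (frozen_lits Y)) = real n * frozen_frac Y" "card (frozen_lits Y) \<le> n"
proof -
  show sub: "frozen_lits Y \<subseteq> {..<n} \<times> UNIV" by (auto simp: frozen_lits_def)
  then show fin: "finite (frozen_lits Y)" by (rule finite_subset) auto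
  show inj: "inj_on fst (frozen_lits Y)"
  proof (rule inj_onI)
    fix l l' assume l: "l \<in> frozen_lits Y" "l' \<in> frozen_lits Y" "fst l = fst l'"
    then have "snd l = snd l'"
      using assms unsat_iff_blocked[of Y "fst l" "snd l"] by (cases "snd l'"; cases "snd l") (auto simp: frozen_lits_def)
    then show "l = l'" using l by (simp add: prod_eq_iff)
  qed
  have "real (card (frozen_lits Y)) = (\<Sum>l\<in>{..<n} \<times> (UNIV :: bool set). of_bool (l \<in> frozen_lits Y))"
  proof -
    have "({..<n} \<times> UNIV) \<inter> {l. l \<in> frozen_lits Y} = frozen_lits Y" using sub by auto
    then show ?thesis by (simp add: of_bool_def sum.If_cases)
  qed
  also have "\<dots> = (\<Sum>x<n. \<Sum>s\<in>UNIV. of_bool ((x, s) \<in> frozen_lits Y))"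
    by (subst sum.cartesian_product) (intro sum.cong refl, auto)
  also have "\<dots> = (\<Sum>x<n. frozen x True Y + frozen x False Y)"
    using assms by (intro sum.cong refl) (auto simp: UNIV_bool frozen_lits_def frozen_def)
  also have "\<dots> = real n * frozen_frac Y"
    unfolding frozen_frac_def sum_distrib_left[symmetric] using hn by simp
  finally show "real (card (frozen_lits Y)) = real n * frozen_frac Y" .
  have "card (frozen_lits Y) = card (fst ` frozen_lits Y)" using inj by (simp add: card_image)
  also have "\<dots> \<le> card {..<n}" using sub by (intro card_mono) auto
  finally show "card (frozen_lits Y) \<le> n" by simp
qed

lemma kill_iff:
  assumes "\<not> unsat Y" "c \<in> CL {..<n} k"
  shows "uind (insert c Y) - uind Y = of_bool (c \<subseteq> frozen_lits Y)"
proof -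
  have "c \<subseteq> {..<n} \<times> UNIV" using assms(2) by (simp add: CL_def)
  then have "unsat (insert c Y) \<longleftrightarrow> c \<subseteq> frozen_lits Y"
    using unsat_insert_clause[of c Y] by (auto simp: frozen_lits_def blocked_def)
  then show ?thesis using assms(1) by (simp add: uind_def)
qed

lemma card_killers:
  assumes "\<not> unsat Y"
  shows "card {c \<in> CL {..<n} k. c \<subseteq> frozen_lits Y} = card (frozen_lits Y) choose k"
proof -
  have "{c \<in> CL {..<n} k. c \<subseteq> frozen_lits Y} = {c. c \<subseteq> frozen_lits Y \<and> card c = k}"
    using frozen_lits_facts(2,3)[OF assms] inj_on_subset[of fst "frozen_lits Y"] by (fastforce simp: CL_def)
  then show ?thesis using n_subsets[OF frozen_lits_facts(1)[OF assms]] by simp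
qed

lemma frozen_frac_bounds: "0 \<le> frozen_frac Y" "frozen_frac Y \<le> 1"
proof -
  show "0 \<le> frozen_frac Y" unfolding frozen_frac_def by (intro sum_nonneg mult_nonneg_nonneg add_nonneg_nonneg) auto
  show "frozen_frac Y \<le> 1"
  proof (cases "unsat Y")
    case True
    then show ?thesis by (simp add: frozen_frac_def frozen_def)
  next
    case False
    then have "real n * frozen_frac Y \<le> real n * 1" using frozen_lits_facts(4,5)[OF False] by simp
    then show ?thesis using hn by (simp only: mult_le_cancel_left_pos[of "real n"] of_nat_0_less_iff)
  qed
qed

lemma lw_pol_le1: "lw (pol p) c \<le> 1"
  unfolding lw_def using p by (intro prod_le_1) (auto simp: pol_def)

text \<open>All literals of a fatal short clause are blocked, and a satisfiable formula blocks at
  most one literal per variable, so each set of variables admits at most one fatal clause, of sign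
  weight at most 1.\<close>

lemma short_pivot_le: "short_pivot Y \<le> frozen_frac Y ^ h"
proof (cases "unsat Y")
  case True
  then have "unsat (insert c Y)" for c using unsat_mono[of Y "insert c Y"] by auto
  then show ?thesis using True frozen_frac_bounds by (simp add: short_pivot_def uind_def)
next
  case False
  let ?K = "{c \<in> CL {..<n} h. c \<subseteq> frozen_lits Y}"
  have n0: "0 < real n" "0 < real (n choose h)" using hn by auto
  have "short_pivot Y = (\<Sum>D\<in>DI. if D \<subseteq> frozen_lits Y then dw D else 0)"
    unfolding short_pivot_def by (intro sum.cong refl) (auto simp: DI_def kill_iff[OF False])
  also have "\<dots> = (\<Sum>D\<in>?K. dw D)"
    by (simp add: sum.inter_filter[symmetric] DI_def)
  also have "\<dots> \<le> (\<Sum>D\<in>?K. 1 / real (n choose h))"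
    unfolding dw_def cw_def by (intro sum_mono divide_right_mono lw_pol_le1) auto
  also have "\<dots> = real (card (frozen_lits Y) choose h) / real (n choose h)"
    using card_killers[OF False, of h] by simp
  also have "\<dots> \<le> (real (card (frozen_lits Y)) / real n) ^ h"
    using binomial_ratio_le[OF frozen_lits_facts(5)[OF False], of h] hn n0
    by (simp add: power_divide divide_le_eq le_divide_eq mult.commute)
  finally show ?thesis using frozen_lits_facts(4)[OF False] n0 by simp
qed

text \<open>A clause makes a satisfiable formula unsatisfiable iff each of its literals is blocked, so with a
fraction \<open>z\<close> of blocked literals the next clause does so with probability about \<open>z\<^sup>k\<close>.  These
probabilities add up to at most 1 over a window of densities, so \<open>z\<close> is small there on average.\<close>

lemma frozen_frac_pow_le: "frozen_frac Y ^ Suc h \<le> 2 ^ Suc h / (\<tau> * p ^ Suc h) * slot_pivot Y + (2 * real (Suc h)) ^ Suc h / real n"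
proof (cases "unsat Y")
  case True
  then have "frozen_frac Y = 0" by (simp add: frozen_frac_def frozen_def)
  moreover have "0 \<le> 2 ^ Suc h / (\<tau> * p ^ Suc h) * slot_pivot Y" using \<tau> p by (intro mult_nonneg_nonneg) auto
  moreover have "0 \<le> (2 * real (Suc h)) ^ Suc h / real n" by (intro divide_nonneg_nonneg zero_le_power) auto
  ultimately show ?thesis by simp
next
  case False
  let ?k = "Suc h" let ?s = "card (frozen_lits Y)"
  let ?K = "{c \<in> CL {..<n} ?k. c \<subseteq> frozen_lits Y}"
  have n0: "0 < real n" "0 < real (n choose ?k)" using hn by auto
  have z: "frozen_frac Y = real ?s / real n" using frozen_lits_facts(4)[OF False] n0 by simp
  have kS0: "0 \<le> 2 ^ ?k / (\<tau> * p ^ ?k) * slot_pivot Y" using \<tau> p by (intro mult_nonneg_nonneg) auto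
  show ?thesis
  proof (cases "2 * ?k \<le> ?s")
    case True
    have "\<tau> * p ^ ?k / real (n choose ?k) * real (?s choose ?k) = (\<Sum>c\<in>?K. \<tau> * (p ^ ?k / real (n choose ?k)))"
      using card_killers[OF False, of ?k] by simp
    also have "\<dots> \<le> (\<Sum>c\<in>?K. \<tau> * cw n ?k p c)"
    proof (intro sum_mono mult_left_mono)
      fix c assume "c \<in> ?K"
      then have c: "card c = ?k" by (auto simp: CL_def)
      have "p ^ ?k = (\<Prod>l\<in>c. p)" using c by simp
      also have "\<dots> \<le> lw (pol p) c" unfolding lw_def using p pol_ge by (intro prod_mono) auto
      finally show "p ^ ?k / real (n choose ?k) \<le> cw n ?k p c" unfolding cw_def by (intro divide_right_mono) auto
    qed (use \<tau> in auto)
    also have "\<dots> = (\<Sum>c\<in>CL {..<n} ?k. if c \<subseteq> frozen_lits Y then \<tau> * cw n ?k p c else 0)"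
      by (simp add: sum.inter_filter[symmetric])
    also have "\<dots> = slot_pivot Y"
      unfolding slot_pivot_eq by (intro sum.cong refl) (auto simp: kill_iff[OF False])
    finally have k1: "\<tau> * p ^ ?k * (real (?s choose ?k) / real (n choose ?k)) \<le> slot_pivot Y" by simp
    have "real ?s ^ ?k * real (n choose ?k) \<le> real (?s choose ?k) * (2 * real n) ^ ?k"
      by (rule binomial_ratio_ge[OF frozen_lits_facts(5)[OF False] True]) simp
    then have "(real ?s / real n) ^ ?k \<le> 2 ^ ?k * (real (?s choose ?k) / real (n choose ?k))"
      using n0 by (simp add: power_divide power_mult_distrib divide_le_eq le_divide_eq mult_ac del: power_Suc)
    also have "\<dots> \<le> 2 ^ ?k * (slot_pivot Y / (\<tau> * p ^ ?k))"
      using k1 \<tau> p by (intro mult_left_mono) (auto simp: pos_le_divide_eq mult_ac simp del: power_Suc)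
    finally have "frozen_frac Y ^ ?k \<le> 2 ^ ?k / (\<tau> * p ^ ?k) * slot_pivot Y" by (simp add: z del: power_Suc)
    moreover have "0 \<le> (2 * real ?k) ^ ?k / real n" by (intro divide_nonneg_nonneg zero_le_power) auto
    ultimately show ?thesis by linarith
  next
    \<comment> \<open>The binomial estimate needs at least \<open>2 * Suc h\<close> frozen
      variables; with fewer of them the fraction is of order \<open>1 / n\<close> anyway.\<close>
    case False
    have "frozen_frac Y ^ ?k \<le> (2 * real ?k / real n) ^ ?k"
      unfolding z using False by (intro power_mono divide_right_mono) auto
    also have "\<dots> = (2 * real ?k) ^ ?k / real n ^ ?k" by (rule power_divide)
    also have "\<dots> \<le> (2 * real ?k) ^ ?k / real n ^ 1"
      using hn by (intro divide_left_mono power_increasing mult_pos_pos zero_less_power) auto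
    finally show ?thesis using kS0 by simp
  qed
qed

text \<open>Below the level \<eta> of \<open>z ^ (h - 1)\<close> the linear term suffices. Above it
  \<open>z \<ge> z ^ (h - 1) > \<eta>\<close>, because \<open>h - 1 \<ge> 1\<close>, and one more
  factor \<open>z\<close> costs at most \<open>1 / \<eta>\<close>. This is where clause length at
  least 3 enters.\<close>

lemma pow_interp:
  fixes z \<eta> :: real
  assumes "0 \<le> z" "z \<le> 1" "0 < \<eta>"
  shows "z ^ h \<le> \<eta> * z + 1 / \<eta> * z ^ Suc h"
proof (cases "z ^ (h - 1) \<le> \<eta>")
  case True
  have "z ^ h = z ^ (h - 1) * z" using h2 power_Suc2[of z "h - 1"] by simp
  also have "\<dots> \<le> \<eta> * z" using True assms by (intro mult_right_mono) auto
  finally show ?thesis using assms by (smt (verit) divide_nonneg_nonneg mult_nonneg_nonneg zero_le_power)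
next
  case False
  have "z ^ (h - 1) \<le> z ^ 1" using assms h2 by (intro power_decreasing) auto
  then have "\<eta> \<le> z" using False by simp
  then have "z ^ h * \<eta> \<le> z ^ h * z" using assms by (intro mult_left_mono) auto
  then have "z ^ h \<le> 1 / \<eta> * z ^ Suc h" using assms by (simp add: field_simps)
  then show ?thesis using assms by (smt (verit) mult_nonneg_nonneg)
qed

definition short_mean :: "nat \<Rightarrow> nat \<Rightarrow> real" where
  "short_mean M m = (OS ^^ m) ((OD ^^ M) short_pivot) {}"

lemma short_mean_nonneg: "0 \<le> short_mean M m"
  unfolding short_mean_def by (intro Op_pow_nonneg) auto

lemma short_mean_window:
  assumes \<eta>: "0 < \<eta>"
  shows "(\<Sum>m\<in>{a..<a+w}. short_mean M m) \<le> \<eta> * (\<Sum>m\<in>{a..<a+w}. frac_mean M m)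
    + 1 / \<eta> * (2 ^ Suc h / (\<tau> * p ^ Suc h) + real w * ((2 * real (Suc h)) ^ Suc h / real n))"
proof -
  let ?A = "2 ^ Suc h / (\<tau> * p ^ Suc h)" and ?B = "(2 * real (Suc h)) ^ Suc h / real n"
  have k: "short_pivot Y \<le> \<eta> * frozen_frac Y + (1 / \<eta> * ?A * slot_pivot Y + 1 / \<eta> * ?B)" for Y
  proof -
    have "short_pivot Y \<le> frozen_frac Y ^ h" by (rule short_pivot_le)
    also have "\<dots> \<le> \<eta> * frozen_frac Y + 1 / \<eta> * frozen_frac Y ^ Suc h" by (rule pow_interp) (use frozen_frac_bounds \<eta> in auto)
    also have "\<dots> \<le> \<eta> * frozen_frac Y + 1 / \<eta> * (?A * slot_pivot Y + ?B)"
      using \<eta> by (intro add_left_mono mult_left_mono frozen_frac_pow_le) auto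
    finally show ?thesis by (simp add: distrib_left)
  qed
  have "short_mean M m \<le> \<eta> * frac_mean M m + (1 / \<eta> * ?A * (OS ^^ m) ((OD ^^ M) slot_pivot) {} + 1 / \<eta> * ?B)" for m
  proof -
    have "short_mean M m \<le> (OS ^^ m) ((OD ^^ M) (\<lambda>Y. \<eta> * frozen_frac Y + (1 / \<eta> * ?A * slot_pivot Y + 1 / \<eta> * ?B))) {}"
      unfolding short_mean_def by (intro Op_pow_mono) (use k in auto)
    also have "\<dots> = \<eta> * frac_mean M m + (1 / \<eta> * ?A * (OS ^^ m) ((OD ^^ M) slot_pivot) {} + 1 / \<eta> * ?B)"
      unfolding frac_mean_def Op_pow_add_fun Op_pow_cmult OD_const OS_const ..
    finally show ?thesis .
  qed
  then have "(\<Sum>m\<in>{a..<a+w}. short_mean M m) \<le> (\<Sum>m\<in>{a..<a+w}. \<eta> * frac_mean M m + (1 / \<eta> * ?A * (OS ^^ m) ((OD ^^ M) slot_pivot) {} + 1 / \<eta> * ?B))"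
    by (intro sum_mono)
  also have "\<dots> = \<eta> * (\<Sum>m\<in>{a..<a+w}. frac_mean M m) + (1 / \<eta> * ?A * (\<Sum>m\<in>{a..<a+w}. (OS ^^ m) ((OD ^^ M) slot_pivot) {}) + real w * (1 / \<eta> * ?B))"
    unfolding sum.distrib sum_distrib_left[symmetric] by simp
  also have "\<dots> \<le> \<eta> * (\<Sum>m\<in>{a..<a+w}. frac_mean M m) + (1 / \<eta> * ?A * 1 + real w * (1 / \<eta> * ?B))"
    using \<eta> \<tau> p by (intro add_left_mono add_right_mono mult_left_mono sum_slot_pivot_window) auto
  finally show ?thesis by (simp add: distrib_left mult.left_commute)
qed

text \<open>A clause without its literal at \<open>x\<close> is stronger, hence at least as likely
  to be fatal.\<close>

lemma pivot_le_short_pivot: "pivot x s Y \<le> short_pivot Y / avoid_prob"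
proof -
  have le: "uind (insert (insert (x, s) D) Y) \<le> uind (insert D Y)" for D
  proof -
    have "unsat (insert D Y)" if u: "unsat (insert (insert (x, s) D) Y)"
      unfolding unsat_def
    proof
      assume "\<exists>\<sigma>. \<forall>C\<in>insert D Y. satisfies_clause \<sigma> C"
      then obtain \<sigma> where s: "satisfies_clause \<sigma> D" "\<forall>C\<in>Y. satisfies_clause \<sigma> C" by auto
      have "satisfies_clause \<sigma> (insert (x, s) D)" using s(1) by (auto simp: satisfies_clause_def)
      then show False using s(2) u by (auto simp: unsat_def)
    qed
    then show ?thesis by (auto simp: uind_def)
  qed
  have "avoid_prob * pivot x s Y = (\<Sum>D\<in>XI x. dw D * (uind (insert (insert (x, s) D) Y) - uind Y))"
    by (simp add: pivot_def sum_distrib_left dw_dx mult.assoc)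
  also have "\<dots> \<le> (\<Sum>D\<in>XI x. dw D * (uind (insert D Y) - uind Y))"
    using le by (intro sum_mono mult_left_mono) (auto simp: diff_right_mono)
  also have "\<dots> \<le> short_pivot Y"
    unfolding short_pivot_def by (intro sum_mono2 XI_DI mult_nonneg_nonneg kill_nonneg) auto
  finally show ?thesis using avoid_prob_bounds by (simp add: le_divide_eq mult.commute)
qed

text \<open>A short clause contains only \<open>h\<close> of the \<open>n\<close> variables. After
  summation over \<open>x\<close> the error is a constant multiple of one short pivot instead of
  \<open>n\<close> of them.\<close>

lemma sum_OT_pivot_le: "(\<Sum>x<n. OT x (pivot x s) Y) \<le> real h / avoid_prob * OD short_pivot Y"
proof -
  have "(\<Sum>x<n. OT x (pivot x s) Y) \<le> (\<Sum>x<n. \<Sum>D\<in>DI - XI x. dw D * (short_pivot (insert D Y) / avoid_prob))"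
    unfolding Op_def by (intro sum_mono mult_left_mono pivot_le_short_pivot) auto
  also have "\<dots> = (\<Sum>x<n. \<Sum>D\<in>DI. if D \<notin> XI x then dw D * (short_pivot (insert D Y) / avoid_prob) else 0)"
  proof (rule sum.cong[OF refl])
    fix x
    have "DI - XI x = {D \<in> DI. D \<notin> XI x}" by auto
    then show "(\<Sum>D\<in>DI - XI x. dw D * (short_pivot (insert D Y) / avoid_prob)) = (\<Sum>D\<in>DI. if D \<notin> XI x then dw D * (short_pivot (insert D Y) / avoid_prob) else 0)"
      by (simp only: sum.inter_filter[OF finite_DI])
  qed
  also have "\<dots> = (\<Sum>D\<in>DI. \<Sum>x<n. if D \<notin> XI x then dw D * (short_pivot (insert D Y) / avoid_prob) else 0)"
    by (rule sum.swap)
  also have "\<dots> \<le> (\<Sum>D\<in>DI. real h * (dw D * (short_pivot (insert D Y) / avoid_prob)))"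
  proof (intro sum_mono)
    fix D assume D: "D \<in> DI"
    then have fin: "finite D" "card D = h" using CL_finite_clause[of "{..<n}" D h] by (auto simp: DI_def CL_def)
    have sub: "{x \<in> {..<n}. D \<notin> XI x} \<subseteq> fst ` D"
      using D by (force simp: DI_def XI_def CL_def)
    have "card {x \<in> {..<n}. D \<notin> XI x} \<le> card (fst ` D)" using sub fin by (intro card_mono) auto
    also have "\<dots> \<le> h" using card_image_le[OF fin(1), of fst] fin(2) by simp
    finally have "real (card {x \<in> {..<n}. D \<notin> XI x}) \<le> real h" by simp
    then have "real (card {x \<in> {..<n}. D \<notin> XI x}) * (dw D * (short_pivot (insert D Y) / avoid_prob)) \<le> real h * (dw D * (short_pivot (insert D Y) / avoid_prob))"
      using avoid_prob_bounds by (intro mult_right_mono mult_nonneg_nonneg divide_nonneg_nonneg) auto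
    moreover have "(\<Sum>x<n. if D \<notin> XI x then c else 0) = real (card {x \<in> {..<n}. D \<notin> XI x}) * c" for c :: real
      by (simp add: sum.inter_filter[symmetric])
    ultimately show "(\<Sum>x<n. if D \<notin> XI x then dw D * (short_pivot (insert D Y) / avoid_prob) else 0) \<le> real h * (dw D * (short_pivot (insert D Y) / avoid_prob))"
      by simp
  qed
  also have "\<dots> = real h / avoid_prob * OD short_pivot Y"
    by (simp add: Op_def sum_distrib_left sum_divide_distrib mult_ac)
  finally show ?thesis .
qed

text \<open>Only the part with the positive sign needs an error term; for the other part the
  one-sided bound \<open>OX_le_OD\<close> points in the right direction.\<close>

lemma pivot_diff_OD_le:
  "(OD ^^ M) (pivot_diff x) Y \<le> avoid_prob ^ M * (OX x ^^ M) (pivot_diff x) Y + real M * (OD ^^ (M - 1)) (OT x (pivot x False)) Y"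
proof -
  have g: "(T (pivot_diff x) :: clause set \<Rightarrow> real) = (\<lambda>Y. (1 - p) * T (pivot x False) Y - p * T (pivot x True) Y)"
    if "T = (Op I w c ^^ M)" for T and I :: "clause set" and w c
    unfolding that pivot_diff_def[abs_def] by (simp add: Op_pow_diff_fun Op_pow_cmult)
  have t0: "0 \<le> real M * (OD ^^ (M - 1)) (OT x (pivot x False)) Y"
    by (intro mult_nonneg_nonneg Op_pow_nonneg Op1_nonneg) auto
  have "(1 - p) * (OD ^^ M) (pivot x False) Y
     \<le> (1 - p) * (avoid_prob ^ M * (OX x ^^ M) (pivot x False) Y + real M * (OD ^^ (M - 1)) (OT x (pivot x False)) Y)"
    using OD_diff_touch[of "pivot x False" M Y x] p by (intro mult_left_mono) auto
  also have "\<dots> \<le> (1 - p) * (avoid_prob ^ M * (OX x ^^ M) (pivot x False) Y) + real M * (OD ^^ (M - 1)) (OT x (pivot x False)) Y"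
    using t0 p mult_right_mono[of "1 - p" 1 "real M * (OD ^^ (M - 1)) (OT x (pivot x False)) Y"] by (simp add: distrib_left)
  finally have a: "(1 - p) * (OD ^^ M) (pivot x False) Y
     \<le> (1 - p) * (avoid_prob ^ M * (OX x ^^ M) (pivot x False) Y) + real M * (OD ^^ (M - 1)) (OT x (pivot x False)) Y" .
  have b: "p * (avoid_prob ^ M * (OX x ^^ M) (pivot x True) Y) \<le> p * (OD ^^ M) (pivot x True) Y"
    using OX_le_OD[of "pivot x True" M x Y] p by (intro mult_left_mono) auto
  show ?thesis
    using a b unfolding g[OF refl] by (simp add: algebra_simps)
qed

text \<open>The weights \<open>1 / avoid_prob ^ M\<close> undo the probability that all
  \<open>M\<close> short clauses avoid \<open>x\<close>. The sum over \<open>M\<close> then has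
  equal weights, as \<open>pivot_window_le\<close> requires.\<close>

lemma pivot_diff_weighted_sum:
  assumes vG: "1/2 \<le> avoid_prob ^ (G + 1)"
  shows "(\<Sum>M<G. (1 / avoid_prob ^ M) * (\<Sum>x<n. (OS ^^ m) ((OD ^^ M) (pivot_diff x)) {}))
    \<le> p * (real n * frozen_mean True G m) + 2 * (real h * real G) * (\<Sum>M<G. short_mean M m)"
proof -
  have n0: "0 < real n" using hn by simp
  have v2: "avoid_prob ^ M \<ge> 1/2" if "M \<le> G + 1" for M
    using power_decreasing[OF that, of avoid_prob] avoid_prob_bounds vG by simp
  have tch: "real M * (\<Sum>x<n. (OS ^^ m) ((OD ^^ (M - 1)) (OT x (pivot x False))) {}) \<le> real M * (real h / avoid_prob) * short_mean M m" for M
  proof (cases M)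
    case (Suc M')
    have "(\<Sum>x<n. (OS ^^ m) ((OD ^^ (M - 1)) (OT x (pivot x False))) {})
      = (OS ^^ m) ((OD ^^ M') (\<lambda>Y. \<Sum>x<n. 1 * OT x (pivot x False) Y)) {}"
      unfolding Op_pow_sum by (simp add: Suc)
    also have "\<dots> \<le> (OS ^^ m) ((OD ^^ M') (\<lambda>Y. real h / avoid_prob * OD short_pivot Y)) {}"
      by (intro Op_pow_mono) (use sum_OT_pivot_le in auto)
    also have "\<dots> = real h / avoid_prob * short_mean M m"
      unfolding short_mean_def Op_pow_cmult by (simp add: Suc Op_pow_commute1)
    finally show ?thesis unfolding mult.assoc[of "real M"] by (rule mult_left_mono) simp
  qed simp
  have "(\<Sum>M<G. (1 / avoid_prob ^ M) * (\<Sum>x<n. (OS ^^ m) ((OD ^^ M) (pivot_diff x)) {}))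
    \<le> (\<Sum>M<G. (\<Sum>x<n. (OS ^^ m) ((OX x ^^ M) (pivot_diff x)) {}) + 2 * (real h * real G) * short_mean M m)"
  proof (intro sum_mono)
    fix M assume M: "M \<in> {..<G}"
    have v: "0 < avoid_prob ^ M" "1/2 \<le> avoid_prob ^ M * avoid_prob" using avoid_prob_bounds v2[of "Suc M"] M by (auto simp: mult.commute)
    have "(OS ^^ m) ((OD ^^ M) (pivot_diff x)) {} \<le> avoid_prob ^ M * (OS ^^ m) ((OX x ^^ M) (pivot_diff x)) {} + real M * (OS ^^ m) ((OD ^^ (M - 1)) (OT x (pivot x False))) {}" for x
    proof -
      have "(OS ^^ m) ((OD ^^ M) (pivot_diff x)) {} \<le> (OS ^^ m) (\<lambda>Y. avoid_prob ^ M * (OX x ^^ M) (pivot_diff x) Y + real M * (OD ^^ (M - 1)) (OT x (pivot x False)) Y) {}"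
        by (intro Op_pow_mono pivot_diff_OD_le) auto
      then show ?thesis unfolding Op_pow_add_fun Op_pow_cmult .
    qed
    then have "(\<Sum>x<n. (OS ^^ m) ((OD ^^ M) (pivot_diff x)) {}) \<le> (\<Sum>x<n. avoid_prob ^ M * (OS ^^ m) ((OX x ^^ M) (pivot_diff x)) {} + real M * (OS ^^ m) ((OD ^^ (M - 1)) (OT x (pivot x False))) {})"
      by (intro sum_mono)
    also have "\<dots> = avoid_prob ^ M * (\<Sum>x<n. (OS ^^ m) ((OX x ^^ M) (pivot_diff x)) {}) + real M * (\<Sum>x<n. (OS ^^ m) ((OD ^^ (M - 1)) (OT x (pivot x False))) {})"
      by (simp add: sum.distrib sum_distrib_left)
    also have "\<dots> \<le> avoid_prob ^ M * (\<Sum>x<n. (OS ^^ m) ((OX x ^^ M) (pivot_diff x)) {}) + real M * (real h / avoid_prob) * short_mean M m"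
      by (intro add_left_mono tch)
    finally have "(1 / avoid_prob ^ M) * (\<Sum>x<n. (OS ^^ m) ((OD ^^ M) (pivot_diff x)) {})
      \<le> (1 / avoid_prob ^ M) * (avoid_prob ^ M * (\<Sum>x<n. (OS ^^ m) ((OX x ^^ M) (pivot_diff x)) {}) + real M * (real h / avoid_prob) * short_mean M m)"
      using v by (intro mult_left_mono) auto
    also have "\<dots> = (\<Sum>x<n. (OS ^^ m) ((OX x ^^ M) (pivot_diff x)) {}) + real M * real h * short_mean M m * (1 / (avoid_prob ^ M * avoid_prob))"
      using v avoid_prob_bounds by (simp add: distrib_left)
    also have "real M * real h * short_mean M m * (1 / (avoid_prob ^ M * avoid_prob)) \<le> real G * real h * short_mean M m * 2"
    proof (intro mult_mono)
      show "1 / (avoid_prob ^ M * avoid_prob) \<le> 2" using v by (simp add: divide_le_eq) 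
    qed (use M short_mean_nonneg v in auto)
    finally show "(1 / avoid_prob ^ M) * (\<Sum>x<n. (OS ^^ m) ((OD ^^ M) (pivot_diff x)) {})
      \<le> (\<Sum>x<n. (OS ^^ m) ((OX x ^^ M) (pivot_diff x)) {}) + 2 * (real h * real G) * short_mean M m"
      by (simp add: mult_ac)
  qed
  also have "\<dots> = (\<Sum>x<n. \<Sum>M<G. (OS ^^ m) ((OX x ^^ M) (pivot_diff x)) {}) + 2 * (real h * real G) * (\<Sum>M<G. short_mean M m)"
    unfolding sum.distrib sum_distrib_left[symmetric] by (subst sum.swap) simp
  also have "(\<Sum>x<n. \<Sum>M<G. (OS ^^ m) ((OX x ^^ M) (pivot_diff x)) {}) \<le> (\<Sum>x<n. p * (OS ^^ m) ((OX x ^^ G) (frozen x True)) {})"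
    by (intro sum_mono pivot_window_le) auto
  also have "\<dots> = p * (real n * frozen_mean True G m)"
    using n0 by (simp add: frozen_mean_def sum_distrib_left)
  finally show ?thesis by simp
qed

end

section \<open>Comparison along a path\<close>

text \<open>The bound of \<open>frozen_mean_window\<close> made uniform along the path, where
  \<open>1 / (\<tau> * p) \<le> 8\<close>. The exponent \<open>a + w + 1\<close> also covers windows
  that start at \<open>a + 1\<close>.\<close>

definition frozen_bound :: "nat \<Rightarrow> nat \<Rightarrow> real \<Rightarrow> nat \<Rightarrow> nat \<Rightarrow> nat \<Rightarrow> real" where
  "frozen_bound n h \<eta> L a w = real w * (\<eta> / 2 + (1 + real (Suc h) / real n) ^ (a + w + 1) / 2 ^ L) + 8 * real L / \<eta>"

text \<open>The corresponding uniform form of \<open>short_mean_window\<close>;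
  \<open>2 * 8 ^ Suc h\<close> comes from \<open>\<tau> \<ge> 1/2\<close> and
  \<open>p \<ge> 1/4\<close>.\<close>

definition short_bound :: "nat \<Rightarrow> nat \<Rightarrow> real \<Rightarrow> real \<Rightarrow> nat \<Rightarrow> nat \<Rightarrow> nat \<Rightarrow> nat \<Rightarrow> real" where
  "short_bound n h \<eta>1 \<eta>2 L G a w = \<eta>2 * (2 * frozen_bound n h \<eta>1 L a w + 2 * real w * (real G * real h / real n))
     + 1 / \<eta>2 * (2 * 8 ^ Suc h + real w * ((2 * real (Suc h)) ^ Suc h / real n))"

context slots
begin

text \<open>The derivative with respect to \<open>b\<close> of the logarithm of a literal weight at
  \<open>p = 1/2 - b\<close>.\<close>

definition log_deriv :: "bool \<Rightarrow> real" where "log_deriv s = (if s then - 1 / p else 1 / (1 - p))"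

definition slot_deriv :: "real \<Rightarrow> clause \<Rightarrow> real" where
  "slot_deriv \<tau>d c = (if c = UNIV then - \<tau>d else \<tau>d * cw n (Suc h) p c + \<tau> * cw n (Suc h) p c * (\<Sum>l\<in>c. log_deriv (snd l)))"

definition short_deriv :: "clause \<Rightarrow> real" where "short_deriv D = dw D * (\<Sum>l\<in>D. log_deriv (snd l))"

lemma slot_pivot_literals: "real (Suc h) * slot_pivot Y = touch_prob * (\<Sum>x<n. (1 - p) * pivot x False Y + p * pivot x True Y)"
proof -
  have "real (Suc h) * slot_pivot Y = (\<Sum>c\<in>CL {..<n} (Suc h). \<tau> * cw n (Suc h) p c * (\<Sum>l\<in>c. 1) * (uind (insert c Y) - uind Y))"
    unfolding slot_pivot_eq sum_distrib_left
    by (intro sum.cong refl) (simp add: CL_def)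
  also have "\<dots> = touch_prob * (\<Sum>x<n. \<Sum>D\<in>XI x. dx D * ((1 - p) * 1 * (uind (insert (insert (x, False) D) Y) - uind Y) + p * 1 * (uind (insert (insert (x, True) D) Y) - uind Y)))"
    by (rule literal_sum)
  also have "\<dots> = touch_prob * (\<Sum>x<n. (1 - p) * pivot x False Y + p * pivot x True Y)"
    unfolding pivot_def sum_distrib_left sum.distrib[symmetric]
    by (intro sum.cong refl) (simp add: algebra_simps)
  finally show ?thesis .
qed

text \<open>A literal weight times its logarithmic derivative is 1 for negative and -1 for positive
  literals. Since the slot weights always sum to 1, \<open>uind\<close> may be replaced by its
  increment.\<close>

lemma Op_slot_deriv: "Op SI (slot_deriv \<tau>d) (\<lambda>c. c) uind Y = touch_prob * (\<Sum>x<n. pivot x False Y - pivot x True Y) + \<tau>d / \<tau> * slot_pivot Y"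
proof -
  let ?C = "CL {..<n} (Suc h)" and ?u = "\<lambda>c. uind (insert c Y)"
  have "UNIV \<notin> ?C" using not_UNIV_CL by blast
  then have "Op SI (slot_deriv \<tau>d) (\<lambda>c. c) uind Y = - \<tau>d * uind Y + (\<Sum>c\<in>?C. slot_deriv \<tau>d c * ?u c)"
    by (simp add: Op_def SI_def slot_deriv_def)
  also have "(\<Sum>c\<in>?C. slot_deriv \<tau>d c * ?u c) = (\<Sum>c\<in>?C. \<tau>d * cw n (Suc h) p c * ?u c) + (\<Sum>c\<in>?C. \<tau> * cw n (Suc h) p c * (\<Sum>l\<in>c. log_deriv (snd l)) * ?u c)"
    unfolding sum.distrib[symmetric] by (intro sum.cong refl) (simp add: slot_deriv_def not_UNIV_CL algebra_simps)
  also have "(\<Sum>c\<in>?C. \<tau> * cw n (Suc h) p c * (\<Sum>l\<in>c. log_deriv (snd l)) * ?u c)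
    = touch_prob * (\<Sum>x<n. \<Sum>D\<in>XI x. dx D * ((1 - p) * log_deriv False * ?u (insert (x, False) D) + p * log_deriv True * ?u (insert (x, True) D)))"
    by (rule literal_sum)
  also have "\<dots> = touch_prob * (\<Sum>x<n. pivot x False Y - pivot x True Y)"
    unfolding pivot_def sum_subtractf[symmetric]
    using p by (intro arg_cong2[where f="(*)"] sum.cong refl) (simp add: log_deriv_def algebra_simps)
  also have "- \<tau>d * uind Y + ((\<Sum>c\<in>?C. \<tau>d * cw n (Suc h) p c * ?u c) + touch_prob * (\<Sum>x<n. pivot x False Y - pivot x True Y))
    = touch_prob * (\<Sum>x<n. pivot x False Y - pivot x True Y) + \<tau>d * ((\<Sum>c\<in>?C. cw n (Suc h) p c * ?u c) - 1 * uind Y)"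
    by (simp add: algebra_simps sum_distrib_left)
  also have "(\<Sum>c\<in>?C. cw n (Suc h) p c * ?u c) - 1 * uind Y = (\<Sum>c\<in>?C. cw n (Suc h) p c * (?u c - uind Y))"
    using sum_cw[of "Suc h" n p] hn
    by (simp only: right_diff_distrib sum_subtractf sum_distrib_right[symmetric])
  also have "\<tau>d * (\<Sum>c\<in>?C. cw n (Suc h) p c * (?u c - uind Y)) = \<tau>d / \<tau> * slot_pivot Y"
    unfolding slot_pivot_eq using \<tau> by (simp add: sum_distrib_left mult.assoc)
  finally show ?thesis .
qed

text \<open>The rate \<open>4 * Suc h * b\<close> is shared among the \<open>Suc h\<close> literals
  of a fatal clause, so the coefficients of the two pivots become \<open>1 + 2b + 4b^2\<close> and
  \<open>-(1 - 2b + 4b^2)\<close>. Multiplication by \<open>2p = 1 - 2b\<close> and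
  \<open>2(1 - p) = 1 + 2b\<close> gives \<open>1 - 8b^3\<close> and \<open>-(1 + 8b^3)\<close>: the
  signed pivot is reached with only a cubic loss. This fixes the exponent \<open>2 * k * b^2\<close>
  of the lower bound.\<close>

lemma Op_slot_deriv_le:
  assumes b: "p = 1/2 - b" "0 \<le> b" and \<tau>d: "\<tau>d = 4 * real (Suc h) * b * \<tau>"
  shows "Op SI (slot_deriv \<tau>d) (\<lambda>c. c) uind Y \<le> touch_prob / (2 * p * (1 - p)) * (\<Sum>x<n. pivot_diff x Y)"
proof -
  have "\<tau>d / \<tau> * slot_pivot Y = 4 * b * (real (Suc h) * slot_pivot Y)" using \<tau> by (simp add: \<tau>d)
  then have "Op SI (slot_deriv \<tau>d) (\<lambda>c. c) uind Y = touch_prob * (\<Sum>x<n. (pivot x False Y - pivot x True Y) + 4 * b * ((1 - p) * pivot x False Y + p * pivot x True Y))"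
    unfolding Op_slot_deriv slot_pivot_literals sum.distrib sum_distrib_left[symmetric] by (simp add: algebra_simps)
  also have "\<dots> \<le> touch_prob * (\<Sum>x<n. 1 / (2 * p * (1 - p)) * pivot_diff x Y)"
  proof (intro mult_left_mono sum_mono)
    fix x
    have q: "0 < 1 - p" "1 - p = 1/2 + b" using p b by auto
    have c1: "1 + 4 * b * (1 - p) \<le> 1 / (2 * p)"
    proof -
      have "0 \<le> 8 * b ^ 3" using b by simp
      then have "(1 + 4 * b * (1 - p)) * (2 * p) \<le> 1" unfolding b(1) by (simp add: algebra_simps power3_eq_cube)
      then show ?thesis using p by (simp add: le_divide_eq)
    qed
    have c2: "1 / (2 * (1 - p)) \<le> 1 - 4 * b * p"
    proof -
      have "0 \<le> 8 * b ^ 3" using b by simp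
      then have "1 \<le> (1 - 4 * b * p) * (2 * (1 - p))" unfolding b(1) by (simp add: algebra_simps power3_eq_cube)
      then show ?thesis using q by (simp add: divide_le_eq)
    qed
    have "(pivot x False Y - pivot x True Y) + 4 * b * ((1 - p) * pivot x False Y + p * pivot x True Y)
      = (1 + 4 * b * (1 - p)) * pivot x False Y - (1 - 4 * b * p) * pivot x True Y" by (simp add: algebra_simps)
    also have "\<dots> \<le> 1 / (2 * p) * pivot x False Y - 1 / (2 * (1 - p)) * pivot x True Y"
      by (intro diff_mono mult_right_mono c1 c2) auto
    also have "\<dots> = 1 / (2 * p * (1 - p)) * pivot_diff x Y"
      using p q(1) by (simp add: pivot_diff_def field_simps)
    finally show "(pivot x False Y - pivot x True Y) + 4 * b * ((1 - p) * pivot x False Y + p * pivot x True Y) \<le> 1 / (2 * p * (1 - p)) * pivot_diff x Y" .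
  qed (use touch_prob_bounds in auto)
  also have "\<dots> = touch_prob / (2 * p * (1 - p)) * (\<Sum>x<n. pivot_diff x Y)"
    unfolding sum_distrib_left[symmetric] by simp
  finally show ?thesis .
qed

text \<open>Short clauses form a probability distribution at every bias; at each variable the
  derivatives of the two signs cancel.\<close>

lemma sum_short_deriv: "(\<Sum>D\<in>DI. short_deriv D) = 0"
proof -
  obtain h' where h': "h = Suc h'" using h2 by (cases h) auto
  have "(\<Sum>D\<in>DI. short_deriv D) = (\<Sum>D\<in>CL {..<n} (Suc h'). \<Sum>l\<in>D. dw D * log_deriv (snd l))"
    unfolding h'[symmetric] by (simp add: DI_def short_deriv_def sum_distrib_left)
  also have "\<dots> = (\<Sum>x<n. \<Sum>D\<in>CL ({..<n} - {x}) h'. \<Sum>s\<in>UNIV. dw (insert (x, s) D) * log_deriv s)"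
    by (subst sum_CL_literals) simp_all
  also have "\<dots> = 0"
  proof (rule sum.neutral, rule ballI, rule sum.neutral, rule ballI)
    fix x D assume D: "D \<in> CL ({..<n} - {x}) h'"
    have "dw (insert (x, s) D) = pol p (x, s) * (lw (pol p) D / real (n choose h))" for s
      using lw_insert[OF _ D, of "pol p" s] by (simp add: dw_def cw_def)
    then show "(\<Sum>s\<in>UNIV. dw (insert (x, s) D) * log_deriv s) = 0"
      using p by (simp add: UNIV_bool log_deriv_def)
  qed
  finally show ?thesis .
qed

lemma Op_short_deriv_le: "Op DI short_deriv (\<lambda>c. c) uind Y \<le> 2 * real h * short_pivot Y"
proof -
  have "Op DI short_deriv (\<lambda>c. c) uind Y = (\<Sum>D\<in>DI. short_deriv D * (uind (insert D Y) - uind Y))"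
    using sum_short_deriv by (simp add: Op_def right_diff_distrib sum_subtractf sum_distrib_right[symmetric])
  also have "\<dots> \<le> (\<Sum>D\<in>DI. 2 * real h * (dw D * (uind (insert D Y) - uind Y)))"
  proof (intro sum_mono)
    fix D assume "D \<in> DI"
    then have c: "card D = h" by (simp add: DI_def CL_def)
    have "1 / (1 - p) \<le> 2" using p by (simp add: divide_le_eq)
    then have "log_deriv s \<le> 2" for s
      using p by (cases s) (auto simp: log_deriv_def intro: order_trans[of _ 0])
    then have "(\<Sum>l\<in>D. log_deriv (snd l)) \<le> (\<Sum>l\<in>D. 2)" by (intro sum_mono)
    then have "(\<Sum>l\<in>D. log_deriv (snd l)) \<le> 2 * real h" using c by simp
    then have "short_deriv D \<le> dw D * (2 * real h)" unfolding short_deriv_def by (intro mult_left_mono) auto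
    then have "short_deriv D * (uind (insert D Y) - uind Y) \<le> dw D * (2 * real h) * (uind (insert D Y) - uind Y)"
      by (intro mult_right_mono kill_nonneg)
    then show "short_deriv D * (uind (insert D Y) - uind Y) \<le> 2 * real h * (dw D * (uind (insert D Y) - uind Y))"
      by (simp only: mult_ac)
  qed
  also have "\<dots> = 2 * real h * short_pivot Y" by (simp add: short_pivot_def sum_distrib_left)
  finally show ?thesis .
qed

text \<open>The product rule for \<open>path_unsat\<close>. With \<open>Suc m\<close> slots exactly
  \<open>m\<close> undifferentiated ones remain, the number used in the pivot estimates.\<close>

definition path_deriv :: "real \<Rightarrow> nat \<Rightarrow> nat \<Rightarrow> real" where
  "path_deriv \<tau>d m M = real (Suc m) * (OS ^^ m) (Op SI (slot_deriv \<tau>d) (\<lambda>c. c) ((OD ^^ M) uind)) {}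
     + (OS ^^ Suc m) (\<lambda>Y. real M * (OD ^^ (M - 1)) (Op DI short_deriv (\<lambda>c. c) uind) Y) {}"

lemma path_deriv_le:
  assumes b: "p = 1/2 - b" "0 \<le> b" and \<tau>d: "\<tau>d = 4 * real (Suc h) * b * \<tau>"
  shows "path_deriv \<tau>d m M \<le> real (Suc m) * (touch_prob / (2 * p * (1 - p))) * (\<Sum>x<n. (OS ^^ m) ((OD ^^ M) (pivot_diff x)) {})
     + real M * (2 * real h) * short_mean (M - 1) (Suc m)"
proof -
  let ?k = "touch_prob / (2 * p * (1 - p))"
  have "(OS ^^ m) (Op SI (slot_deriv \<tau>d) (\<lambda>c. c) ((OD ^^ M) uind)) {} = (OS ^^ m) ((OD ^^ M) (Op SI (slot_deriv \<tau>d) (\<lambda>c. c) uind)) {}"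
    by (simp only: Op_pow_commute1)
  also have "\<dots> \<le> (OS ^^ m) ((OD ^^ M) (\<lambda>Y. \<Sum>x<n. ?k * pivot_diff x Y)) {}"
    by (intro Op_pow_mono) (use Op_slot_deriv_le[OF assms] in \<open>auto simp: sum_distrib_left\<close>)
  also have "\<dots> = ?k * (\<Sum>x<n. (OS ^^ m) ((OD ^^ M) (pivot_diff x)) {})"
    by (simp only: Op_pow_sum sum_distrib_left)
  finally have 1: "(OS ^^ m) (Op SI (slot_deriv \<tau>d) (\<lambda>c. c) ((OD ^^ M) uind)) {} \<le> ?k * (\<Sum>x<n. (OS ^^ m) ((OD ^^ M) (pivot_diff x)) {})" .
  have "(OS ^^ Suc m) (\<lambda>Y. real M * (OD ^^ (M - 1)) (Op DI short_deriv (\<lambda>c. c) uind) Y) {}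
    \<le> (OS ^^ Suc m) (\<lambda>Y. real M * (OD ^^ (M - 1)) (\<lambda>Y. 2 * real h * short_pivot Y) Y) {}"
    by (intro Op_pow_mono mult_left_mono) (use Op_short_deriv_le in auto)
  also have "\<dots> = real M * (2 * real h) * short_mean (M - 1) (Suc m)"
    unfolding Op_pow_cmult short_mean_def by simp
  finally show ?thesis
    unfolding path_deriv_def using mult_left_mono[OF 1, of "real (Suc m)"] by (simp only: mult.assoc) linarith
qed

context
  fixes a w L G :: nat and \<eta>1 \<eta>2 :: real
  assumes pq: "1/4 \<le> p" and tq: "1/2 \<le> \<tau>" and \<eta>: "0 < \<eta>1" "0 < \<eta>2" and vG: "1/2 \<le> avoid_prob ^ (G + L + 1)"
begin

lemma avoid_prob_half: "M \<le> G + L + 1 \<Longrightarrow> 1/2 \<le> avoid_prob ^ M"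
  using power_decreasing[of M "G + L + 1" avoid_prob] avoid_prob_bounds vG by simp

lemma inv_tp: "1 / (\<tau> * p) \<le> 8"
proof -
  have "1/8 \<le> \<tau> * p" using mult_mono[of "1/2" \<tau> "1/4" p] tq pq by simp
  then show ?thesis using \<tau> p by (simp add: divide_le_eq)
qed

lemma frozen_mean_bound:
  assumes M: "M \<le> G" and a': "a' \<le> a + 1"
  shows "(\<Sum>m\<in>{a'..<a'+w}. frozen_mean s M m) \<le> frozen_bound n h \<eta>1 L a w"
proof -
  have touch_prob: "touch_prob \<le> real (Suc h) / real n"
    unfolding touch_prob_def using \<tau> mult_right_mono[of \<tau> 1 "real (Suc h) / real n"] by simp
  have "(1 + touch_prob) ^ (a' + w) \<le> (1 + real (Suc h) / real n) ^ (a' + w)"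
    using touch_prob touch_prob_bounds by (intro power_mono) auto
  also have "\<dots> \<le> (1 + real (Suc h) / real n) ^ (a + w + 1)"
    using a' by (intro power_increasing) auto
  finally have pw: "(1 + touch_prob) ^ (a' + w) \<le> (1 + real (Suc h) / real n) ^ (a + w + 1)" .
  have "(\<Sum>m\<in>{a'..<a'+w}. frozen_mean s M m) \<le> real w * (\<eta>1 / 2 + (1 + touch_prob) ^ (a' + w) / 2 ^ L) + real L / (\<eta>1 * (\<tau> * p))"
    by (rule frozen_mean_window[OF \<eta>(1)]) (use avoid_prob_half M in auto)
  also have "real L / (\<eta>1 * (\<tau> * p)) = real L / \<eta>1 * (1 / (\<tau> * p))" by simp
  also have "real w * (\<eta>1 / 2 + (1 + touch_prob) ^ (a' + w) / 2 ^ L) + real L / \<eta>1 * (1 / (\<tau> * p))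
    \<le> real w * (\<eta>1 / 2 + (1 + real (Suc h) / real n) ^ (a + w + 1) / 2 ^ L) + real L / \<eta>1 * 8"
    using pw inv_tp \<eta> by (intro add_mono mult_left_mono divide_right_mono) auto
  finally show ?thesis by (simp add: frozen_bound_def mult.commute)
qed

lemma short_mean_bound:
  assumes M: "M \<le> G" and a': "a' \<le> a + 1"
  shows "(\<Sum>m\<in>{a'..<a'+w}. short_mean M m) \<le> short_bound n h \<eta>1 \<eta>2 L G a w"
proof -
  have z: "(\<Sum>m\<in>{a'..<a'+w}. frac_mean M m) \<le> 2 * frozen_bound n h \<eta>1 L a w + 2 * real w * (real G * real h / real n)"
  proof -
    have "(\<Sum>m\<in>{a'..<a'+w}. frac_mean M m) \<le> (\<Sum>m\<in>{a'..<a'+w}. frozen_mean True M m + frozen_mean False M m + 2 * (real G * real h / real n))"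
      using M by (intro sum_mono order_trans[OF frac_mean_le] add_left_mono mult_left_mono divide_right_mono mult_right_mono) auto
    also have "\<dots> = (\<Sum>m\<in>{a'..<a'+w}. frozen_mean True M m) + (\<Sum>m\<in>{a'..<a'+w}. frozen_mean False M m) + real w * (2 * (real G * real h / real n))"
      by (simp add: sum.distrib)
    also have "\<dots> \<le> frozen_bound n h \<eta>1 L a w + frozen_bound n h \<eta>1 L a w + real w * (2 * (real G * real h / real n))"
      by (intro add_mono frozen_mean_bound[OF assms] order_refl)
    finally show ?thesis by (simp add: mult_ac)
  qed
  have "(1/4) ^ Suc h \<le> p ^ Suc h" using pq by (intro power_mono) auto
  then have "1/2 * (1/4) ^ Suc h \<le> \<tau> * p ^ Suc h" using tq p by (intro mult_mono) auto
  then have "2 ^ Suc h / (\<tau> * p ^ Suc h) \<le> 2 ^ Suc h / (1/2 * (1/4) ^ Suc h)"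
    using \<tau> p by (intro divide_left_mono mult_pos_pos) auto
  also have "\<dots> = 2 * 8 ^ Suc h" by (simp add: power_divide flip: power_mult_distrib)
  finally have t: "2 ^ Suc h / (\<tau> * p ^ Suc h) \<le> 2 * 8 ^ Suc h" .
  have "(\<Sum>m\<in>{a'..<a'+w}. short_mean M m) \<le> \<eta>2 * (\<Sum>m\<in>{a'..<a'+w}. frac_mean M m)
    + 1 / \<eta>2 * (2 ^ Suc h / (\<tau> * p ^ Suc h) + real w * ((2 * real (Suc h)) ^ Suc h / real n))"
    by (rule short_mean_window[OF \<eta>(2)])
  also have "\<dots> \<le> short_bound n h \<eta>1 \<eta>2 L G a w"
    unfolding short_bound_def using \<eta> z t by (intro add_mono mult_left_mono) auto
  finally show ?thesis .
qed

text \<open>The prefactor \<open>Suc m * touch_prob\<close>, the mean number of clauses through a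
  variable up to one slot, is at most \<open>A * Suc h\<close>. The main term carries no factor
  \<open>G\<close>, since the sum over \<open>M\<close> was absorbed by the race; the later division
  by \<open>G * w\<close> makes it small.\<close>

lemma path_deriv_total:
  assumes b: "p = 1/2 - b" "0 \<le> b" and \<tau>d: "\<tau>d = 4 * real (Suc h) * b * \<tau>"
    and A: "real (a + w) \<le> A * real n" "0 \<le> A" and G1: "1 \<le> G"
  shows "(\<Sum>m\<in>{a..<a+w}. \<Sum>M<G. 1 / avoid_prob ^ M * path_deriv \<tau>d m M)
    \<le> A * real (Suc h) * (real n * frozen_bound n h \<eta>1 L a w + 6 * real h * real G * real G * short_bound n h \<eta>1 \<eta>2 L G a w)
      + 4 * real h * real G * real G * short_bound n h \<eta>1 \<eta>2 L G a w"
proof -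
  let ?K = "short_bound n h \<eta>1 \<eta>2 L G a w" and ?C = "frozen_bound n h \<eta>1 L a w"
  let ?s = "touch_prob / (2 * p * (1 - p))"
  have n0: "0 < real n" using hn by simp
  have pp: "3/16 \<le> p * (1 - p)"
  proof -
    have "0 \<le> (p - 1/4) * (3/4 - p)" using pq p by (intro mult_nonneg_nonneg) auto
    moreover have "(p - 1/4) * (3/4 - p) = p * (1 - p) - 3/16" by (simp add: field_simps)
    ultimately show ?thesis by linarith
  qed
  have per: "(\<Sum>M<G. 1 / avoid_prob ^ M * path_deriv \<tau>d m M) \<le> A * real (Suc h) * (real n * frozen_mean True G m + 6 * real h * real G * (\<Sum>M<G. short_mean M m))
      + 4 * real h * real G * (\<Sum>M<G. short_mean (M - 1) (Suc m))" if m: "m \<in> {a..<a+w}" for m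
  proof -
    let ?X = "\<Sum>M<G. short_mean M m"
    have X0: "0 \<le> ?X" by (intro sum_nonneg short_mean_nonneg)
    have c0: "0 \<le> frozen_mean True G m" unfolding frozen_mean_def by (intro sum_nonneg mult_nonneg_nonneg Op_pow_nonneg) auto
    have "(\<Sum>M<G. 1 / avoid_prob ^ M * path_deriv \<tau>d m M) \<le> (\<Sum>M<G. 1 / avoid_prob ^ M * (real (Suc m) * ?s * (\<Sum>x<n. (OS ^^ m) ((OD ^^ M) (pivot_diff x)) {})
        + real M * (2 * real h) * short_mean (M - 1) (Suc m)))"
      using avoid_prob_bounds by (intro sum_mono mult_left_mono path_deriv_le[OF b \<tau>d]) auto
    also have "\<dots> = real (Suc m) * ?s * (\<Sum>M<G. 1 / avoid_prob ^ M * (\<Sum>x<n. (OS ^^ m) ((OD ^^ M) (pivot_diff x)) {}))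
        + (\<Sum>M<G. 1 / avoid_prob ^ M * (real M * (2 * real h) * short_mean (M - 1) (Suc m)))"
      unfolding distrib_left sum.distrib by (simp only: sum_distrib_left mult.left_commute)
    also have "(\<Sum>M<G. 1 / avoid_prob ^ M * (real M * (2 * real h) * short_mean (M - 1) (Suc m))) \<le> (\<Sum>M<G. 2 * (real G * (2 * real h) * short_mean (M - 1) (Suc m)))"
    proof (intro sum_mono mult_mono)
      fix M assume M: "M \<in> {..<G}"
      then show "1 / avoid_prob ^ M \<le> 2" using avoid_prob_half[of M] avoid_prob_bounds by (simp add: divide_le_eq)
    qed (use short_mean_nonneg avoid_prob_bounds in auto)
    also have "\<dots> = 4 * real h * real G * (\<Sum>M<G. short_mean (M - 1) (Suc m))"
      by (simp add: sum_distrib_left mult_ac)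
    also have "real (Suc m) * ?s * (\<Sum>M<G. 1 / avoid_prob ^ M * (\<Sum>x<n. (OS ^^ m) ((OD ^^ M) (pivot_diff x)) {}))
      \<le> real (Suc m) * ?s * (p * (real n * frozen_mean True G m) + 2 * (real h * real G) * ?X)"
      using touch_prob_bounds p avoid_prob_half[of "G + 1"] by (intro mult_left_mono pivot_diff_weighted_sum) auto
    also have "\<dots> = (real (Suc m) * touch_prob) * (1 / (2 * (1 - p)) * (real n * frozen_mean True G m) + 1 / (p * (1 - p)) * (real h * real G * ?X))"
    proof -
      have "S * (x / (2 * p * q)) * (p * Z + 2 * W) = (S * x) * (1 / (2 * q) * Z + 1 / (p * q) * W)"
        if "p \<noteq> 0" "q \<noteq> 0" for S x p q Z W :: real using that by (simp add: field_simps)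
      then show ?thesis using p by (simp add: mult.assoc)
    qed
    also have "\<dots> \<le> (A * real (Suc h)) * (1 * (real n * frozen_mean True G m) + 6 * (real h * real G * ?X))"
    proof -
      have "real (Suc m) \<le> A * real n" using m A by auto
      moreover have "touch_prob \<le> real (Suc h) / real n"
        unfolding touch_prob_def using \<tau> mult_right_mono[of \<tau> 1 "real (Suc h) / real n"] by simp
      ultimately have "real (Suc m) * touch_prob \<le> (A * real n) * (real (Suc h) / real n)"
        using A(2) touch_prob_bounds by (intro mult_mono) auto
      then have h1: "real (Suc m) * touch_prob \<le> A * real (Suc h)" using n0 by simp
      have h2: "1 / (2 * (1 - p)) \<le> 1" using p by (simp add: divide_le_eq)
      have "1 / (p * (1 - p)) \<le> 1 / (3/16)" using pp p by (intro divide_left_mono mult_pos_pos) auto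
      then have h3: "1 / (p * (1 - p)) \<le> 6" by simp
      have h4: "1 / (2 * (1 - p)) * (real n * frozen_mean True G m) + 1 / (p * (1 - p)) * (real h * real G * ?X)
        \<le> 1 * (real n * frozen_mean True G m) + 6 * (real h * real G * ?X)"
        using X0 c0 by (intro add_mono mult_right_mono h2 h3 mult_nonneg_nonneg) auto
      show ?thesis
        using A(2) X0 c0 p by (intro mult_mono[OF h1 h4] mult_nonneg_nonneg add_nonneg_nonneg divide_nonneg_nonneg) auto
    qed
    finally show ?thesis by (simp add: mult_ac)
  qed
  have "(\<Sum>m\<in>{a..<a+w}. \<Sum>M<G. 1 / avoid_prob ^ M * path_deriv \<tau>d m M) \<le> (\<Sum>m\<in>{a..<a+w}. A * real (Suc h) * (real n * frozen_mean True G m + 6 * real h * real G * (\<Sum>M<G. short_mean M m))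
      + 4 * real h * real G * (\<Sum>M<G. short_mean (M - 1) (Suc m)))"
    by (intro sum_mono per)
  also have "\<dots> = A * real (Suc h) * (real n * (\<Sum>m\<in>{a..<a+w}. frozen_mean True G m) + 6 * real h * real G * (\<Sum>M<G. \<Sum>m\<in>{a..<a+w}. short_mean M m))
      + 4 * real h * real G * (\<Sum>M<G. \<Sum>m\<in>{a..<a+w}. short_mean (M - 1) (Suc m))"
  proof -
    have sw: "(\<Sum>m\<in>{a..<a+w}. \<Sum>M<G. f m M) = (\<Sum>M<G. \<Sum>m\<in>{a..<a+w}. f m M)" for f :: "nat \<Rightarrow> nat \<Rightarrow> real"
      by (rule sum.swap)
    show ?thesis by (simp only: sum.distrib sum_distrib_left[symmetric] sw)
  qed
  also have "\<dots> \<le> A * real (Suc h) * (real n * ?C + 6 * real h * real G * (\<Sum>M<G. ?K))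
      + 4 * real h * real G * (\<Sum>M<G. ?K)"
  proof (intro add_mono mult_left_mono sum_mono)
    show "(\<Sum>m\<in>{a..<a+w}. frozen_mean True G m) \<le> ?C" by (rule frozen_mean_bound) auto
    show "(\<Sum>m\<in>{a..<a+w}. short_mean M m) \<le> ?K" if "M \<in> {..<G}" for M using that by (intro short_mean_bound) auto
    show "(\<Sum>m\<in>{a..<a+w}. short_mean (M - 1) (Suc m)) \<le> ?K" if "M \<in> {..<G}" for M
    proof -
      have "(\<Sum>m\<in>{a..<a+w}. short_mean (M - 1) (Suc m)) = (\<Sum>m\<in>{Suc a..<Suc a+w}. short_mean (M - 1) m)"
        using sum.shift_bounds_Suc_ivl[of "short_mean (M - 1)" a "a + w"] by simp
      also have "\<dots> \<le> ?K" using that by (intro short_mean_bound) auto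
      finally show ?thesis .
    qed
  qed (use A in auto)
  finally show ?thesis by (simp add: mult.assoc)
qed

end

end

section \<open>Differentiability and integration along the path\<close>

lemma lw_has_derivative:
  assumes "finite c" "0 < 1/2 - b" "0 < 1/2 + b"
  shows "((\<lambda>t. lw (pol (1/2 - t)) c) has_real_derivative
    lw (pol (1/2 - b)) c * (\<Sum>l\<in>c. if snd l then - 1 / (1/2 - b) else 1 / (1 - (1/2 - b)))) (at b)"
  using assms(1)
proof (induction c rule: finite_induct)
  case (insert l c)
  have l: "((\<lambda>t. pol (1/2 - t) l) has_real_derivative (if snd l then - 1 else 1)) (at b)"
    unfolding pol_def by (cases "snd l") (auto intro!: derivative_eq_intros)
  have "((\<lambda>t. pol (1/2 - t) l * lw (pol (1/2 - t)) c) has_real_derivative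
     (if snd l then - 1 else 1) * lw (pol (1/2 - b)) c + lw (pol (1/2 - b)) c * (\<Sum>l\<in>c. if snd l then - 1 / (1/2 - b) else 1 / (1 - (1/2 - b))) * pol (1/2 - b) l) (at b)"
    by (rule DERIV_mult[OF l insert.IH])
  moreover have "pol (1/2 - b) l * (if snd l then - 1 / (1/2 - b) else 1 / (1 - (1/2 - b))) = (if snd l then - 1 else 1)"
    using assms by (simp add: pol_def)
  then have "(if snd l then - 1 else 1) * lw (pol (1/2 - b)) c + lw (pol (1/2 - b)) c * (\<Sum>l\<in>c. if snd l then - 1 / (1/2 - b) else 1 / (1 - (1/2 - b))) * pol (1/2 - b) l
    = pol (1/2 - b) l * lw (pol (1/2 - b)) c * ((if snd l then - 1 / (1/2 - b) else 1 / (1 - (1/2 - b))) + (\<Sum>l\<in>c. if snd l then - 1 / (1/2 - b) else 1 / (1 - (1/2 - b))))"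
  proof -
    have "d * L + L * S * P = P * L * (e + S)" if "P * e = d" for d L S P e :: real
      using that by (auto simp: algebra_simps)
    then show ?thesis using \<open>pol (1/2 - b) l * (if snd l then - 1 / (1/2 - b) else 1 / (1 - (1/2 - b))) = (if snd l then - 1 else 1)\<close> .
  qed
  moreover have "lw (pol t) (insert l c) = pol t l * lw (pol t) c" for t
    using insert.hyps by (simp add: lw_def)
  ultimately show ?case
    using insert.hyps by simp
qed (simp add: lw_def)

definition slot_weight :: "nat \<Rightarrow> nat \<Rightarrow> real \<Rightarrow> real \<Rightarrow> clause \<Rightarrow> real" where
  "slot_weight n k p t c = (if c = UNIV then 1 - t else t * cw n k p c)"

abbreviation slot_clauses :: "nat \<Rightarrow> nat \<Rightarrow> clause set" where "slot_clauses n k \<equiv> insert UNIV (CL {..<n} k)"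

lemma (in slots) slots_global: "SI = slot_clauses n (Suc h)" "sw = slot_weight n (Suc h) p \<tau>" "DI = CL {..<n} h" "dw = cw n h p"
  by (auto simp: SI_def sw_def slot_weight_def DI_def dw_def fun_eq_iff)

lemma slot_weight_op_insensitive:
  assumes "\<And>X. f (insert UNIV X) = f X" "t = 1"
  shows "(Op (slot_clauses n k) (slot_weight n k p t) (\<lambda>c. c) ^^ m) f = (COp n k p ^^ m) f"
proof -
  have "UNIV \<notin> CL {..<n} k" using not_UNIV_CL by blast
  then have "Op (slot_clauses n k) (slot_weight n k p t) (\<lambda>c. c) = COp n k p"
    unfolding COp_def Op_def fun_eq_iff by (auto simp: slot_weight_def assms(2) not_UNIV_CL intro!: sum.cong)
  then show ?thesis by simp
qed

text \<open>At bias \<open>b\<close> a slot is occupied with this probability; its logarithmic derivative \<open>4 k b\<close> is what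
\<open>Op_slot_deriv_le\<close> can absorb.\<close>

definition occupancy :: "nat \<Rightarrow> real \<Rightarrow> real \<Rightarrow> real" where
  "occupancy h b0 b = exp (- (2 * real (Suc h) * (b0\<^sup>2 - b\<^sup>2)))"

text \<open>At \<open>b = b0\<close> every slot is occupied; at \<open>b = 0\<close> the clauses are
  unbiased and thinned.\<close>

definition path_unsat :: "nat \<Rightarrow> nat \<Rightarrow> real \<Rightarrow> nat \<Rightarrow> nat \<Rightarrow> real \<Rightarrow> real" where
  "path_unsat n h b0 m M b = (Op (slot_clauses n (Suc h)) (slot_weight n (Suc h) (1/2 - b) (occupancy h b0 b)) (\<lambda>c. c) ^^ Suc m)
     ((Op (CL {..<n} h) (cw n h (1/2 - b)) (\<lambda>c. c) ^^ M) uind) {}"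

lemma slots_at:
  assumes "2 \<le> h" "h + 2 \<le> n" "0 \<le> b" "b \<le> b0" "b0 \<le> 1/4"
  shows "slots n h (1/2 - b) (occupancy h b0 b)"
proof
  have "b\<^sup>2 \<le> b0\<^sup>2" using assms by (intro power_mono) auto
  then show "occupancy h b0 b \<le> 1" by (simp add: occupancy_def)
qed (use assms in \<open>auto simp: occupancy_def\<close>)

lemma path_unsat_eq_slots:
  assumes "slots n h (1/2 - b) (occupancy h b0 b)"
  shows "path_unsat n h b0 m M b = (Op (slots.SI n h) (slots.sw n h (1/2 - b) (occupancy h b0 b)) (\<lambda>c. c) ^^ Suc m)
     ((Op (slots.DI n h) (slots.dw n h (1/2 - b)) (\<lambda>c. c) ^^ M) uind) {}"
  unfolding path_unsat_def slots.slots_global[OF assms] ..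

lemma cw_has_derivative:
  assumes "finite c" "0 < 1/2 - b" "0 < 1/2 + b"
  shows "((\<lambda>t. cw n k (1/2 - t) c) has_real_derivative
    cw n k (1/2 - b) c * (\<Sum>l\<in>c. if snd l then - 1 / (1/2 - b) else 1 / (1 - (1/2 - b)))) (at b)"
  unfolding cw_def using DERIV_cdivide[OF lw_has_derivative[OF assms], of "real (n choose k)"] by simp

lemma path_unsat_has_derivative:
  assumes sl: "slots n h (1/2 - b) (occupancy h b0 b)" and b: "0 \<le> b" "b \<le> 1/4"
  shows "(path_unsat n h b0 m M has_real_derivative
     slots.path_deriv n h (1/2 - b) (occupancy h b0 b) (4 * real (Suc h) * b * occupancy h b0 b) m M) (at b)"
proof -
  interpret slots n h "1/2 - b" "occupancy h b0 b" by (rule sl)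
  have b': "0 < 1/2 - b" "0 < 1/2 + b" using b by auto
  let ?td = "4 * real (Suc h) * b * occupancy h b0 b"
  have td: "(occupancy h b0 has_real_derivative ?td) (at b)"
    unfolding occupancy_def by (auto intro!: derivative_eq_intros simp: power2_eq_square)
  have D: "((\<lambda>t. (Op (CL {..<n} h) (cw n h (1/2 - t)) (\<lambda>c. c) ^^ M) uind Y) has_real_derivative
     real M * (Op (CL {..<n} h) (cw n h (1/2 - b)) (\<lambda>c. c) ^^ (M - 1)) (Op (CL {..<n} h) short_deriv (\<lambda>c. c) uind) Y
       + (Op (CL {..<n} h) (cw n h (1/2 - b)) (\<lambda>c. c) ^^ M) (\<lambda>_. 0) Y) (at b)" for Y
  proof (rule Op_pow_has_derivative)
    fix D assume "D \<in> CL {..<n} h"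
    then have "finite D" using CL_finite_clause by blast
    then show "((\<lambda>t. cw n h (1/2 - t) D) has_real_derivative short_deriv D) (at b)"
      unfolding short_deriv_def dw_def log_deriv_def using cw_has_derivative[OF _ b', of D n h] by (simp add: if_distrib)
  qed simp
  have S: "(path_unsat n h b0 m M has_real_derivative
     real (Suc m) * (Op (slot_clauses n (Suc h)) (slot_weight n (Suc h) (1/2 - b) (occupancy h b0 b)) (\<lambda>c. c) ^^ (Suc m - 1))
        (Op (slot_clauses n (Suc h)) (slot_deriv ?td) (\<lambda>c. c) ((Op (CL {..<n} h) (cw n h (1/2 - b)) (\<lambda>c. c) ^^ M) uind)) {}
     + (Op (slot_clauses n (Suc h)) (slot_weight n (Suc h) (1/2 - b) (occupancy h b0 b)) (\<lambda>c. c) ^^ Suc m)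
       (\<lambda>Y. real M * (Op (CL {..<n} h) (cw n h (1/2 - b)) (\<lambda>c. c) ^^ (M - 1)) (Op (CL {..<n} h) short_deriv (\<lambda>c. c) uind) Y
       + (Op (CL {..<n} h) (cw n h (1/2 - b)) (\<lambda>c. c) ^^ M) (\<lambda>_. 0) Y) {}) (at b)"
    unfolding path_unsat_def
  proof (rule Op_pow_has_derivative[OF _ D])
    fix c assume c: "c \<in> slot_clauses n (Suc h)"
    show "((\<lambda>t. slot_weight n (Suc h) (1/2 - t) (occupancy h b0 t) c) has_real_derivative slot_deriv ?td c) (at b)"
    proof (cases "c = UNIV")
      case True
      then show ?thesis unfolding slot_weight_def slot_deriv_def using DERIV_diff[OF DERIV_const[of 1] td] by simp
    next
      case False
      then have "finite c" using c CL_finite_clause by blast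
      then show ?thesis
        using False DERIV_mult[OF td cw_has_derivative[OF _ b', of c n "Suc h"]]
        unfolding slot_weight_def slot_deriv_def log_deriv_def by (simp add: if_distrib algebra_simps)
    qed
  qed
  have z: "(Op (CL {..<n} h) (cw n h (1/2 - b)) (\<lambda>c. c) ^^ M) (\<lambda>_. 0) Y = 0" for Y
    using OD_const[of M 0] unfolding slots_global by (simp add: fun_eq_iff)
  show ?thesis using S unfolding z path_deriv_def slots_global by simp
qed

text \<open>The derivative bound is integrated from 0 to \<open>b0\<close> for a weighted sum over
  the window and over \<open>M\<close>, then divided by the total weight, which is at least
  \<open>G * w\<close>. The first error term removes the auxiliary short clauses, the second is the
  integrated derivative.\<close>

lemma window_compare:
  fixes n h a w L G :: nat and b0 A \<eta>1 \<eta>2 :: real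
  assumes h: "2 \<le> h" "h + 2 \<le> n" and b0: "0 \<le> b0" "b0 \<le> 1/4" "1/2 \<le> exp (- (2 * real (Suc h) * b0\<^sup>2))"
    and A: "real (a + w) \<le> A * real n" "0 \<le> A" and G1: "1 \<le> G" and w1: "1 \<le> w" and \<eta>: "0 < \<eta>1" "0 < \<eta>2"
    and vG: "1/2 \<le> ((real n - real h) / real n) ^ (G + L + 1)"
  defines "K \<equiv> short_bound n h \<eta>1 \<eta>2 L G a w" and "C \<equiv> frozen_bound n h \<eta>1 L a w"
  shows "US (Suc h) (1/2 - b0) n (Suc a)
    \<le> (Op (slot_clauses n (Suc h)) (slot_weight n (Suc h) (1/2) (exp (- (2 * real (Suc h) * b0\<^sup>2)))) (\<lambda>c. c) ^^ (a + w)) uind {}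
      + real G * K / real w
      + (A * real (Suc h) * (real n * C + 6 * real h * real G * real G * K) + 4 * real h * real G * real G * K) / (real G * real w)"
proof -
  define E where "E = A * real (Suc h) * (real n * C + 6 * real h * real G * real G * K) + 4 * real h * real G * real G * K"
  define v where "v = (real n - real h) / real n"
  \<comment> \<open>The weights are those of \<open>pivot_diff_weighted_sum\<close>.\<close>
  define H where "H b = (\<Sum>m\<in>{a..<a+w}. \<Sum>M<G. 1 / v ^ M * path_unsat n h b0 m M b)" for b
  define Sv where "Sv = (\<Sum>M<G. 1 / v ^ M)"
  have sl: "slots n h (1/2 - b) (occupancy h b0 b)" if "0 \<le> b" "b \<le> b0" for b
    by (rule slots_at) (use h b0 that in auto)
  have avoid_prob: "slots.avoid_prob n h = v" by (simp add: v_def slots.avoid_prob_def[OF sl[of 0]] b0)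
  have t2: "1/2 \<le> occupancy h b0 b" if "0 \<le> b" "b \<le> b0" for b
  proof -
    have "exp (- (2 * real (Suc h) * b0\<^sup>2)) \<le> occupancy h b0 b"
      unfolding occupancy_def exp_le_cancel_iff by (intro le_imp_neg_le mult_left_mono) auto
    then show ?thesis using b0(3) by linarith
  qed
  have CK: "frozen_bound n h \<eta>1 L a w = C" "short_bound n h \<eta>1 \<eta>2 L G a w = K"
    by (simp_all add: C_def K_def)
  have v01: "0 < v" "v \<le> 1" using h by (auto simp: v_def)
  have n0: "0 < real n" using h by simp
  have Sv: "real G \<le> Sv"
  proof -
    have "(\<Sum>M<G. 1) \<le> Sv" unfolding Sv_def
      using v01 power_le_one[of v] by (intro sum_mono) (simp add: le_divide_eq)
    then show ?thesis by simp
  qed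
  have der: "((\<lambda>b. H b - E * b) has_real_derivative
      (\<Sum>m\<in>{a..<a+w}. \<Sum>M<G. 1 / v ^ M * slots.path_deriv n h (1/2 - b) (occupancy h b0 b) (4 * real (Suc h) * b * occupancy h b0 b) m M) - E) (at b)"
    if "0 \<le> b" "b \<le> b0" for b
  proof -
    have "(H has_real_derivative
      (\<Sum>m\<in>{a..<a+w}. \<Sum>M<G. 1 / v ^ M * slots.path_deriv n h (1/2 - b) (occupancy h b0 b) (4 * real (Suc h) * b * occupancy h b0 b) m M)) (at b)"
      unfolding H_def by (intro DERIV_sum DERIV_cmult path_unsat_has_derivative sl that) (use that b0 in auto)
    from DERIV_diff[OF this DERIV_cmult[OF DERIV_ident, of E]] show ?thesis by simp
  qed
  have "H b0 - E * b0 \<le> H 0 - E * 0"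
  proof (rule DERIV_nonpos_imp_nonincreasing[OF b0(1)])
    fix b assume bb: "0 \<le> b" "b \<le> b0"
    interpret slots n h "1/2 - b" "occupancy h b0 b" by (rule sl[OF bb])
    have "(\<Sum>m\<in>{a..<a+w}. \<Sum>M<G. 1 / slots.avoid_prob n h ^ M * path_deriv (4 * real (Suc h) * b * occupancy h b0 b) m M)
      \<le> A * real (Suc h) * (real n * frozen_bound n h \<eta>1 L a w + 6 * real h * real G * real G * short_bound n h \<eta>1 \<eta>2 L G a w)
      + 4 * real h * real G * real G * short_bound n h \<eta>1 \<eta>2 L G a w"
      by (rule path_deriv_total[where b=b]) (use bb b0 t2[OF bb] \<eta> vG A G1 in \<open>auto simp: avoid_prob_def\<close>)
    then have "(\<Sum>m\<in>{a..<a+w}. \<Sum>M<G. 1 / v ^ M * path_deriv (4 * real (Suc h) * b * occupancy h b0 b) m M) - E \<le> 0"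
      by (simp only: avoid_prob CK E_def)
    then show "\<exists>y. ((\<lambda>b. H b - E * b) has_real_derivative y) (at b) \<and> y \<le> 0"
      using der[OF bb] by blast
  qed
  then have Hcmp: "H b0 \<le> H 0 + E * b0" by simp
  \<comment> \<open>At the biased end every slot is occupied, so dropping the extra short clauses only helps.\<close>
  have Hb: "real w * Sv * US (Suc h) (1/2 - b0) n (Suc a) \<le> H b0"
  proof -
    interpret slots n h "1/2 - b0" "occupancy h b0 b0" by (rule sl) (use b0 in auto)
    have ge: "US (Suc h) (1/2 - b0) n (Suc a) \<le> path_unsat n h b0 m M b0" if m: "m \<in> {a..<a+w}" for m M
    proof -
      have "US (Suc h) (1/2 - b0) n (Suc a) = (OS ^^ Suc a) uind {}"
        unfolding US_def slots_global
        by (subst slot_weight_op_insensitive) (simp_all add: occupancy_def)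
      also have "\<dots> \<le> (OS ^^ Suc m) uind {}"
        by (rule Op_pow_incr) (use m sum_sw uind_mono in auto)
      also have "\<dots> \<le> (OS ^^ Suc m) ((OD ^^ M) uind) {}"
      proof (rule Op_pow_mono)
        show "uind Y \<le> (OD ^^ M) uind Y" for Y
          using Op_pow_incr[of DI dw uind 0 M "\<lambda>c. c" Y] sum_dw uind_mono by auto
      qed auto
      also have "\<dots> = path_unsat n h b0 m M b0" by (rule path_unsat_eq_slots[OF sl, symmetric]) (use b0 in auto)
      finally show ?thesis .
    qed
    have "real w * Sv * US (Suc h) (1/2 - b0) n (Suc a) = (\<Sum>m\<in>{a..<a+w}. \<Sum>M<G. 1 / v ^ M * US (Suc h) (1/2 - b0) n (Suc a))"
      by (simp add: Sv_def sum_distrib_right sum_distrib_left)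
    also have "\<dots> \<le> H b0" unfolding H_def using v01 by (intro sum_mono mult_left_mono ge) auto
    finally show ?thesis .
  qed
  \<comment> \<open>At the unbiased end the short clauses are removed one by one; each removal costs
    a short pivot, whose window sum is at most \<open>K\<close>.\<close>
  have H0: "H 0 \<le> Sv * (real w * (Op (slot_clauses n (Suc h)) (slot_weight n (Suc h) (1/2) (exp (- (2 * real (Suc h) * b0\<^sup>2)))) (\<lambda>c. c) ^^ (a + w)) uind {} + real G * K)"
  proof -
    interpret slots n h "1/2 - 0" "occupancy h b0 0" by (rule sl) (use b0 in auto)
    let ?T = "(OS ^^ (a + w)) uind {}"
    have up: "path_unsat n h b0 m M 0 \<le> ?T + (\<Sum>M'<G. short_mean M' (Suc m))" if m: "m \<in> {a..<a+w}" and M: "M < G" for m M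
    proof -
      have "path_unsat n h b0 m M 0 = (OS ^^ Suc m) ((OD ^^ M) uind) {}" by (rule path_unsat_eq_slots[OF sl]) (use b0 in auto)
      also have "\<dots> = (OS ^^ Suc m) uind {} + (\<Sum>M'<M. short_mean M' (Suc m))"
      proof -
        have "(OD ^^ M) uind Y = uind Y + (\<Sum>M'<M. 1 * (OD ^^ M') short_pivot Y)" for Y
        proof -
          have "(\<Sum>M'<M. (OD ^^ M') short_pivot Y) = (\<Sum>M'<M. (OD ^^ Suc M') uind Y - (OD ^^ M') uind Y)"
            by (intro sum.cong refl) (simp only: Op_pow_telescope[OF sum_dw] short_pivot_def[abs_def])
          then show ?thesis using sum_lessThan_telescope[of "\<lambda>M. (OD ^^ M) uind Y" M] by simp
        qed
        then have "(OD ^^ M) uind = (\<lambda>Y. uind Y + (\<Sum>M'<M. 1 * (OD ^^ M') short_pivot Y))" by (simp add: fun_eq_iff)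
        then show ?thesis unfolding short_mean_def by (simp only: Op_pow_add_fun Op_pow_sum) simp
      qed
      also have "\<dots> \<le> ?T + (\<Sum>M'<G. short_mean M' (Suc m))"
      proof (intro add_mono)
        show "(OS ^^ Suc m) uind {} \<le> ?T"
          by (rule Op_pow_incr[OF sw_nonneg sum_sw uind_mono]) (use m in auto)
        show "(\<Sum>M'<M. short_mean M' (Suc m)) \<le> (\<Sum>M'<G. short_mean M' (Suc m))"
          using M short_mean_nonneg by (intro sum_mono2) auto
      qed
      finally show ?thesis .
    qed
    have "H 0 \<le> (\<Sum>m\<in>{a..<a+w}. \<Sum>M<G. 1 / v ^ M * (?T + (\<Sum>M'<G. short_mean M' (Suc m))))"
      unfolding H_def using v01 by (intro sum_mono mult_left_mono up) auto
    also have "\<dots> = Sv * (\<Sum>m\<in>{a..<a+w}. ?T + (\<Sum>M'<G. short_mean M' (Suc m)))"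
      unfolding Sv_def sum_distrib_right[symmetric] sum_distrib_left[symmetric] ..
    also have "(\<Sum>m\<in>{a..<a+w}. ?T + (\<Sum>M'<G. short_mean M' (Suc m))) = real w * ?T + (\<Sum>M'<G. \<Sum>m\<in>{a..<a+w}. short_mean M' (Suc m))"
      by (simp only: sum.distrib sum.swap[of "\<lambda>m M'. short_mean M' (Suc m)"]) simp
    also have "(\<Sum>M'<G. \<Sum>m\<in>{a..<a+w}. short_mean M' (Suc m)) \<le> (\<Sum>M'<G. K)"
    proof (intro sum_mono)
      fix M' assume M': "M' \<in> {..<G}"
      have "(\<Sum>m\<in>{a..<a+w}. short_mean M' (Suc m)) = (\<Sum>m\<in>{Suc a..<Suc a+w}. short_mean M' m)"
        using sum.shift_bounds_Suc_ivl[of "short_mean M'" a "a + w"] by simp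
      also have "\<dots> \<le> short_bound n h \<eta>1 \<eta>2 L G a w"
        by (rule short_mean_bound) (use b0 t2[of 0] \<eta> vG M' in \<open>auto simp: avoid_prob_def\<close>)
      finally show "(\<Sum>m\<in>{a..<a+w}. short_mean M' (Suc m)) \<le> K" by (simp only: CK)
    qed
    finally have "H 0 \<le> Sv * (real w * ?T + real G * K)"
      using Sv by (simp add: mult_left_mono)
    then show ?thesis unfolding slots_global by (simp add: occupancy_def)
  qed
  have E0: "0 \<le> E"
  proof -
    have "0 \<le> C" unfolding C_def frozen_bound_def using \<eta> by (intro add_nonneg_nonneg mult_nonneg_nonneg divide_nonneg_nonneg) auto
    then have "0 \<le> K" unfolding K_def short_bound_def C_def[symmetric] using \<eta> by (intro add_nonneg_nonneg mult_nonneg_nonneg divide_nonneg_nonneg) auto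
    then show ?thesis unfolding E_def using A \<open>0 \<le> C\<close> by (intro add_nonneg_nonneg mult_nonneg_nonneg) auto
  qed
  let ?T = "(Op (slot_clauses n (Suc h)) (slot_weight n (Suc h) (1/2) (exp (- (2 * real (Suc h) * b0\<^sup>2)))) (\<lambda>c. c) ^^ (a + w)) uind {}"
  have Sv0: "0 < Sv" using Sv G1 by linarith
  have "real w * Sv * US (Suc h) (1/2 - b0) n (Suc a) \<le> Sv * (real w * ?T + real G * K) + E * b0"
    using Hb Hcmp H0 by linarith
  also have "E * b0 \<le> E" using E0 b0 mult_left_mono[of b0 1 E] by simp
  also have "E \<le> Sv * (E / real G)" using Sv E0 G1 mult_right_mono[of "real G" Sv "E / real G"] by simp
  finally have "Sv * (real w * US (Suc h) (1/2 - b0) n (Suc a)) \<le> Sv * (real w * ?T + real G * K + E / real G)"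
    by (simp add: algebra_simps)
  then have "real w * US (Suc h) (1/2 - b0) n (Suc a) \<le> real w * ?T + real G * K + E / real G"
    using Sv0 by simp
  then have "US (Suc h) (1/2 - b0) n (Suc a) \<le> (real w * ?T + real G * K + E / real G) / real w"
    using w1 by (simp add: le_divide_eq mult.commute)
  also have "\<dots> = ?T + real G * K / real w + E / (real G * real w)"
    using w1 G1 by (simp add: add_divide_distrib)
  finally show ?thesis unfolding E_def .
qed

section \<open>From thinned slots to a fixed number of clauses\<close>

lemma US_0 [simp]: "US k p n 0 = 0"
  by (simp add: US_def uind_def unsat_def)

lemma US_bounds:
  assumes "k \<le> n" "0 \<le> p" "p \<le> 1"
  shows "0 \<le> US k p n m" "US k p n m \<le> 1"
  unfolding US_def COp_def
  by (rule Op_pow_nonneg Op_pow_le_const, simp_all add: cw_nonneg sum_cw assms)+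

lemma US_mono:
  assumes "k \<le> n" "0 \<le> p" "p \<le> 1" "m \<le> j"
  shows "US k p n m \<le> US k p n j"
  unfolding US_def COp_def
  by (rule Op_pow_incr) (simp_all add: cw_nonneg sum_cw assms uind_mono)

text \<open>The number of occupied slots is binomial: either it is at most \<open>J\<close>, or the
  exponential Markov inequality with base \<open>z\<close> applies. The induction reveals the slots
  and lets \<open>j\<close> count the clauses already present.\<close>

lemma thinned_slots_le:
  assumes kn: "k \<le> n" and p: "0 \<le> p" "p \<le> 1" and t: "0 \<le> t" "t \<le> 1" and z: "1 \<le> z"
  shows "(Op (slot_clauses n k) (slot_weight n k p t) (\<lambda>c. c) ^^ m) uind {} \<le> US k p n J + (1 - t + t * z) ^ m / z ^ J"
proof -
  let ?O = "Op (slot_clauses n k) (slot_weight n k p t) (\<lambda>c. c)"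
  have U: "UNIV \<notin> CL {..<n} k" using not_UNIV_CL by blast
  have split: "?O f = (\<lambda>X. (1 - t) * f (insert UNIV X) + t * COp n k p f X)" for f
    unfolding COp_def Op_def fun_eq_iff using U
    by (auto simp: slot_weight_def sum_distrib_left mult.assoc not_UNIV_CL intro!: sum.cong)
  \<comment> \<open>Inserting the tautology is itself an insertion operator with a single outcome,
    so it commutes with drawing clauses.\<close>
  have ins: "(COp n k p ^^ j) uind (insert UNIV X) = (COp n k p ^^ j) uind X" for j X
  proof -
    have I: "Op {UNIV :: clause} (\<lambda>_. 1) (\<lambda>c. c) f = (\<lambda>X. f (insert UNIV X))" for f
      by (simp add: Op_def fun_eq_iff)
    have "(COp n k p ^^ j) (\<lambda>X. uind (insert UNIV X)) = (\<lambda>X. (COp n k p ^^ j) uind (insert UNIV X))"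
      using Op_pow_commute1[where I="CL {..<n} k" and w="cw n k p" and c="\<lambda>c. c" and m=j
          and J="{UNIV :: clause}" and v="\<lambda>_. 1" and d="\<lambda>c. c" and f=uind] unfolding I COp_def .
    then show ?thesis unfolding uind_insert_UNIV by (simp add: fun_eq_iff)
  qed
  have "(?O ^^ m) ((COp n k p ^^ j) uind) {} \<le> US k p n J + z ^ j * (1 - t + t * z) ^ m / z ^ J" for j
  proof (induction m arbitrary: j)
    case 0
    show ?case
    proof (cases "j \<le> J")
      case True
      then show ?thesis using US_mono[OF kn p True] z by (simp add: US_def add_increasing2)
    next
      case False
      then have "z ^ J \<le> z ^ j" using z by (intro power_increasing) auto
      then have "1 \<le> z ^ j / z ^ J" using z by simp
      then show ?thesis using US_bounds[OF kn p, of j] US_bounds[OF kn p, of J]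
        by (simp add: US_def[of k p n j])
    qed
  next
    case (Suc m)
    let ?f = "(COp n k p ^^ j) uind" and ?g = "(COp n k p ^^ Suc j) uind"
    have "?O ?f = (\<lambda>X. (1 - t) * ?f X + t * ?g X)"
      unfolding split ins by simp
    then have "(?O ^^ Suc m) ?f {} = (1 - t) * (?O ^^ m) ?f {} + t * (?O ^^ m) ?g {}"
      unfolding Op_pow_Suc' by (simp only: Op_pow_add_fun Op_pow_cmult)
    also have "\<dots> \<le> (1 - t) * (US k p n J + z ^ j * (1 - t + t * z) ^ m / z ^ J)
        + t * (US k p n J + z ^ Suc j * (1 - t + t * z) ^ m / z ^ J)"
      by (intro add_mono mult_left_mono Suc.IH) (use t in auto)
    also have "\<dots> = US k p n J + z ^ j * (1 - t + t * z) ^ Suc m / z ^ J"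
    proof -
      have "(1 - t) * (u + x * y / e) + t * (u + z * x * y / e) = u + x * ((1 - t + t * z) * y) / e" for u x y e :: real
        by (cases "e = 0") (simp_all add: field_simps)
      then show ?thesis by (simp add: mult.assoc)
    qed
    finally show ?case .
  qed
  from this[of 0] show ?thesis by simp
qed

text \<open>Combines \<open>1 + t * s \<le> exp (t * s)\<close> with
  \<open>ln (1 + s) \<ge> s - s^2\<close>; \<open>D\<close> is the excess of \<open>J\<close> over
  the mean number of occupied slots.\<close>

lemma chernoff_exponent:
  fixes t M J s :: real
  assumes "0 \<le> t" "t \<le> 1" "0 \<le> s" "s \<le> 1" "real J' = J" "real M' = M" "t * M + D \<le> J"
  shows "(1 - t + t * (1 + s)) ^ M' / (1 + s) ^ J' \<le> exp (s\<^sup>2 * J - s * D)"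
proof -
  have "(1 - t + t * (1 + s)) ^ M' = (1 + t * s) ^ M'" by (simp add: algebra_simps)
  also have "\<dots> \<le> exp (t * s) ^ M'" using assms by (intro power_mono exp_ge_add_one_self) auto
  also have "\<dots> = exp (s * (t * M))" using assms by (simp add: exp_of_nat_mult[symmetric] mult_ac)
  finally have 1: "(1 - t + t * (1 + s)) ^ M' \<le> exp (s * (t * M))" .
  have "exp (s - s\<^sup>2) \<le> 1 + s" using exp_bound[of s] assms
  proof -
    have "s - s\<^sup>2 \<le> ln (1 + s)" using ln_one_plus_pos_lower_bound[of s] assms by simp
    then have "exp (s - s\<^sup>2) \<le> exp (ln (1 + s))" by simp
    then show ?thesis using assms by simp
  qed
  then have "exp (s - s\<^sup>2) ^ J' \<le> (1 + s) ^ J'" by (intro power_mono) auto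
  then have 2: "exp (J * (s - s\<^sup>2)) \<le> (1 + s) ^ J'" using assms by (simp add: exp_of_nat_mult[symmetric])
  have "(1 - t + t * (1 + s)) ^ M' / (1 + s) ^ J' \<le> exp (s * (t * M)) / exp (J * (s - s\<^sup>2))"
    using 1 2 assms by (intro frac_le) auto
  also have "\<dots> = exp (s * (t * M - J) + s\<^sup>2 * J)" by (simp add: exp_diff[symmetric] algebra_simps)
  also have "s * (t * M - J) \<le> s * (- D)" using assms by (intro mult_left_mono) auto
  finally show ?thesis by (simp add: algebra_simps)
qed

text \<open>Orders in \<open>x = n^(1/20)\<close>: the window has length \<open>x^20\<close>,
  \<open>G\<close> is \<open>x^12\<close>, \<open>L\<close> is \<open>x\<close>, and the two
  interpolation parameters are \<open>x^(-9)\<close> and \<open>x^(-6)\<close>. Then the window sums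
  are \<open>C = O(x^11)\<close> and \<open>K = O(x^6)\<close>, so \<open>n * C / (G * w')\<close>
  is \<open>O(1 / x)\<close> and \<open>G * K / w'\<close> is \<open>O(1 / x^2)\<close>. Thus
  \<open>G\<close> is above the order of \<open>C\<close> and far below that of
  \<open>w' / K\<close>.\<close>

lemma window_error:
  fixes x \<delta> W e0 A w :: real and n h a w' L G :: nat
  assumes x: "1 \<le> x" "real n = x ^ 20" and w: "\<delta> * real n \<le> real w'" "real w' \<le> W * real n" "0 < \<delta>"
    and G: "x ^ 12 \<le> real G" "real G \<le> 2 * x ^ 12" and L: "real L \<le> 2 * x" "x ^ 9 \<le> 2 ^ L"
    and e0: "(1 + real (Suc h) / real n) ^ (a + w' + 1) \<le> e0" and A: "0 \<le> A"
  defines "c1 \<equiv> W * (1/2 + e0) + 16"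
  defines "c2 \<equiv> 2 * c1 + 4 * W * real h + 2 * 8 ^ Suc h + W * (2 * real (Suc h)) ^ Suc h"
  defines "C \<equiv> frozen_bound n h (1 / x ^ 9) L a w'" and "K \<equiv> short_bound n h (1 / x ^ 9) (1 / x ^ 6) L G a w'"
  shows "real G * K / real w'
      + (A * real (Suc h) * (real n * C + 6 * real h * real G * real G * K) + 4 * real h * real G * real G * K) / (real G * real w')
    \<le> (2 * c2 / \<delta> + (A * real (Suc h) * (c1 + 12 * real h * c2) + 8 * real h * c2) / \<delta>) / x"
proof -
  have xp: "0 < x ^ i" for i using x by simp
  have xm: "x ^ i \<le> x ^ j" if "i \<le> j" for i j using x that by (intro power_increasing) auto
  have n0: "0 < real n" using x by simp
  have w0: "0 < real w'" using w n0 by (smt (verit) mult_pos_pos)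
  have W0: "0 < W" using w0 w(2) n0 by (smt (verit) mult_nonpos_nonneg)
  have e00: "0 < e0"
    by (rule less_le_trans[OF _ e0]) (use n0 in \<open>simp add: add_pos_nonneg\<close>)
  have c1: "0 < c1" unfolding c1_def using W0 e00 by (simp add: add_pos_pos)
  have c2: "0 < c2" unfolding c2_def using c1 W0 by (intro add_pos_nonneg) auto
  have C0: "0 \<le> C" unfolding C_def frozen_bound_def using n0 x by simp
  have C: "C \<le> c1 * x ^ 11"
  proof -
    have "(1 + real (Suc h) / real n) ^ (a + w' + 1) / 2 ^ L \<le> e0 / x ^ 9"
      using e0 e00 L x by (intro frac_le) auto
    then have "real w' * (1 / x ^ 9 / 2 + (1 + real (Suc h) / real n) ^ (a + w' + 1) / 2 ^ L)
      \<le> (W * x ^ 20) * (1 / x ^ 9 / 2 + e0 / x ^ 9)"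
      using w x W0 n0 e00 by (intro mult_mono add_mono) auto
    also have "\<dots> = W * (1/2 + e0) * (x ^ 20 / x ^ 9)" by (simp add: algebra_simps add_divide_distrib)
    also have "x ^ 20 / x ^ 9 = x ^ 11" using x by (simp add: power_diff[symmetric])
    finally have 1: "real w' * (1 / x ^ 9 / 2 + (1 + real (Suc h) / real n) ^ (a + w' + 1) / 2 ^ L) \<le> W * (1/2 + e0) * x ^ 11" .
    have "8 * real L * x ^ 9 \<le> 8 * (2 * x) * x ^ 9" using L x by (intro mult_right_mono mult_left_mono) auto
    also have "\<dots> = 16 * x ^ 10" by (simp add: power_Suc[symmetric] del: power_Suc)
    also have "\<dots> \<le> 16 * x ^ 11" using xm[of 10 11] by simp
    finally have "8 * real L / (1 / x ^ 9) \<le> 16 * x ^ 11" by simp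
    with 1 show ?thesis unfolding C_def frozen_bound_def c1_def by (simp add: distrib_right)
  qed
  have K: "K \<le> c2 * x ^ 6"
  proof -
    have "real w' * (real G * real h / real n) \<le> (W * real n) * ((2 * x ^ 12) * real h / real n)"
      using w G W0 n0 by (intro mult_mono divide_right_mono) auto
    also have "\<dots> = 2 * W * real h * x ^ 12" using n0 by simp
    finally have 1: "2 * C + 2 * real w' * (real G * real h / real n) \<le> 2 * (c1 * x ^ 11) + 4 * W * real h * x ^ 12"
      using C by simp
    also have "\<dots> \<le> (2 * c1 + 4 * W * real h) * x ^ 12"
      using xm[of 11 12] c1 mult_left_mono[of "x^11" "x^12" "2 * c1"] by (simp add: distrib_right)
    finally have "1 / x ^ 6 * (2 * C + 2 * real w' * (real G * real h / real n)) \<le> 1 / x ^ 6 * ((2 * c1 + 4 * W * real h) * x ^ 12)"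
      using x by (intro mult_left_mono) auto
    also have "\<dots> = (2 * c1 + 4 * W * real h) * (x ^ 12 / x ^ 6)" by simp
    also have "x ^ 12 / x ^ 6 = x ^ 6" using x by (simp add: power_diff[symmetric])
    finally have 2: "1 / x ^ 6 * (2 * C + 2 * real w' * (real G * real h / real n)) \<le> (2 * c1 + 4 * W * real h) * x ^ 6" .
    have "real w' * ((2 * real (Suc h)) ^ Suc h / real n) \<le> (W * real n) * ((2 * real (Suc h)) ^ Suc h / real n)"
      using w by (intro mult_right_mono) auto
    also have "\<dots> = W * (2 * real (Suc h)) ^ Suc h" using n0 by simp
    finally have "1 / (1 / x ^ 6) * (2 * 8 ^ Suc h + real w' * ((2 * real (Suc h)) ^ Suc h / real n))
      \<le> x ^ 6 * (2 * 8 ^ Suc h + W * (2 * real (Suc h)) ^ Suc h)"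
      using x by (simp add: mult_left_mono)
    with 2 show ?thesis unfolding K_def short_bound_def C_def[symmetric] c2_def
      by (simp only: distrib_right mult.commute[of "x ^ 6"])
  qed
  have K0: "0 \<le> K" unfolding K_def short_bound_def C_def[symmetric] using C0 x by simp
  have G0: "0 < real G" using G xp[of 12] by linarith
  have wl: "\<delta> * x ^ 20 \<le> real w'" using w x by simp
  have s1: "real G * K / real w' \<le> 2 * c2 / \<delta> / x"
  proof -
    have "real G * K / real w' \<le> (2 * x ^ 12) * (c2 * x ^ 6) / (\<delta> * x ^ 20)"
      using G K K0 wl w x by (intro frac_le mult_mono) auto
    also have "\<dots> = 2 * c2 / \<delta> * (x ^ 18 / x ^ 20)" by (simp add: power_add[symmetric])
    also have "\<dots> \<le> 2 * c2 / \<delta> * (1 / x)"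
    proof (rule mult_left_mono)
      have "x ^ 18 * x \<le> x ^ 20" using xm[of 19 20] by (simp add: power_Suc2[symmetric] del: power_Suc)
      then show "x ^ 18 / x ^ 20 \<le> 1 / x" using x by (simp add: divide_le_eq le_divide_eq)
    qed (use c2 w in auto)
    finally show ?thesis by simp
  qed
  have s2: "real n * C / (real G * real w') \<le> c1 / \<delta> / x"
  proof -
    have "real n * C / (real G * real w') \<le> x ^ 20 * (c1 * x ^ 11) / (x ^ 12 * (\<delta> * x ^ 20))"
      using x(2) x(1) C C0 G0 G wl w by (intro frac_le mult_mono) auto
    also have "\<dots> = c1 / \<delta> * (x ^ 11 / x ^ 12)" using x by simp
    also have "x ^ 11 / x ^ 12 = 1 / x" using x by (simp add: divide_simps power_Suc2[symmetric] del: power_Suc)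
    finally show ?thesis by simp
  qed
  have "(A * real (Suc h) * (real n * C + 6 * real h * real G * real G * K) + 4 * real h * real G * real G * K) / (real G * real w')
    = A * real (Suc h) * (real n * C / (real G * real w') + 6 * real h * (real G * K / real w')) + 4 * real h * (real G * K / real w')"
    using G0 w0 by (simp add: field_simps)
  also have "\<dots> \<le> A * real (Suc h) * (c1 / \<delta> / x + 6 * real h * (2 * c2 / \<delta> / x)) + 4 * real h * (2 * c2 / \<delta> / x)"
    using s1 s2 A by (intro add_mono mult_left_mono) auto
  also have "\<dots> = (A * real (Suc h) * (c1 + 12 * real h * c2) + 8 * real h * c2) / \<delta> / x"
  proof -
    have "B * (c1 / \<delta> / x + 6 * h' * (2 * c2 / \<delta> / x)) + 4 * h' * (2 * c2 / \<delta> / x) = (B * (c1 + 12 * h' * c2) + 8 * h' * c2) / \<delta> / x" for B h' :: real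
      using x w by (simp add: field_simps)
    then show ?thesis .
  qed
  finally show ?thesis using s1 by (simp add: add_divide_distrib)
qed

lemma biased_unsat_le:
  fixes h :: nat and b \<delta> A :: real
  assumes h: "2 \<le> h" and b: "0 \<le> b" "b \<le> 1/4" "1/2 \<le> exp (- (2 * real (Suc h) * b\<^sup>2))" and \<delta>: "0 < \<delta>" and A: "0 \<le> A"
  shows "\<forall>\<^sub>F n in sequentially. \<forall>m j. real m \<le> A * real n \<longrightarrow>
    exp (- (2 * real (Suc h) * b\<^sup>2)) * real m + \<delta> * real n \<le> real j \<longrightarrow>
    US (Suc h) (1/2 - b) n m \<le> US (Suc h) (1/2) n j + \<delta>"
proof -
  define t where "t = exp (- (2 * real (Suc h) * b\<^sup>2))"
  have t: "0 \<le> t" "t \<le> 1" by (auto simp: t_def)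
  \<comment> \<open>One quarter of the slack is the length of the window; the other three absorb the
    fluctuation of the number of occupied slots.\<close>
  define d where "d = \<delta> / 4"
  define A' where "A' = A + d"
  define e0 where "e0 = exp (real (Suc h) * (A' + 1))"
  define W where "W = d + 1"
  define c1 where "c1 = W * (1/2 + e0) + 16"
  define c2 where "c2 = 2 * c1 + 4 * W * real h + 2 * 8 ^ Suc h + W * (2 * real (Suc h)) ^ Suc h"
  define c3 where "c3 = 2 * c2 / d + (A' * real (Suc h) * (c1 + 12 * real h * c2) + 8 * real h * c2) / d"
  \<comment> \<open>Chosen so that \<open>s * J \<le> d * n\<close>; the quadratic loss then uses
    one third of the linear gain \<open>3 * s * d * n\<close>.\<close>
  define s where "s = d / (A + \<delta> + 1)"
  have d: "0 < d" "0 \<le> A'" using \<delta> A by (auto simp: d_def A'_def)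
  have s: "0 < s" "s \<le> 1" using d \<delta> A by (auto simp: s_def d_def)
  have lim_x: "filterlim (\<lambda>n::nat. real n powr (1/20)) at_top sequentially" by real_asymp
  have lim_e: "((\<lambda>n::nat. exp (- (2 * s * d) * real n)) \<longlongrightarrow> 0) sequentially"
    using s(1) d(1) by real_asymp
  have ev1: "\<forall>\<^sub>F n::nat in sequentially. (real n powr (1/20)) ^ 9 \<le> 2 powr (real n powr (1/20))" by real_asymp
  have ev2: "\<forall>\<^sub>F n::nat in sequentially. max (max 1 (10 * real h)) (2 * c3 / \<delta>) \<le> real n powr (1/20)"
    using lim_x unfolding filterlim_at_top by blast
  have ev3: "\<forall>\<^sub>F n::nat in sequentially. exp (- (2 * s * d) * real n) < \<delta> / 2"
    by (rule order_tendstoD(2)[OF lim_e]) (use \<delta> in simp)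
  show ?thesis unfolding t_def[symmetric]
    using ev1 ev2 ev3 eventually_ge_at_top[of "h + 2"]
  proof eventually_elim
    case (elim n)
    define x where "x = real n powr (1/20)"
    have x: "1 \<le> x" "10 * real h \<le> x" "2 * c3 / \<delta> \<le> x" "x ^ 9 \<le> 2 powr x" using elim by (auto simp: x_def)
    have n: "h + 2 \<le> n" "1 \<le> real n" using elim by auto
    have xn: "real n = x ^ 20" unfolding x_def using n by (simp add: powr_realpow[symmetric] powr_powr)
    have xm: "x ^ i \<le> x ^ j" if "i \<le> j" for i j using x that by (intro power_increasing) auto
    define L where "L = nat \<lceil>x\<rceil>"
    define G where "G = nat \<lceil>x ^ 12\<rceil>"
    define w where "w = nat \<lceil>d * real n\<rceil>"
    have L: "x \<le> real L" "real L \<le> 2 * x" using x unfolding L_def by linarith+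
    have x12: "1 \<le> x ^ 12" using x by simp
    have G: "x ^ 12 \<le> real G" "real G \<le> 2 * x ^ 12" using x12 unfolding G_def by linarith+
    have dn: "0 < d * real n" using d n by simp
    have w: "d * real n \<le> real w" "real w \<le> d * real n + 1" using dn unfolding w_def by linarith+
    have wW: "real w \<le> W * real n" using w n by (simp add: W_def distrib_right)
    have L2: "x ^ 9 \<le> 2 ^ L"
    proof -
      have "2 powr x \<le> 2 powr real L" using L by simp
      then show ?thesis using x by (simp add: powr_realpow)
    qed
    \<comment> \<open>Bernoulli's inequality: the number of short clauses is of order
      \<open>x^12\<close> only, while each contains a given variable with probability
      \<open>h / x^20\<close>.\<close>
    have vG: "1/2 \<le> ((real n - real h) / real n) ^ (G + L + 1)"
    proof -
      have "real (G + L + 1) \<le> 5 * x ^ 12" using G L x12 xm[of 1 12] by simp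
      then have "real (G + L + 1) * real h \<le> 5 * x ^ 12 * (x / 10)" using x by (intro mult_mono) auto
      also have "\<dots> \<le> x ^ 20 / 2" using xm[of 13 20] by (simp add: power_Suc[symmetric] del: power_Suc)
      finally have "real (G + L + 1) * (real h / real n) \<le> 1/2" using xn n by (simp add: divide_le_eq)
      moreover have "1 - real (G + L + 1) * (real h / real n) \<le> (1 - real h / real n) ^ (G + L + 1)"
        using Bernoulli_inequality[of "- (real h / real n)" "G + L + 1"] n by simp
      moreover have "((real n - real h) / real n) ^ (G + L + 1) = (1 - real h / real n) ^ (G + L + 1)"
        using n by (simp add: diff_divide_distrib)
      ultimately show ?thesis by linarith
    qed
    have pp: "0 \<le> 1/2 - b" "1/2 - b \<le> (1::real)" using b by auto
    show ?case
    proof (intro allI impI)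
      fix m j assume m: "real m \<le> A * real n" and j: "t * real m + \<delta> * real n \<le> real j"
      show "US (Suc h) (1/2 - b) n m \<le> US (Suc h) (1/2) n j + \<delta>"
      proof (cases m)
        case 0
        then show ?thesis using US_bounds[of "Suc h" n "1/2" j] n \<delta> by simp
      next
        case (Suc a)
        have aw: "real (a + w) \<le> A' * real n" using m w Suc by (simp add: A'_def distrib_right)
        have e0: "(1 + real (Suc h) / real n) ^ (a + w + 1) \<le> e0"
        proof -
          have "(1 + real (Suc h) / real n) ^ (a + w + 1) \<le> exp (real (Suc h) / real n) ^ (a + w + 1)"
            using n by (intro power_mono exp_ge_add_one_self) auto
          also have "\<dots> = exp (real (a + w + 1) * (real (Suc h) / real n))" by (rule exp_of_nat_mult[symmetric])
          also have "\<dots> \<le> e0" unfolding e0_def exp_le_cancel_iff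
          proof -
            have "real (a + w + 1) \<le> (A' + 1) * real n" using aw n by (simp add: distrib_right)
            then have "real (a + w + 1) * (real (Suc h) / real n) \<le> (A' + 1) * real n * (real (Suc h) / real n)"
              by (rule mult_right_mono) simp
            then show "real (a + w + 1) * (real (Suc h) / real n) \<le> real (Suc h) * (A' + 1)"
              using n by (simp add: mult.commute)
          qed
          finally show ?thesis .
        qed
        \<comment> \<open>\<open>j\<close> may be arbitrarily large; the least admissible value
          \<open>J\<close> is linear in \<open>n\<close>, as the quadratic term of the tail bound
          requires.\<close>
        define J where "J = nat \<lceil>t * real m + \<delta> * real n\<rceil>"
        have tm: "0 \<le> t * real m + \<delta> * real n" using t \<delta> by simp
        have J: "t * real m + \<delta> * real n \<le> real J" "real J \<le> t * real m + \<delta> * real n + 1" "J \<le> j"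
          using tm j unfolding J_def by linarith+
        have "t * real m \<le> A * real n" using m t mult_right_mono[of t 1 "real m"] by simp
        then have JA: "real J \<le> (A + \<delta> + 1) * real n" using J n by (simp add: distrib_right)
        have "t * real (a + w) \<le> t * real m + d * real n"
        proof -
          have "t * real (a + w) \<le> t * (real m + d * real n)" using w Suc t by (intro mult_left_mono) auto
          also have "\<dots> \<le> t * real m + d * real n" using t dn mult_right_mono[of t 1 "d * real n"] by (simp add: distrib_left)
          finally show ?thesis .
        qed
        then have JD: "t * real (a + w) + 3 * d * real n \<le> real J" using J by (simp add: d_def)
        have "US (Suc h) (1/2 - b) n m \<le> (Op (slot_clauses n (Suc h)) (slot_weight n (Suc h) (1/2) t) (\<lambda>c. c) ^^ (a + w)) uind {}
          + (real G * short_bound n h (1 / x ^ 9) (1 / x ^ 6) L G a w / real w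
          + (A' * real (Suc h) * (real n * frozen_bound n h (1 / x ^ 9) L a w + 6 * real h * real G * real G * short_bound n h (1 / x ^ 9) (1 / x ^ 6) L G a w)
            + 4 * real h * real G * real G * short_bound n h (1 / x ^ 9) (1 / x ^ 6) L G a w) / (real G * real w))"
          unfolding Suc t_def add.assoc[symmetric]
        proof (rule window_compare)
          have "1 \<le> real G" using G x12 by linarith
          then show "1 \<le> G" by simp
          have "0 < real w" using w dn by linarith
          then show "1 \<le> w" by simp
        qed (use h n b aw d x vG in auto)
        also have "\<dots> \<le> (US (Suc h) (1/2) n J + (1 - t + t * (1 + s)) ^ (a + w) / (1 + s) ^ J) + c3 / x"
          unfolding c3_def c2_def c1_def
          by (intro add_mono thinned_slots_le window_error) (use n t s x xn w wW d G L L2 e0 in auto)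
        also have "(1 - t + t * (1 + s)) ^ (a + w) / (1 + s) ^ J \<le> exp (s\<^sup>2 * real J - s * (3 * d * real n))"
          by (rule chernoff_exponent[OF t]) (use s JD in auto)
        also have "s\<^sup>2 * real J - s * (3 * d * real n) \<le> - (2 * s * d) * real n"
        proof -
          have "s * real J \<le> s * ((A + \<delta> + 1) * real n)" using JA s by (intro mult_left_mono) auto
          also have "\<dots> = d * real n" using A \<delta> by (simp add: s_def)
          finally have "s * (s * real J) \<le> s * (d * real n)" using s by (intro mult_left_mono) auto
          then show ?thesis by (simp add: power2_eq_square mult_ac)
        qed
        also have "exp (- (2 * s * d) * real n) \<le> \<delta> / 2" using elim by simp
        also have "c3 / x \<le> \<delta> / 2" using x \<delta> by (simp add: divide_le_eq mult.commute)
        also have "US (Suc h) (1/2) n J \<le> US (Suc h) (1/2) n j" by (rule US_mono) (use n J in auto)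
        finally show ?thesis by simp
      qed
    qed
  qed
qed

section \<open>Poissonization\<close>

text \<open>The expectation of \<open>f\<close> at a Poisson variable of mean
  \<open>l\<close>.\<close>

definition pt :: "(nat \<Rightarrow> real) \<Rightarrow> real \<Rightarrow> real" where
  "pt f l = exp (- l) * (\<Sum>j. f j * l ^ j / fact j)"

lemma pt_summable:
  assumes "\<And>j. \<bar>f j\<bar> \<le> B"
  shows "summable (\<lambda>j. f j * l ^ j / fact j :: real)"
proof (rule summable_comparison_test)
  show "summable (\<lambda>j. B * (\<bar>l\<bar> ^ j / fact j))"
    using summable_mult[OF summable_exp[of "\<bar>l\<bar>"], of B] by (simp add: divide_inverse mult_ac)
  show "\<exists>N. \<forall>n\<ge>N. norm (f n * l ^ n / fact n) \<le> B * (\<bar>l\<bar> ^ n / fact n)"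
    using assms by (auto simp: abs_mult power_abs intro!: mult_right_mono divide_right_mono)
qed

lemma pt_derivative:
  assumes "\<And>j. \<bar>f j\<bar> \<le> B"
  shows "(pt f has_real_derivative pt (\<lambda>j. f (Suc j) - f j) l) (at l)"
proof -
  let ?g = "\<lambda>l. \<Sum>j. f j * l ^ j / fact j"
  have B': "\<bar>f (Suc j)\<bar> \<le> B" for j using assms by simp
  have "((\<lambda>x. \<Sum>j. (f j / fact j) * x ^ j) has_real_derivative (\<Sum>j. diffs (\<lambda>j. f j / fact j) j * l ^ j)) (at l)"
    by (rule termdiffs_strong_converges_everywhere)
      (use pt_summable[where f=f, OF assms] in simp)
  moreover have "diffs (\<lambda>j. f j / fact j) = (\<lambda>j. f (Suc j) / fact j)"
    by (simp add: diffs_def fun_eq_iff del: of_nat_Suc)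
  ultimately have g: "(?g has_real_derivative (\<Sum>j. f (Suc j) * l ^ j / fact j)) (at l)" by simp
  have "(\<Sum>j. (f (Suc j) - f j) * l ^ j / fact j) = (\<Sum>j. f (Suc j) * l ^ j / fact j) - ?g l"
    using suminf_diff[OF pt_summable[where f="\<lambda>j. f (Suc j)" and l=l, OF B'] pt_summable[where f=f and l=l, OF assms]]
    by (simp add: left_diff_distrib diff_divide_distrib)
  then have "pt (\<lambda>j. f (Suc j) - f j) l = - exp (- l) * ?g l + exp (- l) * (\<Sum>j. f (Suc j) * l ^ j / fact j)"
    unfolding pt_def by (simp only: right_diff_distrib)
  then show ?thesis
    unfolding pt_def[abs_def] using DERIV_mult[OF DERIV_fun_exp[OF DERIV_minus[OF DERIV_ident]] g]
    by (simp add: mult.commute)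
qed

lemma pt_nonneg: "(\<And>j. \<bar>f j\<bar> \<le> B) \<Longrightarrow> (\<And>j. 0 \<le> f j) \<Longrightarrow> 0 \<le> l \<Longrightarrow> 0 \<le> pt f l"
  unfolding pt_def by (intro mult_nonneg_nonneg suminf_nonneg pt_summable) auto

lemma pt_pos:
  assumes "\<And>j. \<bar>f j\<bar> \<le> B" "\<And>j. 0 \<le> f j" "0 < f i" "0 < l"
  shows "0 < pt f l"
  unfolding pt_def using assms by (intro mult_pos_pos suminf_pos2[where i=i] pt_summable) auto

text \<open>The factor \<open>exp (- l)\<close> cancels in \<open>F F'' - F'\<^sup>2\<close>, so this is the log-convexity, as a function of
\<open>ln l\<close>, of a power series with nonnegative coefficients.\<close>

lemma pt_log_convex:
  assumes B: "\<And>j. \<bar>f j\<bar> \<le> B" and f0: "\<And>j. 0 \<le> f j" and l: "0 < l"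
  defines "F \<equiv> pt f l" and "F1 \<equiv> pt (\<lambda>j. f (Suc j) - f j) l"
    and "F2 \<equiv> pt (\<lambda>j. (f (Suc (Suc j)) - f (Suc j)) - (f (Suc j) - f j)) l"
  shows "0 \<le> l * (F * F2 - F1\<^sup>2) + F * (F + F1)"
proof -
  define a where "a i j = f (i + j) * l ^ j / fact j" for i j
  define S where "S i = (\<Sum>j. a i j)" for i
  have sm: "summable (a i)" for i
    unfolding a_def using pt_summable[of "\<lambda>j. f (i + j)" B l] B by simp
  have Sl: "(\<lambda>n. \<Sum>j<n. a i j) \<longlonglongrightarrow> S i" for i
    using summable_LIMSEQ[OF sm] unfolding S_def .
  have F: "F = exp (- l) * S 0" by (simp add: F_def pt_def S_def a_def)
  have F1: "F1 = exp (- l) * (S 1 - S 0)"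
    unfolding F1_def pt_def S_def suminf_diff[OF sm sm] by (simp add: a_def algebra_simps diff_divide_distrib)
  have F2: "F2 = exp (- l) * ((S 2 - S 1) - (S 1 - S 0))"
    unfolding F2_def pt_def S_def suminf_diff[OF sm sm] suminf_diff[OF summable_diff[OF sm sm] summable_diff[OF sm sm]]
    by (simp add: a_def algebra_simps diff_divide_distrib add_divide_distrib)
  have "(l * S 1)\<^sup>2 \<le> S 0 * (l\<^sup>2 * S 2 + l * S 1)"
  proof (rule LIMSEQ_le)
    \<comment> \<open>Factors \<open>j\<close> cancel against the factorial and shift the index. The
      truncation points are chosen such that the moments become exact partial sums of the shifted
      series.\<close>
    have 1: "(\<Sum>j<Suc n. real j * a 0 j) = l * (\<Sum>j<n. a 1 j)" for n
      by (subst sum.lessThan_Suc_shift) (simp add: a_def sum_distrib_left mult_ac del: sum.lessThan_Suc of_nat_Suc)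
    have 2: "(\<Sum>j<Suc (Suc n). (real j)\<^sup>2 * a 0 j) = l\<^sup>2 * (\<Sum>j<n. a 2 j) + l * (\<Sum>j<Suc n. a 1 j)" for n
    proof -
      have "(real j)\<^sup>2 = real j * (real j - 1) + real j" for j by (simp add: power2_eq_square algebra_simps)
      then have "(\<Sum>j<Suc (Suc n). (real j)\<^sup>2 * a 0 j)
          = (\<Sum>j<Suc (Suc n). real j * (real j - 1) * a 0 j) + (\<Sum>j<Suc (Suc n). real j * a 0 j)"
        by (simp only: distrib_right sum.distrib)
      also have "(\<Sum>j<Suc (Suc n). real j * (real j - 1) * a 0 j) = l\<^sup>2 * (\<Sum>j<n. a 2 j)"
      proof -
        have "real (Suc (Suc j)) * (real (Suc (Suc j)) - 1) * a 0 (Suc (Suc j)) = l\<^sup>2 * a 2 j" for j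
        proof -
          have "fact (Suc (Suc j)) = real (Suc (Suc j)) * (real (Suc (Suc j)) - 1) * fact j" by (simp add: algebra_simps)
          then show ?thesis by (simp add: a_def power2_eq_square del: fact_Suc of_nat_Suc)
        qed
        then show ?thesis
          by (subst sum.lessThan_Suc_shift, subst sum.lessThan_Suc_shift) (simp add: sum_distrib_left del: sum.lessThan_Suc)
      qed
      finally show ?thesis by (simp only: 1)
    qed
    show "(\<lambda>n. (l * (\<Sum>j<Suc n. a 1 j))\<^sup>2) \<longlonglongrightarrow> (l * S 1)\<^sup>2"
      by (intro tendsto_intros LIMSEQ_Suc[OF Sl])
    show "(\<lambda>n. (\<Sum>j<Suc (Suc n). a 0 j) * (l\<^sup>2 * (\<Sum>j<n. a 2 j) + l * (\<Sum>j<Suc n. a 1 j))) \<longlonglongrightarrow> S 0 * (l\<^sup>2 * S 2 + l * S 1)"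
      by (intro tendsto_intros LIMSEQ_Suc[OF Sl] LIMSEQ_Suc[OF LIMSEQ_Suc[OF Sl]] Sl)
    have "(l * (\<Sum>j<Suc n. a 1 j))\<^sup>2 \<le> (\<Sum>j<Suc (Suc n). a 0 j) * (l\<^sup>2 * (\<Sum>j<n. a 2 j) + l * (\<Sum>j<Suc n. a 1 j))" for n
    proof -
      have a0: "0 \<le> a 0 j" for j unfolding a_def using f0 l by simp
      \<comment> \<open>Cauchy-Schwarz for the weights \<open>a 0 j\<close> and the functions 1 and
        \<open>j\<close>.\<close>
      have "(\<Sum>j<Suc (Suc n). sqrt (a 0 j) * (real j * sqrt (a 0 j)))\<^sup>2
          \<le> (\<Sum>j<Suc (Suc n). (sqrt (a 0 j))\<^sup>2) * (\<Sum>j<Suc (Suc n). (real j * sqrt (a 0 j))\<^sup>2)"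
        by (rule Cauchy_Schwarz_ineq_sum)
      also have "(\<Sum>j<Suc (Suc n). sqrt (a 0 j) * (real j * sqrt (a 0 j))) = (\<Sum>j<Suc (Suc n). real j * a 0 j)"
      proof (intro sum.cong refl)
        fix j show "sqrt (a 0 j) * (real j * sqrt (a 0 j)) = real j * a 0 j" using a0[of j]
          by (simp add: mult.left_commute[of "sqrt (a 0 j)"])
      qed
      finally show ?thesis using a0 by (simp only: power_mult_distrib real_sqrt_pow2 1 2)
    qed
    then show "\<exists>N. \<forall>n\<ge>N. (l * (\<Sum>j<Suc n. a 1 j))\<^sup>2 \<le> (\<Sum>j<Suc (Suc n). a 0 j) * (l\<^sup>2 * (\<Sum>j<n. a 2 j) + l * (\<Sum>j<Suc n. a 1 j))" by blast
  qed
  then have "0 \<le> l * (l * (S 0 * S 2 - (S 1)\<^sup>2) + S 0 * S 1)" by (simp add: power2_eq_square algebra_simps)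
  then have "0 \<le> l * (S 0 * S 2 - (S 1)\<^sup>2) + S 0 * S 1" using l by (simp add: zero_le_mult_iff)
  then have "0 \<le> (exp (- l))\<^sup>2 * (l * (S 0 * S 2 - (S 1)\<^sup>2) + S 0 * S 1)" by simp
  also have "\<dots> = l * (F * F2 - F1\<^sup>2) + F * (F + F1)"
    unfolding F F1 F2 by (simp add: power2_eq_square algebra_simps)
  finally show ?thesis .
qed

text \<open>For positive \<open>F'\<close> the logarithmic derivative of the ratio is
  \<open>(C + 1) / l + F'' / F' - F' / F\<close>. If \<open>F' \<le> F\<close>, it suffices that
  \<open>F'' \<ge> - F'\<close>, which holds as \<open>f\<close> is nondecreasing, together with
  \<open>2 * l \<le> C + 1\<close>. If \<open>F' > F\<close>, the log-convexity in
  \<open>pt_log_convex\<close> suffices since \<open>C \<ge> 1\<close>.\<close>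

lemma pt_ratio_mono:
  fixes C :: nat
  assumes B: "\<And>j. \<bar>f j\<bar> \<le> B" and f0: "\<And>j. 0 \<le> f j" and inc: "\<And>j. f j \<le> f (Suc j)"
    and pos: "0 < f i" and C: "1 \<le> C" and lu: "0 < l" "l \<le> u" "2 * u \<le> real C + 1"
  shows "l ^ Suc C * pt (\<lambda>j. f (Suc j) - f j) l * pt f u \<le> u ^ Suc C * pt (\<lambda>j. f (Suc j) - f j) u * pt f l"
proof -
  let ?F = "pt f" and ?F1 = "pt (\<lambda>j. f (Suc j) - f j)" and ?F2 = "pt (\<lambda>j. (f (Suc (Suc j)) - f (Suc j)) - (f (Suc j) - f j))"
  have Fp: "0 < ?F t" if "0 < t" for t by (rule pt_pos[of f B]) (use assms that in auto)
  have B2: "\<bar>f (Suc j) - f j\<bar> \<le> 2 * B" for j using B[of j] B[of "Suc j"] by linarith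
  have "l ^ Suc C * ?F1 l / ?F l \<le> u ^ Suc C * ?F1 u / ?F u"
  proof (rule DERIV_nonneg_imp_nondecreasing[OF lu(2)])
    fix t assume t: "l \<le> t" "t \<le> u"
    then have t0: "0 < t" "2 * t \<le> real C + 1" using lu by auto
    have d: "((\<lambda>t. t ^ Suc C * ?F1 t / ?F t) has_real_derivative
      (((real (Suc C) * t ^ C * ?F1 t + t ^ Suc C * ?F2 t) * ?F t - t ^ Suc C * ?F1 t * ?F1 t) / (?F t * ?F t))) (at t)"
    proof (rule DERIV_cong)
      have "((\<lambda>t. t ^ Suc C) has_real_derivative real (Suc C) * t ^ C) (at t)"
        using DERIV_pow[of "Suc C" t] by simp
      from DERIV_divide[OF DERIV_mult[OF this pt_derivative[where f="\<lambda>j. f (Suc j) - f j", OF B2]] pt_derivative[where f=f, OF B]]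
      show "((\<lambda>t. t ^ Suc C * ?F1 t / ?F t) has_real_derivative
        ((real (Suc C) * t ^ C * ?F1 t + ?F2 t * t ^ Suc C) * ?F t - t ^ Suc C * ?F1 t * ?F1 t) / (?F t * ?F t)) (at t)"
        using Fp[OF t0(1)] by simp
    qed (simp add: mult.commute)
    have F1n: "0 \<le> ?F1 t" using inc t0 by (intro pt_nonneg[OF B2]) auto
    have FF: "0 \<le> ?F t * ?F1 t" using F1n Fp[OF t0(1)] by simp
    have "0 \<le> pt (\<lambda>j. f (Suc (Suc j)) - f (Suc j)) t" using inc t0 by (intro pt_nonneg[of _ "2 * B"] B2) auto
    also have "pt (\<lambda>j. f (Suc (Suc j)) - f (Suc j)) t = ?F2 t + ?F1 t"
    proof -
      have B3: "\<bar>(f (Suc (Suc j)) - f (Suc j)) - (f (Suc j) - f j)\<bar> \<le> 4 * B" for j using B2[of j] B2[of "Suc j"] by linarith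
      show ?thesis unfolding pt_def distrib_left[symmetric] suminf_add[OF pt_summable[where f="\<lambda>j. (f (Suc (Suc j)) - f (Suc j)) - (f (Suc j) - f j)" and l=t, OF B3] pt_summable[where f="\<lambda>j. f (Suc j) - f j" and l=t, OF B2]]
        by (simp add: algebra_simps add_divide_distrib diff_divide_distrib)
    qed
    finally have F2: "- ?F1 t \<le> ?F2 t" by simp
    have "0 \<le> (real C + 1) * (?F t * ?F1 t) + t * (?F t * ?F2 t - (?F1 t)\<^sup>2)"
    proof (cases "?F1 t \<le> ?F t")
      case True
      have "?F t * (- ?F1 t) \<le> ?F t * ?F2 t" using F2 Fp[OF t0(1)] by (intro mult_left_mono) auto
      moreover have "(?F1 t)\<^sup>2 \<le> ?F t * ?F1 t" using True F1n by (simp add: power2_eq_square mult_right_mono)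
      ultimately have "t * (- (2 * (?F t * ?F1 t))) \<le> t * (?F t * ?F2 t - (?F1 t)\<^sup>2)" using t0 by (intro mult_left_mono) auto
      moreover have "(2 * t) * (?F t * ?F1 t) \<le> (real C + 1) * (?F t * ?F1 t)" using FF t0 by (intro mult_right_mono) auto
      ultimately show ?thesis by simp
    next
      case False
      have "?F t * ?F t \<le> ?F t * ?F1 t" using False Fp[OF t0(1)] by (intro mult_left_mono) auto
      moreover have "0 \<le> t * (?F t * ?F2 t - (?F1 t)\<^sup>2) + ?F t * (?F t + ?F1 t)" using pt_log_convex[OF B f0 t0(1)] by simp
      moreover have "2 * (?F t * ?F1 t) \<le> (real C + 1) * (?F t * ?F1 t)" using FF C by (intro mult_right_mono) auto
      ultimately show ?thesis by (simp add: distrib_left)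
    qed
    then have "0 \<le> t ^ C * ((real C + 1) * (?F t * ?F1 t) + t * (?F t * ?F2 t - (?F1 t)\<^sup>2))" using t0 by simp
    also have "\<dots> = (real (Suc C) * t ^ C * ?F1 t + t ^ Suc C * ?F2 t) * ?F t - t ^ Suc C * ?F1 t * ?F1 t"
      by (simp add: power2_eq_square algebra_simps)
    finally show "\<exists>y. ((\<lambda>t. t ^ Suc C * ?F1 t / ?F t) has_real_derivative y) (at t) \<and> 0 \<le> y"
      using d Fp[OF t0(1)] by (intro exI[where x="((real (Suc C) * t ^ C * ?F1 t + t ^ Suc C * ?F2 t) * ?F t - t ^ Suc C * ?F1 t * ?F1 t) / (?F t * ?F t)"] conjI divide_nonneg_nonneg) auto
  qed
  then show ?thesis using Fp[of l] Fp[of u] lu by (simp add: divide_le_eq le_divide_eq mult_ac)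
qed

text \<open>For \<open>z < 1\<close> this is \<open>z \<le> artanh z\<close> after taking
  logarithms.\<close>

lemma one_minus_exp_le: "0 \<le> z \<Longrightarrow> (1 - z) * exp (2 * z) \<le> 1 + (z::real)"
proof -
  assume z: "0 \<le> z"
  have "(1 + 0) - (1 - 0) * exp (2 * 0) \<le> (1 + z) - (1 - z) * exp (2 * z)"
  proof (rule DERIV_nonneg_imp_nondecreasing[OF z])
    fix x :: real
    have "((\<lambda>z. (1 + z) - (1 - z) * exp (2 * z)) has_real_derivative (1 - (1 - 2 * x) * exp (2 * x))) (at x)"
      by (auto intro!: derivative_eq_intros simp: algebra_simps)
    moreover have "(1 - 2 * x) * exp (2 * x) \<le> exp (- (2 * x)) * exp (2 * x)"
      using exp_ge_add_one_self[of "- (2 * x)"] by (intro mult_right_mono) auto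
    then have "0 \<le> 1 - (1 - 2 * x) * exp (2 * x)" by (simp add: exp_minus)
    ultimately show "\<exists>y. ((\<lambda>z. (1 + z) - (1 - z) * exp (2 * z)) has_real_derivative y) (at x) \<and> 0 \<le> y" by blast
  qed
  then show ?thesis by simp
qed

text \<open>At time \<open>x\<close> the logarithms of the two rates separate with speed 1 in either
  direction and drift upwards with speed \<open>C * x\<close>. Separation alone changes the product
  at speed \<open>P - Q\<close>, which can be negative, but \<open>pt_ratio_mono\<close> gives
  \<open>Q \<le> exp (2 * C * x) * P\<close>. The drift adds \<open>C * x * (P + Q)\<close>, just
  enough by \<open>one_minus_exp_le\<close>.\<close>

lemma pt_spread:
  fixes C :: nat
  assumes B: "\<And>j. \<bar>f j\<bar> \<le> B" and f0: "\<And>j. 0 \<le> f j" and inc: "\<And>j. f j \<le> f (Suc j)"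
    and C: "1 \<le> C" and l: "0 < l" and e: "0 \<le> e" and u: "2 * (l * exp (real C * e\<^sup>2 / 2 + e)) \<le> real C + 1"
  shows "(pt f l)\<^sup>2 \<le> pt f (l * exp (real C * e\<^sup>2 / 2 + e)) * pt f (l * exp (real C * e\<^sup>2 / 2 - e))"
proof (cases "\<exists>i. 0 < f i")
  case False
  then have "f j = 0" for j using f0[of j] by (simp add: order.antisym not_less)
  then show ?thesis by (simp add: pt_def)
next
  case True
  then obtain i where i: "0 < f i" by blast
  define F1 where "F1 = pt (\<lambda>j. f (Suc j) - f j)"
  define up where "up e = l * exp (real C * e\<^sup>2 / 2 + e)" for e
  define dn where "dn e = l * exp (real C * e\<^sup>2 / 2 - e)" for e
  have B2: "\<bar>f (Suc j) - f j\<bar> \<le> 2 * B" for j using B[of j] B[of "Suc j"] by linarith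
  have "pt f (up 0) * pt f (dn 0) \<le> pt f (up e) * pt f (dn e)"
  proof (rule DERIV_nonneg_imp_nondecreasing[OF e])
    fix x assume x: "0 \<le> x" "x \<le> e"
    have du: "(up has_real_derivative up x * (real C * x + 1)) (at x)"
      unfolding up_def by (auto intro!: derivative_eq_intros simp: algebra_simps)
    have dd: "(dn has_real_derivative dn x * (real C * x - 1)) (at x)"
      unfolding dn_def by (auto intro!: derivative_eq_intros simp: algebra_simps)
    define P where "P = up x * F1 (up x) * pt f (dn x)"
    define Q where "Q = dn x * F1 (dn x) * pt f (up x)"
    have d: "((\<lambda>x. pt f (up x) * pt f (dn x)) has_real_derivative ((real C * x + 1) * P + (real C * x - 1) * Q)) (at x)"
    proof (rule DERIV_cong)
      show "((\<lambda>x. pt f (up x) * pt f (dn x)) has_real_derivative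
         (F1 (up x) * (up x * (real C * x + 1)) * pt f (dn x) + F1 (dn x) * (dn x * (real C * x - 1)) * pt f (up x))) (at x)"
        unfolding F1_def by (rule DERIV_mult DERIV_chain2[OF pt_derivative[where f=f, OF B] du] DERIV_chain2[OF pt_derivative[where f=f, OF B] dd])+
    qed (simp add: P_def Q_def mult_ac)
    have updn: "up x = dn x * exp (2 * x)" unfolding up_def dn_def mult.assoc exp_add[symmetric] by simp
    have dn0: "0 < dn x" using l by (simp add: dn_def)
    have "exp (2 * 0) \<le> exp (2 * x)" using x by simp
    then have le: "dn x \<le> up x" unfolding updn using dn0 by simp
    have "x\<^sup>2 \<le> e\<^sup>2" using x by (intro power_mono) auto
    then have "real C * x\<^sup>2 / 2 + x \<le> real C * e\<^sup>2 / 2 + e" using x by (intro add_mono divide_right_mono mult_left_mono) auto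
    then have "up x \<le> up e" unfolding up_def using l by simp
    then have ux: "2 * up x \<le> real C + 1" using u unfolding up_def by linarith
    have Q0: "0 \<le> Q"
      unfolding Q_def F1_def using dn0 le inc f0
      by (intro mult_nonneg_nonneg pt_nonneg[OF B2] pt_nonneg[OF B]) auto
    have "dn x ^ C * Q \<le> up x ^ C * P"
      using pt_ratio_mono[OF B f0 inc i C dn0 le ux] unfolding P_def Q_def F1_def by (simp add: mult_ac)
    also have "\<dots> = dn x ^ C * (exp (2 * (real C * x)) * P)"
      unfolding updn power_mult_distrib exp_of_nat_mult[symmetric] by (simp add: mult_ac)
    finally have "Q \<le> exp (2 * (real C * x)) * P" using dn0 by simp
    then have "(real C * x + 1) * Q \<le> (real C * x + 1) * (exp (2 * (real C * x)) * P)" using x by (intro mult_left_mono) auto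
    moreover have "(1 - real C * x) * exp (2 * (real C * x)) * Q \<le> (1 + real C * x) * Q"
      using one_minus_exp_le[of "real C * x"] x Q0 by (intro mult_right_mono) auto
    ultimately have "0 \<le> exp (2 * (real C * x)) * ((real C * x + 1) * P + (real C * x - 1) * Q)"
      by (simp add: algebra_simps)
    then have "0 \<le> (real C * x + 1) * P + (real C * x - 1) * Q" by (simp add: zero_le_mult_iff)
    then show "\<exists>y. ((\<lambda>x. pt f (up x) * pt f (dn x)) has_real_derivative y) (at x) \<and> 0 \<le> y" using d by blast
  qed
  then show ?thesis by (simp add: up_def dn_def power2_eq_square)
qed

section \<open>Exponentials of commuting insertion operators\<close>

lemma sums_antidiagonal:
  fixes a :: "nat \<Rightarrow> nat \<Rightarrow> real"
  assumes a0: "\<And>j i. 0 \<le> a j i" and row: "\<And>j. a j sums r j" and r: "r sums S"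
  shows "(\<lambda>m. \<Sum>j\<le>m. a j (m - j)) sums S"
proof -
  have r0: "0 \<le> r j" for j by (rule sums_le[OF _ sums_zero row]) (use a0 in auto)
  have rh: "(r has_sum S) UNIV" by (rule sums_nonneg_imp_has_sum[OF r r0])
  have rowh: "((\<lambda>i. (\<lambda>(j, i). a j i) (j, i)) has_sum r j) UNIV" for j
    using sums_nonneg_imp_has_sum[OF row a0] by simp
  have S: "((\<lambda>(j, i). a j i) has_sum S) (UNIV \<times> UNIV)"
    by (rule has_sum_SigmaI[OF rowh rh], rule summable_on_SigmaI[OF rowh])
      (use rh a0 in \<open>auto simp: summable_on_def\<close>)
  have bij: "bij_betw (\<lambda>(m, j). (j, m - j)) (SIGMA m:UNIV. {..m}) (UNIV \<times> (UNIV :: nat set))"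
    by (rule bij_betwI[where g="\<lambda>(j, i). (i + j, j)"]) auto
  have "((\<lambda>x. (\<lambda>(j, i). a j i) ((\<lambda>(m, j). (j, m - j)) x)) has_sum S) (SIGMA m:UNIV. {..m})"
    using has_sum_reindex_bij_betw[OF bij, of "\<lambda>(j, i). a j i" S] S by blast
  then have "((\<lambda>m. \<Sum>j\<le>m. a j (m - j)) has_sum S) UNIV"
    by (rule has_sum_SigmaD) (simp add: has_sum_finite)
  then show ?thesis by (rule has_sum_imp_sums)
qed

text \<open>The operator exponential: independent Poisson numbers of clauses with rates
  \<open>w\<close>, without the normalizing factor.\<close>

definition EO :: "'i set \<Rightarrow> ('i \<Rightarrow> real) \<Rightarrow> ('i \<Rightarrow> 'c) \<Rightarrow> ('c set \<Rightarrow> real) \<Rightarrow> 'c set \<Rightarrow> real" where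
  "EO I w c f X = (\<Sum>m. (Op I w c ^^ m) f X / fact m)"

lemma Op_pow_bounds:
  assumes w: "\<And>i. i \<in> I \<Longrightarrow> 0 \<le> w i" and f: "\<And>Y. 0 \<le> f Y" "\<And>Y. f Y \<le> B"
  shows "0 \<le> (Op I w c ^^ m) f X" "(Op I w c ^^ m) f X \<le> (\<Sum>i\<in>I. w i) ^ m * B"
proof -
  show "0 \<le> (Op I w c ^^ m) f X" by (rule Op_pow_nonneg[OF w f(1)])
  have "(Op I w c ^^ m) f X \<le> (Op I w c ^^ m) (\<lambda>_. B) X" by (rule Op_pow_mono[OF w f(2)])
  then show "(Op I w c ^^ m) f X \<le> (\<Sum>i\<in>I. w i) ^ m * B"
    by (simp add: Op_pow_const[OF refl, where c=c and I=I])
qed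

lemma EO_sums:
  assumes w: "\<And>i. i \<in> I \<Longrightarrow> 0 \<le> w i" and f: "\<And>Y. 0 \<le> f Y" "\<And>Y. f Y \<le> B"
  shows "(\<lambda>m. (Op I w c ^^ m) f X / fact m) sums EO I w c f X"
    and "0 \<le> EO I w c f X" "EO I w c f X \<le> exp (\<Sum>i\<in>I. w i) * B"
proof -
  let ?s = "\<Sum>i\<in>I. w i"
  have E: "(\<lambda>m. ?s ^ m * B / fact m) sums (exp ?s * B)"
    using sums_mult2[OF exp_converges[of ?s], of B] by (simp add: divide_inverse mult_ac)
  have le: "(Op I w c ^^ m) f X / fact m \<le> ?s ^ m * B / fact m" for m
    by (intro divide_right_mono Op_pow_bounds[OF w f]) auto
  have ge: "0 \<le> (Op I w c ^^ m) f X / fact m" for m by (intro divide_nonneg_nonneg Op_pow_bounds(1)[OF w f]) auto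
  have "summable (\<lambda>m. (Op I w c ^^ m) f X / fact m)"
  proof (rule summable_comparison_test[OF _ sums_summable[OF E]], intro exI allI impI)
    show "norm ((Op I w c ^^ m) f X / fact m) \<le> ?s ^ m * B / fact m" for m
      unfolding real_norm_def abs_of_nonneg[OF ge] by (rule le)
  qed
  then show s: "(\<lambda>m. (Op I w c ^^ m) f X / fact m) sums EO I w c f X"
    unfolding EO_def by (rule summable_sums)
  show "0 \<le> EO I w c f X" by (rule sums_le[OF _ sums_zero s]) (rule ge)
  show "EO I w c f X \<le> exp ?s * B" by (rule sums_le[OF _ s E]) (rule le)
qed

lemma Op_pow_sums:
  assumes "\<And>Y. (\<lambda>n. g n Y) sums G Y"
  shows "(\<lambda>n. (Op I w c ^^ m) (g n) X) sums (Op I w c ^^ m) G X"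
proof (induction m arbitrary: X)
  case 0 then show ?case using assms by simp
next
  case (Suc m)
  have "(\<lambda>n. \<Sum>i\<in>I. w i * (Op I w c ^^ m) (g n) (insert (c i) X)) sums (\<Sum>i\<in>I. w i * (Op I w c ^^ m) G (insert (c i) X))"
    by (intro sums_sum sums_mult Suc.IH)
  then show ?case by (simp add: Op_def[of I w c "(Op I w c ^^ m) _"])
qed

text \<open>The binomial theorem, valid since the two operators on the right commute.\<close>

lemma Op_pow_binomial:
  assumes "\<And>f X. Op K u e f X = Op I w c f X + Op J v d f X"
  shows "(Op K u e ^^ m) f X = (\<Sum>j\<le>m. real (m choose j) * (Op I w c ^^ j) ((Op J v d ^^ (m - j)) f) X)"
proof (induction m arbitrary: X)
  case (Suc m)
  define G where "G j i = (Op I w c ^^ j) ((Op J v d ^^ i) f)" for j i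
  have GI: "Op I w c (G j i) = G (Suc j) i" for j i by (simp add: G_def)
  have GJ: "Op J v d (G j i) = G j (Suc i)" for j i
    unfolding G_def by (simp only: funpow.simps o_apply Op_pow_commute1)
  have IH: "(Op K u e ^^ m) f = (\<lambda>X. \<Sum>j\<in>{..m}. real (m choose j) * G j (m - j) X)"
    using Suc.IH by (simp add: G_def fun_eq_iff)
  have "(Op K u e ^^ Suc m) f X = (\<Sum>j\<le>m. real (m choose j) * G (Suc j) (m - j) X) + (\<Sum>j\<le>m. real (m choose j) * G j (Suc m - j) X)"
    unfolding funpow.simps o_apply assms IH Op_sum GI GJ
    by (simp add: Suc_diff_le distrib_left sum.distrib cong: sum.cong_simp)
  also have "(\<Sum>j\<le>m. real (m choose j) * G j (Suc m - j) X)
      = (\<Sum>j\<le>Suc m. real (m choose j) * G j (Suc m - j) X)" by simp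
  also have "\<dots> = G 0 (Suc m) X + (\<Sum>j\<le>m. real (m choose Suc j) * G (Suc j) (m - j) X)"
    by (subst sum.atMost_Suc_shift) simp
  also have "(\<Sum>j\<le>m. real (m choose j) * G (Suc j) (m - j) X) + (G 0 (Suc m) X + (\<Sum>j\<le>m. real (m choose Suc j) * G (Suc j) (m - j) X))
      = G 0 (Suc m) X + (\<Sum>j\<le>m. real (Suc m choose Suc j) * G (Suc j) (m - j) X)"
    by (simp add: sum.distrib distrib_right)
  also have "\<dots> = (\<Sum>j\<le>Suc m. real (Suc m choose j) * G j (Suc m - j) X)"
    by (subst sum.atMost_Suc_shift) simp
  finally show ?case by (simp only: G_def)
qed simp

text \<open>The exponential of a sum of commuting operators is the product of the exponentials; in
  probability, disjoint parts of a Poisson process are independent.\<close>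

lemma EO_split:
  assumes KIJ: "\<And>f X. Op K u e f X = Op I w c f X + Op J v d f X"
    and w: "\<And>i. i \<in> I \<Longrightarrow> 0 \<le> w i" and v: "\<And>j. j \<in> J \<Longrightarrow> 0 \<le> v j"
    and f: "\<And>Y. 0 \<le> f Y" "\<And>Y. f Y \<le> B"
  shows "EO K u e f X = EO I w c (EO J v d f) X"
proof -
  define a where "a j i = (Op I w c ^^ j) ((Op J v d ^^ i) f) X / (fact j * fact i)" for j i
  have "(\<lambda>m. \<Sum>j\<le>m. a j (m - j)) sums EO I w c (EO J v d f) X"
  proof (rule sums_antidiagonal)
    show "0 \<le> a j i" for j i
      unfolding a_def by (intro divide_nonneg_nonneg Op_pow_nonneg w v f) auto
    show "(\<lambda>j. (Op I w c ^^ j) (EO J v d f) X / fact j) sums EO I w c (EO J v d f) X"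
      by (rule EO_sums(1)[where B="exp (sum v J) * B"]) (use w EO_sums[OF v f] in auto)
    show "a j sums ((Op I w c ^^ j) (EO J v d f) X / fact j)" for j
    proof -
      have "(\<lambda>i. (Op I w c ^^ j) (\<lambda>Y. (Op J v d ^^ i) f Y / fact i) X) sums (Op I w c ^^ j) (EO J v d f) X"
        by (rule Op_pow_sums, rule EO_sums(1)) (use v f in auto)
      moreover have "(Op I w c ^^ j) (\<lambda>Y. (Op J v d ^^ i) f Y / fact i) = (\<lambda>Y. (Op I w c ^^ j) ((Op J v d ^^ i) f) Y / fact i)" for i
        using Op_pow_cmult[where I=I and w=w and c=c and m=j and a="1 / fact i" and f="(Op J v d ^^ i) f"] by simp
      ultimately show ?thesis
        using sums_divide[of "\<lambda>i. (Op I w c ^^ j) ((Op J v d ^^ i) f) X / fact i" "(Op I w c ^^ j) (EO J v d f) X" "fact j"]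
        by (simp add: a_def[abs_def] mult.commute)
    qed
  qed
  moreover have "(\<Sum>j\<le>m. a j (m - j)) = (Op K u e ^^ m) f X / fact m" for m
    unfolding Op_pow_binomial[of K u e I w c J v d, OF KIJ] a_def
    by (simp add: sum_divide_distrib binomial_fact field_simps cong: sum.cong_simp)
  ultimately show ?thesis unfolding EO_def[of K] by (simp add: sums_unique[symmetric])
qed

lemma EO_mono_inv:
  assumes w: "\<And>i. i \<in> I \<Longrightarrow> 0 \<le> w i" and Q: "\<And>Y i. Q Y \<Longrightarrow> i \<in> I \<Longrightarrow> Q (insert (c i) Y)"
    and fg: "\<And>Y. Q Y \<Longrightarrow> f Y \<le> g Y" and X: "Q X"
    and f: "\<And>Y. 0 \<le> f Y" "\<And>Y. f Y \<le> B" and g: "\<And>Y. 0 \<le> g Y" "\<And>Y. g Y \<le> B'"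
  shows "EO I w c f X \<le> EO I w c g X"
proof (rule sums_le[OF _ EO_sums(1) EO_sums(1)])
  show "(Op I w c ^^ m) f X / fact m \<le> (Op I w c ^^ m) g X / fact m" for m
    by (intro divide_right_mono Op_pow_mono_inv[where Q=Q]) (use assms in auto)
qed (use assms in auto)

lemma EO_pt:
  assumes s: "0 < (\<Sum>i\<in>I. w i)"
  shows "exp (- (t * (\<Sum>i\<in>I. w i))) * EO I (\<lambda>i. t * w i) c f X
    = pt (\<lambda>j. (Op I (\<lambda>i. w i / (\<Sum>i\<in>I. w i)) c ^^ j) f X) (t * (\<Sum>i\<in>I. w i))"
proof -
  let ?s = "\<Sum>i\<in>I. w i"
  have "(Op I (\<lambda>i. t * w i) c ^^ j) f = (\<lambda>X. (t * ?s) ^ j * (Op I (\<lambda>i. w i / ?s) c ^^ j) f X)" for j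
  proof -
    have "Op I (\<lambda>i. t * w i) c = (\<lambda>f X. (t * ?s) * Op I (\<lambda>i. w i / ?s) c f X)"
      using s by (simp add: Op_def fun_eq_iff mult.assoc sum_distrib_left[symmetric] sum_divide_distrib[symmetric])
    then show ?thesis
      by (induction j) (simp_all add: Op_cmult mult.assoc)
  qed
  then show ?thesis by (simp add: pt_def EO_def mult.commute)
qed

text \<open>Unsatisfiability means that both values of \<open>x\<close> are blocked. Clauses with a
  positive \<open>x\<close> matter only for the value False, so the indicator for True passes
  through as a constant factor.\<close>

lemma EO_glue_pos:
  assumes H: "\<And>D. D \<in> H \<Longrightarrow> avoids x D" and w: "\<And>D. D \<in> H \<Longrightarrow> 0 \<le> w D"
    and X: "all_avoid x X" "all_avoid x N" "all_avoid x P"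
  shows "EO H w (insert (x, True)) uind (glue x X N P) = uind (X \<union> N) * EO H w (\<lambda>D. D) uind (X \<union> P)"
proof -
  have "(Op H w (insert (x, True)) ^^ j) uind (glue x X N P) = uind (X \<union> N) * (Op H w (\<lambda>D. D) ^^ j) uind (X \<union> P)" for j
    using X(3)
  proof (induction j arbitrary: P)
    case 0
    then show ?case using X blocked_glue[of x X N P] unsat_iff_blocked[of "glue x X N P" x True]
      by (simp add: uind_def)
  next
    case (Suc j)
    have "(Op H w (insert (x, True)) ^^ Suc j) uind (glue x X N P)
      = (\<Sum>D\<in>H. w D * (uind (X \<union> N) * (Op H w (\<lambda>D. D) ^^ j) uind (X \<union> insert D P)))"
      unfolding funpow.simps o_apply Op_def[of H w _ "(Op H w (insert (x, True)) ^^ j) uind"] glue_insert(3)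
      by (intro sum.cong refl arg_cong2[where f="(*)"] Suc.IH) (use H Suc.prems in \<open>auto simp: all_avoid_insert\<close>)
    then show ?case by (simp add: Op_def[of H w _ "(Op H w (\<lambda>D. D) ^^ j) uind"] sum_distrib_left mult.left_commute)
  qed
  then show ?thesis
    using suminf_mult[OF sums_summable[OF EO_sums(1)[of H w uind 1 "\<lambda>D. D" "X \<union> P"]], of "uind (X \<union> N)"] w
    by (simp add: EO_def)
qed

lemma EO_glue:
  assumes H: "\<And>D. D \<in> H \<Longrightarrow> avoids x D" and w: "\<And>D. D \<in> H \<Longrightarrow> 0 \<le> w D" and v: "\<And>D. D \<in> H \<Longrightarrow> 0 \<le> v D"
    and X: "all_avoid x X" "all_avoid x N" "all_avoid x P"
  shows "EO H v (insert (x, False)) (EO H w (insert (x, True)) uind) (glue x X N P)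
    = EO H v (\<lambda>D. D) uind (X \<union> N) * EO H w (\<lambda>D. D) uind (X \<union> P)"
proof -
  let ?c = "EO H w (\<lambda>D. D) uind (X \<union> P)"
  have "(Op H v (insert (x, False)) ^^ j) (EO H w (insert (x, True)) uind) (glue x X N P)
      = (Op H v (\<lambda>D. D) ^^ j) uind (X \<union> N) * ?c" for j
    using X(2)
  proof (induction j arbitrary: N)
    case 0
    then show ?case using EO_glue_pos[OF H w X(1) _ X(3)] by simp
  next
    case (Suc j)
    have "(Op H v (insert (x, False)) ^^ Suc j) (EO H w (insert (x, True)) uind) (glue x X N P)
      = (\<Sum>D\<in>H. v D * ((Op H v (\<lambda>D. D) ^^ j) uind (X \<union> insert D N) * ?c))"
      unfolding funpow.simps o_apply Op_def[of H v _ "(Op H v (insert (x, False)) ^^ j) _"] glue_insert(2)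
      by (intro sum.cong refl arg_cong2[where f="(*)"] Suc.IH) (use H Suc.prems in \<open>auto simp: all_avoid_insert\<close>)
    then show ?case by (simp add: Op_def[of H v _ "(Op H v (\<lambda>D. D) ^^ j) uind"] sum_distrib_right mult.assoc)
  qed
  then show ?thesis
    using suminf_mult2[OF sums_summable[OF EO_sums(1)[of H v uind 1 "\<lambda>D. D" "X \<union> N"]], of ?c] v
    by (simp add: EO_def[of H v])
qed

section \<open>Changing the literal weights of one variable\<close>

definition poisson_unsat :: "nat \<Rightarrow> nat \<Rightarrow> (literal \<Rightarrow> real) \<Rightarrow> real \<Rightarrow> real" where
  "poisson_unsat n k a r = exp (- (\<Sum>c\<in>CL {..<n} k. r * lw a c)) * EO (CL {..<n} k) (\<lambda>c. r * lw a c) (\<lambda>c. c) uind {}"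

text \<open>The conditional probability of unsatisfiability given the clauses \<open>X\<close>
  without \<open>x\<close>.\<close>

definition poisson_split :: "nat \<Rightarrow> nat \<Rightarrow> (literal \<Rightarrow> real) \<Rightarrow> real \<Rightarrow> nat \<Rightarrow> clause set \<Rightarrow> real" where
  "poisson_split n h a r x X = (let H = CL ({..<n} - {x}) h; \<kappa> = (\<lambda>D. r * lw a D) in
    exp (- (a (x, False) * sum \<kappa> H)) * exp (- (a (x, True) * sum \<kappa> H)) *
    EO H (\<lambda>D. a (x, False) * \<kappa> D) (insert (x, False)) (EO H (\<lambda>D. a (x, True) * \<kappa> D) (insert (x, True)) uind) X)"

text \<open>The last claim brings the conditional probability into the shape required by
  \<open>pt_spread\<close>: one and the same function at two rates proportional to the two literal
  weights of \<open>x\<close>.\<close>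

lemma poisson_unsat_split:
  fixes n h :: nat and a :: "literal \<Rightarrow> real" and r :: real and x :: nat
  assumes x: "x < n" and a: "\<And>l. 0 \<le> a l" and r: "0 \<le> r"
  defines "Fr \<equiv> CL ({..<n} - {x}) (Suc h)" and "H \<equiv> CL ({..<n} - {x}) h"
  defines "\<kappa> \<equiv> \<lambda>D. r * lw a D"
  defines "g \<equiv> poisson_split n h a r x"
  shows "poisson_unsat n (Suc h) a r = exp (- sum \<kappa> Fr) * EO Fr \<kappa> (\<lambda>c. c) g {}"
    and "\<And>X. 0 \<le> g X" "\<And>X. g X \<le> 1"
    and "0 < sum \<kappa> H \<Longrightarrow> all_avoid x X \<Longrightarrow> g X =
       pt (\<lambda>j. (Op H (\<lambda>D. \<kappa> D / sum \<kappa> H) (\<lambda>D. D) ^^ j) uind X) (a (x, False) * sum \<kappa> H)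
     * pt (\<lambda>j. (Op H (\<lambda>D. \<kappa> D / sum \<kappa> H) (\<lambda>D. D) ^^ j) uind X) (a (x, True) * sum \<kappa> H)"
proof -
  have g_def: "g = (\<lambda>X. exp (- (a (x, False) * sum \<kappa> H)) * exp (- (a (x, True) * sum \<kappa> H)) *
    EO H (\<lambda>D. a (x, False) * \<kappa> D) (insert (x, False)) (EO H (\<lambda>D. a (x, True) * \<kappa> D) (insert (x, True)) uind) X)"
    by (simp add: g_def poisson_split_def[abs_def] H_def \<kappa>_def Let_def)
  have k0: "0 \<le> \<kappa> D" "0 \<le> a l * \<kappa> D" for D l unfolding \<kappa>_def using r by (auto intro!: mult_nonneg_nonneg lw_nonneg a)
  let ?pos = "EO H (\<lambda>D. a (x, True) * \<kappa> D) (insert (x, True)) uind"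
  let ?neg = "EO H (\<lambda>D. a (x, False) * \<kappa> D) (insert (x, False)) ?pos"
  have pos: "0 \<le> ?pos X" "?pos X \<le> exp (a (x, True) * sum \<kappa> H)" for X
    using EO_sums(2,3)[of H "\<lambda>D. a (x, True) * \<kappa> D" uind 1 "insert (x, True)" X] k0 by (simp_all add: sum_distrib_left)
  have neg: "0 \<le> ?neg X" "?neg X \<le> exp (a (x, False) * sum \<kappa> H) * exp (a (x, True) * sum \<kappa> H)" for X
    using EO_sums(2,3)[of H "\<lambda>D. a (x, False) * \<kappa> D" ?pos "exp (a (x, True) * sum \<kappa> H)" "insert (x, False)" X] k0 pos
    by (simp_all add: sum_distrib_left)
  show g0: "0 \<le> g X" for X using neg by (simp add: g_def)
  show g1: "g X \<le> 1" for X
  proof -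
    have "g X \<le> exp (- (a (x, False) * sum \<kappa> H)) * exp (- (a (x, True) * sum \<kappa> H)) * (exp (a (x, False) * sum \<kappa> H) * exp (a (x, True) * sum \<kappa> H))"
      unfolding g_def by (intro mult_left_mono neg) auto
    also have "\<dots> = 1" by (simp add: exp_minus field_simps)
    finally show ?thesis .
  qed
  have lwx: "r * lw a (insert (x, s) D) = a (x, s) * \<kappa> D" if "D \<in> H" for s D
    using lw_insert[of "{..<n}" D x h a s] that by (simp add: H_def \<kappa>_def)
  define J where "J = H \<times> (UNIV :: bool set)"
  define v where "v = (\<lambda>(D, s :: bool). a (x, s) * \<kappa> D)"
  define d where "d = (\<lambda>(D, s :: bool). insert (x, s) D)"
  have split: "(\<Sum>c\<in>CL {..<n} (Suc h). r * lw a c * f c) = (\<Sum>c\<in>Fr. \<kappa> c * f c) + (\<Sum>(D, s)\<in>J. v (D, s) * f (d (D, s)))" for f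
  proof -
    have "(\<Sum>D\<in>H. \<Sum>s\<in>UNIV. r * lw a (insert (x, s) D) * f (insert (x, s) D)) = (\<Sum>(D, s)\<in>J. v (D, s) * f (d (D, s)))"
      unfolding J_def sum.cartesian_product[symmetric] by (intro sum.cong refl) (simp add: lwx v_def d_def)
    then show ?thesis using sum_CL_split[of "{..<n}" x "\<lambda>c. r * lw a c * f c" h] x by (simp add: Fr_def H_def \<kappa>_def)
  qed
  have "EO (CL {..<n} (Suc h)) (\<lambda>c. r * lw a c) (\<lambda>c. c) uind X = EO Fr \<kappa> (\<lambda>c. c) (EO J v d uind) X" for X
    by (rule EO_split[where B=1])
      (use split k0 in \<open>auto simp: Op_def case_prod_beta v_def\<close>)
  moreover have "EO J v d uind = ?neg"
  proof
    fix X show "EO J v d uind X = ?neg X"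
    proof (rule EO_split[where B=1])
      show "Op J v d f Y = Op H (\<lambda>D. a (x, False) * \<kappa> D) (insert (x, False)) f Y + Op H (\<lambda>D. a (x, True) * \<kappa> D) (insert (x, True)) f Y" for f Y
      proof -
        have "Op J v d f Y = (\<Sum>D\<in>H. \<Sum>s\<in>UNIV. v (D, s) * f (insert (d (D, s)) Y))"
          by (simp add: Op_def J_def sum.cartesian_product case_prod_unfold)
        then show ?thesis by (simp add: Op_def v_def d_def UNIV_bool sum.distrib)
      qed
    qed (use k0 in auto)
  qed
  ultimately have 1: "EO (CL {..<n} (Suc h)) (\<lambda>c. r * lw a c) (\<lambda>c. c) uind {} = EO Fr \<kappa> (\<lambda>c. c) ?neg {}" by simp
  have tot: "(\<Sum>c\<in>CL {..<n} (Suc h). r * lw a c) = sum \<kappa> Fr + (a (x, False) * sum \<kappa> H + a (x, True) * sum \<kappa> H)"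
    using split[of "\<lambda>_. 1"] by (simp add: J_def v_def sum.cartesian_product[symmetric] UNIV_bool sum.distrib sum_distrib_left)
  have 2: "EO Fr \<kappa> (\<lambda>c. c) g {} = exp (- (a (x, False) * sum \<kappa> H)) * exp (- (a (x, True) * sum \<kappa> H)) * EO Fr \<kappa> (\<lambda>c. c) ?neg {}"
  proof -
    let ?e = "exp (- (a (x, False) * sum \<kappa> H)) * exp (- (a (x, True) * sum \<kappa> H))"
    have "(\<lambda>m. (Op Fr \<kappa> (\<lambda>c. c) ^^ m) ?neg {} / fact m) sums EO Fr \<kappa> (\<lambda>c. c) ?neg {}"
      by (rule EO_sums(1)[OF _ neg]) (use k0 in auto)
    from sums_mult[OF this, of ?e] show ?thesis
      unfolding g_def by (subst EO_def) (simp add: Op_pow_cmult sums_unique[symmetric])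
  qed
  show "poisson_unsat n (Suc h) a r = exp (- sum \<kappa> Fr) * EO Fr \<kappa> (\<lambda>c. c) g {}"
    unfolding poisson_unsat_def 1 2 tot by (simp only: minus_add_distrib exp_add mult.assoc)
  assume K: "0 < sum \<kappa> H" and X: "all_avoid x X"
  have "?neg (glue x X {} {}) = EO H (\<lambda>D. a (x, False) * \<kappa> D) (\<lambda>D. D) uind (X \<union> {}) * EO H (\<lambda>D. a (x, True) * \<kappa> D) (\<lambda>D. D) uind (X \<union> {})"
    by (rule EO_glue) (use X k0 avoids_CL in \<open>auto simp: H_def\<close>)
  then have "?neg X = EO H (\<lambda>D. a (x, False) * \<kappa> D) (\<lambda>D. D) uind X * EO H (\<lambda>D. a (x, True) * \<kappa> D) (\<lambda>D. D) uind X"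
    by (simp add: glue_def)
  then show "g X =
       pt (\<lambda>j. (Op H (\<lambda>D. \<kappa> D / sum \<kappa> H) (\<lambda>D. D) ^^ j) uind X) (a (x, False) * sum \<kappa> H)
     * pt (\<lambda>j. (Op H (\<lambda>D. \<kappa> D / sum \<kappa> H) (\<lambda>D. D) ^^ j) uind X) (a (x, True) * sum \<kappa> H)"
    unfolding g_def EO_pt[OF K, symmetric] by (simp add: mult_ac)
qed

text \<open>Changing the weights at \<open>x\<close> affects neither the clauses without
  \<open>x\<close> nor the law of the remainders. So \<open>pt_spread\<close> applies conditionally
  on the former and is then averaged.\<close>

lemma poisson_unsat_spread:
  fixes C :: nat
  assumes x: "x < n" and a: "\<And>l. 0 \<le> a l" and r: "0 \<le> r" and ax: "a (x, False) = w" "a (x, True) = w" and w: "0 < w"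
    and C: "1 \<le> C" and e: "0 \<le> e"
    and K: "0 < (\<Sum>D\<in>CL ({..<n} - {x}) h. r * lw a D)"
      "2 * ((\<Sum>D\<in>CL ({..<n} - {x}) h. r * lw a D) * (w * exp (real C * e\<^sup>2 / 2 + e))) \<le> real C + 1"
  shows "poisson_unsat n (Suc h) a r \<le> poisson_unsat n (Suc h) (a((x, False) := w * exp (real C * e\<^sup>2 / 2 + e), (x, True) := w * exp (real C * e\<^sup>2 / 2 - e))) r"
    (is "_ \<le> poisson_unsat n (Suc h) ?a r")
proof -
  have a': "0 \<le> ?a l" for l using a w by auto
  have off: "lw ?a D = lw a D" if "D \<in> CL ({..<n} - {x}) k" for D k
    by (rule lw_cong) (use CL_avoid[OF that] in auto)
  let ?Fr = "CL ({..<n} - {x}) (Suc h)" and ?H = "CL ({..<n} - {x}) h"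
  define \<kappa> where "\<kappa> D = r * lw a D" for D
  have keq: "(\<lambda>D. r * lw a D) = \<kappa>" by (simp add: \<kappa>_def fun_eq_iff)
  note S = poisson_unsat_split[where a=a and r=r and x=x and n=n and h=h, OF x a r, folded \<kappa>_def[abs_def]] and S' = poisson_unsat_split[where a="?a" and r=r and x=x and n=n and h=h, OF x a' r]
  have eqs: "(\<Sum>D\<in>?H. r * lw ?a D) = sum \<kappa> ?H" "(\<Sum>D\<in>?Fr. r * lw ?a D) = sum \<kappa> ?Fr"
    unfolding \<kappa>_def using off by (auto intro!: sum.cong)
  have EOeq: "EO ?Fr (\<lambda>D. r * lw ?a D) c f X = EO ?Fr \<kappa> c f X" for c f X
  proof -
    have "Op ?Fr (\<lambda>D. r * lw ?a D) c = Op ?Fr \<kappa> c" unfolding Op_def fun_eq_iff \<kappa>_def using off by (auto intro!: sum.cong)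
    then show ?thesis by (simp add: EO_def)
  qed
  have Opeq: "Op ?H (\<lambda>D. r * lw ?a D / s) c = Op ?H (\<lambda>D. \<kappa> D / s) c" for s c
    unfolding Op_def fun_eq_iff \<kappa>_def using off by (auto intro!: sum.cong)
  have K': "0 < sum \<kappa> ?H" "0 < (\<Sum>D\<in>?H. r * lw ?a D)" using K eqs by (simp_all add: \<kappa>_def[abs_def])
  have k0: "0 \<le> \<kappa> D" for D unfolding \<kappa>_def using r by (auto intro!: mult_nonneg_nonneg lw_nonneg a)
  have main: "(pt (\<lambda>j. (Op ?H (\<lambda>D. \<kappa> D / sum \<kappa> ?H) (\<lambda>D. D) ^^ j) uind X) (w * sum \<kappa> ?H))\<^sup>2
     \<le> pt (\<lambda>j. (Op ?H (\<lambda>D. \<kappa> D / sum \<kappa> ?H) (\<lambda>D. D) ^^ j) uind X) (w * sum \<kappa> ?H * exp (real C * e\<^sup>2 / 2 + e))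
     * pt (\<lambda>j. (Op ?H (\<lambda>D. \<kappa> D / sum \<kappa> ?H) (\<lambda>D. D) ^^ j) uind X) (w * sum \<kappa> ?H * exp (real C * e\<^sup>2 / 2 - e))" for X
  proof (rule pt_spread[where B=1])
    let ?O = "Op ?H (\<lambda>D. \<kappa> D / sum \<kappa> ?H) (\<lambda>D. D)"
    have n0: "0 \<le> \<kappa> D / sum \<kappa> ?H" for D using k0 K' by simp
    have s1: "(\<Sum>D\<in>?H. \<kappa> D / sum \<kappa> ?H) = 1" using K' by (simp add: sum_divide_distrib[symmetric])
    show p0: "0 \<le> (?O ^^ j) uind X" for j by (rule Op_pow_nonneg) (use n0 in auto)
    show "\<bar>(?O ^^ j) uind X\<bar> \<le> 1" for j
      unfolding abs_of_nonneg[OF p0] by (rule Op_pow_le_const) (use n0 s1 in auto)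
    show "(?O ^^ j) uind X \<le> (?O ^^ Suc j) uind X" for j
      by (rule Op_pow_incr) (use n0 s1 uind_mono in auto)
    show "2 * (w * sum \<kappa> ?H * exp (real C * e\<^sup>2 / 2 + e)) \<le> real C + 1"
      using K(2) unfolding \<kappa>_def[symmetric] by (simp add: mult_ac)
  qed (use C e w K' in auto)
  show ?thesis
    unfolding S(1) S'(1) eqs EOeq keq
  proof (rule mult_left_mono, rule EO_mono_inv[where Q="all_avoid x" and B=1 and B'=1])
    fix Y assume Y: "all_avoid x Y"
    show "poisson_split n h a r x Y \<le> poisson_split n h ?a r x Y"
      using main[of Y] S(4)[OF K'(1) Y] S'(4)[OF K'(2) Y] unfolding eqs Opeq ax \<kappa>_def[symmetric]
      by (simp add: power2_eq_square mult_ac)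
  qed (use S(2,3) S'(2,3) k0 avoids_CL in \<open>auto simp: all_avoid_insert eqs\<close>)
qed

lemma lw_const: "lw (\<lambda>_. w) c = w ^ card c"
  by (simp add: lw_def)

lemma poisson_unsat_cong:
  assumes "\<And>l. fst l < n \<Longrightarrow> a l = a' l"
  shows "poisson_unsat n k a r = poisson_unsat n k a' r"
proof -
  have eq: "lw a c = lw a' c" if "c \<in> CL {..<n} k" for c
    by (rule lw_cong, rule assms) (use that in \<open>auto simp: CL_def\<close>)
  then have "Op (CL {..<n} k) (\<lambda>c. r * lw a c) (\<lambda>c. c) = Op (CL {..<n} k) (\<lambda>c. r * lw a' c) (\<lambda>c. c)"
    unfolding Op_def fun_eq_iff by (auto intro!: sum.cong)
  then show ?thesis using eq by (simp add: poisson_unsat_def EO_def)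
qed

lemma poisson_unsat_eq_pt:
  assumes "k \<le> n" "\<And>c. c \<in> CL {..<n} k \<Longrightarrow> r * lw a c = t * cw n k p c"
  shows "poisson_unsat n k a r = pt (US k p n) t"
proof -
  have "Op (CL {..<n} k) (\<lambda>c. r * lw a c) (\<lambda>c. c) = Op (CL {..<n} k) (\<lambda>c. t * cw n k p c) (\<lambda>c. c)"
    unfolding Op_def fun_eq_iff using assms(2) by (auto intro!: sum.cong)
  moreover have "(\<Sum>c\<in>CL {..<n} k. r * lw a c) = t"
    using assms sum_cw[OF assms(1), of p] by (simp add: sum_distrib_left[symmetric])
  ultimately have "poisson_unsat n k a r = exp (- (t * (\<Sum>c\<in>CL {..<n} k. cw n k p c))) * EO (CL {..<n} k) (\<lambda>c. t * cw n k p c) (\<lambda>c. c) uind {}"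
    using sum_cw[OF assms(1), of p] by (simp add: poisson_unsat_def EO_def)
  also have "\<dots> = pt (US k p n) t"
    by (subst EO_pt) (use sum_cw[OF assms(1), of p] in \<open>simp_all add: US_def[abs_def] COp_def\<close>)
  finally show ?thesis .
qed

text \<open>The two literal weights \<open>1/2 \<plusminus> b\<close> are \<open>sqrt (1/4 - b\<^sup>2) * exp (\<plusminus> e)\<close> with
\<open>e = ln ((1 + 2 b) / (1 - 2 b)) / 2\<close>; the loss \<open>exp (- C e\<^sup>2 / 2)\<close> per literal is the one in \<open>pt_spread\<close>.\<close>

definition retained :: "nat \<Rightarrow> nat \<Rightarrow> real \<Rightarrow> real" where
  "retained C k b = (2 * (sqrt (1/4 - b\<^sup>2) * exp (- (real C * (ln ((1 + 2 * b) / (1 - 2 * b)) / 2)\<^sup>2 / 2)))) ^ k"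

text \<open>The polarities are changed one variable at a time.  Given the clauses avoiding \<open>x\<close>, the formula is
unsatisfiable iff it becomes so both after adding the remainders of the clauses containing \<open>x\<close> positively
and after adding those containing \<open>x\<close> negatively; under Poissonization these events are independent.\<close>

lemma poisson_compare:
  fixes b \<mu> :: real and C h n :: nat
  assumes b: "0 \<le> b" "b < 1/2" and n: "Suc h \<le> n" and \<mu>: "0 < \<mu>" and C: "1 \<le> C" "2 * \<mu> * real (Suc h) \<le> (real C + 1) * real n"
  shows "pt (US (Suc h) (1/2) n) (retained C (Suc h) b * \<mu>) \<le> pt (US (Suc h) (1/2 - b) n) \<mu>"
proof -
  define e where "e = ln ((1 + 2 * b) / (1 - 2 * b)) / 2"
  define w where "w = sqrt (1/4 - b\<^sup>2) * exp (- (real C * e\<^sup>2 / 2))"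
  define r where "r = \<mu> / real (n choose Suc h)"
  have ch: "0 < real (n choose Suc h)" using n by simp
  have r0: "0 < r" using \<mu> ch by (simp add: r_def)
  have e0: "0 \<le> e" unfolding e_def using b by (simp add: divide_le_eq)
  have exe: "exp e = sqrt ((1 + 2 * b) / (1 - 2 * b))"
    using b by (simp add: e_def sqrt_def[symmetric] ln_sqrt[symmetric])
  have b2: "1/4 - b\<^sup>2 = (1/2 - b) * (1/2 + b)" by (simp add: power2_eq_square algebra_simps)
  have sq: "sqrt (1/4 - b\<^sup>2) * exp e = 1/2 + b"
  proof -
    have "(1/2 - b) * (1/2 + b) * ((1 + 2 * b) / (1 - 2 * b)) = (1/2 + b)\<^sup>2"
      using b by (simp add: power2_eq_square field_simps)
    then show ?thesis unfolding b2 exe real_sqrt_mult[symmetric] using b by simp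
  qed
  have sq': "sqrt (1/4 - b\<^sup>2) * exp (- e) = 1/2 - b"
  proof -
    have "sqrt (1/4 - b\<^sup>2) * exp (- e) * (1/2 + b) = (1/4 - b\<^sup>2) * (exp (- e) * exp e)"
      unfolding sq[symmetric] using b by (simp add: b2 mult_ac real_sqrt_mult)
    also have "\<dots> = (1/2 - b) * (1/2 + b)" unfolding b2 by (simp add: exp_minus)
    finally show ?thesis using b by simp
  qed
  have w0: "0 < w" using b by (simp add: w_def b2)
  have wup: "w * exp (real C * e\<^sup>2 / 2 + e) = 1/2 + b" and wdn: "w * exp (real C * e\<^sup>2 / 2 - e) = 1/2 - b"
  proof -
    show "w * exp (real C * e\<^sup>2 / 2 + e) = 1/2 + b" unfolding w_def sq[symmetric] mult.assoc exp_add[symmetric] by simp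
    show "w * exp (real C * e\<^sup>2 / 2 - e) = 1/2 - b" unfolding w_def sq'[symmetric] mult.assoc exp_add[symmetric] by simp
  qed
  have whalf: "w \<le> 1/2"
  proof -
    have "sqrt (1/4 - b\<^sup>2) \<le> sqrt ((1/2)\<^sup>2)" unfolding real_sqrt_le_iff by (simp add: power2_eq_square)
    also have "\<dots> = 1/2" by (rule real_sqrt_unique) auto
    finally have "sqrt (1/4 - b\<^sup>2) * exp (- (real C * e\<^sup>2 / 2)) \<le> 1/2 * 1" using b by (intro mult_mono) (auto simp: b2)
    then show ?thesis by (simp add: w_def)
  qed
  \<comment> \<open>Variables not yet changed carry \<open>w\<close> instead of 1/2; this deficit
    becomes the factor \<open>retained\<close> at \<open>hyb 0\<close>.\<close>
  define hyb where "hyb i l = (if fst l < i then (if snd l then 1/2 - b else 1/2 + b) else w)" for i and l :: literal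
  have hyb0: "0 < hyb i l" for i l unfolding hyb_def using b w0 by auto
  have step: "poisson_unsat n (Suc h) (hyb i) r \<le> poisson_unsat n (Suc h) (hyb (Suc i)) r" if i: "i < n" for i
  proof -
    have up: "hyb (Suc i) = (hyb i)((i, False) := w * exp (real C * e\<^sup>2 / 2 + e), (i, True) := w * exp (real C * e\<^sup>2 / 2 - e))"
      unfolding wup wdn by (auto simp: hyb_def fun_eq_iff)
    show ?thesis unfolding up
    proof (rule poisson_unsat_spread[OF i])
      have card: "card ({..<n} - {i}) = n - 1" using i by simp
      have nk: "h \<le> n - 1" using n by simp
      have pk: "(\<Sum>D\<in>CL ({..<n} - {i}) h. (1::real)) > 0"
      proof -
        have "(\<Sum>D\<in>CL ({..<n} - {i}) h. lw (\<lambda>_. 1/2) D) = real (n - 1 choose h)"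
          using sum_lw_CL[of "{..<n} - {i}" "\<lambda>_. 1/2" 1 h] card by simp
        moreover have "0 < n - 1 choose h" using nk by simp
        ultimately have "CL ({..<n} - {i}) h \<noteq> {}" by auto
        then show ?thesis by (simp add: card_gt_0_iff)
      qed
      show "0 < (\<Sum>D\<in>CL ({..<n} - {i}) h. r * lw (hyb i) D)"
      proof (rule sum_pos)
        show "0 < r * lw (hyb i) D" for D unfolding lw_def using r0 hyb0 by (intro mult_pos_pos prod_pos) auto
      qed (use pk in auto)
      \<comment> \<open>With \<open>w\<close> raised to 1/2 every variable has total weight 1, so
        the rate is bounded by the mean number of clauses through a variable, whatever
        \<open>i\<close> is.\<close>
      have "(\<Sum>D\<in>CL ({..<n} - {i}) h. r * lw (hyb i) D) \<le> (\<Sum>D\<in>CL ({..<n} - {i}) h. r * lw (\<lambda>l. if fst l < i then (if snd l then 1/2 - b else 1/2 + b) else 1/2) D)"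
      proof (intro sum_mono mult_left_mono)
        show "lw (hyb i) D \<le> lw (\<lambda>l. if fst l < i then (if snd l then 1/2 - b else 1/2 + b) else 1/2) D" for D
          unfolding lw_def by (rule prod_mono) (use whalf w0 b in \<open>auto simp: hyb_def\<close>)
      qed (use r0 in auto)
      also have "\<dots> = r * real (n - 1 choose h)"
        unfolding sum_distrib_left[symmetric]
        by (subst sum_lw_CL[where A=1]) (simp_all add: card)
      also have "\<dots> = \<mu> * real (Suc h) / real n"
      proof -
        have "Suc h * (n choose Suc h) = n * (n - 1 choose h)" by (rule binomial_absorption) 
        then have "real (Suc h) * real (n choose Suc h) = real n * real (n - 1 choose h)"
          unfolding of_nat_mult[symmetric] by simp
        then show ?thesis using ch n unfolding r_def by (simp add: field_simps del: of_nat_Suc binomial_Suc_Suc)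
      qed
      finally have le: "(\<Sum>D\<in>CL ({..<n} - {i}) h. r * lw (hyb i) D) \<le> \<mu> * real (Suc h) / real n" .
      have "(\<Sum>D\<in>CL ({..<n} - {i}) h. r * lw (hyb i) D) * (1/2 + b) \<le> \<mu> * real (Suc h) / real n * 1"
        using le b \<mu> by (intro mult_mono) auto
      also have "2 * (\<mu> * real (Suc h) / real n * 1) \<le> real C + 1"
        using C n by (simp add: divide_le_eq mult_ac)
      finally show "2 * ((\<Sum>D\<in>CL ({..<n} - {i}) h. r * lw (hyb i) D) * (w * exp (real C * e\<^sup>2 / 2 + e))) \<le> real C + 1"
        unfolding wup by simp
    qed (use hyb0 r0 w0 C e0 in \<open>auto simp: less_imp_le hyb_def\<close>)
  qed
  have chain: "poisson_unsat n (Suc h) (hyb 0) r \<le> poisson_unsat n (Suc h) (hyb i) r" if "i \<le> n" for i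
    using that by (induction i) (auto intro: order_trans[OF _ step])
  have "poisson_unsat n (Suc h) (hyb 0) r = pt (US (Suc h) (1/2) n) (retained C (Suc h) b * \<mu>)"
  proof (rule poisson_unsat_eq_pt[OF n])
    fix c assume "c \<in> CL {..<n} (Suc h)"
    then have c: "card c = Suc h" by (simp add: CL_def)
    have "lw (hyb 0) c = w ^ Suc h" using lw_const[of w c] c by (simp add: lw_def hyb_def)
    moreover have "lw (pol (1/2)) c = (1/2) ^ Suc h"
    proof -
      have "pol (1/2) = (\<lambda>_. 1/2)" by (auto simp: pol_def fun_eq_iff)
      then show ?thesis using lw_const[of "1/2" c] c by simp
    qed
    moreover have "retained C (Suc h) b = 2 ^ Suc h * w ^ Suc h"
      unfolding retained_def w_def e_def power_mult_distrib ..
    ultimately show "r * lw (hyb 0) c = retained C (Suc h) b * \<mu> * cw n (Suc h) (1/2) c"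
      by (simp add: r_def cw_def power_one_over field_simps del: power_Suc)
  qed
  moreover have "poisson_unsat n (Suc h) (hyb n) r = poisson_unsat n (Suc h) (pol (1/2 - b)) r"
    by (rule poisson_unsat_cong) (auto simp: hyb_def pol_def)
  moreover have "\<dots> = pt (US (Suc h) (1/2 - b) n) \<mu>"
    by (rule poisson_unsat_eq_pt[OF n]) (simp add: r_def cw_def)
  ultimately show ?thesis using chain[of n] by simp
qed

section \<open>De-Poissonization\<close>

lemma geometric_terms:
  "(\<lambda>m. (u + v * z ^ m) * \<mu> ^ m / fact m) sums (u * exp \<mu> + v * exp (\<mu> * z :: real))"
proof -
  have "(\<lambda>m. u * (\<mu> ^ m / fact m) + v * ((\<mu> * z) ^ m / fact m)) sums (u * exp \<mu> + v * exp (\<mu> * z))"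
    by (intro sums_add sums_mult) (use exp_converges[of \<mu>] exp_converges[of "\<mu> * z"] in \<open>simp_all add: divide_inverse mult.commute\<close>)
  moreover have "u * (\<mu> ^ m / fact m) + v * ((\<mu> * z) ^ m / fact m) = (u + v * z ^ m) * \<mu> ^ m / fact m" for m
    by (simp add: power_mult_distrib algebra_simps add_divide_distrib)
  ultimately show ?thesis by simp
qed

lemma pt_geometric: "pt (\<lambda>m. u + v * z ^ m) \<mu> = u + v * exp (\<mu> * (z - 1))"
proof -
  have "pt (\<lambda>m. u + v * z ^ m) \<mu> = exp (- \<mu>) * (u * exp \<mu> + v * exp (\<mu> * z))"
    unfolding pt_def sums_unique[OF geometric_terms, symmetric] ..
  also have "\<dots> = u * exp (- \<mu> + \<mu>) + v * exp (- \<mu> + \<mu> * z)"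
    by (simp only: exp_add distrib_left mult_ac)
  finally show ?thesis by (simp add: algebra_simps)
qed

lemma pt_mono:
  assumes "\<And>m. f m \<le> g m" "0 \<le> \<mu>" "summable (\<lambda>m. f m * \<mu> ^ m / fact m)" "summable (\<lambda>m. g m * \<mu> ^ m / fact m)"
  shows "pt f \<mu> \<le> pt g \<mu>"
  unfolding pt_def
  by (intro mult_left_mono suminf_le assms divide_right_mono mult_right_mono) (use assms(2) in auto)

text \<open>By monotonicity \<open>f m\<close> exceeds \<open>f j\<close> only for
  \<open>m > j\<close>, and then by at most \<open>1 \<le> z^(m - j)\<close>. A Poisson variable of
  mean \<mu> has exponential moment \<open>exp (\<mu> * (z - 1))\<close>. The lower tail is treated
  alike with \<open>z \<le> 1\<close>.\<close>

lemma depoissonize: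
  assumes f: "\<And>m. 0 \<le> f m" "\<And>m. f m \<le> 1" "\<And>m j. m \<le> j \<Longrightarrow> f m \<le> f j" and \<mu>: "0 \<le> \<mu>"
  shows "1 \<le> z \<Longrightarrow> pt f \<mu> \<le> f j + exp (\<mu> * (z - 1)) / z ^ j"
    and "0 < z \<Longrightarrow> z \<le> 1 \<Longrightarrow> f j - exp (\<mu> * (z - 1)) / z ^ j \<le> pt f \<mu>"
proof -
  have sf: "summable (\<lambda>m. f m * \<mu> ^ m / fact m)"
    by (rule pt_summable[where B=1]) (use f in auto)
  {
    assume z: "1 \<le> z"
    have "f m \<le> f j + 1 / z ^ j * z ^ m" for m
    proof (cases "m \<le> j")
      case True then show ?thesis using f(3)[OF True] z by (simp add: add_increasing2)
    next
      case False
      then have "z ^ j \<le> z ^ m" using z by (intro power_increasing) auto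
      then have "1 \<le> 1 / z ^ j * z ^ m" using z by simp
      then show ?thesis using f(1)[of j] f(2)[of m] by linarith
    qed
    from pt_mono[OF this \<mu> sf sums_summable[OF geometric_terms]]
    show "pt f \<mu> \<le> f j + exp (\<mu> * (z - 1)) / z ^ j" unfolding pt_geometric by simp
  }
  {
    assume z: "0 < z" "z \<le> 1"
    have "f j + (- 1 / z ^ j) * z ^ m \<le> f m" for m
    proof (cases "j \<le> m")
      case True 
      have "0 \<le> 1 / z ^ j * z ^ m" using z by simp
      then show ?thesis using f(3)[OF True] by simp
    next
      case False
      then have "z ^ j \<le> z ^ m" using z by (intro power_decreasing) auto
      then have "1 \<le> 1 / z ^ j * z ^ m" using z by simp
      then show ?thesis using f(1)[of m] f(2)[of j] by simp
    qed
    from pt_mono[OF this \<mu> sums_summable[OF geometric_terms] sf]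
    show "f j - exp (\<mu> * (z - 1)) / z ^ j \<le> pt f \<mu>" unfolding pt_geometric by simp
  }
qed

lemma retained_bounds:
  assumes b: "0 \<le> b" "b < 1/2"
  shows "0 < retained C k b" "retained C k b \<le> 1"
proof -
  have b2: "b\<^sup>2 < 1/4" using b power_strict_mono[of b "1/2" 2] by (simp add: power2_eq_square)
  then show "0 < retained C k b" by (simp add: retained_def)
  have "sqrt (1/4 - b\<^sup>2) \<le> sqrt ((1/2)\<^sup>2)" unfolding real_sqrt_le_iff by (simp add: power2_eq_square)
  also have "\<dots> = 1/2" by (rule real_sqrt_unique) auto
  finally have "sqrt (1/4 - b\<^sup>2) * exp (- (real C * (ln ((1 + 2 * b) / (1 - 2 * b)) / 2)\<^sup>2 / 2)) \<le> 1/2 * 1"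
    using b2 by (intro mult_mono) auto
  then show "retained C k b \<le> 1"
    unfolding retained_def using b2 by (intro power_le_one) auto
qed

lemma biased_unsat_ge:
  fixes h C :: nat and b \<delta> A :: real
  assumes b: "0 \<le> b" "b < 1/2" and \<delta>: "0 < \<delta>" and A: "0 \<le> A" "2 * A * real (Suc h) \<le> real C + 1" and C: "1 \<le> C"
  shows "\<forall>\<^sub>F n in sequentially. \<forall>m j. real m \<le> A * real n \<longrightarrow>
    real j + \<delta> * real n \<le> retained C (Suc h) b * real m \<longrightarrow>
    US (Suc h) (1/2) n j \<le> US (Suc h) (1/2 - b) n m + \<delta>"
proof -
  \<comment> \<open>The biased Poisson mean is taken \<open>d * n\<close> below \<open>m\<close>;
    after multiplication by the retained fraction it still exceeds \<open>j\<close> by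
    \<open>d * n\<close>.\<close>
  define d where "d = \<delta> / 2"
  \<comment> \<open>The quadratic terms of both tail bounds then cost at most half of the linear
    gain \<open>s * d * n\<close>.\<close>
  define s where "s = d / (4 * (A + d + 1))"
  let ?\<rho> = "retained C (Suc h) b"
  have \<rho>: "0 < ?\<rho>" "?\<rho> \<le> 1" using retained_bounds[OF b] by auto
  have d: "0 < d" using \<delta> by (simp add: d_def)
  have s: "0 < s" "s \<le> 1/4" using d A by (auto simp: s_def divide_le_eq)
  have sA: "s * A \<le> d / 4" using d A by (auto simp: s_def divide_le_eq field_simps)
  have lim_e: "((\<lambda>n::nat. exp (- (s * d / 2) * real n)) \<longlongrightarrow> 0) sequentially"
    using s(1) d(1) by real_asymp
  have ev: "\<forall>\<^sub>F n::nat in sequentially. exp (- (s * d / 2) * real n) < d"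
    by (rule order_tendstoD(2)[OF lim_e]) (use d in simp)
  show ?thesis
    using ev eventually_ge_at_top[of "Suc h"]
  proof eventually_elim
    case (elim n)
    have n: "Suc h \<le> n" "0 < real n" using elim by auto
    have pp: "0 \<le> 1/2 - b" "1/2 - b \<le> (1::real)" using b by auto
    show ?case
    proof (intro allI impI)
      fix m j assume m: "real m \<le> A * real n" and j: "real j + \<delta> * real n \<le> ?\<rho> * real m"
      have \<delta>n: "0 < \<delta> * real n" using \<delta> n by simp
      have \<rho>m: "?\<rho> * real m \<le> real m" using \<rho> by (intro mult_left_le_one_le) auto
      define \<mu> where "\<mu> = real m - d * real n"
      have \<mu>0: "0 < \<mu>" using j \<rho>m \<delta>n unfolding \<mu>_def d_def by simp
      have \<mu>A: "\<mu> \<le> A * real n" using m d n unfolding \<mu>_def by (simp add: order_trans[OF _ m])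
      have jA: "real j \<le> A * real n" using j \<rho>m m \<delta>n by linarith
      have "?\<rho> * (d * real n) \<le> d * real n" using \<rho> d n by (intro mult_left_le_one_le) auto
      then have \<rho>\<mu>: "real j + d * real n \<le> ?\<rho> * \<mu>" using j unfolding \<mu>_def d_def by (simp add: right_diff_distrib)
      have quad: "s\<^sup>2 * x \<le> (s * d / 4) * real n" if "x \<le> A * real n" for x
      proof -
        have "s * x \<le> s * (A * real n)" using that s by (intro mult_left_mono) auto
        also have "\<dots> \<le> d / 4 * real n" using sA n by (simp add: mult.assoc[symmetric] mult_right_mono)
        finally have "s * (s * x) \<le> s * (d / 4 * real n)" using s by (intro mult_left_mono) auto
        then show ?thesis by (simp add: power2_eq_square mult.assoc)
      qed
      have C2: "2 * \<mu> * real (Suc h) \<le> (real C + 1) * real n"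
      proof -
        have "2 * \<mu> * real (Suc h) \<le> 2 * (A * real n) * real (Suc h)" using \<mu>A by (intro mult_right_mono mult_left_mono) auto
        also have "\<dots> = (2 * A * real (Suc h)) * real n" by simp
        also have "\<dots> \<le> (real C + 1) * real n" using A n by (intro mult_right_mono) auto
        finally show ?thesis .
      qed
      have "US (Suc h) (1/2) n j - exp (?\<rho> * \<mu> * ((1 - s) - 1)) / (1 - s) ^ j \<le> pt (US (Suc h) (1/2) n) (?\<rho> * \<mu>)"
        by (rule depoissonize(2)) (use US_bounds[OF n(1), of "1/2"] US_mono[OF n(1), of "1/2"] \<rho> \<mu>0 s in auto)
      also have "\<dots> \<le> pt (US (Suc h) (1/2 - b) n) \<mu>" by (rule poisson_compare[OF b n(1) \<mu>0 C C2])
      also have "\<dots> \<le> US (Suc h) (1/2 - b) n m + exp (\<mu> * ((1 + s) - 1)) / (1 + s) ^ m"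
        by (rule depoissonize(1)) (use US_bounds[OF n(1) pp] US_mono[OF n(1) pp] \<mu>0 s in auto)
      finally have main: "US (Suc h) (1/2) n j \<le> US (Suc h) (1/2 - b) n m
          + exp (\<mu> * s) / (1 + s) ^ m + exp (- (?\<rho> * \<mu> * s)) / (1 - s) ^ j" by simp
      have e1: "exp (\<mu> * s) / (1 + s) ^ m \<le> exp (- (s * d / 2) * real n)"
      proof -
        have "s - s\<^sup>2 \<le> ln (1 + s)" using ln_one_plus_pos_lower_bound[of s] s by simp
        then have "exp (s - s\<^sup>2) \<le> 1 + s" using s by (simp add: ln_ge_iff)
        then have "exp (s - s\<^sup>2) ^ m \<le> (1 + s) ^ m" by (intro power_mono) auto
        then have "exp (real m * (s - s\<^sup>2)) \<le> (1 + s) ^ m" by (simp add: exp_of_nat_mult)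
        then have "exp (\<mu> * s) / (1 + s) ^ m \<le> exp (\<mu> * s) / exp (real m * (s - s\<^sup>2))"
          using s by (intro divide_left_mono mult_pos_pos zero_less_power) auto
        also have "\<dots> = exp (s\<^sup>2 * real m - s * d * real n)"
          unfolding exp_diff[symmetric] \<mu>_def by (simp add: algebra_simps)
        also have "\<dots> \<le> exp (- (s * d / 2) * real n)"
        proof -
          have "0 \<le> s * d * real n" using s d n by simp
          then show ?thesis using quad[OF m] by simp
        qed
        finally show ?thesis .
      qed
      have e2: "exp (- (?\<rho> * \<mu> * s)) / (1 - s) ^ j \<le> exp (- (s * d / 2) * real n)"
      proof -
        have "- s - 2 * s\<^sup>2 \<le> ln (1 - s)" using ln_one_minus_pos_lower_bound[of s] s by simp
        then have "exp (- s - 2 * s\<^sup>2) \<le> 1 - s" using s by (simp add: ln_ge_iff)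
        then have "exp (- s - 2 * s\<^sup>2) ^ j \<le> (1 - s) ^ j" by (intro power_mono) auto
        then have "exp (real j * (- s - 2 * s\<^sup>2)) \<le> (1 - s) ^ j" by (simp add: exp_of_nat_mult)
        then have "exp (- (?\<rho> * \<mu> * s)) / (1 - s) ^ j \<le> exp (- (?\<rho> * \<mu> * s)) / exp (real j * (- s - 2 * s\<^sup>2))"
          using s by (intro divide_left_mono mult_pos_pos zero_less_power) auto
        also have "\<dots> = exp (2 * (s\<^sup>2 * real j) - s * (?\<rho> * \<mu> - real j))"
          unfolding exp_diff[symmetric] by (simp add: algebra_simps)
        also have "\<dots> \<le> exp (- (s * d / 2) * real n)"
        proof -
          have "s * (d * real n) \<le> s * (?\<rho> * \<mu> - real j)" using \<rho>\<mu> s by (intro mult_left_mono) auto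
          then show ?thesis using quad[OF jA] by simp
        qed
        finally show ?thesis .
      qed
      have "exp (- (s * d / 2) * real n) < d" using elim by simp
      then show "US (Suc h) (1/2) n j \<le> US (Suc h) (1/2 - b) n m + \<delta>"
        using main e1 e2 unfolding d_def by linarith
    qed
  qed
qed

section \<open>Bounds on the unbiased threshold\<close>

text \<open>For functionals that one clause multiplies by at most \<open>l\<close> on average: the
  survival of an assignment and an exponential moment.\<close>

lemma COp_pow_geometric_le:
  assumes p: "0 \<le> p" "p \<le> 1" and g: "\<And>X. 0 \<le> g X" and l: "0 \<le> l"
    and step: "\<And>X. COp n k p g X \<le> l * g X"
  shows "(COp n k p ^^ m) g X \<le> l ^ m * g X"
proof (induction m arbitrary: X)
  case (Suc m)
  have "(COp n k p ^^ Suc m) g X = (COp n k p ^^ m) (COp n k p g) X" unfolding COp_def Op_pow_Suc' ..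
  also have "\<dots> \<le> (COp n k p ^^ m) (\<lambda>X. l * g X) X"
    unfolding COp_def by (rule Op_pow_mono) (use step p cw_nonneg in \<open>auto simp: COp_def\<close>)
  also have "\<dots> = l * (COp n k p ^^ m) g X" unfolding COp_def Op_pow_cmult ..
  also have "\<dots> \<le> l * (l ^ m * g X)" by (intro mult_left_mono Suc.IH l)
  finally show ?case by (simp add: mult.assoc)
qed simp

definition sat_by :: "(nat \<Rightarrow> bool) \<Rightarrow> clause set \<Rightarrow> real" where
  "sat_by \<sigma> X = of_bool (\<forall>C\<in>X. satisfies_clause \<sigma> C)"

lemma sum_cw_satisfied:
  assumes k: "k \<le> n"
  shows "(\<Sum>c\<in>CL {..<n} k. cw n k (1/2) c * of_bool (satisfies_clause \<sigma> c)) = 1 - 1 / 2 ^ k"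
proof -
  \<comment> \<open>With these weights \<open>lw a\<close> keeps only clauses falsified by \<sigma>,
    and each variable has total weight 1/2.\<close>
  define a where "a l = (if snd l = \<sigma> (fst l) then 0 else 1/2 :: real)" for l
  have eq: "cw n k (1/2) c * of_bool (satisfies_clause \<sigma> c) = cw n k (1/2) c - lw a c / real (n choose k)"
    if c: "c \<in> CL {..<n} k" for c
  proof -
    have fin: "finite c" using CL_finite_clause[OF _ c] by simp
    have pol: "pol (1/2) = (\<lambda>_. 1/2)" by (auto simp: pol_def fun_eq_iff)
    show ?thesis
    proof (cases "satisfies_clause \<sigma> c")
      case True
      then have "\<exists>l\<in>c. a l = 0" unfolding satisfies_clause_def a_def by (force split: prod.splits)
      then have "lw a c = 0" unfolding lw_def using fin by simp
      then show ?thesis using True by simp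
    next
      case False
      then have "a l = 1/2" if "l \<in> c" for l using that by (force simp: satisfies_clause_def a_def)
      then have "lw a c = lw (\<lambda>_. 1/2) c" by (rule lw_cong)
      then show ?thesis using False by (simp add: cw_def pol)
    qed
  qed
  have "(\<Sum>c\<in>CL {..<n} k. lw a c) = real (n choose k) * (1/2) ^ k"
    using sum_lw_CL[of "{..<n}" a "1/2" k] by (auto simp: a_def)
  then show ?thesis
    using sum_cw[OF k, of "1/2"] k
    by (simp add: eq sum_subtractf sum_divide_distrib[symmetric] power_one_over cong: sum.cong)
qed

text \<open>The expected number of satisfying assignments; each of the \<open>2 ^ n\<close>
  assignments survives a clause with probability \<open>1 - 1 / 2 ^ k\<close>.\<close>

lemma sat_first_moment:
  assumes k: "k \<le> n"
  shows "1 - US k (1/2) n m \<le> 2 ^ n * (1 - 1 / 2 ^ k) ^ m"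
proof -
  let ?C = "CL {..<n} k"
  have "1 - US k (1/2) n m = (COp n k (1/2) ^^ m) (\<lambda>X. 1 - uind X) {}"
    unfolding US_def COp_def Op_pow_diff_fun Op_pow_const[OF sum_cw[OF k]] by simp
  also have "\<dots> \<le> (COp n k (1/2) ^^ m) (\<lambda>X. \<Sum>A\<in>Pow {..<n}. 1 * sat_by (\<lambda>x. x \<in> A) X) {}"
    unfolding COp_def
  proof (rule Op_pow_mono_inv[where Q="\<lambda>X. X \<subseteq> ?C"])
    fix X assume X: "X \<subseteq> ?C"
    show "1 - uind X \<le> (\<Sum>A\<in>Pow {..<n}. 1 * sat_by (\<lambda>x. x \<in> A) X)"
    proof (cases "unsat X")
      case True
      then show ?thesis by (auto simp: uind_def sat_by_def intro!: sum_nonneg)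
    next
      case False
      then obtain \<sigma> where \<sigma>: "\<forall>C\<in>X. satisfies_clause \<sigma> C" by (auto simp: unsat_def)
      define A where "A = {x. x < n \<and> \<sigma> x}"
      have "satisfies_clause (\<lambda>x. x \<in> A) C" if C: "C \<in> X" for C
      proof -
        obtain x s where xs: "(x, s) \<in> C" "\<sigma> x = s" using \<sigma> C by (auto simp: satisfies_clause_def)
        then have "x < n" using X C by (auto simp: CL_def)
        then show ?thesis using xs by (auto simp: satisfies_clause_def A_def)
      qed
      then have "1 = sat_by (\<lambda>x. x \<in> A) X" by (simp add: sat_by_def)
      also have "\<dots> \<le> (\<Sum>A\<in>Pow {..<n}. sat_by (\<lambda>x. x \<in> A) X)"
        by (rule member_le_sum) (auto simp: A_def sat_by_def)
      finally show ?thesis using uind_nonneg[of X] by (simp only: mult_1)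
    qed
  qed (use cw_nonneg in auto)
  also have "\<dots> = (\<Sum>A\<in>Pow {..<n}. (COp n k (1/2) ^^ m) (sat_by (\<lambda>x. x \<in> A)) {})"
    unfolding COp_def Op_pow_sum by simp
  also have "\<dots> \<le> (\<Sum>A\<in>Pow {..<n}. (1 - 1 / 2 ^ k) ^ m * sat_by (\<lambda>x. x \<in> A) {})"
  proof (intro sum_mono COp_pow_geometric_le)
    fix A X
    have ins: "sat_by (\<lambda>x. x \<in> A) (insert c X) = of_bool (satisfies_clause (\<lambda>x. x \<in> A) c) * sat_by (\<lambda>x. x \<in> A) X" for c
      by (simp add: sat_by_def)
    have "COp n k (1/2) (sat_by (\<lambda>x. x \<in> A)) X
      = (\<Sum>c\<in>?C. cw n k (1/2) c * of_bool (satisfies_clause (\<lambda>x. x \<in> A) c)) * sat_by (\<lambda>x. x \<in> A) X"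
      unfolding COp_def Op_def ins sum_distrib_right by (simp add: mult.assoc)
    then show "COp n k (1/2) (sat_by (\<lambda>x. x \<in> A)) X \<le> (1 - 1 / 2 ^ k) * sat_by (\<lambda>x. x \<in> A) X"
      unfolding sum_cw_satisfied[OF k] by simp
  qed (auto simp: sat_by_def)
  also have "\<dots> = 2 ^ n * (1 - 1 / 2 ^ k) ^ m"
    by (simp add: sat_by_def card_Pow)
  finally show ?thesis .
qed

text \<open>In an unsatisfiable subset of least cardinality every variable lies in two clauses: if
  only one clause contained \<open>x\<close>, a solution of the others could be changed at
  \<open>x\<close> to satisfy it. Counting incidences of variables and clauses gives the
  bound.\<close>

lemma minimal_unsat_core:
  assumes X: "finite V" "X \<subseteq> CL V k" "unsat X"
  obtains Y where "Y \<subseteq> X" "Y \<noteq> {}" "2 * card (\<Union>C\<in>Y. fst ` C) \<le> k * card Y"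
proof -
  have finX: "finite X" using X finite_subset finite_CL by blast
  obtain Y where Y: "Y \<subseteq> X" "unsat Y" and min: "\<And>Z. Z \<subseteq> X \<Longrightarrow> unsat Z \<Longrightarrow> card Y \<le> card Z"
    using ex_has_least_nat[of "\<lambda>Y. Y \<subseteq> X \<and> unsat Y" X card] X(3) by auto
  have finY: "finite Y" using Y finX finite_subset by blast
  have finC: "finite C" if "C \<in> Y" for C using CL_finite_clause[OF X(1), of C k] that Y X by blast
  have "Y \<noteq> {}" using Y by (auto simp: unsat_def)
  moreover have "2 * card (\<Union>C\<in>Y. fst ` C) \<le> k * card Y"
  proof -
    let ?U = "\<Union>C\<in>Y. fst ` C"
    have deg: "2 \<le> card {C\<in>Y. x \<in> fst ` C}" if x: "x \<in> ?U" for x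
    proof (rule ccontr)
      assume lt: "\<not> 2 \<le> card {C\<in>Y. x \<in> fst ` C}"
      obtain C s where C: "C \<in> Y" "(x, s) \<in> C" using x by force
      have only: "C' = C" if "C' \<in> Y" "x \<in> fst ` C'" for C'
      proof (rule ccontr)
        assume "C' \<noteq> C"
        then have "card {C', C} \<le> card {C\<in>Y. x \<in> fst ` C}"
          using C that finY by (intro card_mono) force+
        then show False using lt \<open>C' \<noteq> C\<close> by simp
      qed
      have "card (Y - {C}) < card Y" using C finY by (intro psubset_card_mono) auto
      then have "\<not> unsat (Y - {C})" using min[of "Y - {C}"] Y by auto
      then obtain \<sigma> where \<sigma>: "\<And>D. D \<in> Y - {C} \<Longrightarrow> satisfies_clause \<sigma> D" by (auto simp: unsat_def)
      have "satisfies_clause (\<sigma>(x := s)) D" if D: "D \<in> Y" for D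
      proof (cases "D = C")
        case True
        then show ?thesis unfolding satisfies_clause_def using C by (intro bexI[of _ "(x, s)"]) simp_all
      next
        case False
        then have nx: "x \<notin> fst ` D" using only D by blast
        obtain y t where "(y, t) \<in> D" "\<sigma> y = t" using \<sigma>[of D] D False by (auto simp: satisfies_clause_def)
        moreover then have "y \<noteq> x" using nx by force
        ultimately show ?thesis unfolding satisfies_clause_def by (intro bexI[of _ "(y, t)"]) simp_all
      qed
      then show False using Y(2) by (auto simp: unsat_def)
    qed
    have "2 * card ?U = (\<Sum>x\<in>?U. 2)" by simp
    also have "\<dots> \<le> (\<Sum>x\<in>?U. card {C\<in>Y. x \<in> fst ` C})" by (intro sum_mono deg)
    also have "\<dots> = (\<Sum>x\<in>?U. \<Sum>C\<in>Y. if x \<in> fst ` C then 1 else 0)"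
      using finY by (simp only: sum.inter_filter[symmetric] card_eq_sum)
    also have "\<dots> = (\<Sum>C\<in>Y. \<Sum>x\<in>?U. if x \<in> fst ` C then 1 else 0)" by (rule sum.swap)
    also have "\<dots> = (\<Sum>C\<in>Y. card (fst ` C))"
    proof (intro sum.cong refl)
      fix C assume C: "C \<in> Y"
      have "finite ?U" using finY finC by auto
      moreover have "?U \<inter> fst ` C = fst ` C" using C by auto
      ultimately show "(\<Sum>x\<in>?U. if x \<in> fst ` C then 1 else 0) = card (fst ` C)"
        by (simp add: sum.If_cases)
    qed
    also have "\<dots> = (\<Sum>C\<in>Y. k)"
      using Y X by (intro sum.cong refl) (auto simp: CL_def card_image)
    finally show ?thesis by (simp add: mult.commute)
  qed
  ultimately show ?thesis using that Y by blast
qed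

text \<open>The left side is a single term in the expansion of
  \<open>(1 + w / n) ^ n\<close>.\<close>

lemma choose_le_exp:
  assumes "0 < w" "w \<le> n"
  shows "real (n choose w) * (real w / real n) ^ w \<le> exp (real w)"
proof -
  have "real (n choose w) * (real w / real n) ^ w \<le> (\<Sum>i\<le>n. real (n choose i) * (real w / real n) ^ i * 1 ^ (n - i))"
    using member_le_sum[of w "{..n}" "\<lambda>i. real (n choose i) * (real w / real n) ^ i"] assms by simp
  also have "\<dots> = (real w / real n + 1) ^ n" by (rule binomial_ring[symmetric])
  also have "\<dots> \<le> exp (real w / real n) ^ n" by (intro power_mono) (use exp_ge_add_one_self[of "real w / real n"] in \<open>auto simp: add.commute\<close>)
  also have "\<dots> = exp (real w)" using assms by (simp add: exp_of_nat_mult[symmetric])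
  finally show ?thesis .
qed

text \<open>A minimal unsatisfiable core of \<open>s\<close> clauses lives on at most \<open>k s / 2\<close> variables.  The union bound over
such sets of variables uses \<open>z\<close> to the number of clauses inside the set as an exponential moment.\<close>

lemma unsat_low_density:
  assumes k: "2 \<le> k" "k \<le> n" and m: "4 * (exp (real k + 1) * real k * real m) \<le> real n"
  shows "US k (1/2) n m \<le> 1/3"
proof (cases "m = 0")
  case False
  define w where "w s = min n (k * s div 2)" for s
  define u where "u s = real (w s) / real n" for s
  \<comment> \<open>The mean number of clauses inside \<open>w s\<close> variables is at most
    \<open>m * u s ^ k\<close>. The base is the ratio of the required number \<open>s\<close> to
    this bound, so the exponential moment is at most \<open>exp s\<close>.\<close>
  define z where "z s = real s / (real m * u s ^ k)" for s
  let ?C = "CL {..<n} k"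
  let ?W = "\<lambda>s. {W. W \<subseteq> {..<n} \<and> card W = w s}"
  let ?g = "\<lambda>z W X. z ^ card (X \<inter> CL W k) :: real"
  have n0: "0 < real n" using k by simp
  have finW: "finite W" if "W \<in> ?W s" for W s using that finite_subset[of W "{..<n}"] by auto
  have ws: "1 \<le> w s" "real (w s) \<le> real k * real s" "s \<le> k * s - w s" if s: "s \<in> {1..n}" for s
  proof -
    have s1: "1 \<le> s" using s by simp
    have "2 * s \<le> k * s" using k by simp
    moreover have "w s \<le> k * s div 2" by (simp add: w_def)
    ultimately show "s \<le> k * s - w s" by linarith
    have "1 \<le> k * s div 2" using \<open>2 * s \<le> k * s\<close> s1 by linarith
    then show "1 \<le> w s" using k by (simp add: w_def)
    have "w s \<le> k * s" using \<open>w s \<le> k * s div 2\<close> by linarith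
    then show "real (w s) \<le> real k * real s" unfolding of_nat_mult[symmetric] of_nat_le_iff .
  qed
  have us: "0 < u s" "u s \<le> 1" "u s \<le> real k * real s / real n" if s: "s \<in> {1..n}" for s
    using ws[OF s] n0 by (auto simp: u_def w_def divide_right_mono)
  have mk: "real m * real k \<le> real n"
  proof -
    have "1 * (real k * real m) \<le> exp (real k + 1) * (real k * real m)" by (intro mult_right_mono) auto
    then show ?thesis using m by (simp add: mult_ac)
  qed
  have z1: "1 \<le> z s" if s: "s \<in> {1..n}" for s
  proof -
    have "u s ^ k \<le> u s" using us[OF s] k power_decreasing[of 1 k "u s"] by simp
    then have "real m * u s ^ k \<le> real m * (real k * real s / real n)" using us[OF s] by (intro mult_left_mono) auto
    also have "\<dots> = (real m * real k) * real s / real n" by simp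
    also have "\<dots> \<le> real n * real s / real n" using mk by (intro divide_right_mono mult_right_mono) auto
    finally have "real m * u s ^ k \<le> real s" using n0 by simp
    then show ?thesis using False us[OF s] by (simp add: z_def le_divide_eq)
  qed
  have z0 [simp]: "0 \<le> z s" for s by (simp add: z_def u_def)
  have cover: "uind X \<le> (\<Sum>s\<in>{1..n}. 1 * (\<Sum>W\<in>?W s. 1 / z s ^ s * ?g (z s) W X))" if X: "X \<subseteq> ?C" for X
  proof (cases "unsat X")
    case False
    then show ?thesis by (auto simp: uind_def intro!: sum_nonneg divide_nonneg_nonneg)
  next
    case True
    obtain Y where Y: "Y \<subseteq> X" "Y \<noteq> {}" "2 * card (\<Union>C\<in>Y. fst ` C) \<le> k * card Y"
      using minimal_unsat_core[OF _ X True] by auto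
    let ?U = "\<Union>C\<in>Y. fst ` C"
    have finY: "finite Y" using Y X finite_subset[of Y ?C] by auto
    have U: "?U \<subseteq> {..<n}" using Y X by (fastforce simp: CL_def)
    \<comment> \<open>A core may have more than \<open>n\<close> clauses. Then \<open>s = n\<close>
      and \<open>w s = n\<close>, so the set of all variables covers it.\<close>
    define s where "s = min (card Y) n"
    have s: "s \<in> {1..n}" using Y finY n0 by (auto simp: s_def Suc_le_eq card_gt_0_iff)
    have "card ?U \<le> w s"
    proof (cases "card Y \<le> n")
      case True
      then show ?thesis using Y(3) card_mono[OF _ U] by (auto simp: w_def s_def)
    next
      case False
      have "2 * n \<le> k * n" using k by simp
      then have "n \<le> k * n div 2" by linarith
      then show ?thesis using False card_mono[OF _ U] by (auto simp: w_def s_def)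
    qed
    then obtain W where W: "?U \<subseteq> W" "W \<subseteq> {..<n}" "card W = w s"
      using exists_subset_between[of ?U "w s" "{..<n}"] U by (auto simp: w_def)
    have finCW: "finite (CL W k)" using W finite_subset[of W "{..<n}"] by auto
    have "Y \<subseteq> CL W k"
    proof
      fix C assume C: "C \<in> Y"
      then have "C \<in> ?C" using Y X by blast
      moreover have "fst ` C \<subseteq> W" using C W by blast
      then have "C \<subseteq> W \<times> UNIV" by force
      ultimately show "C \<in> CL W k" by (simp add: CL_def)
    qed
    then have "s \<le> card (X \<inter> CL W k)"
      using card_mono[of "X \<inter> CL W k" Y] Y finCW by (auto simp: s_def)
    then have "z s ^ s \<le> ?g (z s) W X" using z1[OF s] by (intro power_increasing)
    then have "uind X \<le> 1 / z s ^ s * ?g (z s) W X" using z1[OF s] by (simp add: uind_def True)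
    also have "\<dots> \<le> (\<Sum>W\<in>?W s. 1 / z s ^ s * ?g (z s) W X)"
      by (rule member_le_sum) (use W in auto)
    also have "\<dots> \<le> (\<Sum>s\<in>{1..n}. \<Sum>W\<in>?W s. 1 / z s ^ s * ?g (z s) W X)"
      by (rule member_le_sum[OF s]) (auto intro!: sum_nonneg)
    finally show ?thesis by simp
  qed
  have one: "(COp n k (1/2) ^^ m) (?g (z s) W) {} \<le> exp (real s)" if s: "s \<in> {1..n}" and W: "W \<in> ?W s" for s W
  proof -
    define q where "q = (\<Sum>c\<in>CL W k. cw n k (1/2) c)"
    have q: "0 \<le> q" "q \<le> u s ^ k"
    proof -
      show "0 \<le> q" unfolding q_def by (intro sum_nonneg cw_nonneg) auto
      have "q = real (w s choose k) / real (n choose k)"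
        unfolding q_def cw_def sum_divide_distrib[symmetric]
        by (subst sum_lw_CL[where A=1]) (use W finW[OF W] in auto)
      also have "\<dots> \<le> u s ^ k" using binomial_ratio_le[of "w s" n k] k n0
        by (simp add: u_def w_def power_divide divide_le_eq le_divide_eq mult.commute)
      finally show "q \<le> u s ^ k" .
    qed
    have "(COp n k (1/2) ^^ m) (?g (z s) W) {} \<le> (1 + q * (z s - 1)) ^ m * ?g (z s) W {}"
    proof (rule COp_pow_geometric_le)
      fix X
      have sub: "CL W k \<subseteq> ?C" using W by (intro CL_mono) auto
      have "COp n k (1/2) (?g (z s) W) X \<le> (\<Sum>c\<in>?C. cw n k (1/2) c * (?g (z s) W X + (if c \<in> CL W k then (z s - 1) * ?g (z s) W X else 0)))"
        unfolding COp_def Op_def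
      proof (intro sum_mono mult_left_mono)
        fix c
        have fin: "finite (X \<inter> CL W k)" using finW[OF W] by simp
        show "?g (z s) W (insert c X) \<le> ?g (z s) W X + (if c \<in> CL W k then (z s - 1) * ?g (z s) W X else 0)"
        proof (cases "c \<in> CL W k")
          case True
          then have "insert c X \<inter> CL W k = insert c (X \<inter> CL W k)" by auto
          then have "card (insert c X \<inter> CL W k) \<le> Suc (card (X \<inter> CL W k))" using card_insert_le_m1[of "Suc (card (X \<inter> CL W k))" "X \<inter> CL W k" c] by simp
          then have "?g (z s) W (insert c X) \<le> z s ^ Suc (card (X \<inter> CL W k))" using z1[OF s] by (intro power_increasing)
          then show ?thesis using True by (simp add: left_diff_distrib)
        qed simp
      qed (use cw_nonneg in auto)
      also have "\<dots> = (1 + q * (z s - 1)) * ?g (z s) W X"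
      proof -
        have "(\<Sum>c\<in>?C. cw n k (1/2) c * (if c \<in> CL W k then (z s - 1) * ?g (z s) W X else 0)) = q * ((z s - 1) * ?g (z s) W X)"
          unfolding q_def sum_distrib_right using sub
          by (intro sum.mono_neutral_cong_right) auto
        then show ?thesis using sum_cw[OF k(2), of "1/2"]
          by (simp add: distrib_left sum.distrib sum_distrib_right[symmetric] distrib_right)
      qed
      finally show "COp n k (1/2) (?g (z s) W) X \<le> (1 + q * (z s - 1)) * ?g (z s) W X" .
    qed (use q z1[OF s] in auto)
    also have "\<dots> \<le> exp (u s ^ k * z s) ^ m"
    proof -
      have "q * (z s - 1) \<le> u s ^ k * z s" using q z1[OF s] by (intro mult_mono) auto
      then have "1 + q * (z s - 1) \<le> exp (u s ^ k * z s)" using exp_ge_add_one_self[of "u s ^ k * z s"] by linarith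
      then show ?thesis using q z1[OF s] by (simp add: power_mono)
    qed
    also have "\<dots> = exp (real s)" using False us[OF s] by (simp add: exp_of_nat_mult[symmetric] z_def)
    finally show ?thesis .
  qed
  have "US k (1/2) n m \<le> (COp n k (1/2) ^^ m) (\<lambda>X. \<Sum>s\<in>{1..n}. 1 * (\<Sum>W\<in>?W s. 1 / z s ^ s * ?g (z s) W X)) {}"
    unfolding US_def COp_def
    by (rule Op_pow_mono_inv[where Q="\<lambda>X. X \<subseteq> ?C"]) (use cover cw_nonneg in auto)
  also have "\<dots> = (\<Sum>s\<in>{1..n}. \<Sum>W\<in>?W s. 1 / z s ^ s * (COp n k (1/2) ^^ m) (?g (z s) W) {})"
    unfolding COp_def Op_pow_sum by simp
  also have "\<dots> \<le> (\<Sum>s\<in>{1..n}. \<Sum>W\<in>?W s. 1 / z s ^ s * exp (real s))"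
    by (intro sum_mono mult_left_mono one) auto
  also have "\<dots> = (\<Sum>s\<in>{1..n}. real (n choose w s) * (1 / z s ^ s * exp (real s)))"
    using n_subsets[of "{..<n}"] by simp
  also have "\<dots> \<le> (\<Sum>s\<in>{1..n}. (1/4) ^ s)"
  proof (rule sum_mono)
    fix s assume s: "s \<in> {1..n}"
    have "1 / z s ^ s = (real m / real s) ^ s * u s ^ (k * s)"
      by (simp add: z_def power_divide power_mult_distrib power_mult)
    also have "u s ^ (k * s) = u s ^ w s * u s ^ (k * s - w s)"
    proof -
      have "w s \<le> k * s" using ws(2)[OF s] unfolding of_nat_mult[symmetric] of_nat_le_iff .
      then have "w s + (k * s - w s) = k * s" by (rule le_add_diff_inverse)
      then show ?thesis unfolding power_add[symmetric] by simp
    qed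
    \<comment> \<open>Of the \<open>k * s\<close> factors \<open>u s\<close>, the binomial
      coefficient consumes \<open>w s\<close>, at most half of them; for \<open>k \<ge> 2\<close> at
      least \<open>s\<close> are left.\<close>
    also have "u s ^ (k * s - w s) \<le> u s ^ s" using ws[OF s] us[OF s] by (intro power_decreasing) auto
    also have "\<dots> \<le> (real k * real s / real n) ^ s" using us[OF s] by (intro power_mono) auto
    finally have "1 / z s ^ s \<le> (real m / real s) ^ s * (u s ^ w s * (real k * real s / real n) ^ s)"
      using us[OF s] by (simp add: mult_left_mono)
    also have "\<dots> = u s ^ w s * (real m / real s * (real k * real s / real n)) ^ s"
      by (simp only: power_mult_distrib mult_ac)
    also have "real m / real s * (real k * real s / real n) = real k * real m / real n" using s by simp
    finally have "real (n choose w s) * (1 / z s ^ s * exp (real s))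
      \<le> real (n choose w s) * (u s ^ w s * (real k * real m / real n) ^ s * exp (real s))"
      by (intro mult_left_mono mult_right_mono) auto
    also have "\<dots> = (real (n choose w s) * u s ^ w s) * ((real k * real m / real n) ^ s * exp (real s))" by simp
    also have "\<dots> \<le> exp (real k * real s) * ((real k * real m / real n) ^ s * exp (real s))"
    proof (intro mult_right_mono)
      have "real (n choose w s) * u s ^ w s \<le> exp (real (w s))"
        unfolding u_def by (rule choose_le_exp) (use ws[OF s] in \<open>auto simp: w_def\<close>)
      also have "\<dots> \<le> exp (real k * real s)" using ws[OF s] by simp
      finally show "real (n choose w s) * u s ^ w s \<le> exp (real k * real s)" .
    qed auto
    also have "\<dots> = (exp (real k + 1) * real k * real m / real n) ^ s"
    proof -
      have "exp (real k * real s) = exp (real k) ^ s" "exp (real s) = exp 1 ^ s"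
        using exp_of_nat2_mult[of "real k" s] exp_of_nat2_mult[of 1 s] by simp_all
      then show ?thesis by (simp only: exp_add power_mult_distrib[symmetric]) (simp only: mult_ac times_divide_eq_right times_divide_eq_left)
    qed
    also have "\<dots> \<le> (1/4) ^ s" using m n0 by (intro power_mono) (auto simp: divide_le_eq)
    finally show "real (n choose w s) * (1 / z s ^ s * exp (real s)) \<le> (1/4) ^ s" .
  qed
  also have "\<dots> \<le> 1/3"
  proof -
    have "(\<Sum>s\<in>{1..n}. (1/4 :: real) ^ s) = (\<Sum>s<n. (1/4) ^ Suc s)"
      by (rule sum.reindex_bij_witness[where i=Suc and j="\<lambda>s. s - 1"]) auto
    also have "\<dots> = 1/4 * (\<Sum>s<n. (1/4) ^ s)" by (simp add: sum_distrib_left)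
    also have "(\<Sum>s<n. (1/4 :: real) ^ s) = (1 - (1/4) ^ n) / (3/4)"
      using sum_gp_strict[of "1/4 :: real" n] by simp
    also have "1/4 * ((1 - (1/4 :: real) ^ n) / (3/4)) \<le> 1/3" by simp
    finally show ?thesis .
  qed
  finally show ?thesis .
qed simp

section \<open>The ratio of the thresholds\<close>

text \<open>This turns small errors in probability into small errors in density.\<close>

lemma US_slope:
  assumes kn: "k \<le> n" and jl: "j \<le> l" and lo: "1/4 \<le> US k (1/2) n j" and hi: "US k (1/2) n l \<le> 3/4"
  shows "real (l - j) * (3 / (16 * real l)) \<le> US k (1/2) n l - US k (1/2) n j"
  using jl hi
proof (induction rule: dec_induct)
  case (step i)
  let ?U = "US k (1/2) n"
  have mono: "?U m \<le> ?U m'" if "m \<le> m'" for m m' using US_mono[OF kn _ _ that, of "1/2"] by simp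
  have "real (i - j) * (3 / (16 * real (Suc i))) \<le> real (i - j) * (3 / (16 * real i))"
    by (cases "i = 0") (auto intro!: mult_left_mono divide_left_mono)
  also have "\<dots> \<le> ?U i - ?U j" using step mono[of i "Suc i"] by simp
  finally have 1: "real (i - j) * (3 / (16 * real (Suc i))) \<le> ?U i - ?U j" .
  \<comment> \<open>Between these levels \<open>U * (1 - U)\<close> is at least 3/16, so by the
    Poincare inequality each clause raises \<open>U\<close> by a definite amount.\<close>
  have "1/4 \<le> ?U (Suc i)" "?U (Suc i) \<le> 3/4" using lo mono[of j "Suc i"] step by auto
  then have "0 \<le> (?U (Suc i) - 1/4) * (3/4 - ?U (Suc i))" by simp
  then have "3/16 \<le> ?U (Suc i) * (1 - ?U (Suc i))" by (simp add: algebra_simps)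
  also have "\<dots> \<le> real (Suc i) * (?U (Suc i) - ?U (Suc i - 1))"
    unfolding US_def COp_def
  proof (rule Op_pow_poincare)
    show "uind X = 0 \<or> uind X = 1" for X by (simp add: uind_def)
  qed (use kn in \<open>auto simp: cw_nonneg sum_cw uind_mono\<close>)
  finally have "3 / (16 * real (Suc i)) \<le> ?U (Suc i) - ?U i"
    by (simp add: field_simps del: of_nat_Suc)
  moreover have "real (Suc i - j) = real (i - j) + 1" using step by (simp add: Suc_diff_le)
  ultimately show ?case using 1 by (simp only: distrib_right mult_1_left)
qed simp

section \<open>Comparison of the thresholds at finite n\<close>

lemma alpha_n_US:
  assumes "k \<le> n" "0 \<le> p" "p \<le> 1"
  shows "alpha_n k p n = Inf {ereal (real m / real n) |m. 1/2 \<le> US k p n m}"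
  unfolding alpha_n_def prob_sat_eq[OF assms] by (simp add: algebra_simps)

lemma alpha_n_le:
  assumes "k \<le> n" "0 \<le> p" "p \<le> 1" "1/2 \<le> US k p n m"
  shows "alpha_n k p n \<le> ereal (real m / real n)"
  unfolding alpha_n_US[OF assms(1-3)] using assms(4) by (intro Inf_lower) auto

lemma alpha_n_ge:
  assumes kn: "k \<le> n" "0 \<le> p" "p \<le> 1" and n: "0 < n" and x: "\<And>m. real m < x * real n \<Longrightarrow> US k p n m < 1/2"
  shows "ereal x \<le> alpha_n k p n"
  unfolding alpha_n_US[OF kn]
proof (rule Inf_greatest)
  fix y assume "y \<in> {ereal (real m / real n) |m. 1/2 \<le> US k p n m}"
  then obtain m where m: "y = ereal (real m / real n)" "1/2 \<le> US k p n m" by blast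
  then have "x * real n \<le> real m" using x[of m] by force
  then show "ereal x \<le> y" using m n by (simp add: le_divide_eq)
qed

lemma unbiased_threshold:
  fixes k n :: nat
  assumes k: "2 \<le> k" "k \<le> n" and n: "6 \<le> n"
  obtains s where "1/2 \<le> US k (1/2) n s" "\<And>m. m < s \<Longrightarrow> US k (1/2) n m < 1/2"
    "alpha_n k (1/2) n = ereal (real s / real n)" "real s \<le> 2 ^ k * real n"
    "1 / (4 * (exp (real k + 1) * real k)) \<le> real s / real n"
proof -
  let ?U = "US k (1/2) n"
  have n0: "0 < real n" using n by simp
  have top: "1/2 \<le> ?U (2 ^ k * n)"
  proof -
    have "1 - ?U (2 ^ k * n) \<le> 2 ^ n * (1 - 1 / 2 ^ k) ^ (2 ^ k * n)" by (rule sat_first_moment[OF k(2)])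
    also have "\<dots> \<le> 2 ^ n * exp (- (1 / 2 ^ k)) ^ (2 ^ k * n)"
      using exp_ge_add_one_self[of "- (1 / 2 ^ k) :: real"] by (intro mult_left_mono power_mono) auto
    also have "exp (- (1 / 2 ^ k) :: real) ^ (2 ^ k * n) = exp (- 1) ^ n"
      by (simp add: exp_of_nat_mult[symmetric])
    also have "2 ^ n * exp (- 1 :: real) ^ n = (2 / exp 1) ^ n"
      by (simp only: power_mult_distrib[symmetric] exp_minus divide_inverse)
    \<comment> \<open>The square of \<open>exp (1/2) \<ge> 3/2\<close> bounds
      \<open>2 / exp 1\<close> by 8/9, whose sixth power is below 1/2; hence the assumption
      \<open>6 \<le> n\<close>.\<close>
    also have "\<dots> \<le> (8/9) ^ n"
    proof (rule power_mono)
      have "(3/2)\<^sup>2 \<le> (exp (1/2 :: real))\<^sup>2" using exp_ge_add_one_self[of "1/2"] by (intro power_mono) auto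
      also have "\<dots> = exp 1" by (simp add: exp_of_nat_mult[symmetric])
      finally show "2 / exp 1 \<le> (8/9 :: real)" by (simp add: divide_le_eq power2_eq_square)
    qed simp
    also have "\<dots> \<le> (8/9) ^ 6" using n by (intro power_decreasing) auto
    also have "\<dots> \<le> (1/2 :: real)" by (simp add: power_divide)
    finally show ?thesis by simp
  qed
  define s where "s = (LEAST m. 1/2 \<le> ?U m)"
  have s1: "1/2 \<le> ?U s" unfolding s_def by (rule LeastI[of "\<lambda>m. 1/2 \<le> ?U m"], rule top)
  have s2: "?U m < 1/2" if "m < s" for m using not_less_Least[of m "\<lambda>m. 1/2 \<le> ?U m"] that unfolding s_def by simp
  have "s \<le> 2 ^ k * n" unfolding s_def by (rule Least_le[of "\<lambda>m. 1/2 \<le> ?U m", OF top])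
  then have s3: "real s \<le> 2 ^ k * real n" by (simp flip: of_nat_le_iff[where 'a=real])
  have s4: "alpha_n k (1/2) n = ereal (real s / real n)"
  proof (rule antisym)
    show "alpha_n k (1/2) n \<le> ereal (real s / real n)" by (rule alpha_n_le) (use k s1 in auto)
    show "ereal (real s / real n) \<le> alpha_n k (1/2) n"
      by (rule alpha_n_ge) (use k n s2 in auto)
  qed
  have s5: "1 / (4 * (exp (real k + 1) * real k)) \<le> real s / real n"
  proof (rule ccontr)
    assume "\<not> ?thesis"
    then have "4 * (exp (real k + 1) * real k * real s) \<le> real n"
      using n0 k by (simp add: field_simps)
    from unsat_low_density[OF k this] s1 show False by simp
  qed
  show ?thesis using that s1 s2 s3 s4 s5 by blast
qed

lemma alpha_n_lower:
  fixes h :: nat and b \<delta> :: real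
  assumes h: "2 \<le> h" and b: "0 \<le> b" "b \<le> 1/4" "1/2 \<le> exp (- (2 * real (Suc h) * b\<^sup>2))" and \<delta>: "0 < \<delta>"
  shows "\<forall>\<^sub>F n in sequentially.
    ereal (exp (2 * real (Suc h) * b\<^sup>2)) * alpha_n (Suc h) (1/2) n \<le> alpha_n (Suc h) (1/2 - b) n + ereal \<delta>"
proof -
  define k where "k = Suc h"
  define E where "E = exp (2 * real k * b\<^sup>2)"
  define \<tau> where "\<tau> = exp (- (2 * real k * b\<^sup>2))"
  have E\<tau>: "E * \<tau> = 1" "0 < E" "0 < \<tau>" by (simp_all add: E_def \<tau>_def exp_minus)
  define d where "d = \<tau> * \<delta>"
  have d: "0 < d" using E\<tau> \<delta> by (simp add: d_def)
  \<comment> \<open>The last bound is the drop that \<open>US_slope\<close> guarantees over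
    \<open>d * n / 4\<close> clauses at density at most \<open>2 ^ k\<close>; the first serves when
    the probability is already below 1/4.\<close>
  define \<gamma> where "\<gamma> = min (1/8) (min (d / 4) (3 * d / (64 * 2 ^ k)))"
  have \<gamma>: "0 < \<gamma>" "\<gamma> \<le> 1/8" "\<gamma> \<le> d / 4" "\<gamma> \<le> 3 * d / (64 * 2 ^ k)" using d by (auto simp: \<gamma>_def)
  have A0: "0 \<le> E * 2 ^ k" using E\<tau> by simp
  have "\<forall>\<^sub>F n::nat in sequentially. 4 / d \<le> real n" by real_asymp
  then show ?thesis
    using biased_unsat_le[OF h b \<gamma>(1) A0] eventually_ge_at_top[of "k + 6"]
    unfolding k_def[symmetric] E_def[symmetric] \<tau>_def[symmetric]
  proof eventually_elim
    case (elim n)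
    have n: "2 \<le> k" "k \<le> n" "6 \<le> n" "0 < real n" using elim h by (auto simp: k_def)
    have dn: "4 \<le> d * real n" using elim d by (simp add: divide_le_eq mult.commute)
    obtain s where s: "1/2 \<le> US k (1/2) n s" "\<And>m. m < s \<Longrightarrow> US k (1/2) n m < 1/2"
      "alpha_n k (1/2) n = ereal (real s / real n)" "real s \<le> 2 ^ k * real n"
      using unbiased_threshold[OF n(1-3)] by metis
    have "ereal (E * (real s / real n) - \<delta>) \<le> alpha_n k (1/2 - b) n"
    proof (rule alpha_n_ge)
      fix m assume m: "real m < (E * (real s / real n) - \<delta>) * real n"
      have "\<tau> * real m \<le> \<tau> * ((E * (real s / real n) - \<delta>) * real n)" using m E\<tau> by simp
      also have "\<dots> = (E * \<tau>) * real s - d * real n" using n by (simp add: d_def field_simps)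
      finally have \<tau>m: "\<tau> * real m \<le> real s - d * real n" using E\<tau> by simp
      define j where "j = nat \<lfloor>real s - d * real n / 2\<rfloor>"
      have "0 \<le> real s - d * real n" using \<tau>m E\<tau> by (smt (verit) mult_nonneg_nonneg of_nat_0_le_iff)
      then have j: "real s - d * real n / 2 - 1 \<le> real j" "real j \<le> real s - d * real n / 2"
        using dn unfolding j_def by linarith+
      have "real m \<le> E * 2 ^ k * real n"
      proof -
        have "real m \<le> E * real s - \<delta> * real n" using m n by (simp add: left_diff_distrib)
        also have "\<dots> \<le> E * (2 ^ k * real n)" 
        proof -
          have "E * real s \<le> E * (2 ^ k * real n)" using s(4) E\<tau> by (intro mult_left_mono) auto
          moreover have "0 \<le> \<delta> * real n" using \<delta> by simp
          ultimately show ?thesis by linarith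
        qed
        finally show ?thesis by simp
      qed
      moreover have "\<tau> * real m + \<gamma> * real n \<le> real j"
      proof -
        have "\<gamma> * real n \<le> d / 4 * real n" using \<gamma> by (intro mult_right_mono) auto
        then show ?thesis using \<tau>m j dn by simp
      qed
      ultimately have le: "US k (1/2 - b) n m \<le> US k (1/2) n j + \<gamma>" using elim by (simp add: mult.commute)
      have "US k (1/2) n j < 1/2 - \<gamma>"
      proof (cases "US k (1/2) n j < 1/4")
        case False
        \<comment> \<open>The slope is used up to \<open>s - 1\<close>, where the probability is
          still below 1/2; at \<open>s\<close> it might exceed the level 3/4 allowed by
          \<open>US_slope\<close>.\<close>
        have js: "j \<le> s - 1" "0 < s" "d * real n / 4 \<le> real (s - 1 - j)" using j dn by auto
        have half: "US k (1/2) n (s - 1) < 1/2" by (rule s(2)) (use js in simp)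
        have s1: "0 < real (s - 1)" using js dn by linarith
        have "\<gamma> \<le> 3 * d / (64 * 2 ^ k)" by (rule \<gamma>)
        also have "\<dots> = d * real n / 4 * (3 / (16 * (2 ^ k * real n)))" using n by (simp add: field_simps)
        also have "\<dots> \<le> real (s - 1 - j) * (3 / (16 * real (s - 1)))"
          using js s(4) s1 dn n by (intro mult_mono divide_left_mono mult_left_mono mult_pos_pos) auto
        also have "\<dots> \<le> US k (1/2) n (s - 1) - US k (1/2) n j"
          by (rule US_slope) (use n js half False in auto)
        finally show ?thesis using half by simp
      qed (use \<gamma> in simp)
      then show "US k (1/2 - b) n m < 1/2" using le by simp
    qed (use n b in auto)
    then have "ereal (E * (real s / real n) - \<delta>) + ereal \<delta> \<le> alpha_n k (1/2 - b) n + ereal \<delta>" by (rule add_right_mono)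
    then show ?case by (simp add: s(3))
  qed
qed

lemma alpha_n_upper:
  fixes h C :: nat and b \<delta> :: real
  assumes h: "2 \<le> h" and b: "0 \<le> b" "b < 1/2" and \<delta>: "0 < \<delta>" "\<delta> \<le> 1"
    and C: "4 * (2 ^ Suc h + 1) * real (Suc h) \<le> real C + 1" "1 \<le> C" and half: "1/2 \<le> retained C (Suc h) b"
  shows "\<forall>\<^sub>F n in sequentially.
    alpha_n (Suc h) (1/2 - b) n \<le> ereal (1 / retained C (Suc h) b) * alpha_n (Suc h) (1/2) n + ereal \<delta>"
proof -
  define k where "k = Suc h"
  define \<rho> where "\<rho> = retained C k b"
  have \<rho>: "1/2 \<le> \<rho>" "\<rho> \<le> 1" "0 < \<rho>" using half retained_bounds[OF b] by (auto simp: \<rho>_def k_def)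
  define d where "d = \<delta> / 8"
  have d: "0 < d" "d \<le> 1/8" using \<delta> by (auto simp: d_def)
  define \<gamma> where "\<gamma> = min (1/8) (min d (3 * d / (16 * (2 ^ k + 1))))"
  have "0 < 3 * d / (16 * (2 ^ k + 1))" using d by (intro divide_pos_pos mult_pos_pos add_pos_pos) auto
  then have \<gamma>: "0 < \<gamma>" "\<gamma> \<le> 1/8" "\<gamma> \<le> d" "\<gamma> \<le> 3 * d / (16 * (2 ^ k + 1))" using d by (auto simp: \<gamma>_def)
  \<comment> \<open>The biased formula is needed up to density \<open>2 * (2 ^ k + 1)\<close>: the
    unbiased threshold is at most \<open>2 ^ k\<close>, and division by the retained fraction at
    most doubles it.\<close>
  have A: "2 * (2 * (2 ^ Suc h + 1)) * real (Suc h) \<le> real C + 1" using C by simp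
  have A0: "0 \<le> 2 * (2 ^ Suc h + 1 :: real)" by simp
  have "\<forall>\<^sub>F n::nat in sequentially. 1 / d \<le> real n" by real_asymp
  then show ?thesis
    using biased_unsat_ge[OF b \<gamma>(1) A0 A C(2)] eventually_ge_at_top[of "k + 6"]
    unfolding k_def[symmetric] \<rho>_def[symmetric]
  proof eventually_elim
    case (elim n)
    have n: "2 \<le> k" "k \<le> n" "6 \<le> n" "0 < real n" using elim h by (auto simp: k_def)
    have dn: "1 \<le> d * real n" using elim d by (simp add: divide_le_eq mult.commute)
    obtain s where s: "1/2 \<le> US k (1/2) n s" "\<And>m. m < s \<Longrightarrow> US k (1/2) n m < 1/2"
      "alpha_n k (1/2) n = ereal (real s / real n)" "real s \<le> 2 ^ k * real n"
      using unbiased_threshold[OF n(1-3)] by metis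
    \<comment> \<open>Going \<open>d * n\<close> clauses beyond the threshold lifts the unbiased
      probability by \<gamma> above 1/2, which pays for the error of
      \<open>biased_unsat_ge\<close>.\<close>
    define j where "j = s + nat \<lceil>d * real n\<rceil>"
    have j: "s \<le> j" "d * real n \<le> real (j - s)" "real j \<le> real s + d * real n + 1" using dn unfolding j_def by linarith+
    have jn: "real j \<le> (2 ^ k + 2 * d) * real n" using j s(4) dn by (simp add: distrib_right)
    define m where "m = nat \<lceil>(real j + \<gamma> * real n) / \<rho>\<rceil>"
    have y0: "0 \<le> (real j + \<gamma> * real n) / \<rho>" using \<gamma> \<rho> n by simp
    then have m: "(real j + \<gamma> * real n) / \<rho> \<le> real m" "real m \<le> (real j + \<gamma> * real n) / \<rho> + 1" unfolding m_def by linarith+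
    have m': "real m \<le> (real s + 4 * d * real n) / \<rho>"
    proof -
      have "1 \<le> d * real n / \<rho>" using dn \<rho> by (simp add: le_divide_eq)
      then have "real m \<le> (real j + \<gamma> * real n) / \<rho> + d * real n / \<rho>" using m by simp
      also have "\<dots> = (real j + \<gamma> * real n + d * real n) / \<rho>" by (simp add: add_divide_distrib)
      also have "\<dots> \<le> (real s + 4 * d * real n) / \<rho>"
      proof (rule divide_right_mono)
        have "\<gamma> * real n \<le> d * real n" using \<gamma> by (intro mult_right_mono) auto
        then show "real j + \<gamma> * real n + d * real n \<le> real s + 4 * d * real n" using j dn by simp
      qed (use \<rho> in simp)
      finally show ?thesis .
    qed
    have "US k (1/2) n j \<le> US k (1/2 - b) n m + \<gamma>"
    proof -
      have "real m \<le> 2 * (2 ^ k + 1) * real n"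
      proof -
        have "4 * d * real n \<le> 1 * real n" using d by (intro mult_right_mono) auto
        then have "real s + 4 * d * real n \<le> (2 ^ k + 1) * real n" using s(4) by (simp only: distrib_right)
        then have "(real s + 4 * d * real n) / \<rho> \<le> ((2 ^ k + 1) * real n) / (1/2)"
          using \<rho> n by (intro frac_le) auto
        also have "\<dots> = 2 * (2 ^ k + 1) * real n" by simp
        finally show ?thesis by (rule order_trans[OF m'])
      qed
      moreover have "real j + \<gamma> * real n \<le> \<rho> * real m" using m \<rho> by (simp add: divide_le_eq mult.commute)
      ultimately show ?thesis using elim by simp
    qed
    moreover have "1/2 + \<gamma> \<le> US k (1/2) n j"
    proof (cases "US k (1/2) n j \<le> 3/4")
      case True
      have j0: "0 < real j" using j dn by linarith
      have "(2 ^ k + 2 * d) * real n \<le> (2 ^ k + 1) * real n" using d by (intro mult_right_mono) auto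
      then have jn': "real j \<le> (2 ^ k + 1) * real n" using jn by linarith
      have "\<gamma> \<le> 3 * d / (16 * (2 ^ k + 1))" by (rule \<gamma>)
      also have "\<dots> = d * real n * (3 / (16 * ((2 ^ k + 1) * real n)))"
      proof -
        have "3 * d / (16 * q) = d * N * (3 / (16 * (q * N)))" if "0 < N" for q N :: real using that by simp
        then show ?thesis using n by blast
      qed
      also have "\<dots> \<le> real (j - s) * (3 / (16 * real j))"
        using j j0 jn' dn n by (intro mult_mono divide_left_mono mult_left_mono mult_pos_pos add_pos_pos) auto
      also have "\<dots> \<le> US k (1/2) n j - US k (1/2) n s"
        by (rule US_slope) (use n j s(1) True in auto)
      finally show ?thesis using s(1) by simp
    qed (use \<gamma> in simp)
    ultimately have "alpha_n k (1/2 - b) n \<le> ereal (real m / real n)"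
      by (intro alpha_n_le) (use n b in auto)
    also have "real m / real n \<le> 1 / \<rho> * (real s / real n) + \<delta>"
    proof -
      have "real m / real n \<le> (real s + 4 * d * real n) / \<rho> / real n" using m' by (intro divide_right_mono) auto
      also have "\<dots> = 1 / \<rho> * (real s / real n) + 4 * d / \<rho>" using n \<rho> by (simp add: field_simps)
      also have "4 * d / \<rho> \<le> \<delta>" using \<rho> \<delta> by (simp add: divide_le_eq d_def mult.commute[of \<delta>])
      finally show ?thesis by simp
    qed
    finally show ?case by (simp add: s(3))
  qed
qed

text \<open>Additive errors that can be made arbitrarily small disappear in either limit. The bounds
  \<open>c\<close> and \<open>B\<close> keep the denominators positive and finite, so the extended
  quotients can be cleared.\<close>

lemma ratio_le_limits:
  fixes X Y :: "nat \<Rightarrow> ereal" and c B l u :: real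
  assumes c: "0 < c" and X: "\<forall>\<^sub>F n in sequentially. ereal c \<le> X n \<and> X n \<le> ereal B" and lu: "0 \<le> l" "0 \<le> u"
    and lo: "\<And>d. 0 < d \<Longrightarrow> d \<le> 1 \<Longrightarrow> \<forall>\<^sub>F n in sequentially. ereal l * X n \<le> Y n + ereal d"
    and up: "\<And>d. 0 < d \<Longrightarrow> d \<le> 1 \<Longrightarrow> \<forall>\<^sub>F n in sequentially. Y n \<le> ereal u * X n + ereal d"
  shows "ereal l \<le> liminf Y / liminf X" "liminf Y / liminf X \<le> ereal u"
    "ereal l \<le> limsup Y / limsup X" "limsup Y / limsup X \<le> ereal u"
proof -
  have eps: "x \<le> y" if "\<And>e::real. 0 < e \<Longrightarrow> e \<le> 1 \<Longrightarrow> x \<le> y + ereal e" for x y :: ereal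
  proof (rule ereal_le_epsilon2)
    fix e :: real assume "0 < e"
    then have "x \<le> y + ereal (min e 1)" by (intro that) auto
    also have "\<dots> \<le> y + ereal e" by (intro add_left_mono) auto
    finally show "x \<le> y + ereal e" .
  qed
  have cl: "ereal c \<le> liminf X" by (rule Liminf_bounded) (use X in \<open>auto elim: eventually_mono\<close>)
  have Bl: "limsup X \<le> ereal B" by (rule Limsup_bounded) (use X in \<open>auto elim: eventually_mono\<close>)
  have le: "liminf X \<le> limsup X" by (rule Liminf_le_Limsup) simp
  have fin: "0 < liminf X" "liminf X \<noteq> \<infinity>" "0 < limsup X" "limsup X \<noteq> \<infinity>"
    using c cl Bl le by (auto intro: less_le_trans[of 0 "ereal c"] order_trans)
  show "ereal l \<le> liminf Y / liminf X"
    unfolding ereal_le_divide_pos[OF fin(1,2)]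
  proof (rule eps)
    fix e :: real assume e: "0 < e" "e \<le> 1"
    have "liminf (\<lambda>n. ereal l * X n) \<le> liminf (\<lambda>n. Y n + ereal e)" by (rule Liminf_mono[OF lo[OF e]])
    then show "liminf X * ereal l \<le> liminf Y + ereal e"
      by (simp add: Liminf_ereal_mult_left Liminf_add_ereal_right lu mult.commute)
  qed
  show "liminf Y / liminf X \<le> ereal u"
    unfolding ereal_divide_le_pos[OF fin(1,2)]
  proof (rule eps)
    fix e :: real assume e: "0 < e" "e \<le> 1"
    have "liminf Y \<le> liminf (\<lambda>n. ereal u * X n + ereal e)" by (rule Liminf_mono[OF up[OF e]])
    then show "liminf Y \<le> liminf X * ereal u + ereal e"
      by (simp add: Liminf_ereal_mult_left Liminf_add_ereal_right lu mult.commute)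
  qed
  show "ereal l \<le> limsup Y / limsup X"
    unfolding ereal_le_divide_pos[OF fin(3,4)]
  proof (rule eps)
    fix e :: real assume e: "0 < e" "e \<le> 1"
    have "limsup (\<lambda>n. ereal l * X n) \<le> limsup (\<lambda>n. Y n + ereal e)" by (rule Limsup_mono[OF lo[OF e]])
    then show "limsup X * ereal l \<le> limsup Y + ereal e"
      by (simp add: Limsup_ereal_mult_left Limsup_add_ereal_right lu mult.commute)
  qed
  show "limsup Y / limsup X \<le> ereal u"
    unfolding ereal_divide_le_pos[OF fin(3,4)]
  proof (rule eps)
    fix e :: real assume e: "0 < e" "e \<le> 1"
    have "limsup Y \<le> limsup (\<lambda>n. ereal u * X n + ereal e)" by (rule Limsup_mono[OF up[OF e]])
    then show "limsup Y \<le> limsup X * ereal u + ereal e"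
      by (simp add: Limsup_ereal_mult_left Limsup_add_ereal_right lu mult.commute)
  qed
qed

lemma inverse_retained:
  assumes b: "0 \<le> b" "b < 1/2"
  shows "1 / retained C k b = exp (real k * (- (ln (1 - 4 * b\<^sup>2) / 2) + real C * (ln ((1 + 2 * b) / (1 - 2 * b)) / 2)\<^sup>2 / 2))"
proof -
  let ?e = "real C * (ln ((1 + 2 * b) / (1 - 2 * b)) / 2)\<^sup>2 / 2"
  have b2: "0 < 1 - 4 * b\<^sup>2" using b power_strict_mono[of b "1/2" 2] by (simp add: power2_eq_square)
  have eq: "4 * (1/4 - b\<^sup>2) = 1 - 4 * b\<^sup>2" by simp
  have "2 * sqrt (1/4 - b\<^sup>2) = sqrt (1 - 4 * b\<^sup>2)" unfolding eq[symmetric] real_sqrt_mult by simp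
  also have "\<dots> = exp (ln (1 - 4 * b\<^sup>2) / 2)" using b2 by (simp add: ln_sqrt[symmetric])
  finally have "retained C k b = (exp (ln (1 - 4 * b\<^sup>2) / 2) * exp (- ?e)) ^ k"
    unfolding retained_def by (simp add: mult.assoc[symmetric])
  also have "\<dots> = exp (- (real k * (- (ln (1 - 4 * b\<^sup>2) / 2) + ?e)))"
    unfolding exp_add[symmetric] exp_of_nat_mult[symmetric] by (simp add: algebra_simps)
  finally have R: "retained C k b = exp (- (real k * (- (ln (1 - 4 * b\<^sup>2) / 2) + ?e)))" .
  have "1 / exp (- y) = exp y" for y :: real by (simp add: exp_minus divide_inverse)
  then show ?thesis unfolding R .
qed

text \<open>As \<open>b\<close> tends to 0, \<open>ln (1 - 4 * b^2) / 2\<close> behaves like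
  \<open>-2 * b^2\<close> and the halved logarithm of the weight ratio like \<open>2 * b\<close>.
  The exponent is therefore \<open>2 * k * (1 + C) * b^2\<close> to leading order.\<close>

lemma inverse_retained_le:
  fixes K :: real
  assumes k: "0 < k" and C: "1 \<le> C" and K: "2 * real k * (1 + real C) < K"
  shows "\<forall>\<^sub>F b in at_right 0. 1 / retained C k b \<le> 1 + K * b\<^sup>2"
proof -
  have pos: "0 < real k" "0 < real C" using k C by auto
  have "((\<lambda>b::real. (exp (real k * (- (ln (1 - 4 * b\<^sup>2) / 2) + real C * (ln ((1 + 2 * b) / (1 - 2 * b)) / 2)\<^sup>2 / 2)) - 1) / b\<^sup>2)
      \<longlongrightarrow> 2 * real k * (1 + real C)) (at_right 0)"
    using pos by (real_asymp simp: algebra_simps)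
  from order_tendstoD(2)[OF this K]
  have "\<forall>\<^sub>F b::real in at_right 0. (exp (real k * (- (ln (1 - 4 * b\<^sup>2) / 2) + real C * (ln ((1 + 2 * b) / (1 - 2 * b)) / 2)\<^sup>2 / 2)) - 1) / b\<^sup>2 < K" .
  moreover have "\<forall>\<^sub>F b::real in at_right 0. b < 1/2" by real_asymp
  ultimately show ?thesis using eventually_at_right_less[of 0]
  proof eventually_elim
    case (elim b)
    then show ?case using inverse_retained[of b C k] by (simp add: divide_less_eq)
  qed
qed

theorem theorem5:
  fixes k :: nat
  assumes "k \<ge> 3"
  shows "\<exists>K::real. K < 2 ^ (8 * k) \<and>
    (\<forall>\<^sub>F b :: real in at_right 0.
      ereal (1 + 2 * real k * b\<^sup>2) \<le> alpha_lower k (1/2 - b) / alpha_lower k (1/2) \<and>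
      alpha_lower k (1/2 - b) / alpha_lower k (1/2) \<le> ereal (1 + K * b\<^sup>2) \<and>
      ereal (1 + 2 * real k * b\<^sup>2) \<le> alpha_upper k (1/2 - b) / alpha_upper k (1/2) \<and>
      alpha_upper k (1/2 - b) / alpha_upper k (1/2) \<le> ereal (1 + K * b\<^sup>2))"
proof -
  define h where "h = k - 1"
  have h: "k = Suc h" "2 \<le> h" using assms by (auto simp: h_def)
  \<comment> \<open>Dictated by the density condition of \<open>alpha_n_upper\<close>. In
    \<open>K\<close> the summand 1 makes the comparison with the limit
    \<open>2 * k * (1 + C)\<close> strict.\<close>
  define C where "C = 4 * (2 ^ k + 1) * k"
  define K where "K = 2 * real k * (1 + real C) + 1"
  have C: "1 \<le> C" "4 * (2 ^ Suc h + 1) * real (Suc h) \<le> real C + 1"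
    unfolding h(1)[symmetric] using assms by (simp_all add: C_def algebra_simps)
  have "\<forall>\<^sub>F b in at_right 0. 1 / retained C k b \<le> 1 + K * b\<^sup>2"
    by (rule inverse_retained_le) (use assms C in \<open>auto simp: K_def\<close>)
  moreover have "\<forall>\<^sub>F b::real in at_right 0. b \<le> 1/4" by real_asymp
  moreover have "0 < real k" "0 < K" using assms by (auto simp: K_def add_nonneg_pos)
  then have "\<forall>\<^sub>F b::real in at_right 0. 1 + K * b\<^sup>2 < 2" "\<forall>\<^sub>F b::real in at_right 0. 1/2 < exp (- (2 * real k * b\<^sup>2))"
    by real_asymp+
  ultimately have "\<forall>\<^sub>F b in at_right 0.
      ereal (1 + 2 * real k * b\<^sup>2) \<le> alpha_lower k (1/2 - b) / alpha_lower k (1/2) \<and>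
      alpha_lower k (1/2 - b) / alpha_lower k (1/2) \<le> ereal (1 + K * b\<^sup>2) \<and>
      ereal (1 + 2 * real k * b\<^sup>2) \<le> alpha_upper k (1/2 - b) / alpha_upper k (1/2) \<and>
      alpha_upper k (1/2 - b) / alpha_upper k (1/2) \<le> ereal (1 + K * b\<^sup>2)"
    using eventually_at_right_less[of 0]
  proof eventually_elim
    case (elim b)
    have b: "0 \<le> b" "b \<le> 1/4" "b < 1/2" using elim by auto
    have r0: "0 < retained C k b" by (rule retained_bounds) (use b in auto)
    have half: "1/2 \<le> retained C k b"
    proof -
      have "1 / retained C k b < 2" using elim by linarith
      then show ?thesis using r0 by (simp add: divide_less_eq)
    qed
    let ?c = "1 / (4 * (exp (real k + 1) * real k))"
    have X: "\<forall>\<^sub>F n in sequentially. ereal ?c \<le> alpha_n k (1/2) n \<and> alpha_n k (1/2) n \<le> ereal (2 ^ k)"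
      using eventually_ge_at_top[of "k + 6"]
    proof eventually_elim
      case (elim n)
      then have n: "2 \<le> k" "k \<le> n" "6 \<le> n" using assms by auto
      obtain s where s: "alpha_n k (1/2) n = ereal (real s / real n)" "real s \<le> 2 ^ k * real n" "?c \<le> real s / real n"
        using unbiased_threshold[OF n] by metis
      then show ?case using n by (simp add: divide_le_eq)
    qed
    note R = ratio_le_limits[of ?c "alpha_n k (1/2)" "2 ^ k" "exp (2 * real k * b\<^sup>2)" "1 / retained C k b" "alpha_n k (1/2 - b)"]
    have c0: "0 < ?c" using assms by simp
    have lo: "\<forall>\<^sub>F n in sequentially. ereal (exp (2 * real k * b\<^sup>2)) * alpha_n k (1/2) n \<le> alpha_n k (1/2 - b) n + ereal d" if "0 < d" for d
      unfolding h(1) by (rule alpha_n_lower) (use h b that elim in auto)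
    have up: "\<forall>\<^sub>F n in sequentially. alpha_n k (1/2 - b) n \<le> ereal (1 / retained C k b) * alpha_n k (1/2) n + ereal d" if "0 < d" "d \<le> 1" for d
      unfolding h(1) by (rule alpha_n_upper) (use h b that C half in auto)
    have E: "1 + 2 * real k * b\<^sup>2 \<le> exp (2 * real k * b\<^sup>2)" by (rule exp_ge_add_one_self)
    have U: "1 / retained C k b \<le> 1 + K * b\<^sup>2" using elim by simp
    show ?case
      unfolding alpha_lower_def alpha_upper_def
      using R[OF c0 X _ _ lo up] E U r0 by (auto intro: order_trans[of _ "ereal (exp (2 * real k * b\<^sup>2))"] order_trans[of _ "ereal (1 / retained C k b)"])
  qed
  moreover have "K < 2 ^ (8 * k)"
  proof -
    have "real k \<le> 2 ^ k" by (metis less_exp less_imp_le of_nat_le_iff of_nat_numeral of_nat_power)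
    have k8: "8 \<le> (2::real) ^ k" using power_increasing[of 3 k "2::real"] assms by simp
    \<comment> \<open>As \<open>k \<le> x\<close>, the constant \<open>K\<close> is at most of cubic
      order in \<open>x\<close>, far below \<open>x ^ 8\<close>.\<close>
    define x where "x = (2::real) ^ k"
    have x: "8 \<le> x" "real k \<le> x" using k8 \<open>real k \<le> 2 ^ k\<close> by (auto simp: x_def)
    have "real C = 4 * (x + 1) * real k" by (simp add: C_def x_def)
    also have "\<dots> \<le> 4 * (x + x) * x" using x by (intro mult_mono) auto
    finally have "1 + real C \<le> 9 * (x * x)" using x mult_mono[of 1 x 1 x] by simp
    then have "2 * real k * (1 + real C) \<le> 2 * x * (9 * (x * x))" using x by (intro mult_mono) auto
    then have "K \<le> 18 * x ^ 3 + 1" by (simp add: K_def power3_eq_cube mult.assoc)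
    also have "\<dots> < 64 * x ^ 3" using x power_mono[of 8 x 3] by simp
    also have "\<dots> \<le> x ^ 5 * x ^ 3"
    proof (rule mult_right_mono)
      have "8 ^ 5 \<le> x ^ 5" using x by (intro power_mono) auto
      then show "64 \<le> x ^ 5" by simp
    qed (use x in simp)
    also have "\<dots> = 2 ^ (8 * k)" by (simp add: x_def power_add[symmetric] power_mult[symmetric] mult.commute)
    finally show ?thesis .
  qed
  ultimately show ?thesis by blast
qed

end
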